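(* Let $(x \in X)$ be a normal hypersurface singularity of dimension $n$. If the sheaf $\check\Omega_X^p$ of K\"ahler $p$-forms modulo torsion is free for some $1 \le p \le n$, then $(x \in X)$ is smooth.
   Context: We work over $\mathbb{C}$. A singularity $(x \in X)$ is a germ of a complex space (smooth germs are allowed). It is a hypersurface singularity of dimension $n$ if it is isomorphic to the germ at a point of $\{f=0\} \subset Y$ for a non-constant holomorphic function $f$ on a connected open set $Y \subset \mathbb{C}^{n+1}$, with structure sheaf $\mathcal{O}_Y/(f)$. $\Omega_X^p = \bigwedge^p \Omega_X^1$ is the sheaf of K\"ahler $p$-forms, where locally, for $X$ cut out by holomorphic functions $f_1,\dots,f_r$ in a complex manifold $Y$, $\Omega_X^1 = \Omega_Y^1|_X / \langle \mathrm{d}f_1,\dots,\mathrm{d}f_r\rangle$. $\check\Omega_X^p := \Omega_X^p / \operatorname{tor}\Omega_X^p$, where $\operatorname{tor}$ denotes the torsion subsheaf. *)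

theory Defs
  imports "HOL-Analysis.Analysis" "HOL-Algebra.QuotRing" "HOL-Algebra.Module"
begin

section \<open>Module constructions missing from HOL-Algebra\<close>

text \<open>Modules are records of HOL-Algebra; their unused fields \<open>mult\<close> and \<open>one\<close> are left undefined.\<close>

definition free_module :: "('r, 'x) ring_scheme \<Rightarrow> 's set \<Rightarrow> ('r, 's \<Rightarrow> 'r) module" where
  "free_module R S =
    \<lparr>carrier = {u. (\<forall>s. u s \<in> carrier R) \<and> (\<forall>s. s \<notin> S \<longrightarrow> u s = \<zero>\<^bsub>R\<^esub>) \<and> finite {s. u s \<noteq> \<zero>\<^bsub>R\<^esub>}},
     mult = undefined, one = undefined,
     zero = (\<lambda>s. \<zero>\<^bsub>R\<^esub>), add = (\<lambda>u v s. u s \<oplus>\<^bsub>R\<^esub> v s),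
     smult = (\<lambda>a u s. a \<otimes>\<^bsub>R\<^esub> u s)\<rparr>"

definition unit_vector :: "('r, 'x) ring_scheme \<Rightarrow> 's \<Rightarrow> 's \<Rightarrow> 'r" where
  "unit_vector R s = (\<lambda>t. if t = s then \<one>\<^bsub>R\<^esub> else \<zero>\<^bsub>R\<^esub>)"

definition generated_submodule ::
  "('r, 'x) ring_scheme \<Rightarrow> ('r, 'e, 'y) module_scheme \<Rightarrow> 'e set \<Rightarrow> 'e set" where
  "generated_submodule R M G = \<Inter>{N. submodule N R M \<and> G \<subseteq> N}"

definition quotient_module ::
  "('r, 'e, 'y) module_scheme \<Rightarrow> 'e set \<Rightarrow> ('r, 'e set) module" where
  "quotient_module M N =
    \<lparr>carrier = a_rcosets\<^bsub>M\<^esub> N, mult = undefined, one = undefined,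
     zero = N, add = set_add M,
     smult = (\<lambda>a A. \<Union>x\<in>A. N +>\<^bsub>M\<^esub> (a \<odot>\<^bsub>M\<^esub> x))\<rparr>"

text \<open>The exterior power of an arbitrary module: the free module on all \<open>p\<close>-tuples of elements
  of \<open>M\<close>, modulo multilinearity and the alternating property.\<close>

definition tuples :: "nat \<Rightarrow> ('r, 'e, 'y) module_scheme \<Rightarrow> 'e list set" where
  "tuples p M = {ms. length ms = p \<and> set ms \<subseteq> carrier M}"

definition exterior_relations ::
  "('r, 'x) ring_scheme \<Rightarrow> nat \<Rightarrow> ('r, 'e, 'y) module_scheme \<Rightarrow> ('e list \<Rightarrow> 'r) set" where
  "exterior_relations R p M =
    (let F = free_module R (tuples p M); \<delta> = unit_vector R in
      {\<delta> (ms[i := a \<oplus>\<^bsub>M\<^esub> b]) \<ominus>\<^bsub>F\<^esub> (\<delta> (ms[i := a]) \<oplus>\<^bsub>F\<^esub> \<delta> (ms[i := b])) | ms i a b.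
         ms \<in> tuples p M \<and> i < p \<and> a \<in> carrier M \<and> b \<in> carrier M} \<union>
      {\<delta> (ms[i := r \<odot>\<^bsub>M\<^esub> a]) \<ominus>\<^bsub>F\<^esub> (r \<odot>\<^bsub>F\<^esub> \<delta> (ms[i := a])) | ms i r a.
         ms \<in> tuples p M \<and> i < p \<and> r \<in> carrier R \<and> a \<in> carrier M} \<union>
      {\<delta> ms | ms. ms \<in> tuples p M \<and> (\<exists>i j. i < j \<and> j < p \<and> ms ! i = ms ! j)})"

definition exterior_power ::
  "('r, 'x) ring_scheme \<Rightarrow> nat \<Rightarrow> ('r, 'e, 'y) module_scheme \<Rightarrow> ('r, ('e list \<Rightarrow> 'r) set) module" where
  "exterior_power R p M =
    (let F = free_module R (tuples p M)
     in quotient_module F (generated_submodule R F (exterior_relations R p M)))"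

definition wedge ::
  "('r, 'x) ring_scheme \<Rightarrow> nat \<Rightarrow> ('r, 'e, 'y) module_scheme \<Rightarrow> 'e list \<Rightarrow> ('e list \<Rightarrow> 'r) set" where
  "wedge R p M ms =
    (let F = free_module R (tuples p M)
     in generated_submodule R F (exterior_relations R p M) +>\<^bsub>F\<^esub> unit_vector R ms)"

definition nonzerodivisors :: "('r, 'x) ring_scheme \<Rightarrow> 'r set" where
  "nonzerodivisors R =
    {a \<in> carrier R. \<forall>b\<in>carrier R. a \<otimes>\<^bsub>R\<^esub> b = \<zero>\<^bsub>R\<^esub> \<longrightarrow> b = \<zero>\<^bsub>R\<^esub>}"

definition torsion_submodule ::
  "('r, 'x) ring_scheme \<Rightarrow> ('r, 'e, 'y) module_scheme \<Rightarrow> 'e set" where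
  "torsion_submodule R M =
    {m \<in> carrier M. \<exists>a\<in>nonzerodivisors R. a \<odot>\<^bsub>M\<^esub> m = \<zero>\<^bsub>M\<^esub>}"

definition is_basis ::
  "('r, 'x) ring_scheme \<Rightarrow> ('r, 'e, 'y) module_scheme \<Rightarrow> nat \<Rightarrow> (nat \<Rightarrow> 'e) \<Rightarrow> bool" where
  "is_basis R M r b \<longleftrightarrow>
    b \<in> {..<r} \<rightarrow> carrier M \<and>
    (\<forall>m\<in>carrier M. \<exists>!a. a \<in> {..<r} \<rightarrow>\<^sub>E carrier R \<and> m = (\<Oplus>\<^bsub>M\<^esub>k\<in>{..<r}. a k \<odot>\<^bsub>M\<^esub> b k))"


section \<open>Normal rings\<close>

text \<open>The total ring of fractions. As denominators are non-zero-divisors, \<open>a/b = c/d\<close> just means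
  \<open>c b = a d\<close>.\<close>

definition frac :: "('r, 'x) ring_scheme \<Rightarrow> 'r \<Rightarrow> 'r \<Rightarrow> ('r \<times> 'r) set" where
  "frac R a b =
    {(c, d). c \<in> carrier R \<and> d \<in> nonzerodivisors R \<and> c \<otimes>\<^bsub>R\<^esub> b = a \<otimes>\<^bsub>R\<^esub> d}"

definition total_fractions :: "('r, 'x) ring_scheme \<Rightarrow> ('r \<times> 'r) set ring" where
  "total_fractions R =
    \<lparr>carrier = {frac R a b | a b. a \<in> carrier R \<and> b \<in> nonzerodivisors R},
     mult = (\<lambda>P Q. \<Union>(a, b)\<in>P. \<Union>(c, d)\<in>Q. frac R (a \<otimes>\<^bsub>R\<^esub> c) (b \<otimes>\<^bsub>R\<^esub> d)),
     one = frac R \<one>\<^bsub>R\<^esub> \<one>\<^bsub>R\<^esub>,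
     zero = frac R \<zero>\<^bsub>R\<^esub> \<one>\<^bsub>R\<^esub>,
     add = (\<lambda>P Q. \<Union>(a, b)\<in>P. \<Union>(c, d)\<in>Q.
       frac R (a \<otimes>\<^bsub>R\<^esub> d \<oplus>\<^bsub>R\<^esub> c \<otimes>\<^bsub>R\<^esub> b) (b \<otimes>\<^bsub>R\<^esub> d))\<rparr>"

definition integral_over_base :: "('r, 'x) ring_scheme \<Rightarrow> ('r \<times> 'r) set \<Rightarrow> bool" where
  "integral_over_base R q \<longleftrightarrow>
    (let K = total_fractions R in
      \<exists>(k::nat) c. c \<in> {..<k} \<rightarrow> carrier R \<and>
        q [^]\<^bsub>K\<^esub> k \<oplus>\<^bsub>K\<^esub> (\<Oplus>\<^bsub>K\<^esub>i\<in>{..<k}. frac R (c i) \<one>\<^bsub>R\<^esub> \<otimes>\<^bsub>K\<^esub> q [^]\<^bsub>K\<^esub> i) = \<zero>\<^bsub>K\<^esub>)"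

definition normal_ring :: "('r, 'x) ring_scheme \<Rightarrow> bool" where
  "normal_ring R \<longleftrightarrow>
    (\<forall>a\<in>carrier R. \<forall>k::nat. a [^]\<^bsub>R\<^esub> k = \<zero>\<^bsub>R\<^esub> \<longrightarrow> a = \<zero>\<^bsub>R\<^esub>) \<and>
    (\<forall>q\<in>carrier (total_fractions R). integral_over_base R q \<longrightarrow>
      (\<exists>a\<in>carrier R. q = frac R a \<one>\<^bsub>R\<^esub>))"


section \<open>Holomorphic functions of several variables and their germs\<close>

definition holo_on :: "(complex ^ 'm \<Rightarrow> complex) \<Rightarrow> (complex ^ 'm::finite) set \<Rightarrow> bool" where
  "holo_on f U \<longleftrightarrow>
    (\<forall>z\<in>U. \<exists>D. (f has_derivative D) (at z) \<and> (\<forall>c v. D (c *s v) = c * D v))"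

definition holo_at :: "complex ^ 'm::finite \<Rightarrow> (complex ^ 'm \<Rightarrow> complex) \<Rightarrow> bool" where
  "holo_at x f \<longleftrightarrow> (\<exists>U. open U \<and> x \<in> U \<and> holo_on f U)"

definition partial_deriv ::
  "'m \<Rightarrow> (complex ^ 'm \<Rightarrow> complex) \<Rightarrow> complex ^ 'm::finite \<Rightarrow> complex" where
  "partial_deriv j f z = deriv (\<lambda>t. f (z + t *s axis j 1)) 0"

definition germ ::
  "complex ^ 'm::finite \<Rightarrow> (complex ^ 'm \<Rightarrow> complex) \<Rightarrow> (complex ^ 'm \<Rightarrow> complex) set" where
  "germ x f = {g. \<forall>\<^sub>F z in nhds x. g z = f z}"

text \<open>The ring of germs at \<open>x\<close> of holomorphic functions on \<open>\<complex>\<^sup>m\<close>, i.e. the stalk at \<open>x\<close> of the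
  structure sheaf of any open set containing \<open>x\<close>.\<close>

definition germ_ring :: "complex ^ 'm::finite \<Rightarrow> (complex ^ 'm \<Rightarrow> complex) set ring" where
  "germ_ring x =
    \<lparr>carrier = germ x ` {f. holo_at x f},
     mult = (\<lambda>A B. \<Union>f\<in>A. \<Union>g\<in>B. germ x (\<lambda>z. f z * g z)),
     one = germ x (\<lambda>_. 1),
     zero = germ x (\<lambda>_. 0),
     add = (\<lambda>A B. \<Union>f\<in>A. \<Union>g\<in>B. germ x (\<lambda>z. f z + g z))\<rparr>"


section \<open>Germs of complex spaces\<close>

text \<open>A germ of a complex space is given by a local model: the common zero locus, in an open subset
  \<open>ambient\<close> of \<open>\<complex>\<^sup>m\<close>, of the finitely many holomorphic functions in \<open>eqns\<close>, whose structure sheaf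
  is the restriction of the quotient of the sheaf of holomorphic functions by the ideal sheaf
  generated by \<open>eqns\<close>; the germ is taken at the point \<open>base\<close>.\<close>

record 'm space_germ =
  ambient :: "(complex ^ 'm) set"
  eqns :: "(complex ^ 'm \<Rightarrow> complex) set"
  base :: "complex ^ 'm"

definition zero_locus :: "'m::finite space_germ \<Rightarrow> (complex ^ 'm) set" where
  "zero_locus X = {z \<in> ambient X. \<forall>f\<in>eqns X. f z = 0}"

definition complex_space_germ :: "'m::finite space_germ \<Rightarrow> bool" where
  "complex_space_germ X \<longleftrightarrow>
    open (ambient X) \<and> finite (eqns X) \<and> (\<forall>f\<in>eqns X. holo_on f (ambient X)) \<and>
    base X \<in> zero_locus X"

definition ideal_at ::
  "'m::finite space_germ \<Rightarrow> complex ^ 'm \<Rightarrow> (complex ^ 'm \<Rightarrow> complex) set set" where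
  "ideal_at X y = genideal (germ_ring y) (germ y ` eqns X)"

text \<open>The stalk at \<open>y\<close> of the structure sheaf of \<open>X\<close>, and the class in it of a function that is
  holomorphic near \<open>y\<close>.\<close>

definition local_ring ::
  "'m::finite space_germ \<Rightarrow> complex ^ 'm \<Rightarrow> (complex ^ 'm \<Rightarrow> complex) set set ring" where
  "local_ring X y = germ_ring y Quot ideal_at X y"

definition local_class ::
  "'m::finite space_germ \<Rightarrow> complex ^ 'm \<Rightarrow> (complex ^ 'm \<Rightarrow> complex) \<Rightarrow>
    (complex ^ 'm \<Rightarrow> complex) set set" where
  "local_class X y f = ideal_at X y +>\<^bsub>germ_ring y\<^esub> germ y f"

text \<open>A morphism of germs of local models is induced by a holomorphic map \<open>\<phi>\<close> of the ambient spaces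
  pulling the target ideal back into the source ideal. Two such maps induce the same morphism iff
  their components agree modulo the source ideal, which is how the two composites in \<open>germ_iso\<close> are
  compared with the identity. All ideals being finitely generated, conditions on germs at the base
  point hold on a neighbourhood.\<close>

definition germ_map ::
  "'a::finite space_germ \<Rightarrow> 'b::finite space_germ \<Rightarrow> (complex ^ 'a \<Rightarrow> complex ^ 'b) \<Rightarrow> bool" where
  "germ_map X X' \<phi> \<longleftrightarrow>
    (\<forall>j. holo_at (base X) (\<lambda>z. \<phi> z $ j)) \<and> \<phi> (base X) = base X' \<and>
    (\<forall>g\<in>eqns X'. germ (base X) (\<lambda>z. g (\<phi> z)) \<in> ideal_at X (base X))"

definition germ_iso :: "'a::finite space_germ \<Rightarrow> 'b::finite space_germ \<Rightarrow> bool" where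
  "germ_iso X X' \<longleftrightarrow>
    (\<exists>\<phi> \<psi>. germ_map X X' \<phi> \<and> germ_map X' X \<psi> \<and>
      (\<forall>j. germ (base X) (\<lambda>z. \<psi> (\<phi> z) $ j - z $ j) \<in> ideal_at X (base X)) \<and>
      (\<forall>j. germ (base X') (\<lambda>z. \<phi> (\<psi> z) $ j - z $ j) \<in> ideal_at X' (base X')))"

text \<open>The dimension \<open>n + 1\<close> of the space containing the hypersurface is the cardinality of the
  index type \<open>'m\<close>, which need not be the index type \<open>'a\<close> of the space in which \<open>X\<close> is given.\<close>

definition hypersurface_singularity ::
  "'m::finite itself \<Rightarrow> nat \<Rightarrow> 'a::finite space_germ \<Rightarrow> bool" where
  "hypersurface_singularity _ n X \<longleftrightarrow>
    CARD('m) = n + 1 \<and>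
    (\<exists>(Y :: (complex ^ 'm) set) f y.
      open Y \<and> connected Y \<and> holo_on f Y \<and> \<not> f constant_on Y \<and> y \<in> Y \<and> f y = 0 \<and>
      germ_iso X \<lparr>ambient = Y, eqns = {f}, base = y\<rparr>)"

definition normal_singularity :: "'m::finite space_germ \<Rightarrow> bool" where
  "normal_singularity X \<longleftrightarrow> normal_ring (local_ring X (base X))"

text \<open>The germ at the origin of \<open>\<complex>\<^sup>d\<close>, realised as the coordinate subspace of \<open>\<complex>\<^sup>m\<close> spanned by \<open>d\<close>
  coordinate axes. A smooth germ that is embedded in \<open>\<complex>\<^sup>m\<close> has dimension at most \<open>m\<close>, so in
  \<open>smooth_germ\<close> these models suffice.\<close>

definition coordinate_germ :: "'m set \<Rightarrow> 'm::finite space_germ" where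
  "coordinate_germ S = \<lparr>ambient = UNIV, eqns = (\<lambda>i z. z $ i) ` (- S), base = 0\<rparr>"

definition smooth_germ :: "'m::finite space_germ \<Rightarrow> bool" where
  "smooth_germ X \<longleftrightarrow> (\<exists>S :: 'm set. germ_iso X (coordinate_germ S))"


section \<open>Kaehler forms\<close>

text \<open>Stalks at \<open>y\<close>. The restriction to \<open>X\<close> of the 1-forms of the ambient space is free on the
  \<open>dz\<^sub>j\<close>, so its elements are coordinate vectors indexed by \<open>'m\<close>.\<close>

abbreviation ambient_forms_at where
  "ambient_forms_at (X :: 'm::finite space_germ) y \<equiv> free_module (local_ring X y) (UNIV :: 'm set)"

definition differential_at ::
  "'m::finite space_germ \<Rightarrow> complex ^ 'm \<Rightarrow> (complex ^ 'm \<Rightarrow> complex) \<Rightarrow>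
    'm \<Rightarrow> (complex ^ 'm \<Rightarrow> complex) set set" where
  "differential_at X y f = (\<lambda>j. local_class X y (partial_deriv j f))"

abbreviation conormal_image_at where
  "conormal_image_at (X :: 'm::finite space_germ) y \<equiv>
    generated_submodule (local_ring X y) (ambient_forms_at X y) (differential_at X y ` eqns X)"

definition kaehler_1_forms_at where
  "kaehler_1_forms_at (X :: 'm::finite space_germ) y =
    quotient_module (ambient_forms_at X y) (conormal_image_at X y)"

definition dz_at where
  "dz_at (X :: 'm::finite space_germ) y j =
    conormal_image_at X y +>\<^bsub>ambient_forms_at X y\<^esub> unit_vector (local_ring X y) j"

definition kaehler_forms_at where
  "kaehler_forms_at p (X :: 'm::finite space_germ) y =
    exterior_power (local_ring X y) p (kaehler_1_forms_at X y)"

definition kaehler_forms_mod_torsion_at where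
  "kaehler_forms_mod_torsion_at p (X :: 'm::finite space_germ) y =
    quotient_module (kaehler_forms_at p X y)
      (torsion_submodule (local_ring X y) (kaehler_forms_at p X y))"

text \<open>The germ at \<open>y\<close> of the section of the sheaf of Kaehler \<open>p\<close>-forms modulo torsion induced by the
  holomorphic \<open>p\<close>-form with coefficients \<open>c J\<close> on the ambient space: the sum of
  \<open>c J dz\<^sub>J\<^sub>1 \<and> \<dots> \<and> dz\<^sub>J\<^sub>p\<close> over all \<open>p\<close>-tuples \<open>J\<close>.\<close>

definition form_class_at where
  "form_class_at p (X :: 'm::finite space_germ) y (c :: 'm list \<Rightarrow> complex ^ 'm \<Rightarrow> complex) =
    (let R = local_ring X y; M = kaehler_forms_at p X y in
      torsion_submodule R M +>\<^bsub>M\<^esub>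
        (\<Oplus>\<^bsub>M\<^esub>J\<in>{J. length J = p}.
          local_class X y (c J) \<odot>\<^bsub>M\<^esub> wedge R p (kaehler_1_forms_at X y) (map (dz_at X y) J)))"

text \<open>Freeness of the sheaf of Kaehler \<open>p\<close>-forms modulo torsion on the germ: on some neighbourhood
  \<open>U\<close> of the base point there are \<open>r\<close> sections whose germs form a basis of the stalk at every point
  of \<open>X\<close> in \<open>U\<close>, that is, which define an isomorphism from the \<open>r\<close>-th power of the structure sheaf.
  After shrinking \<open>U\<close>, every section is induced by a holomorphic form on \<open>U\<close>.\<close>

definition kaehler_mod_torsion_free :: "nat \<Rightarrow> 'm::finite space_germ \<Rightarrow> bool" where
  "kaehler_mod_torsion_free p X \<longleftrightarrow>
    (\<exists>U r (c :: nat \<Rightarrow> 'm list \<Rightarrow> complex ^ 'm \<Rightarrow> complex).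
      open U \<and> base X \<in> U \<and> U \<subseteq> ambient X \<and> (\<forall>k J. holo_on (c k J) U) \<and>
      (\<forall>y\<in>U \<inter> zero_locus X.
        is_basis (local_ring X y) (kaehler_forms_mod_torsion_at p X y) r
          (\<lambda>k. form_class_at p X y (c k))))"

end

theory Submission
  imports Defs "HOL-Complex_Analysis.Conformal_Mappings"
begin

text \<open>Write the hypersurface as \<open>f = 0\<close> near a point \<open>y\<close> of \<open>\<complex>\<^sup>m\<close> with \<open>m = n + 1\<close>, let \<open>\<phi>\<close> and \<open>\<psi>\<close> be
the two mutually inverse morphisms between \<open>X\<close> and the hypersurface, let \<open>R\<close> be the local ring of \<open>X\<close> at
its base point \<open>x\<close> with maximal ideal \<open>\<mm>\<close>, and let \<open>G\<^sub>i\<close> be the class in \<open>R\<close> of \<open>\<partial>\<^sub>if \<circ> \<phi>\<close>. The argument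
shows that the ideal \<open>J\<close> generated by all \<open>G\<^sub>i\<close> is principal, and that this forces some \<open>\<partial>\<^sub>if\<close> not to
vanish at \<open>y\<close>.

\<^emph>\<open>The ideal is principal.\<close> Let \<open>N\<close> be the module of \<open>p\<close>-forms modulo torsion at \<open>x\<close>. It is spanned by the
forms \<open>d\<phi>\<^sub>K\<close>, where \<open>K\<close> runs through the sets of \<open>p\<close> coordinates of \<open>\<complex>\<^sup>m\<close>, and \<open>df = 0\<close> gives the relations
\<open>\<Sum>\<^sub>j G\<^sub>j d\<phi>\<^sub>j \<and> d\<phi>\<^sub>L = 0\<close> for \<open>card L = p - 1\<close>. Conversely every relation \<open>\<Sum>\<^sub>K \<omega>\<^sub>K d\<phi>\<^sub>K = 0\<close> in \<open>N\<close> implies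
\<open>df \<and> \<omega> = 0\<close> coefficientwise: the coefficients of \<open>df \<and> \<omega>\<close> are determinants with first row \<open>G\<close>, they
define linear forms on \<open>p\<close>-forms, and a linear form with values in \<open>R\<close> kills torsion (lemma
\<open>wedge_functional\<close>). Suppose that \<open>N\<close> has a basis of \<open>r\<close> elements and that some \<open>G\<^sub>1\<close> is not in \<open>\<mm>J\<close>. The
relations express \<open>G\<^sub>1 d\<phi>\<^sub>K\<close> with \<open>1 \<in> K\<close> by the forms \<open>d\<phi>\<^sub>K\<^sub>'\<close> with \<open>1 \<notin> K'\<close>, and since \<open>R\<close>, being normal, is reduced, this
bounds \<open>r\<close> by the number of such \<open>K'\<close> (lemma \<open>rank_inequality\<close>). So these forms together with one more,
\<open>d\<phi>\<^sub>K\<^sub>0\<close> where \<open>1 \<in> K\<^sub>0\<close> and \<open>j \<notin> K\<^sub>0\<close>, satisfy a relation whose constant terms are supported on them and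
are not all zero. If the constant term at \<open>K\<^sub>0\<close> were zero, the coefficient of \<open>df \<and> \<omega>\<close> at some \<open>K' \<union> {1}\<close> would put \<open>G\<^sub>1\<close>
into \<open>\<mm>J\<close>; so it is not, and the coefficient at \<open>K\<^sub>0 \<union> {j}\<close> shows \<open>G\<^sub>j \<in> \<complex> G\<^sub>1 + \<mm>J\<close>. By Nakayama's lemma \<open>J\<close> is generated by \<open>G\<^sub>1\<close> (theorems \<open>jacobian_principal\<close> and
\<open>gradient_principal\<close>).

\<^emph>\<open>A principal gradient does not vanish.\<close> Transported back to \<open>\<complex>\<^sup>m\<close> this reads
\<open>\<partial>\<^sub>jf = a\<^sub>j \<partial>\<^sub>if + b\<^sub>j f\<close> near \<open>y\<close>. If \<open>\<partial>\<^sub>if\<close> vanished at \<open>y\<close>, then \<open>f\<close> would divide \<open>(\<partial>\<^sub>if)\<^sup>2\<close> (theorem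
\<open>partial_deriv_square_divisible\<close>): the quotient \<open>W = (\<partial>\<^sub>if)\<^sup>2 / f\<close> satisfies a linear first-order system, from which
it follows that the Cauchy integrals detecting a pole of \<open>W\<close> on the lines in direction \<open>i\<close> vanish
identically. As \<open>R\<close> is reduced, \<open>f\<close> then divides \<open>\<partial>\<^sub>if\<close>, hence all \<open>\<partial>\<^sub>jf\<close>, so all derivatives of \<open>f\<close> vanish
at \<open>y\<close> and \<open>f\<close> is zero near \<open>y\<close>. By the identity theorem \<open>f\<close> would be constant.

\<^emph>\<open>Conclusion.\<close> Once \<open>\<partial>\<^sub>if (y) \<noteq> 0\<close>, the inverse function theorem makes \<open>f\<close> a coordinate, which identifies \<open>X\<close>
with a coordinate subspace (lemma \<open>smooth_if_partial_deriv_nonzero\<close>).\<close>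

section \<open>Holomorphic functions of several variables\<close>

lemma vec_eq_sum_axis: "v = (\<Sum>j\<in>UNIV. v $ j *s axis j 1)" for v :: "complex ^ 'm::finite"
  by (simp add: vec_eq_iff axis_def if_distrib [where f = "\<lambda>x. _ * x"] sum.If_cases)

lemma bounded_linear_vec_scale: "bounded_linear (\<lambda>t. t *s v)" for v :: "complex ^ 'm::finite"
  by (intro linear_conv_bounded_linear [THEN iffD1] linearI) (auto simp: vec_eq_iff algebra_simps)

lemma bounded_linear_axis: "bounded_linear (axis k :: complex \<Rightarrow> complex ^ 'm::finite)"
  by (intro linear_conv_bounded_linear [THEN iffD1] linearI) (auto simp: vec_eq_iff axis_def algebra_simps)

lemma has_derivative_vecI:
  fixes \<phi> :: "'c::real_normed_vector \<Rightarrow> complex ^ 'm::finite"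
  assumes "\<And>k. ((\<lambda>z. \<phi> z $ k) has_derivative (\<lambda>v. D v $ k)) F"
  shows "(\<phi> has_derivative D) F"
proof -
  have *: "x = (\<Sum>k\<in>UNIV. axis k (x $ k))" for x :: "complex ^ 'm"
    by (simp add: vec_eq_iff axis_def sum.If_cases)
  have "((\<lambda>z. \<Sum>k\<in>UNIV. axis k (\<phi> z $ k)) has_derivative (\<lambda>v. \<Sum>k\<in>UNIV. axis k (D v $ k))) F"
    by (intro has_derivative_sum bounded_linear.has_derivative [OF bounded_linear_axis] assms)
  then show ?thesis
    by (simp flip: *)
qed

lemma has_derivative_line:
  fixes z :: "complex ^ 'm::finite"
  assumes "(f has_derivative D) (at (z + t *s v))" and "\<And>c w. D (c *s w) = c * D w"
  shows "((\<lambda>t. f (z + t *s v)) has_field_derivative D v) (at t)"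
proof -
  have "((\<lambda>t. z + t *s v) has_derivative (\<lambda>t. t *s v)) (at t)"
    by (auto intro!: derivative_eq_intros bounded_linear_imp_has_derivative bounded_linear_vec_scale)
  from has_derivative_compose [OF this assms(1)] have
    "((\<lambda>t. f (z + t *s v)) has_derivative (\<lambda>t. D (t *s v))) (at t)" .
  moreover have "(\<lambda>t. D (t *s v)) = (*) (D v)"
    by (simp add: assms(2) fun_eq_iff)
  ultimately show ?thesis
    by (simp add: has_field_derivative_def)
qed

lemma holo_on_subset: "holo_on f U \<Longrightarrow> V \<subseteq> U \<Longrightarrow> holo_on f V"
  unfolding holo_on_def by blast

lemma holo_on_cong_open:
  assumes "open U" "\<And>z. z \<in> U \<Longrightarrow> f z = g z" "holo_on f U"
  shows "holo_on g U"
  unfolding holo_on_def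
proof
  fix z assume z: "z \<in> U"
  then obtain D where D: "(f has_derivative D) (at z)" "\<forall>c v. D (c *s v) = c * D v"
    using assms(3) unfolding holo_on_def by blast
  have "(g has_derivative D) (at z)"
    using has_derivative_transform_within_open [OF D(1) assms(1) z assms(2)] by simp
  then show "\<exists>D. (g has_derivative D) (at z) \<and> (\<forall>c v. D (c *s v) = c * D v)"
    using D(2) by blast
qed

lemma holo_on_imp_has_derivative:
  assumes "holo_on f U" "z \<in> U"
  shows "(f has_derivative (\<lambda>v. \<Sum>j\<in>UNIV. v $ j * partial_deriv j f z)) (at z)"
proof -
  obtain D where D: "(f has_derivative D) (at z)" "\<And>c v. D (c *s v) = c * D v"
    using assms unfolding holo_on_def by blast
  have lin: "linear D"
    using D(1) has_derivative_linear by blast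
  have p: "partial_deriv j f z = D (axis j 1)" for j
    unfolding partial_deriv_def
    by (rule DERIV_imp_deriv, rule has_derivative_line) (use D in auto)
  have "D v = (\<Sum>j\<in>UNIV. v $ j * partial_deriv j f z)" for v
  proof -
    have "D v = D (\<Sum>j\<in>UNIV. v $ j *s axis j 1)"
      by (simp flip: vec_eq_sum_axis)
    also have "\<dots> = (\<Sum>j\<in>UNIV. D (v $ j *s axis j 1))"
      by (simp add: linear_sum [OF lin])
    finally show ?thesis
      by (simp add: D(2) p)
  qed
  then have "D = (\<lambda>v. \<Sum>j\<in>UNIV. v $ j * partial_deriv j f z)" by blast
  with D(1) show ?thesis by simp
qed

text \<open>Conversely, a derivative of this form is complex linear, so it proves holomorphy and determines the
partial derivatives.\<close>

lemma holo_onI_sum: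
  assumes "\<And>z. z \<in> U \<Longrightarrow> (f has_derivative (\<lambda>v. \<Sum>j\<in>UNIV. v $ j * g j z)) (at z)"
  shows "holo_on f U" and "z \<in> U \<Longrightarrow> partial_deriv j f z = g j z"
proof -
  show "holo_on f U"
    unfolding holo_on_def
    using assms by (fastforce simp: sum_distrib_left algebra_simps)
  assume "z \<in> U"
  show "partial_deriv j f z = g j z"
    unfolding partial_deriv_def
  proof (rule DERIV_imp_deriv)
    have "((\<lambda>t. f (z + t *s axis j 1)) has_field_derivative (\<Sum>i\<in>UNIV. axis j 1 $ i * g i z)) (at 0)"
      using assms [OF \<open>z \<in> U\<close>]
      by (intro has_derivative_line) (auto simp: sum_distrib_left algebra_simps)
    then show "((\<lambda>t. f (z + t *s axis j 1)) has_field_derivative g j z) (at 0)"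
      by (simp add: axis_def if_distrib [where f = "\<lambda>x. x * _"] cong: if_cong)
  qed
qed

lemma holo_on_imp_continuous_on: "holo_on f U \<Longrightarrow> continuous_on U f"
  unfolding holo_on_def
  by (meson continuous_at_imp_continuous_on has_derivative_continuous)

lemma holo_on_const [simp]: "holo_on (\<lambda>_. c) U"
  unfolding holo_on_def by (auto intro!: exI [of _ "\<lambda>_. 0"])

lemma holo_on_coord [simp]: "holo_on (\<lambda>z. z $ k) U"
  unfolding holo_on_def
  by (auto intro!: exI [of _ "\<lambda>z. z $ k"] bounded_linear_imp_has_derivative bounded_linear_vec_nth)

lemma
  assumes "holo_on f U" "holo_on g U"
  shows holo_on_add: "holo_on (\<lambda>z. f z + g z) U"
    and partial_deriv_add: "z \<in> U \<Longrightarrow>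
      partial_deriv j (\<lambda>z. f z + g z) z = partial_deriv j f z + partial_deriv j g z"
    and holo_on_diff: "holo_on (\<lambda>z. f z - g z) U"
    and partial_deriv_diff: "z \<in> U \<Longrightarrow>
      partial_deriv j (\<lambda>z. f z - g z) z = partial_deriv j f z - partial_deriv j g z"
    and holo_on_mult: "holo_on (\<lambda>z. f z * g z) U"
    and partial_deriv_mult: "z \<in> U \<Longrightarrow>
      partial_deriv j (\<lambda>z. f z * g z) z = partial_deriv j f z * g z + f z * partial_deriv j g z"
proof -
  note d = holo_on_imp_has_derivative [OF assms(1)] holo_on_imp_has_derivative [OF assms(2)]
  have a: "((\<lambda>z. f z + g z) has_derivative
      (\<lambda>v. \<Sum>j\<in>UNIV. v $ j * (partial_deriv j f z + partial_deriv j g z))) (at z)" if "z \<in> U" for z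
    using has_derivative_add [OF d [OF that]] by (simp add: sum.distrib algebra_simps)
  have b: "((\<lambda>z. f z - g z) has_derivative
      (\<lambda>v. \<Sum>j\<in>UNIV. v $ j * (partial_deriv j f z - partial_deriv j g z))) (at z)" if "z \<in> U" for z
    using has_derivative_diff [OF d [OF that]] by (simp add: sum_subtractf algebra_simps)
  have c: "((\<lambda>z. f z * g z) has_derivative
      (\<lambda>v. \<Sum>j\<in>UNIV. v $ j * (partial_deriv j f z * g z + f z * partial_deriv j g z))) (at z)"
    if "z \<in> U" for z
    using has_derivative_mult [OF d [OF that]]
    by (simp add: sum.distrib sum_distrib_left sum_distrib_right algebra_simps)
  show "holo_on (\<lambda>z. f z + g z) U" "z \<in> U \<Longrightarrow>
      partial_deriv j (\<lambda>z. f z + g z) z = partial_deriv j f z + partial_deriv j g z"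
    using holo_onI_sum [OF a] by auto
  show "holo_on (\<lambda>z. f z - g z) U" "z \<in> U \<Longrightarrow>
      partial_deriv j (\<lambda>z. f z - g z) z = partial_deriv j f z - partial_deriv j g z"
    using holo_onI_sum [OF b] by auto
  show "holo_on (\<lambda>z. f z * g z) U" "z \<in> U \<Longrightarrow>
      partial_deriv j (\<lambda>z. f z * g z) z = partial_deriv j f z * g z + f z * partial_deriv j g z"
    using holo_onI_sum [OF c] by auto
qed

lemma
  assumes "holo_on f U" "holo_on g U" "\<And>z. z \<in> U \<Longrightarrow> g z \<noteq> 0"
  shows holo_on_divide: "holo_on (\<lambda>z. f z / g z) U"
    and partial_deriv_divide: "z \<in> U \<Longrightarrow> partial_deriv j (\<lambda>z. f z / g z) z =
      (partial_deriv j f z * g z - f z * partial_deriv j g z) / (g z)\<^sup>2"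
proof -
  note d = holo_on_imp_has_derivative [OF assms(1)] holo_on_imp_has_derivative [OF assms(2)]
  have a: "((\<lambda>z. f z / g z) has_derivative
      (\<lambda>v. \<Sum>j\<in>UNIV. v $ j * ((partial_deriv j f z * g z - f z * partial_deriv j g z) / (g z)\<^sup>2))) (at z)"
    if "z \<in> U" for z
  proof -
    have "(\<Sum>j\<in>UNIV. v $ j * ((partial_deriv j f z * g z - f z * partial_deriv j g z) / (g z)\<^sup>2)) =
      ((\<Sum>j\<in>UNIV. v $ j * partial_deriv j f z) * g z - f z * (\<Sum>j\<in>UNIV. v $ j * partial_deriv j g z)) / (g z * g z)" for v
      by (simp add: sum_distrib_left sum_distrib_right power2_eq_square
          flip: sum_subtractf sum_divide_distrib) (simp add: algebra_simps)
    then show ?thesis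
      using has_derivative_divide' [OF d [OF that] assms(3) [OF that]] by simp
  qed
  show "holo_on (\<lambda>z. f z / g z) U" "z \<in> U \<Longrightarrow> partial_deriv j (\<lambda>z. f z / g z) z =
      (partial_deriv j f z * g z - f z * partial_deriv j g z) / (g z)\<^sup>2"
    using holo_onI_sum [OF a] by auto
qed

lemma
  fixes \<phi> :: "complex ^ 'a::finite \<Rightarrow> complex ^ 'b::finite"
  assumes "\<And>k. holo_on (\<lambda>z. \<phi> z $ k) U" "holo_on g V" "\<And>z. z \<in> U \<Longrightarrow> \<phi> z \<in> V"
  shows holo_on_compose: "holo_on (\<lambda>z. g (\<phi> z)) U"
    and partial_deriv_compose: "z \<in> U \<Longrightarrow> partial_deriv j (\<lambda>z. g (\<phi> z)) z =
      (\<Sum>k\<in>UNIV. partial_deriv k g (\<phi> z) * partial_deriv j (\<lambda>z. \<phi> z $ k) z)"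
proof -
  have a: "((\<lambda>z. g (\<phi> z)) has_derivative (\<lambda>v. \<Sum>j\<in>UNIV. v $ j *
      (\<Sum>k\<in>UNIV. partial_deriv k g (\<phi> z) * partial_deriv j (\<lambda>z. \<phi> z $ k) z))) (at z)"
    if "z \<in> U" for z
  proof -
    have "(\<phi> has_derivative (\<lambda>v. \<chi> k. \<Sum>j\<in>UNIV. v $ j * partial_deriv j (\<lambda>z. \<phi> z $ k) z)) (at z)"
      by (rule has_derivative_vecI) (simp add: holo_on_imp_has_derivative [OF assms(1) that])
    from has_derivative_compose [OF this holo_on_imp_has_derivative [OF assms(2) assms(3) [OF that]]]
    have "((\<lambda>z. g (\<phi> z)) has_derivative (\<lambda>v. \<Sum>k\<in>UNIV.
      (\<Sum>j\<in>UNIV. v $ j * partial_deriv j (\<lambda>z. \<phi> z $ k) z) * partial_deriv k g (\<phi> z))) (at z)"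
      by simp
    moreover have "(\<Sum>k\<in>UNIV. (\<Sum>j\<in>UNIV. v $ j * partial_deriv j (\<lambda>z. \<phi> z $ k) z) * partial_deriv k g (\<phi> z)) =
      (\<Sum>j\<in>UNIV. v $ j * (\<Sum>k\<in>UNIV. partial_deriv k g (\<phi> z) * partial_deriv j (\<lambda>z. \<phi> z $ k) z))" for v
      unfolding sum_distrib_left sum_distrib_right
      by (subst sum.swap) (simp add: algebra_simps)
    ultimately show ?thesis by simp
  qed
  show "holo_on (\<lambda>z. g (\<phi> z)) U" "z \<in> U \<Longrightarrow> partial_deriv j (\<lambda>z. g (\<phi> z)) z =
      (\<Sum>k\<in>UNIV. partial_deriv k g (\<phi> z) * partial_deriv j (\<lambda>z. \<phi> z $ k) z)"
    using holo_onI_sum [OF a] by auto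
qed

lemma partial_deriv_const [simp]: "partial_deriv j (\<lambda>_. c) z = 0"
  by (simp add: partial_deriv_def)

lemma partial_deriv_coord [simp]: "partial_deriv j (\<lambda>z. z $ k) z = (if j = k then 1 else 0)"
proof -
  have "((\<lambda>t. z $ k + t * axis j 1 $ k) has_field_derivative axis j 1 $ k) (at 0)"
    by (auto intro!: derivative_eq_intros)
  then show ?thesis
    by (auto simp: partial_deriv_def axis_def dest!: DERIV_imp_deriv)
qed

lemma partial_deriv_cong:
  assumes "open U" "z \<in> U" "\<And>z. z \<in> U \<Longrightarrow> f z = g z"
  shows "partial_deriv j f z = partial_deriv j g z"
  unfolding partial_deriv_def
proof (rule deriv_cong_ev)
  have "((\<lambda>t. z + t *s axis j 1) \<longlongrightarrow> z + 0 *s axis j 1) (nhds 0)"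
    by (rule tendsto_add [OF tendsto_const bounded_linear.tendsto [OF bounded_linear_vec_scale filterlim_ident]])
  then have "\<forall>\<^sub>F t in nhds 0. z + t *s axis j 1 \<in> U"
    by (rule topological_tendstoD) (use assms in auto)
  then show "\<forall>\<^sub>F t in nhds 0. f (z + t *s axis j 1) = g (z + t *s axis j 1)"
    by eventually_elim (rule assms(3))
qed simp

text \<open>Restricting to complex lines reduces questions about several variables to the one-variable theory.\<close>

lemma holomorphic_on_line:
  assumes "holo_on f U" "\<And>t. t \<in> T \<Longrightarrow> z + t *s v \<in> U"
  shows "(\<lambda>t. f (z + t *s v)) holomorphic_on T"
    and "t \<in> T \<Longrightarrow> ((\<lambda>t. f (z + t *s v)) has_field_derivative
      (\<Sum>j\<in>UNIV. v $ j * partial_deriv j f (z + t *s v))) (at t)"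
proof -
  have *: "((\<lambda>t. f (z + t *s v)) has_field_derivative
      (\<Sum>j\<in>UNIV. v $ j * partial_deriv j f (z + t *s v))) (at t)" if "t \<in> T" for t
    by (rule has_derivative_line)
      (use holo_on_imp_has_derivative [OF assms(1) assms(2) [OF that]] in
        \<open>auto simp: sum_distrib_left algebra_simps\<close>)
  then show "t \<in> T \<Longrightarrow> ((\<lambda>t. f (z + t *s v)) has_field_derivative
      (\<Sum>j\<in>UNIV. v $ j * partial_deriv j f (z + t *s v))) (at t)" .
  show "(\<lambda>t. f (z + t *s v)) holomorphic_on T"
    unfolding holomorphic_on_def field_differentiable_def
    using * DERIV_subset by blast
qed

lemma holo_on_local:
  assumes "\<And>z. z \<in> U \<Longrightarrow> \<exists>V. open V \<and> z \<in> V \<and> holo_on f V"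
  shows "holo_on f U"
  using assms unfolding holo_on_def by blast

section \<open>Circle means, parameter integrals and the identity theorem\<close>

definition circle_point :: "real \<Rightarrow> real \<Rightarrow> complex" where
  "circle_point r \<theta> = of_real r * cis (2 * pi * \<theta>)"

text \<open>The mean value of \<open>h\<close> over the circle of radius \<open>r\<close>, that is the contour integral of \<open>h \<zeta> / (2\<pi>\<i>\<zeta>)\<close>. As an
integral over a real interval it can be differentiated with respect to parameters.\<close>

definition circle_mean :: "real \<Rightarrow> (complex \<Rightarrow> complex) \<Rightarrow> complex" where
  "circle_mean r h = integral {0..1} (\<lambda>\<theta>. h (circle_point r \<theta>))"

lemma norm_circle_point: "r > 0 \<Longrightarrow> norm (circle_point r \<theta>) = r"
  by (simp add: circle_point_def norm_mult)

lemma continuous_on_circle_point [continuous_intros]: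
  "continuous_on A f \<Longrightarrow> continuous_on A (\<lambda>x. circle_point r (f x))"
  unfolding circle_point_def by (intro continuous_intros)

lemma circle_mean_cong:
  assumes "r > 0" "\<And>\<zeta>. norm \<zeta> = r \<Longrightarrow> h \<zeta> = k \<zeta>"
  shows "circle_mean r h = circle_mean r k"
  unfolding circle_mean_def using assms norm_circle_point by simp

lemma circle_mean_add:
  assumes "r > 0" "continuous_on (sphere 0 r) h" "continuous_on (sphere 0 r) k"
  shows "circle_mean r (\<lambda>\<zeta>. h \<zeta> + k \<zeta>) = circle_mean r h + circle_mean r k"
proof -
  have "(\<lambda>\<theta>. g (circle_point r \<theta>)) integrable_on {0..1}" if "continuous_on (sphere 0 r) g" for g :: "complex \<Rightarrow> complex"
    by (intro integrable_continuous_interval continuous_on_compose2 [OF that] continuous_intros)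
      (auto simp: norm_circle_point assms(1))
  then show ?thesis
    unfolding circle_mean_def by (intro integral_add) (use assms in auto)
qed

lemma contour_integral_circlepath_eq_circle_mean:
  assumes "r > 0"
  shows "contour_integral (circlepath 0 r) h = 2 * pi * \<i> * circle_mean r (\<lambda>\<zeta>. h \<zeta> * \<zeta>)"
proof -
  have "circlepath 0 r \<theta> = circle_point r \<theta>" for \<theta>
    by (simp add: circlepath circle_point_def cis_conv_exp algebra_simps)
  moreover have "vector_derivative (circlepath 0 r) (at \<theta>) = 2 * pi * \<i> * circle_point r \<theta>" for \<theta>
    by (simp add: vector_derivative_circlepath circle_point_def cis_conv_exp algebra_simps)
  ultimately show ?thesis
    unfolding contour_integral_integral circle_mean_def
    by (subst integral_mult_right [symmetric]) (simp add: algebra_simps)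
qed

text \<open>Cauchy's formula for the Taylor coefficients.\<close>

lemma circle_mean_over_power:
  assumes "h holomorphic_on S" "open S" "cball 0 r \<subseteq> S" "r > 0"
  shows "circle_mean r (\<lambda>\<zeta>. h \<zeta> / \<zeta> ^ k) = (deriv ^^ k) h 0 / fact k"
proof -
  have "((\<lambda>u. h u / (u - 0) ^ (Suc k)) has_contour_integral ((2 * pi * \<i>) / (fact k) * (deriv ^^ k) h 0))
    (circlepath 0 r)"
    using assms by (intro Cauchy_has_contour_integral_higher_derivative_circlepath)
      (auto intro: holomorphic_on_subset [OF assms(1) order_trans [OF ball_subset_cball assms(3)]]
        holomorphic_on_imp_continuous_on holomorphic_on_subset)
  from contour_integral_unique [OF this]
  have "2 * pi * \<i> * circle_mean r (\<lambda>\<zeta>. h \<zeta> / \<zeta> ^ Suc k * \<zeta>) = (2 * pi * \<i>) / (fact k) * (deriv ^^ k) h 0"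
    by (simp add: contour_integral_circlepath_eq_circle_mean assms(4))
  moreover have "circle_mean r (\<lambda>\<zeta>. h \<zeta> / \<zeta> ^ Suc k * \<zeta>) = circle_mean r (\<lambda>\<zeta>. h \<zeta> / \<zeta> ^ k)"
    using assms(4) by (intro circle_mean_cong) auto
  ultimately show ?thesis
    by (simp add: field_simps)
qed

lemma circle_mean_holomorphic:
  assumes "h holomorphic_on S" "open S" "cball 0 r \<subseteq> S" "r > 0"
  shows "circle_mean r h = h 0"
  using circle_mean_over_power [OF assms, of 0] by simp

text \<open>The integrand is a derivative along a closed curve.\<close>

lemma circle_mean_deriv:
  assumes "\<And>\<zeta>. norm \<zeta> = r \<Longrightarrow> (h has_field_derivative h' \<zeta>) (at \<zeta>)" "r > 0"
  shows "circle_mean r (\<lambda>\<zeta>. h' \<zeta> * \<zeta>) = 0"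
proof -
  have "(h' has_contour_integral (h (pathfinish (circlepath 0 r)) - h (pathstart (circlepath 0 r)))) (circlepath 0 r)"
    using assms by (intro contour_integral_primitive [where S = "sphere 0 r"])
      (auto intro: DERIV_subset)
  from contour_integral_unique [OF this] show ?thesis
    by (simp add: contour_integral_circlepath_eq_circle_mean assms(2))
qed

lemma norm_vec_scale: "norm (c *s v) = norm c * norm v" for v :: "complex ^ 'm::finite"
  by (simp add: norm_vec_def norm_mult L2_set_right_distrib)

lemma norm_axis_complex: "norm (axis j c :: complex ^ 'm::finite) = norm c"
  by (simp add: norm_vec_def L2_set_def axis_def if_distrib [where f = norm] if_distrib [where f = "\<lambda>x. x\<^sup>2"] cong: if_cong)

lemma continuous_on_vec_scale [continuous_intros]:
  "continuous_on A f \<Longrightarrow> continuous_on A g \<Longrightarrow> continuous_on A (\<lambda>x. f x *s (g x :: complex ^ 'm::finite))"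
  unfolding vector_scalar_mult_def
  by (intro continuous_intros) 

lemma partial_deriv_circle_mean:
  assumes "holo_on f U" "cball z r \<subseteq> U" "open U" "r > 0"
  shows "partial_deriv j f z = circle_mean r (\<lambda>\<zeta>. f (z + \<zeta> *s axis j 1) / \<zeta>)"
proof -
  let ?S = "(\<lambda>\<zeta>. z + \<zeta> *s axis j 1) -` U"
  have "open ?S"
    by (intro open_vimage assms continuous_intros)
  moreover have "cball 0 r \<subseteq> ?S"
    using assms(2) by (auto simp: dist_norm norm_vec_scale norm_axis_complex subset_iff)
  moreover have "(\<lambda>\<zeta>. f (z + \<zeta> *s axis j 1)) holomorphic_on ?S"
    by (rule holomorphic_on_line(1) [OF assms(1)]) auto
  ultimately show ?thesis
    using circle_mean_over_power [where h = "\<lambda>\<zeta>. f (z + \<zeta> *s axis j 1)" and S = ?S and r = r and k = 1] assms(4)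
    by (simp add: partial_deriv_def)
qed

text \<open>Locally the partial derivative is a circle mean of the function, so joint continuity passes from the
function to its partial derivatives.\<close>

lemma continuous_on_partial_deriv_param:
  fixes F :: "complex ^ 'm::finite \<Rightarrow> 's::metric_space \<Rightarrow> complex"
  assumes U: "open U" and cont: "continuous_on (U \<times> S) (\<lambda>(z, s). F z s)"
    and holo: "\<And>s. s \<in> S \<Longrightarrow> holo_on (\<lambda>z. F z s) U"
  shows "continuous_on (U \<times> S) (\<lambda>(z, s). partial_deriv j (\<lambda>z. F z s) z)"
  unfolding continuous_on_eq_continuous_within
proof
  fix x assume "x \<in> U \<times> S"
  then obtain z0 s0 where x: "x = (z0, s0)" "z0 \<in> U" "s0 \<in> S" by auto
  then obtain e where e: "e > 0" "cball z0 e \<subseteq> U"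
    using U open_contains_cball by blast
  define r where "r = e / 2"
  have r: "r > 0" using e by (simp add: r_def)
  have sub: "cball z r \<subseteq> U" if "z \<in> ball z0 r" for z
  proof
    fix w assume "w \<in> cball z r"
    then have "dist z0 w \<le> e"
      using that dist_triangle [of z0 w z] by (simp add: r_def)
    then show "w \<in> U" using e by auto
  qed
  have "continuous_on (ball z0 r \<times> S) (\<lambda>x. integral (cbox 0 1)
    (\<lambda>\<theta>. (\<lambda>(z, s). F z s) (fst x + circle_point r \<theta> *s axis j 1, snd x) / circle_point r \<theta>))"
  proof (rule integral_continuous_on_param)
    show "continuous_on ((ball z0 r \<times> S) \<times> cbox 0 1) (\<lambda>(x, \<theta>).
      (\<lambda>(z, s). F z s) (fst x + circle_point r \<theta> *s axis j 1, snd x) / circle_point r \<theta>)"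
      unfolding case_prod_beta [of "\<lambda>x \<theta>. (\<lambda>(z, s). F z s) (fst x + circle_point r \<theta> *s axis j 1, snd x) / circle_point r \<theta>"]
    proof (intro continuous_intros continuous_on_compose2 [OF cont])
      show "\<forall>x\<in>(ball z0 r \<times> S) \<times> cbox 0 1. circle_point r (snd x) \<noteq> 0"
        using r norm_circle_point by (metis norm_zero less_irrefl)
      show "(\<lambda>x. (fst (fst x) + circle_point r (snd x) *s axis j 1, snd (fst x))) ` ((ball z0 r \<times> S) \<times> cbox 0 1)
        \<subseteq> U \<times> S"
        using sub r by (fastforce simp: dist_norm norm_vec_scale norm_axis_complex norm_circle_point subset_iff)
    qed
  qed
  then have "continuous_on (ball z0 r \<times> S) (\<lambda>(z, s). partial_deriv j (\<lambda>z. F z s) z)"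
    by (rule continuous_on_eq)
      (auto simp: partial_deriv_circle_mean [OF holo sub U r] circle_mean_def)
  then have "continuous (at x within ball z0 r \<times> S) (\<lambda>(z, s). partial_deriv j (\<lambda>z. F z s) z)"
    using x r by (simp add: continuous_on_eq_continuous_within)
  moreover have "at x within ball z0 r \<times> S = at x within U \<times> S"
    by (rule at_within_nhd [where S = "ball z0 r \<times> UNIV"])
      (use x r sub in \<open>auto simp: open_Times subset_iff\<close>)
  ultimately show "continuous (at x within U \<times> S) (\<lambda>(z, s). partial_deriv j (\<lambda>z. F z s) z)"
    by simp
qed

lemma continuous_on_slice:
  assumes "continuous_on (U \<times> S) (\<lambda>(z, s). G z s)" "z \<in> U"
  shows "continuous_on S (G z)"
proof -
  have "continuous_on S (\<lambda>s. (\<lambda>(z, s). G z s) (z, s))"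
    by (rule continuous_on_compose2 [OF assms(1)]) (use assms(2) in \<open>auto intro!: continuous_intros\<close>)
  then show ?thesis by simp
qed

text \<open>Differentiation under the integral sign. The partial derivatives of the integrand are jointly continuous
by the preceding lemma, so Leibniz' rule applies.\<close>

lemma
  fixes F :: "complex ^ 'm::finite \<Rightarrow> real \<Rightarrow> complex"
  assumes U: "open U" and cont: "continuous_on (U \<times> {a..b}) (\<lambda>(z, s). F z s)"
    and holo: "\<And>s. s \<in> {a..b} \<Longrightarrow> holo_on (\<lambda>z. F z s) U"
  shows holo_on_integral: "holo_on (\<lambda>z. integral {a..b} (F z)) U"
    and partial_deriv_integral: "z \<in> U \<Longrightarrow> partial_deriv j (\<lambda>z. integral {a..b} (F z)) z =
      integral {a..b} (\<lambda>s. partial_deriv j (\<lambda>z. F z s) z)"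
proof -
  define D where "D z s = Blinfun (\<lambda>v. \<Sum>j\<in>UNIV. v $ j * partial_deriv j (\<lambda>z. F z s) z)" for z s
  have D: "blinfun_apply (D z s) = (\<lambda>v. \<Sum>j\<in>UNIV. v $ j * partial_deriv j (\<lambda>z. F z s) z)" for z s
    unfolding D_def
    by (intro bounded_linear_Blinfun_apply bounded_linear_sum
      bounded_linear_compose [OF bounded_linear_mult_left bounded_linear_vec_nth])
  have contp: "continuous_on (U \<times> {a..b}) (\<lambda>x. partial_deriv j (\<lambda>z. F z (snd x)) (fst x))" for j
    using continuous_on_partial_deriv_param [OF U cont holo, of j] by (simp add: case_prod_beta)
  have contD: "continuous_on (U \<times> {a..b}) (\<lambda>(z, s). D z s)"
    unfolding case_prod_beta
    by (rule continuous_on_blinfun_componentwise) (auto simp: D intro!: continuous_intros contp)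
  have der: "((\<lambda>z. integral {a..b} (F z)) has_derivative (\<lambda>v. \<Sum>j\<in>UNIV. v $ j *
      integral {a..b} (\<lambda>s. partial_deriv j (\<lambda>z. F z s) z))) (at z)" if z: "z \<in> U" for z
  proof -
    obtain e where e: "e > 0" "ball z e \<subseteq> U"
      using U z open_contains_ball by blast
    have "((\<lambda>z. integral (cbox a b) (F z)) has_derivative blinfun_apply (integral (cbox a b) (D z))) (at z within ball z e)"
    proof (rule leibniz_rule [where f = F and fx = D and U = "ball z e"])
      fix w s assume "w \<in> ball z e" and s: "s \<in> cbox a b"
      then have "w \<in> U" using e by blast
      with s show "((\<lambda>z. F z s) has_derivative blinfun_apply (D w s)) (at w within ball z e)"
        unfolding D by (simp add: has_derivative_at_withinI holo_on_imp_has_derivative [OF holo])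
    next
      fix w assume "w \<in> ball z e"
      then have "continuous_on {a..b} (F w)"
        using continuous_on_slice [OF cont, of w] e by blast
      then show "F w integrable_on cbox a b"
        by (simp add: integrable_continuous_interval)
    next
      show "continuous_on (ball z e \<times> cbox a b) (\<lambda>(x, t). D x t)"
        by (rule continuous_on_subset [OF contD]) (use e in auto)
    qed (use e in \<open>simp_all add: convex_ball\<close>)
    moreover have "blinfun_apply (integral (cbox a b) (D z)) =
      (\<lambda>v. \<Sum>j\<in>UNIV. v $ j * integral {a..b} (\<lambda>s. partial_deriv j (\<lambda>z. F z s) z))"
    proof
      fix v
      have "D z integrable_on cbox a b"
        using continuous_on_slice [OF contD z] by (simp add: integrable_continuous_interval)
      then have "blinfun_apply (integral (cbox a b) (D z)) v = integral {a..b} (\<lambda>s. \<Sum>j\<in>UNIV. v $ j * partial_deriv j (\<lambda>z. F z s) z)"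
        by (simp add: blinfun_apply_integral D)
      also have "\<dots> = (\<Sum>j\<in>UNIV. integral {a..b} (\<lambda>s. v $ j * partial_deriv j (\<lambda>z. F z s) z))"
        by (intro integral_sum integrable_continuous_interval continuous_on_mult continuous_on_const
            continuous_on_slice [OF continuous_on_partial_deriv_param [OF U cont holo] z]) auto
      finally show "blinfun_apply (integral (cbox a b) (D z)) v =
        (\<Sum>j\<in>UNIV. v $ j * integral {a..b} (\<lambda>s. partial_deriv j (\<lambda>z. F z s) z))" by simp
    qed
    ultimately have "((\<lambda>z. integral {a..b} (F z)) has_derivative (\<lambda>v. \<Sum>j\<in>UNIV. v $ j *
      integral {a..b} (\<lambda>s. partial_deriv j (\<lambda>z. F z s) z))) (at z within ball z e)"
      by simp
    then show ?thesis
      using e by (simp add: at_within_open [of z "ball z e"])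
  qed
  show "holo_on (\<lambda>z. integral {a..b} (F z)) U" "z \<in> U \<Longrightarrow> partial_deriv j (\<lambda>z. integral {a..b} (F z)) z =
      integral {a..b} (\<lambda>s. partial_deriv j (\<lambda>z. F z s) z)"
    using holo_onI_sum [OF der] by auto
qed

lemma partial_deriv_translate: "partial_deriv i (\<lambda>z. G (z + c)) z = partial_deriv i G (z + c)"
  by (simp add: partial_deriv_def algebra_simps)

lemma holo_on_translate:
  assumes "holo_on G V" "\<And>z. z \<in> U \<Longrightarrow> z + c \<in> V"
  shows "holo_on (\<lambda>z. G (z + c)) U"
  by (rule holo_on_compose [OF _ assms(1)]) (use assms(2) in \<open>simp_all add: holo_on_add\<close>)

lemma
  assumes G: "holo_on G V" and U: "open U" and r: "r > 0"
    and k: "continuous_on (sphere 0 r) k"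
    and sub: "\<And>z \<zeta>. z \<in> U \<Longrightarrow> norm \<zeta> = r \<Longrightarrow> z + \<zeta> *s axis j 1 \<in> V"
  shows holo_on_circle_mean:
      "holo_on (\<lambda>z. circle_mean r (\<lambda>\<zeta>. G (z + \<zeta> *s axis j 1) * k \<zeta>)) U"
    and partial_deriv_of_circle_mean: "z \<in> U \<Longrightarrow>
      partial_deriv i (\<lambda>z. circle_mean r (\<lambda>\<zeta>. G (z + \<zeta> *s axis j 1) * k \<zeta>)) z =
      circle_mean r (\<lambda>\<zeta>. partial_deriv i G (z + \<zeta> *s axis j 1) * k \<zeta>)"
proof -
  have cont: "continuous_on (U \<times> {0..1})
    (\<lambda>(z, \<theta>). G (z + circle_point r \<theta> *s axis j 1) * k (circle_point r \<theta>))"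
    unfolding case_prod_beta
    by (intro continuous_intros continuous_on_compose2 [OF holo_on_imp_continuous_on [OF G]]
      continuous_on_compose2 [OF k]) (use sub r in \<open>auto simp: norm_circle_point\<close>)
  have t: "holo_on (\<lambda>z. G (z + circle_point r \<theta> *s axis j 1)) U" for \<theta>
    by (rule holo_on_translate [OF G]) (simp add: sub norm_circle_point r)
  then have h: "holo_on (\<lambda>z. G (z + circle_point r \<theta> *s axis j 1) * k (circle_point r \<theta>)) U" for \<theta>
    by (intro holo_on_mult) simp_all
  show "holo_on (\<lambda>z. circle_mean r (\<lambda>\<zeta>. G (z + \<zeta> *s axis j 1) * k \<zeta>)) U"
    unfolding circle_mean_def by (rule holo_on_integral [OF U cont h])
  assume z: "z \<in> U"
  have "partial_deriv i (\<lambda>z. G (z + circle_point r \<theta> *s axis j 1) * k (circle_point r \<theta>)) z =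
    partial_deriv i G (z + circle_point r \<theta> *s axis j 1) * k (circle_point r \<theta>)" for \<theta>
    by (simp add: partial_deriv_mult [OF t holo_on_const z] partial_deriv_translate)
  then show "partial_deriv i (\<lambda>z. circle_mean r (\<lambda>\<zeta>. G (z + \<zeta> *s axis j 1) * k \<zeta>)) z =
      circle_mean r (\<lambda>\<zeta>. partial_deriv i G (z + \<zeta> *s axis j 1) * k \<zeta>)"
    unfolding circle_mean_def by (simp add: partial_deriv_integral [OF U cont h z])
qed

lemma cball_subset_around:
  fixes z0 :: "'z::metric_space"
  assumes "open U" "z0 \<in> U"
  obtains r where "r > 0" "\<And>z. z \<in> ball z0 r \<Longrightarrow> cball z r \<subseteq> U"
proof -
  obtain e where e: "e > 0" "cball z0 e \<subseteq> U"
    using assms open_contains_cball by blast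
  have "cball z (e / 2) \<subseteq> U" if "z \<in> ball z0 (e / 2)" for z
  proof
    fix w assume "w \<in> cball z (e / 2)"
    then have "dist z0 w \<le> e"
      using that dist_triangle [of z0 w z] by simp
    then show "w \<in> U" using e by auto
  qed
  with e show ?thesis
    by (intro that [of "e / 2"]) auto
qed

text \<open>Near each point a partial derivative is a circle mean of \<open>f\<close>, that is an integral of holomorphic functions.
Differentiating this integral also shows that the two derivatives commute.\<close>

lemma
  assumes f: "holo_on f U" and U: "open U"
  shows holo_on_partial_deriv: "holo_on (partial_deriv j f) U"
    and partial_deriv_commute: "z \<in> U \<Longrightarrow>
      partial_deriv i (partial_deriv j f) z = partial_deriv j (partial_deriv i f) z"
proof -
  have *: "\<exists>r>0. (\<forall>w\<in>ball z r. cball w r \<subseteq> U) \<and> holo_on (partial_deriv j f) (ball z r) \<and>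
    partial_deriv i (partial_deriv j f) z =
      circle_mean r (\<lambda>\<zeta>. partial_deriv i f (z + \<zeta> *s axis j 1) * (1 / \<zeta>))" if z: "z \<in> U" for z i j
  proof -
    obtain r where r: "r > 0" "\<And>w. w \<in> ball z r \<Longrightarrow> cball w r \<subseteq> U"
      using cball_subset_around [OF U z] by blast
    let ?M = "\<lambda>w. circle_mean r (\<lambda>\<zeta>. f (w + \<zeta> *s axis j 1) * (1 / \<zeta>))"
    have eq: "?M w = partial_deriv j f w" if "w \<in> ball z r" for w
      using partial_deriv_circle_mean [OF f r(2) [OF that] U r(1)] by simp
    have k: "continuous_on (sphere 0 r) (\<lambda>\<zeta> :: complex. 1 / \<zeta>)"
      using r(1) by (intro continuous_intros) auto
    have sub: "w + \<zeta> *s axis j 1 \<in> U" if "w \<in> ball z r" "norm \<zeta> = r" for w \<zeta>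
      using r(2) [OF that(1)] that(2) by (auto simp: dist_norm norm_vec_scale norm_axis_complex subset_iff)
    have zr: "z \<in> ball z r" using r(1) by simp
    have "holo_on (partial_deriv j f) (ball z r)"
      by (rule holo_on_cong_open [OF open_ball eq holo_on_circle_mean [OF f open_ball r(1) k sub]])
    moreover have "partial_deriv i (partial_deriv j f) z = partial_deriv i ?M z"
      by (rule partial_deriv_cong [OF open_ball zr eq [symmetric]])
    then have "partial_deriv i (partial_deriv j f) z =
      circle_mean r (\<lambda>\<zeta>. partial_deriv i f (z + \<zeta> *s axis j 1) * (1 / \<zeta>))"
      by (simp only: partial_deriv_of_circle_mean [OF f open_ball r(1) k sub zr])
    ultimately show ?thesis
      using r by blast
  qed
  have h: "holo_on (partial_deriv j f) U" for j
    by (rule holo_on_local) (meson * centre_in_ball open_ball)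
  then show "holo_on (partial_deriv j f) U" .
  assume z: "z \<in> U"
  then obtain r where r: "r > 0" "\<And>w. w \<in> ball z r \<Longrightarrow> cball w r \<subseteq> U" and
    e: "partial_deriv i (partial_deriv j f) z =
      circle_mean r (\<lambda>\<zeta>. partial_deriv i f (z + \<zeta> *s axis j 1) * (1 / \<zeta>))"
    using * by meson
  then show "partial_deriv i (partial_deriv j f) z = partial_deriv j (partial_deriv i f) z"
    using partial_deriv_circle_mean [OF h r(2) U r(1), of z j i] by simp
qed

lemma higher_deriv_sum:
  assumes "\<And>j. j \<in> A \<Longrightarrow> h j holomorphic_on T" "open T" "t \<in> T"
  shows "(deriv ^^ n) (\<lambda>t. \<Sum>j\<in>A. h j t) t = (\<Sum>j\<in>A. (deriv ^^ n) (h j) t)"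
  using assms(1)
proof (induction A rule: infinite_finite_induct)
  case (insert j A)
  have "(deriv ^^ n) (\<lambda>t. h j t + (\<Sum>j\<in>A. h j t)) t =
    (deriv ^^ n) (h j) t + (deriv ^^ n) (\<lambda>t. \<Sum>j\<in>A. h j t) t"
    using insert.prems assms(2,3) by (intro higher_deriv_add [where S = T] holomorphic_intros) auto
  then show ?case
    using insert by simp
qed (simp_all add: higher_deriv_const)

lemma
  fixes w v :: "complex ^ 'm::finite"
  shows open_line_vimage: "open B \<Longrightarrow> open {t :: complex. w + t *s v \<in> B}"
    and convex_line_vimage: "convex B \<Longrightarrow> convex {t :: complex. w + t *s v \<in> B}"
proof -
  have *: "{t :: complex. w + t *s v \<in> B} = (\<lambda>t. w + t *s v) -` B" by auto
  show "open {t :: complex. w + t *s v \<in> B}" if "open B"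
    unfolding * by (intro open_vimage continuous_intros that)
  have "linear (\<lambda>t. t *s v)"
    using bounded_linear_vec_scale bounded_linear.linear by blast
  moreover have "{t :: complex. w + t *s v \<in> B} = (\<lambda>t. t *s v) -` ((\<lambda>z. - w + z) ` B)"
    by (auto simp: image_iff algebra_simps)
  ultimately show "convex {t :: complex. w + t *s v \<in> B}" if "convex B"
    using that by (simp add: convex_linear_vimage convex_translation)
qed

text \<open>If a family of holomorphic functions vanishes at \<open>y\<close> and each partial derivative of a member is a sum of
two members, then all iterated derivatives of the members vanish at \<open>y\<close>, so their restrictions to the lines
through \<open>y\<close> have Taylor series zero.\<close>

lemma iterated_partial_derivs_zero_imp_zero:
  fixes y :: "complex ^ 'm::finite"
  assumes zero: "\<And>q. q \<in> Q \<Longrightarrow> q y = 0"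
    and holo: "\<And>q. q \<in> Q \<Longrightarrow> holo_on q (ball y r)"
    and step: "\<And>q j. q \<in> Q \<Longrightarrow> \<exists>q1\<in>Q. \<exists>q2\<in>Q. \<forall>z\<in>ball y r. partial_deriv j q z = q1 z + q2 z"
    and "q \<in> Q" "z \<in> ball y r"
  shows "q z = 0"
proof -
  define v where "v = z - y"
  define T where "T = {t :: complex. y + t *s v \<in> ball y r}"
  have oT: "open T" and cT: "convex T"
    unfolding T_def by (intro open_line_vimage convex_line_vimage open_ball convex_ball)+
  have z0: "0 \<in> T" "1 \<in> T"
    using assms(5) by (auto simp: T_def v_def intro: le_less_trans [OF zero_le_dist])
  have hol: "(\<lambda>t. q (y + t *s v)) holomorphic_on T" if "q \<in> Q" for q
    by (rule holomorphic_on_line(1) [OF holo [OF that]]) (simp add: T_def)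
  have der: "(deriv ^^ n) (\<lambda>t. q (y + t *s v)) 0 = 0" if "q \<in> Q" for n q
    using that
  proof (induction n arbitrary: q)
    case 0
    then show ?case using zero by simp
  next
    case (Suc n)
    have "\<forall>j. \<exists>p1 p2. p1 \<in> Q \<and> p2 \<in> Q \<and> (\<forall>z\<in>ball y r. partial_deriv j q z = p1 z + p2 z)"
      using step [OF Suc.prems] by blast
    then obtain q1 q2 where q: "\<And>j. q1 j \<in> Q" "\<And>j. q2 j \<in> Q"
      "\<And>j z. z \<in> ball y r \<Longrightarrow> partial_deriv j q z = q1 j z + q2 j z"
      by metis
    have "deriv (\<lambda>t. q (y + t *s v)) t = (\<Sum>j\<in>UNIV. v $ j * (q1 j (y + t *s v) + q2 j (y + t *s v)))"
      if "t \<in> T" for t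
    proof -
      have "deriv (\<lambda>t. q (y + t *s v)) t = (\<Sum>j\<in>UNIV. v $ j * partial_deriv j q (y + t *s v))"
        by (rule DERIV_imp_deriv, rule holomorphic_on_line(2) [OF holo [OF Suc.prems] _ that])
          (simp add: T_def)
      then show ?thesis
        using that by (simp add: q(3) T_def)
    qed
    then have "(deriv ^^ n) (deriv (\<lambda>t. q (y + t *s v))) 0 =
      (deriv ^^ n) (\<lambda>t. \<Sum>j\<in>UNIV. v $ j * (q1 j (y + t *s v) + q2 j (y + t *s v))) 0"
      by (intro higher_deriv_cong_ev eventually_nhds_in_open [OF oT z0(1), THEN eventually_mono]) auto
    also have "\<dots> = (\<Sum>j\<in>UNIV. (deriv ^^ n) (\<lambda>t. v $ j * (q1 j (y + t *s v) + q2 j (y + t *s v))) 0)"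
      by (rule higher_deriv_sum [OF _ oT z0(1)]) (intro holomorphic_intros hol q)
    also have "\<dots> = (\<Sum>j\<in>UNIV. v $ j * (deriv ^^ n) (\<lambda>t. q1 j (y + t *s v) + q2 j (y + t *s v)) 0)"
      by (intro sum.cong refl higher_deriv_cmult [OF _ z0(1) oT] holomorphic_intros hol q)
    also have "\<dots> = 0"
      by (simp add: higher_deriv_add [OF hol hol oT z0(1)] q Suc.IH)
    finally show ?case
      by (simp add: funpow_Suc_right del: funpow.simps)
  qed
  have "q (y + 1 *s v) = 0"
    by (rule holomorphic_fun_eq_0_on_connected [OF hol oT convex_connected [OF cT]])
      (use assms(4) der z0 in auto)
  then show ?thesis
    by (simp add: v_def)
qed

lemma holo_on_zero_on_ball:
  assumes f: "holo_on f (ball z e)" and w: "w \<in> ball z e" and ev: "\<forall>\<^sub>F u in nhds w. f u = 0"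
    and u: "u \<in> ball z e"
  shows "f u = 0"
proof -
  define T where "T = {t :: complex. w + t *s (u - w) \<in> ball z e}"
  have T: "open T" "connected T"
    unfolding T_def
    by (intro open_line_vimage convex_connected convex_line_vimage open_ball convex_ball)+
  have "((\<lambda>t. w + t *s (u - w)) \<longlongrightarrow> w + 0 *s (u - w)) (nhds 0)"
    by (rule tendsto_add [OF tendsto_const bounded_linear.tendsto [OF bounded_linear_vec_scale filterlim_ident]])
  then have "\<forall>\<^sub>F t in nhds 0. f (w + t *s (u - w)) = 0"
    using ev by (auto simp: filterlim_iff)
  then have "(deriv ^^ n) (\<lambda>t. f (w + t *s (u - w))) 0 = (deriv ^^ n) (\<lambda>t. 0) 0" for n
    by (intro higher_deriv_cong_ev) auto
  then have "(deriv ^^ n) (\<lambda>t. f (w + t *s (u - w))) 0 = 0" for n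
    by simp
  then have "f (w + 1 *s (u - w)) = 0"
    by (intro holomorphic_fun_eq_0_on_connected [OF holomorphic_on_line(1) [OF f] T, where z = 0])
      (use w u in \<open>auto simp: T_def\<close>)
  then show ?thesis by simp
qed

lemma holo_on_zero_on_connected:
  assumes Y: "open Y" "connected Y" and f: "holo_on f Y" and y: "y \<in> Y" "\<forall>\<^sub>F u in nhds y. f u = 0"
    and z: "z \<in> Y"
  shows "f z = 0"
proof -
  define E where "E = {z \<in> Y. \<forall>\<^sub>F u in nhds z. f u = 0}"
  have "open E"
    unfolding open_subopen [of E]
  proof
    fix z assume "z \<in> E"
    then obtain S where "open S" "z \<in> S" "\<forall>u\<in>S. f u = 0"
      by (auto simp: E_def eventually_nhds)
    then show "\<exists>T. open T \<and> z \<in> T \<and> T \<subseteq> E"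
      using \<open>z \<in> E\<close> Y(1) by (intro exI [of _ "S \<inter> Y"]) (auto simp: E_def eventually_nhds)
  qed
  have *: "\<exists>e>0. ball z e \<subseteq> Y - E" if zY: "z \<in> Y - E" for z
  proof -
    obtain e where e: "e > 0" "ball z e \<subseteq> Y"
      using zY openE [OF Y(1), of z] by blast
    have "w \<notin> E" if w: "w \<in> ball z e" for w
    proof
      assume "w \<in> E"
      then have ev: "\<forall>\<^sub>F u in nhds w. f u = 0"
        by (simp add: E_def)
      have "f u = 0" if "u \<in> ball z e" for u
        by (rule holo_on_zero_on_ball [OF holo_on_subset [OF f e(2)] w ev that])
      then have "\<forall>\<^sub>F u in nhds z. f u = 0"
        using eventually_nhds_in_open [OF open_ball, of z z e] e(1) by (auto elim!: eventually_mono)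
      then show False using \<open>z \<in> Y - E\<close> by (simp add: E_def)
    qed
    then have "ball z e \<subseteq> Y - E" using e(2) by blast
    with e(1) show ?thesis by metis
  qed
  then have "open (Y - E)"
    unfolding open_contains_ball by (rule ballI)
  moreover have "y \<in> E"
    using y by (simp add: E_def)
  ultimately have "E \<inter> (Y - E) \<inter> Y \<noteq> {}" if "z \<notin> E"
    using connectedD [OF Y(2) \<open>open E\<close> \<open>open (Y - E)\<close>] y(1) z that by blast
  then have "z \<in> E" by blast
  then show ?thesis
    by (auto simp: E_def dest: eventually_nhds_x_imp_x)
qed

text \<open>Hadamard's lemma: integrate the derivative of \<open>g\<close> along the segment from \<open>u' z\<close> to \<open>u z\<close>.\<close>

lemma difference_as_combination:
  fixes u u' :: "complex ^ 'a::finite \<Rightarrow> complex ^ 'b::finite"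
  assumes V: "open V" and u: "\<And>k. holo_on (\<lambda>z. u z $ k) V" "\<And>k. holo_on (\<lambda>z. u' z $ k) V"
    and g: "holo_on g W" "open W"
    and seg: "\<And>z s. z \<in> V \<Longrightarrow> s \<in> {0..1} \<Longrightarrow> u' z + of_real s *s (u z - u' z) \<in> W"
  obtains K where "\<And>k. holo_on (K k) V"
    and "\<And>z. z \<in> V \<Longrightarrow> g (u z) - g (u' z) = (\<Sum>k\<in>UNIV. (u z $ k - u' z $ k) * K k z)"
proof -
  define P where "P z s = u' z + of_real s *s (u z - u' z)" for z and s :: real
  define K where "K k z = integral {0..1} (\<lambda>s. partial_deriv k g (P z s))" for k z
  have hP: "holo_on (\<lambda>z. P z s $ k) V" for s k
    by (auto simp: P_def intro!: holo_on_add holo_on_mult holo_on_diff u)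
  have cu: "continuous_on V u" "continuous_on V u'"
    using u by (auto intro!: continuous_on_vec_lambda [of V "\<lambda>k z. _ z $ k", simplified] holo_on_imp_continuous_on)
  have cP: "continuous_on (V \<times> {0..1}) (\<lambda>(z, s). P z s)"
    unfolding case_prod_beta P_def
    by (intro continuous_intros continuous_on_compose2 [OF cu(1)] continuous_on_compose2 [OF cu(2)]) auto
  have hg: "holo_on (partial_deriv k g) W" for k
    by (rule holo_on_partial_deriv [OF g])
  have cg: "continuous_on (V \<times> {0..1}) (\<lambda>(z, s). partial_deriv k g (P z s))" for k
    unfolding case_prod_beta
    by (rule continuous_on_compose2 [OF holo_on_imp_continuous_on [OF hg] cP [unfolded case_prod_beta]])
      (use seg in \<open>auto simp only: P_def fst_conv snd_conv\<close>)
  have h: "holo_on (\<lambda>z. partial_deriv k g (P z s)) V" if "s \<in> {0..1}" for k s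
    by (rule holo_on_compose [where \<phi> = "\<lambda>z. P z s", OF hP hg]) (use seg that in \<open>simp only: P_def\<close>)
  have "holo_on (K k) V" for k
    unfolding K_def by (rule holo_on_integral [OF V cg h])
  moreover have "g (u z) - g (u' z) = (\<Sum>k\<in>UNIV. (u z $ k - u' z $ k) * K k z)" if z: "z \<in> V" for z
  proof -
    have "((\<lambda>s. g (u' z + of_real s *s (u z - u' z))) has_vector_derivative
        (\<Sum>k\<in>UNIV. (u z $ k - u' z $ k) * partial_deriv k g (P z s))) (at s within {0..1})"
      if s: "s \<in> {0..1}" for s :: real
    proof -
      have "((\<lambda>t. g (u' z + t *s (u z - u' z))) has_field_derivative
        (\<Sum>k\<in>UNIV. (u z - u' z) $ k * partial_deriv k g (u' z + of_real s *s (u z - u' z)))) (at (of_real s))"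
        by (rule holomorphic_on_line(2) [OF g(1), where T = "of_real ` {0..1}"]) (use seg z s in auto)
      from has_vector_derivative_real_field [OF this] show ?thesis
        by (simp add: P_def has_vector_derivative_at_within)
    qed
    then have "((\<lambda>s. \<Sum>k\<in>UNIV. (u z $ k - u' z $ k) * partial_deriv k g (P z s)) has_integral
        (g (u' z + of_real 1 *s (u z - u' z)) - g (u' z + of_real 0 *s (u z - u' z)))) {0..1}"
      by (intro fundamental_theorem_of_calculus) auto
    then have "g (u z) - g (u' z) =
        integral {0..1} (\<lambda>s. \<Sum>k\<in>UNIV. (u z $ k - u' z $ k) * partial_deriv k g (P z s))"
      by (simp add: integral_unique)
    also have "\<dots> = (\<Sum>k\<in>UNIV. integral {0..1} (\<lambda>s. (u z $ k - u' z $ k) * partial_deriv k g (P z s)))"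
      by (intro integral_sum integrable_continuous_interval continuous_on_mult continuous_on_const
        continuous_on_slice [OF cg z]) auto
    finally show ?thesis by (simp add: K_def)
  qed
  ultimately show ?thesis by (rule that)
qed

section \<open>Functions whose gradient is generated by one partial derivative\<close>

lemma has_field_derivative_axis:
  assumes "holo_on f U" "z + \<zeta> *s axis i 1 \<in> U"
  shows "((\<lambda>t. f (z + t *s axis i 1)) has_field_derivative partial_deriv i f (z + \<zeta> *s axis i 1)) (at \<zeta>)"
proof -
  have "((\<lambda>t. f (z + t *s axis i 1)) has_field_derivative
    (\<Sum>j\<in>UNIV. axis i 1 $ j * partial_deriv j f (z + \<zeta> *s axis i 1))) (at \<zeta>)"
    by (rule holomorphic_on_line(2) [OF assms(1), where T = "{\<zeta>}"]) (use assms(2) in auto)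
  then show ?thesis
    by (simp add: axis_def if_distrib [where f = "\<lambda>x. x * _"] cong: if_cong)
qed

lemma holo_on_funpow_partial_deriv:
  "holo_on h U \<Longrightarrow> open U \<Longrightarrow> holo_on ((partial_deriv i ^^ l) h) U"
  by (induction l) (auto intro: holo_on_partial_deriv)

lemma funpow_partial_deriv_cong:
  assumes "open U" "\<And>z. z \<in> U \<Longrightarrow> g z = h z" "z \<in> U"
  shows "(partial_deriv i ^^ l) g z = (partial_deriv i ^^ l) h z"
  using assms(3)
proof (induction l arbitrary: z)
  case 0
  then show ?case using assms(2) by simp
next
  case (Suc l)
  then show ?case
    using partial_deriv_cong [OF assms(1) Suc.prems Suc.IH] by simp
qed

lemma funpow_partial_deriv_add:
  assumes "open U" "holo_on g U" "holo_on h U" "z \<in> U"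
  shows "(partial_deriv i ^^ l) (\<lambda>z. g z + h z) z = (partial_deriv i ^^ l) g z + (partial_deriv i ^^ l) h z"
  using assms(4)
proof (induction l arbitrary: z)
  case (Suc l)
  have "partial_deriv i ((partial_deriv i ^^ l) (\<lambda>z. g z + h z)) z =
    partial_deriv i (\<lambda>z. (partial_deriv i ^^ l) g z + (partial_deriv i ^^ l) h z) z"
    by (rule partial_deriv_cong [OF assms(1) Suc.prems Suc.IH])
  also have "\<dots> = partial_deriv i ((partial_deriv i ^^ l) g) z + partial_deriv i ((partial_deriv i ^^ l) h) z"
    by (intro partial_deriv_add [where U = U] holo_on_funpow_partial_deriv assms Suc.prems)
  finally show ?case by simp
qed simp

lemma funpow_partial_deriv_commute:
  assumes "open U" "holo_on h U" "z \<in> U"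
  shows "partial_deriv j ((partial_deriv i ^^ l) h) z = (partial_deriv i ^^ l) (partial_deriv j h) z"
  using assms(3)
proof (induction l arbitrary: z)
  case (Suc l)
  have "partial_deriv j (partial_deriv i ((partial_deriv i ^^ l) h)) z =
    partial_deriv i (partial_deriv j ((partial_deriv i ^^ l) h)) z"
    by (rule partial_deriv_commute [OF holo_on_funpow_partial_deriv [OF assms(2,1)] assms(1) Suc.prems])
  also have "\<dots> = partial_deriv i ((partial_deriv i ^^ l) (partial_deriv j h)) z"
    by (rule partial_deriv_cong [OF assms(1) Suc.prems Suc.IH])
  finally show ?case by simp
qed simp

text \<open>The functions \<open>\<partial>\<^sub>i\<^sup>l (C f)\<close> with \<open>C\<close> holomorphic form a family as in
\<open>iterated_partial_derivs_zero_imp_zero\<close>: the equation for \<open>\<partial>\<^sub>jf\<close> trades a derivative in direction \<open>j\<close> for one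
in direction \<open>i\<close>, and derivatives in direction \<open>i\<close> vanish on the axis together with \<open>f\<close>.\<close>

lemma zero_of_zero_on_axis:
  fixes y :: "complex ^ 'm::finite"
  assumes f: "holo_on f (ball y r)" and a: "\<And>j. holo_on (a j) (ball y r)"
    and b: "\<And>j. holo_on (b j) (ball y r)"
    and eq: "\<And>z j. z \<in> ball y r \<Longrightarrow> partial_deriv j f z = a j z * partial_deriv i f z + b j z * f z"
    and axis: "\<And>t. y + t *s axis i 1 \<in> ball y r \<Longrightarrow> f (y + t *s axis i 1) = 0"
    and z: "z \<in> ball y r"
  shows "f z = 0"
proof -
  let ?B = "ball y r" and ?D = "partial_deriv i"
  define Q where "Q = {(?D ^^ l) (\<lambda>z. C z * f z) | l C. holo_on C ?B}"
  note oB = open_ball [of y r]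
  have y: "y \<in> ?B"
    using z by (metis centre_in_ball dist_commute dist_not_less_zero less_le_trans mem_ball not_le)
  have "(?D ^^ l) (\<lambda>z. C z * f z) (y + t *s axis i 1) = 0"
    if C: "holo_on C ?B" and "y + t *s axis i 1 \<in> ?B" for l C t
    using that(2)
  proof (induction l arbitrary: t)
    case 0
    then show ?case by (simp add: axis)
  next
    case (Suc l)
    let ?h = "(?D ^^ l) (\<lambda>z. C z * f z)"
    let ?T = "{t :: complex. y + t *s axis i 1 \<in> ?B}"
    have "holo_on ?h ?B"
      by (intro holo_on_funpow_partial_deriv holo_on_mult C f open_ball)
    then have "((\<lambda>t. ?h (y + t *s axis i 1)) has_field_derivative ?D ?h (y + t *s axis i 1)) (at t)"
      by (rule has_field_derivative_axis) (rule Suc.prems)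
    moreover have "((\<lambda>t. ?h (y + t *s axis i 1)) has_field_derivative 0) (at t)"
    proof (rule has_field_derivative_transform_within_open [OF DERIV_const [of 0]])
      show "open ?T" by (rule open_line_vimage) simp
    qed (use Suc in auto)
    ultimately show ?case
      using DERIV_unique by fastforce
  qed
  from this [where t = 0] y have zero: "q y = 0" if "q \<in> Q" for q
    using that by (auto simp: Q_def)
  have holo: "holo_on q ?B" if "q \<in> Q" for q
    using that by (auto simp: Q_def intro!: holo_on_funpow_partial_deriv holo_on_mult f)
  have step: "\<exists>q1\<in>Q. \<exists>q2\<in>Q. \<forall>z\<in>?B. partial_deriv j q z = q1 z + q2 z" if qQ: "q \<in> Q" for q j
  proof -
    obtain l C where q: "q = (?D ^^ l) (\<lambda>z. C z * f z)" and C: "holo_on C ?B"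
      using qQ by (auto simp: Q_def)
    define C2 where "C2 z = C z * a j z" for z
    define C1 where "C1 z = partial_deriv j C z + C z * b j z - ?D C2 z" for z
    have C2: "holo_on C2 ?B"
      unfolding C2_def by (intro holo_on_mult C a)
    have C1: "holo_on C1 ?B"
      unfolding C1_def
      by (intro holo_on_add holo_on_diff holo_on_mult holo_on_partial_deriv C C2 b open_ball)
    have "partial_deriv j q w = (?D ^^ l) (\<lambda>z. C1 z * f z) w + (?D ^^ Suc l) (\<lambda>z. C2 z * f z) w"
      if w: "w \<in> ?B" for w
    proof -
      have "partial_deriv j q w = (?D ^^ l) (partial_deriv j (\<lambda>z. C z * f z)) w"
        unfolding q by (intro funpow_partial_deriv_commute [OF oB _ w] holo_on_mult C f)
      also have "\<dots> = (?D ^^ l) (\<lambda>z. C1 z * f z + ?D (\<lambda>z. C2 z * f z) z) w"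
      proof (rule funpow_partial_deriv_cong [OF oB _ w])
        fix z assume z: "z \<in> ?B"
        show "partial_deriv j (\<lambda>z. C z * f z) z = C1 z * f z + ?D (\<lambda>z. C2 z * f z) z"
          unfolding partial_deriv_mult [OF C f z] partial_deriv_mult [OF C2 f z] eq [OF z, of j] C1_def
          by (simp add: C2_def algebra_simps)
      qed
      also have "\<dots> = (?D ^^ l) (\<lambda>z. C1 z * f z) w + (?D ^^ l) (?D (\<lambda>z. C2 z * f z)) w"
        by (intro funpow_partial_deriv_add [OF oB _ _ w] holo_on_mult holo_on_partial_deriv C1 C2 f oB)
      finally show ?thesis
        by (simp add: funpow_Suc_right del: funpow.simps)
    qed
    moreover have "(?D ^^ l) (\<lambda>z. C1 z * f z) \<in> Q" "(?D ^^ Suc l) (\<lambda>z. C2 z * f z) \<in> Q"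
      unfolding Q_def using C1 C2 by blast+
    ultimately show ?thesis by blast
  qed
  have "(?D ^^ 0) (\<lambda>z. 1 * f z) \<in> Q"
    unfolding Q_def using holo_on_const [of 1 ?B] by (intro CollectI exI conjI) (rule refl, simp)
  then have "f \<in> Q" by simp
  then show ?thesis
    using iterated_partial_derivs_zero_imp_zero [of Q y r f z] zero holo step z by blast
qed

lemma circle_mean_mult: "circle_mean r (\<lambda>\<zeta>. c * h \<zeta>) = c * circle_mean r h"
  by (simp add: circle_mean_def)

text \<open>At a zero of order \<open>n \<ge> 2\<close> the square of the derivative vanishes to order \<open>2n - 2 \<ge> n\<close>.\<close>

lemma first_zero_square_divisible:
  assumes g: "g holomorphic_on ball 0 R" "R > 0" "g 0 = 0" "deriv g 0 = 0"
    and nz: "\<exists>t\<in>ball 0 R. g t \<noteq> 0"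
  obtains r h where "0 < r" "r \<le> R" "h holomorphic_on ball 0 r"
    "\<And>\<zeta>. \<zeta> \<in> ball 0 r - {0} \<Longrightarrow> g \<zeta> \<noteq> 0"
    "\<And>\<zeta>. \<zeta> \<in> ball 0 r - {0} \<Longrightarrow> (deriv g \<zeta>)\<^sup>2 / g \<zeta> = h \<zeta>"
proof -
  have 0: "0 \<in> ball (0::complex) R" using g(2) by simp
  have nc: "\<not> g constant_on ball 0 R"
    using nz g(3) 0 by (metis constant_on_def)
  obtain u r n where n: "0 < n" and r: "0 < r" "ball (0::complex) r \<subseteq> ball 0 R"
    and u: "u holomorphic_on ball 0 r" and gu: "\<And>w. w \<in> ball 0 r \<Longrightarrow> g w = (w - 0) ^ n * u w"
    and unz: "\<And>w. w \<in> ball 0 r \<Longrightarrow> u w \<noteq> 0"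
    by (rule holomorphic_factor_zero_nonconstant [OF g(1) open_ball connected_ball 0 g(3) nc]) (rule that)
  have du: "(u has_field_derivative deriv u w) (at w)" if "w \<in> ball 0 r" for w
    using u that by (simp add: holomorphic_derivI)
  have dg: "deriv g w = of_nat n * w ^ (n - 1) * u w + w ^ n * deriv u w" if "w \<in> ball 0 r" for w
  proof (rule DERIV_imp_deriv)
    have "((\<lambda>w. w ^ n * u w) has_field_derivative of_nat n * w ^ (n - 1) * u w + w ^ n * deriv u w) (at w)"
      by (auto intro!: derivative_eq_intros du that)
    then show "(g has_field_derivative of_nat n * w ^ (n - 1) * u w + w ^ n * deriv u w) (at w)"
      by (rule has_field_derivative_transform_within_open [OF _ open_ball that]) (simp add: gu)
  qed
  have "n \<noteq> 1"
    using dg [of 0] unz [of 0] r(1) g(4) by auto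
  with n have "n = Suc (Suc (n - 2))" by simp
  then obtain k where k: "n = Suc (Suc k)" by blast
  define h where "h w = w ^ k * (of_nat n * u w + w * deriv u w)\<^sup>2 / u w" for w
  show ?thesis
  proof (rule that [of r h])
    show "h holomorphic_on ball 0 r"
      unfolding h_def by (intro holomorphic_intros u unz) auto
    show "r \<le> R"
      using r by (simp add: ball_subset_ball_iff)
    show "g \<zeta> \<noteq> 0" if "\<zeta> \<in> ball 0 r - {0}" for \<zeta>
      using gu [of \<zeta>] unz [of \<zeta>] that by simp
    show "(deriv g \<zeta>)\<^sup>2 / g \<zeta> = h \<zeta>" if "\<zeta> \<in> ball 0 r - {0}" for \<zeta>
    proof -
      have "deriv g \<zeta> = \<zeta> ^ Suc k * (of_nat n * u \<zeta> + \<zeta> * deriv u \<zeta>)"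
        using that by (simp add: dg k algebra_simps)
      moreover have "g \<zeta> = \<zeta> ^ Suc (Suc k) * u \<zeta>"
        using that by (simp add: gu k)
      ultimately show ?thesis
        using that unz [of \<zeta>] by (simp add: h_def power2_eq_square field_simps)
    qed
  qed (use r in auto)
qed

text \<open>In one variable this is the preceding lemma; the equations for \<open>\<partial>\<^sub>jf\<close> spread it from the line through
\<open>y\<close> in direction \<open>i\<close> to a neighbourhood. The quotient \<open>W = (\<partial>\<^sub>if)\<^sup>2 / f\<close> is holomorphic off the zeros of \<open>f\<close>,
in particular on small circles in direction \<open>i\<close> around the points near \<open>y\<close>. The integrals \<open>Q\<^sub>C(z)\<close> of
\<open>C W\<close> over these circles, with \<open>C\<close> holomorphic, vanish at \<open>z = y\<close>. Since \<open>\<partial>\<^sub>jW\<close> is a combination of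
\<open>\<partial>\<^sub>iW\<close>, \<open>W\<close> and a holomorphic function, integration by parts gives \<open>\<partial>\<^sub>j Q\<^sub>C = Q\<^sub>C\<^sub>'\<close> for another \<open>C'\<close>, so all
\<open>Q\<^sub>C\<close> vanish near \<open>y\<close>. The quotient is then given by the Cauchy integral of \<open>W\<close>.\<close>

theorem partial_deriv_square_divisible:
  fixes y :: "complex ^ 'm::finite"
  assumes U: "open U" "y \<in> U" and f: "holo_on f U" "f y = 0" "partial_deriv i f y = 0"
    and nz: "\<not> (\<forall>\<^sub>F z in nhds y. f z = 0)"
    and a: "\<And>j. holo_on (a j) U" and b: "\<And>j. holo_on (b j) U"
    and eq: "\<And>z j. z \<in> U \<Longrightarrow> partial_deriv j f z = a j z * partial_deriv i f z + b j z * f z"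
  obtains V H where "open V" "y \<in> V" "holo_on H V" "\<And>z. z \<in> V \<Longrightarrow> (partial_deriv i f z)\<^sup>2 = f z * H z"
proof -
  define e :: "complex ^ 'm" where "e = axis i 1"
  let ?D = "partial_deriv i"
  let ?f1 = "partial_deriv i f"
  have norm_e: "norm (c *s e) = norm c" for c
    by (simp add: e_def norm_vec_scale norm_axis_complex)
  obtain R where R: "R > 0" "ball y R \<subseteq> U"
    using openE [OF U] by blast
  (* Below, points of the small ball are moved in direction i by up to twice its radius. *)
  define \<rho> where "\<rho> = R / 4"
  have \<rho>: "\<rho> > 0" using R(1) by (simp add: \<rho>_def)
  let ?B = "ball y \<rho>"
  have BU: "?B \<subseteq> U"
    using R by (auto simp: \<rho>_def subset_iff)
  have y: "y \<in> ?B" using \<rho> by simp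
  note oB = open_ball [of y \<rho>]
  have hf1: "holo_on ?f1 U"
    by (rule holo_on_partial_deriv [OF f(1) U(1)])
  have fB: "holo_on f ?B" and f1B: "holo_on ?f1 ?B" and aB: "holo_on (a j) ?B" and bB: "holo_on (b j) ?B" for j
    using f(1) hf1 a b BU holo_on_subset by blast+
  have dB: "holo_on (?D h) ?B" if "holo_on h ?B" for h
    by (rule holo_on_partial_deriv [OF that oB])
  have dBj: "holo_on (partial_deriv j h) ?B" if "holo_on h ?B" for h j
    by (rule holo_on_partial_deriv [OF that oB])

  define g where "g t = f (y + t *s e)" for t
  have line: "y + t *s e \<in> ?B" if "norm t < \<rho>" for t
    using that by (simp add: dist_norm norm_e)
  have g: "g holomorphic_on ball 0 \<rho>"
    unfolding g_def by (rule holomorphic_on_line(1) [OF fB line]) simp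
  have dg: "deriv g t = ?f1 (y + t *s e)" if "norm t < \<rho>" for t
    unfolding g_def e_def
    by (intro DERIV_imp_deriv has_field_derivative_axis [OF fB]) (use line [OF that] in \<open>simp add: e_def\<close>)
  (* If f vanished on the axis, it would vanish near y. *)
  have "\<exists>t\<in>ball 0 \<rho>. g t \<noteq> 0"
  proof (rule ccontr)
    assume "\<not> (\<exists>t\<in>ball 0 \<rho>. g t \<noteq> 0)"
    then have "f (y + t *s axis i 1) = 0" if "y + t *s axis i 1 \<in> ?B" for t
      using that by (auto simp: g_def dist_norm norm_e simp flip: e_def)
    note axis = this
    have eqB: "partial_deriv j f z = a j z * partial_deriv i f z + b j z * f z" if "z \<in> ?B" for z j
      using eq BU that by blast
    have "f z = 0" if "z \<in> ?B" for z
      by (rule zero_of_zero_on_axis [OF fB aB bB eqB axis that])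
    then have "\<forall>\<^sub>F z in nhds y. f z = 0"
      using eventually_nhds_in_open [OF oB y] by (auto elim!: eventually_mono)
    then show False using nz by simp
  qed
  moreover have "g 0 = 0" "deriv g 0 = 0"
    using f \<rho> dg [of 0] by (simp_all add: g_def)
  ultimately obtain r h where r: "0 < r" "r \<le> \<rho>" and h: "h holomorphic_on ball 0 r"
    and gnz: "\<And>\<zeta>. \<zeta> \<in> ball 0 r - {0} \<Longrightarrow> g \<zeta> \<noteq> 0"
    and gh: "\<And>\<zeta>. \<zeta> \<in> ball 0 r - {0} \<Longrightarrow> (deriv g \<zeta>)\<^sup>2 / g \<zeta> = h \<zeta>"
    using first_zero_square_divisible [OF g \<rho>] by metis
  define \<epsilon> where "\<epsilon> = r / 2"
  have \<epsilon>: "\<epsilon> > 0" "\<epsilon> < r" "\<epsilon> \<le> \<rho> / 2" "\<epsilon> < \<rho>"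
    using r by (auto simp: \<epsilon>_def)

  define N where "N = {z \<in> ?B. f z \<noteq> 0}"
  have oN: "open N"
  proof -
    have "open (?B \<inter> f -` (- {0}))"
      by (rule continuous_open_preimage [OF holo_on_imp_continuous_on [OF fB] oB]) auto
    moreover have "?B \<inter> f -` (- {0}) = N" by (auto simp: N_def)
    ultimately show ?thesis by simp
  qed
  have NB: "N \<subseteq> ?B" by (auto simp: N_def)
  have "compact ((\<lambda>\<zeta>. y + \<zeta> *s e) ` sphere 0 \<epsilon>)"
    by (intro compact_continuous_image continuous_intros compact_sphere)
  moreover have "(\<lambda>\<zeta>. y + \<zeta> *s e) ` sphere 0 \<epsilon> \<subseteq> N"
    using gnz line \<epsilon> by (fastforce simp: N_def g_def)
  ultimately obtain \<delta>0 where \<delta>0: "\<delta>0 > 0" "(\<Union>x\<in>(\<lambda>\<zeta>. y + \<zeta> *s e) ` sphere 0 \<epsilon>. ball x \<delta>0) \<subseteq> N"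
    using compact_subset_open_imp_ball_epsilon_subset [OF _ oN] by metis
  define \<delta> where "\<delta> = min \<delta>0 (\<rho> / 2)"
  have \<delta>: "\<delta> > 0" "\<delta> \<le> \<rho> / 2" using \<delta>0 \<rho> by (auto simp: \<delta>_def)
  let ?S = "ball y \<delta>"
  have circN: "z + \<zeta> *s e \<in> N" if "z \<in> ?S" "norm \<zeta> = \<epsilon>" for z \<zeta>
  proof -
    have "z + \<zeta> *s e \<in> ball (y + \<zeta> *s e) \<delta>0"
      using that(1) by (simp add: \<delta>_def dist_norm)
    moreover have "ball (y + \<zeta> *s e) \<delta>0 \<subseteq> N"
      using \<delta>0(2) that(2) by (simp add: UN_subset_iff)
    ultimately show ?thesis by blast
  qed
  have discB: "z + \<zeta> *s e \<in> ?B" if "z \<in> ?S" "norm \<zeta> \<le> \<epsilon>" for z \<zeta>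
  proof -
    have "dist y (z + \<zeta> *s e) \<le> dist y z + dist z (z + \<zeta> *s e)"
      by (rule dist_triangle)
    also have "dist z (z + \<zeta> *s e) = norm \<zeta>"
      by (simp add: dist_norm norm_e)
    finally show ?thesis
      using that \<delta> \<epsilon> by simp
  qed
  have SB: "?S \<subseteq> ?B" using \<delta> \<rho> by (auto simp: subset_iff)
  have contN: "continuous_on (sphere 0 \<epsilon>) (\<lambda>\<zeta>. G (z + \<zeta> *s e) * k \<zeta>)"
    if "holo_on G N" "z \<in> ?S" "continuous_on (sphere 0 \<epsilon>) k" for G z k
    by (intro continuous_intros continuous_on_compose2 [OF holo_on_imp_continuous_on [OF that(1)]] that(3))
      (use circN that(2) in auto)
  have hN: "holo_on G N" if "holo_on G ?B" for G
    using that NB holo_on_subset by blast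

  (* The differential equations for W, obtained from the symmetry of second derivatives. *)
  define W where "W z = (?f1 z)\<^sup>2 / f z" for z
  have hW: "holo_on W N"
    unfolding W_def power2_eq_square
    by (intro holo_on_divide holo_on_mult hN f1B fB) (auto simp: N_def)
  define E where "E j z = 2 * ?D (a j) z + b j z" for j z
  have hE: "holo_on (E j) ?B" for j
    unfolding E_def by (intro holo_on_add holo_on_mult holo_on_const dB aB bB)
  have dW: "partial_deriv j W z = a j z * ?D W z + E j z * W z + 2 * ?D (b j) z * ?f1 z" if z: "z \<in> N" for j z
  proof -
    have zB: "z \<in> ?B" and fz: "f z \<noteq> 0" using z by (auto simp: N_def)
    have sq: "partial_deriv k (\<lambda>z. ?f1 z * ?f1 z) z = 2 * ?f1 z * partial_deriv k ?f1 z" for k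
      by (simp add: partial_deriv_mult [OF f1B f1B zB])
    have W: "partial_deriv k W z =
      (2 * ?f1 z * partial_deriv k ?f1 z * f z - (?f1 z * ?f1 z) * partial_deriv k f z) / (f z)\<^sup>2" for k
      unfolding W_def power2_eq_square [of "?f1 _"] sq [symmetric]
      by (rule partial_deriv_divide [OF holo_on_mult [OF hN [OF f1B] hN [OF f1B]] hN [OF fB] _ z])
        (simp add: N_def)
    have "partial_deriv j ?f1 z = ?D (partial_deriv j f) z"
      by (rule partial_deriv_commute [OF fB oB zB])
    also have "\<dots> = ?D (\<lambda>z. a j z * ?f1 z + b j z * f z) z"
      by (rule partial_deriv_cong [OF oB zB]) (rule eq [OF subsetD [OF BU]])
    also have "\<dots> = ?D (a j) z * ?f1 z + a j z * ?D ?f1 z + (?D (b j) z * f z + b j z * ?f1 z)"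
      by (simp only: partial_deriv_add [OF holo_on_mult [OF aB f1B] holo_on_mult [OF bB fB] zB]
          partial_deriv_mult [OF aB f1B zB] partial_deriv_mult [OF bB fB zB])
    finally have A: "partial_deriv j ?f1 z =
      ?D (a j) z * ?f1 z + a j z * ?D ?f1 z + (?D (b j) z * f z + b j z * ?f1 z)" .
    have B: "partial_deriv j f z = a j z * ?f1 z + b j z * f z"
      by (rule eq [OF subsetD [OF BU zB]])
    show ?thesis
      unfolding W A B E_def W_def using fz by (simp add: field_simps power2_eq_square)
  qed

  (* The obstruction integrals; at y the integrand extends holomorphically over the disc. *)
  define Qf where "Qf C z = circle_mean \<epsilon> (\<lambda>\<zeta>. (C (z + \<zeta> *s e) * W (z + \<zeta> *s e)) * \<zeta>)" for C z
  define Q where "Q = {Qf C | C. holo_on C ?B}"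
  have hQf: "holo_on (Qf C) ?S"
    and dQf: "z \<in> ?S \<Longrightarrow> partial_deriv j (Qf C) z =
      circle_mean \<epsilon> (\<lambda>\<zeta>. partial_deriv j (\<lambda>z. C z * W z) (z + \<zeta> *s e) * \<zeta>)" if C: "holo_on C ?B" for C j z
  proof -
    have h: "holo_on (\<lambda>z. C z * W z) N"
      by (intro holo_on_mult hN C hW)
    have c: "continuous_on (sphere 0 \<epsilon>) (\<lambda>\<zeta>. \<zeta>)" by (rule continuous_on_id)
    note * = h open_ball \<epsilon>(1) c circN [unfolded e_def]
    show "holo_on (Qf C) ?S"
      unfolding Qf_def [abs_def] e_def by (rule holo_on_circle_mean [OF *])
    show "z \<in> ?S \<Longrightarrow> partial_deriv j (Qf C) z =
      circle_mean \<epsilon> (\<lambda>\<zeta>. partial_deriv j (\<lambda>z. C z * W z) (z + \<zeta> *s e) * \<zeta>)"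
      unfolding Qf_def [abs_def] e_def by (rule partial_deriv_of_circle_mean [OF *])
  qed
  have Q0: "q y = 0" if "q \<in> Q" for q
  proof -
    obtain C where q: "q = Qf C" and C: "holo_on C ?B"
      using \<open>q \<in> Q\<close> by (auto simp: Q_def)
    have "q y = circle_mean \<epsilon> (\<lambda>\<zeta>. (C (y + \<zeta> *s e) * h \<zeta>) * \<zeta>)"
      unfolding q Qf_def
    proof (rule circle_mean_cong [OF \<epsilon>(1)])
      fix \<zeta> :: complex assume "norm \<zeta> = \<epsilon>"
      then have "W (y + \<zeta> *s e) = h \<zeta>"
        using gh [of \<zeta>] dg [of \<zeta>] \<epsilon> by (auto simp: W_def g_def)
      then show "C (y + \<zeta> *s e) * W (y + \<zeta> *s e) * \<zeta> = C (y + \<zeta> *s e) * h \<zeta> * \<zeta>" by simp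
    qed
    also have "\<dots> = (C (y + 0 *s e) * h 0) * 0"
    proof (rule circle_mean_holomorphic [OF _ open_ball _ \<epsilon>(1)])
      show "(\<lambda>\<zeta>. C (y + \<zeta> *s e) * h \<zeta> * \<zeta>) holomorphic_on ball 0 r"
        by (intro holomorphic_intros h holomorphic_on_line(1) [OF C line]) (use r in auto)
    qed (use \<epsilon> in auto)
    finally show ?thesis by simp
  qed
  have Qstep: "\<exists>q1\<in>Q. \<exists>q2\<in>Q. \<forall>z\<in>?S. partial_deriv j q z = q1 z + q2 z" if qQ: "q \<in> Q" for q j
  proof -
    obtain C where q: "q = Qf C" and C: "holo_on C ?B"
      using qQ by (auto simp: Q_def)
    define CA where "CA z = C z * a j z" for z
    have hCA: "holo_on CA ?B"
      unfolding CA_def by (intro holo_on_mult C aB)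
    (* Integration by parts moves the derivative of W in direction i onto the coefficient C a_j. *)
    define C' where "C' z = partial_deriv j C z + C z * E j z - ?D CA z" for z
    have C': "holo_on C' ?B"
      unfolding C'_def by (intro holo_on_add holo_on_diff holo_on_mult dB dBj C hE hCA)
    define P where "P z = CA z * W z" for z
    have hP: "holo_on P N"
      unfolding P_def by (intro holo_on_mult hN hCA hW)
    define M where "M z = C z * (2 * ?D (b j) z * ?f1 z)" for z
    have hM: "holo_on M ?B"
      unfolding M_def by (intro holo_on_mult holo_on_const C dB bB f1B)
    have "partial_deriv j q z = Qf C' z" if z: "z \<in> ?S" for z
    proof -
      have "partial_deriv j (\<lambda>z. C z * W z) w = C' w * W w + (?D P w + M w)" if w: "w \<in> N" for w
      proof -
        have wB: "w \<in> ?B" using w NB by blast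
        have "?D P w = ?D CA w * W w + (C w * a j w) * ?D W w"
          unfolding P_def partial_deriv_mult [OF hN [OF hCA] hW w] by (simp add: CA_def)
        then show ?thesis
          unfolding partial_deriv_mult [OF hN [OF C] hW w] dW [OF w, of j] C'_def M_def
          by (simp add: algebra_simps)
      qed
      then have "partial_deriv j q z = circle_mean \<epsilon> (\<lambda>\<zeta>. (C' (z + \<zeta> *s e) * W (z + \<zeta> *s e)) * \<zeta> +
        (?D P (z + \<zeta> *s e) * \<zeta> + M (z + \<zeta> *s e) * \<zeta>))"
        unfolding q dQf [OF C z]
        by (intro circle_mean_cong [OF \<epsilon>(1)]) (simp add: circN [OF z] distrib_right)
      also have "\<dots> = Qf C' z + (circle_mean \<epsilon> (\<lambda>\<zeta>. ?D P (z + \<zeta> *s e) * \<zeta>) + circle_mean \<epsilon> (\<lambda>\<zeta>. M (z + \<zeta> *s e) * \<zeta>))"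
        unfolding Qf_def
        using contN [OF holo_on_mult [OF hN [OF C'] hW] z continuous_on_id]
          contN [OF holo_on_partial_deriv [OF hP oN, of i] z continuous_on_id]
          contN [OF hN [OF hM] z continuous_on_id]
        by (simp add: circle_mean_add [OF \<epsilon>(1)] continuous_on_add)
      also have "circle_mean \<epsilon> (\<lambda>\<zeta>. ?D P (z + \<zeta> *s e) * \<zeta>) = 0"
        unfolding e_def
        by (rule circle_mean_deriv [where h = "\<lambda>\<zeta>. P (z + \<zeta> *s axis i 1)", OF has_field_derivative_axis [OF hP] \<epsilon>(1)])
          (simp add: circN [OF z, unfolded e_def])
      also have "circle_mean \<epsilon> (\<lambda>\<zeta>. M (z + \<zeta> *s e) * \<zeta>) = M (z + 0 *s e) * 0"
      proof (rule circle_mean_holomorphic [OF _ open_line_vimage [OF oB] _ \<epsilon>(1)])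
        show "(\<lambda>\<zeta>. M (z + \<zeta> *s e) * \<zeta>) holomorphic_on {t. z + t *s e \<in> ?B}"
          by (intro holomorphic_intros holomorphic_on_line(1) [OF hM]) simp
        show "cball 0 \<epsilon> \<subseteq> {t. z + t *s e \<in> ?B}"
          using discB [OF z] by auto
      qed
      finally show ?thesis by simp
    qed
    moreover have "Qf C' \<in> Q" "Qf (\<lambda>_. 0) \<in> Q"
      unfolding Q_def using C' holo_on_const by blast+
    moreover have "Qf (\<lambda>_. 0) z = 0" for z
      by (simp add: Qf_def circle_mean_def)
    ultimately show ?thesis
      by (intro bexI [of _ "Qf C'"] bexI [of _ "Qf (\<lambda>_. 0)"] ballI) simp_all
  qed
  have hQ: "holo_on q ?S" if "q \<in> Q" for q
    using that hQf by (auto simp: Q_def)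
  have Qf0: "Qf C z = 0" if C: "holo_on C ?B" and z: "z \<in> ?S" for C z
  proof -
    have "Qf C \<in> Q" using C by (auto simp: Q_def)
    from iterated_partial_derivs_zero_imp_zero [where Q = Q and y = y and r = \<delta> and q = "Qf C" and z = z,
        OF _ _ _ this z] Q0 hQ Qstep
    show ?thesis by simp
  qed

  (* The candidate quotient: the value at the centre of the Cauchy integral of W. *)
  define H where "H z = circle_mean \<epsilon> (\<lambda>\<zeta>. W (z + \<zeta> *s e) * 1)" for z
  have hH: "holo_on H ?S"
    unfolding H_def [abs_def] e_def
    by (rule holo_on_circle_mean [OF hW open_ball \<epsilon>(1) continuous_on_const circN [unfolded e_def]])
  have "(?f1 z)\<^sup>2 = f z * H z" if z: "z \<in> ?S" for z
  proof -
    have uB: "u - s *s e \<in> ball y R" if u: "u \<in> ?B" and s: "norm s \<le> norm (u $ i - z $ i)" for u s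
    proof -
      have "norm (u $ i - z $ i) \<le> norm (u - z)"
        using Finite_Cartesian_Product.norm_nth_le [of "u - z" i] by simp
      also have "\<dots> \<le> dist y u + dist y z"
        using dist_triangle [of u z y] by (simp add: dist_norm norm_minus_commute)
      also have "\<dots> < 2 * \<rho>"
        using u z SB by (auto simp: subset_iff)
      finally have "norm s < 2 * \<rho>" using s by simp
      moreover have "dist y (u - s *s e) \<le> dist y u + norm s"
        using dist_triangle [of y "u - s *s e" u] by (simp add: dist_norm norm_e)
      moreover have "dist y u < \<rho>" using u by simp
      ultimately have "dist y (u - s *s e) < R"
        using \<rho>_def \<rho> by linarith
      then show ?thesis by simp
    qed
    (* On the line through z, write f(u) - f(z) as the coordinate difference times a holomorphic function K i.
       Then f(z) W differs from the square of the derivative by a term whose mean is an obstruction integral. *)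
    obtain K where K: "\<And>k. holo_on (K k) ?B"
      "\<And>u. u \<in> ?B \<Longrightarrow> f u - f (u - (u $ i - z $ i) *s e) =
        (\<Sum>k\<in>UNIV. (u $ k - (u - (u $ i - z $ i) *s e) $ k) * K k u)"
    proof (rule difference_as_combination [where V = ?B and u = "\<lambda>u. u" and
          u' = "\<lambda>u. u - (u $ i - z $ i) *s e" and g = f and W = "ball y R"])
      show "holo_on (\<lambda>u. (u - (u $ i - z $ i) *s e) $ k) ?B" for k
        by (simp, intro holo_on_diff holo_on_mult) simp_all
      show "holo_on f (ball y R)" by (rule holo_on_subset [OF f(1) R(2)])
      show "u - (u $ i - z $ i) *s e + complex_of_real s *s (u - (u - (u $ i - z $ i) *s e)) \<in> ball y R"
        if "u \<in> ?B" "s \<in> {0..1}" for u and s :: real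
      proof -
        have eq1: "u - (u $ i - z $ i) *s e + complex_of_real s *s (u - (u - (u $ i - z $ i) *s e)) =
          u - (of_real (1 - s) * (u $ i - z $ i)) *s e"
          by (simp add: vec_eq_iff algebra_simps)
        have nrm: "norm (of_real (1 - s) * (u $ i - z $ i)) \<le> norm (u $ i - z $ i)"
          using \<open>s \<in> {0..1}\<close> by (simp add: norm_mult mult_left_le_one_le del: of_real_diff)
        show ?thesis
          unfolding eq1 by (rule uB [OF \<open>u \<in> ?B\<close> nrm])
      qed
    qed (auto simp: that)
    have fK: "f (z + \<zeta> *s e) - f z = \<zeta> * K i (z + \<zeta> *s e)" if "norm \<zeta> = \<epsilon>" for \<zeta>
    proof -
      have "e $ i = 1" and ek: "e $ k = (if k = i then 1 else 0)" for k
        by (simp_all add: e_def axis_def)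
      moreover have "z + \<zeta> *s e \<in> ?B" using discB [OF z] that by simp
      ultimately show ?thesis
        using K(2) [of "z + \<zeta> *s e"]
        by (simp add: ek if_distrib [where f = "\<lambda>x. _ * x"] if_distrib [where f = "\<lambda>x. x * _"] cong: if_cong)
    qed
    have "f z * H z + Qf (K i) z = circle_mean \<epsilon> (\<lambda>\<zeta>. f z * (W (z + \<zeta> *s e) * 1)) +
        circle_mean \<epsilon> (\<lambda>\<zeta>. (K i (z + \<zeta> *s e) * W (z + \<zeta> *s e)) * \<zeta>)"
      by (simp only: circle_mean_mult H_def Qf_def)
    also have "\<dots> = circle_mean \<epsilon> (\<lambda>\<zeta>. f z * (W (z + \<zeta> *s e) * 1) + (K i (z + \<zeta> *s e) * W (z + \<zeta> *s e)) * \<zeta>)"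
      by (intro circle_mean_add [OF \<epsilon>(1), symmetric] continuous_on_mult continuous_on_const
          contN [OF hW z] contN [OF holo_on_mult [OF hN [OF K(1)] hW] z] continuous_on_id)
    also have "\<dots> = circle_mean \<epsilon> (\<lambda>\<zeta>. ?f1 (z + \<zeta> *s e) * ?f1 (z + \<zeta> *s e))"
    proof (rule circle_mean_cong [OF \<epsilon>(1)])
      fix \<zeta> :: complex assume \<zeta>: "norm \<zeta> = \<epsilon>"
      then have "f (z + \<zeta> *s e) \<noteq> 0" using circN [OF z] by (auto simp: N_def)
      moreover have "f z * (W (z + \<zeta> *s e) * 1) + (K i (z + \<zeta> *s e) * W (z + \<zeta> *s e)) * \<zeta> =
        W (z + \<zeta> *s e) * (f z + \<zeta> * K i (z + \<zeta> *s e))"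
        by (simp add: algebra_simps)
      moreover have "f z + \<zeta> * K i (z + \<zeta> *s e) = f (z + \<zeta> *s e)"
        using fK [OF \<zeta>] by (simp add: algebra_simps)
      ultimately show "f z * (W (z + \<zeta> *s e) * 1) + (K i (z + \<zeta> *s e) * W (z + \<zeta> *s e)) * \<zeta> =
        ?f1 (z + \<zeta> *s e) * ?f1 (z + \<zeta> *s e)"
        by (simp add: W_def power2_eq_square)
    qed
    also have "\<dots> = ?f1 (z + 0 *s e) * ?f1 (z + 0 *s e)"
    proof (rule circle_mean_holomorphic [OF _ open_line_vimage [OF oB] _ \<epsilon>(1)])
      show "(\<lambda>\<zeta>. ?f1 (z + \<zeta> *s e) * ?f1 (z + \<zeta> *s e)) holomorphic_on {t. z + t *s e \<in> ?B}"
        by (intro holomorphic_intros holomorphic_on_line(1) [OF f1B]) simp_all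
      show "cball 0 \<epsilon> \<subseteq> {t. z + t *s e \<in> ?B}"
        using discB [OF z] by auto
    qed
    finally show ?thesis
      by (simp add: Qf0 [OF K(1) z] power2_eq_square)
  qed
  then show ?thesis
    using that [OF open_ball _ hH] \<delta>(1) by simp
qed

section \<open>Modules, linear maps and exterior powers\<close>

lemma free_module_simps [simp]:
  "zero (free_module R S) = (\<lambda>s. \<zero>\<^bsub>R\<^esub>)"
  "add (free_module R S) u v = (\<lambda>s. u s \<oplus>\<^bsub>R\<^esub> v s)"
  "smult (free_module R S) a u = (\<lambda>s. a \<otimes>\<^bsub>R\<^esub> u s)"
  by (simp_all add: free_module_def)

lemma carrier_free_module:
  "u \<in> carrier (free_module R S) \<longleftrightarrow> (\<forall>s. u s \<in> carrier R) \<and> (\<forall>s. s \<notin> S \<longrightarrow> u s = \<zero>\<^bsub>R\<^esub>) \<and>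
    finite {s. u s \<noteq> \<zero>\<^bsub>R\<^esub>}"
  by (simp add: free_module_def)

lemma module_free_module:
  assumes "cring R"
  shows "module R (free_module R S)"
proof -
  interpret R: cring R by fact
  show ?thesis
  proof (rule moduleI [OF assms])
    show "abelian_group (free_module R S)"
    proof (rule abelian_groupI)
      fix u v assume uv: "u \<in> carrier (free_module R S)" "v \<in> carrier (free_module R S)"
      have "finite {s. u s \<oplus>\<^bsub>R\<^esub> v s \<noteq> \<zero>\<^bsub>R\<^esub>}"
        by (rule finite_subset [of _ "{s. u s \<noteq> \<zero>\<^bsub>R\<^esub>} \<union> {s. v s \<noteq> \<zero>\<^bsub>R\<^esub>}"])
          (use uv in \<open>auto simp: carrier_free_module\<close>)
      then show "u \<oplus>\<^bsub>free_module R S\<^esub> v \<in> carrier (free_module R S)"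
        using uv by (auto simp: carrier_free_module)
    next
      fix u assume u: "u \<in> carrier (free_module R S)"
      have "finite {s. \<ominus>\<^bsub>R\<^esub> u s \<noteq> \<zero>\<^bsub>R\<^esub>}"
        by (rule finite_subset [of _ "{s. u s \<noteq> \<zero>\<^bsub>R\<^esub>}"])
          (use u in \<open>auto simp: carrier_free_module\<close>)
      then show "\<exists>v\<in>carrier (free_module R S). v \<oplus>\<^bsub>free_module R S\<^esub> u = \<zero>\<^bsub>free_module R S\<^esub>"
        using u by (intro bexI [of _ "\<lambda>s. \<ominus>\<^bsub>R\<^esub> u s"]) (auto simp: carrier_free_module R.l_neg)
    qed (auto simp: carrier_free_module R.a_ac fun_eq_iff)
  next
    fix a u assume au: "a \<in> carrier R" "u \<in> carrier (free_module R S)"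
    have "finite {s. a \<otimes>\<^bsub>R\<^esub> u s \<noteq> \<zero>\<^bsub>R\<^esub>}"
      by (rule finite_subset [of _ "{s. u s \<noteq> \<zero>\<^bsub>R\<^esub>}"])
        (use au in \<open>auto simp: carrier_free_module\<close>)
    then show "a \<odot>\<^bsub>free_module R S\<^esub> u \<in> carrier (free_module R S)"
      using au by (auto simp: carrier_free_module)
  qed (auto simp: carrier_free_module R.l_distr R.r_distr R.m_assoc fun_eq_iff)
qed

lemma unit_vector_carrier: "cring R \<Longrightarrow> s \<in> S \<Longrightarrow> unit_vector R s \<in> carrier (free_module R S)"
proof -
  assume "cring R" "s \<in> S"
  then interpret R: cring R by simp
  have "finite {t. (if t = s then \<one>\<^bsub>R\<^esub> else \<zero>\<^bsub>R\<^esub>) \<noteq> \<zero>\<^bsub>R\<^esub>}"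
    by (rule finite_subset [of _ "{s}"]) auto
  with \<open>s \<in> S\<close> show ?thesis
    by (auto simp: carrier_free_module unit_vector_def)
qed

lemma (in module) submodule_carrier: "submodule (carrier M) R M"
  by (rule submoduleI) auto

lemma (in module) submodule_generated_submodule:
  assumes "G \<subseteq> carrier M"
  shows "submodule (generated_submodule R M G) R M"
proof (rule submoduleI)
  note N = submoduleE
  show "generated_submodule R M G \<subseteq> carrier M"
    unfolding generated_submodule_def using submodule_carrier assms by blast
  show "\<zero>\<^bsub>M\<^esub> \<in> generated_submodule R M G"
    unfolding generated_submodule_def
    by (auto simp: submodule_def dest: subgroup.one_closed)
  show "\<ominus>\<^bsub>M\<^esub> a \<in> generated_submodule R M G" if "a \<in> generated_submodule R M G" for a
    using that N(3) unfolding generated_submodule_def by blast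
  show "a \<oplus>\<^bsub>M\<^esub> b \<in> generated_submodule R M G"
    if "a \<in> generated_submodule R M G" "b \<in> generated_submodule R M G" for a b
    using that N(5) unfolding generated_submodule_def by blast
  show "a \<odot>\<^bsub>M\<^esub> b \<in> generated_submodule R M G" if "a \<in> carrier R" "b \<in> generated_submodule R M G" for a b
    using that N(4) unfolding generated_submodule_def by blast
qed

lemma generated_submodule_subset: "submodule N R M \<Longrightarrow> G \<subseteq> N \<Longrightarrow> generated_submodule R M G \<subseteq> N"
  unfolding generated_submodule_def by blast

lemma subset_generated_submodule: "G \<subseteq> generated_submodule R M G"
  unfolding generated_submodule_def by blast

definition is_linear ::
  "('r, 'x) ring_scheme \<Rightarrow> ('r, 'e, 'y) module_scheme \<Rightarrow> ('r, 'f, 'z) module_scheme \<Rightarrow> ('e \<Rightarrow> 'f) \<Rightarrow> bool" where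
  "is_linear R M N h \<longleftrightarrow> (\<forall>x\<in>carrier M. h x \<in> carrier N) \<and>
    (\<forall>x\<in>carrier M. \<forall>y\<in>carrier M. h (x \<oplus>\<^bsub>M\<^esub> y) = h x \<oplus>\<^bsub>N\<^esub> h y) \<and>
    (\<forall>a\<in>carrier R. \<forall>x\<in>carrier M. h (a \<odot>\<^bsub>M\<^esub> x) = a \<odot>\<^bsub>N\<^esub> h x)"

lemma
  assumes "is_linear R M N h"
  shows is_linear_closed: "x \<in> carrier M \<Longrightarrow> h x \<in> carrier N"
    and is_linear_add: "x \<in> carrier M \<Longrightarrow> y \<in> carrier M \<Longrightarrow> h (x \<oplus>\<^bsub>M\<^esub> y) = h x \<oplus>\<^bsub>N\<^esub> h y"
    and is_linear_smult: "a \<in> carrier R \<Longrightarrow> x \<in> carrier M \<Longrightarrow> h (a \<odot>\<^bsub>M\<^esub> x) = a \<odot>\<^bsub>N\<^esub> h x"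
  using assms unfolding is_linear_def by blast+

lemma is_linear_zero:
  assumes "module R M" "module R N" "is_linear R M N h"
  shows "h \<zero>\<^bsub>M\<^esub> = \<zero>\<^bsub>N\<^esub>"
proof -
  interpret M: module R M by fact
  interpret N: module R N by fact
  have "h (\<zero>\<^bsub>R\<^esub> \<odot>\<^bsub>M\<^esub> \<zero>\<^bsub>M\<^esub>) = \<zero>\<^bsub>R\<^esub> \<odot>\<^bsub>N\<^esub> h \<zero>\<^bsub>M\<^esub>"
    by (rule is_linear_smult [OF assms(3)]) auto
  then show ?thesis
    using is_linear_closed [OF assms(3) M.M.zero_closed] by simp
qed

lemma is_linear_neg:
  assumes "module R M" "module R N" "is_linear R M N h" "x \<in> carrier M"
  shows "h (\<ominus>\<^bsub>M\<^esub> x) = \<ominus>\<^bsub>N\<^esub> h x"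
proof -
  interpret M: module R M by fact
  interpret N: module R N by fact
  have "h ((\<ominus>\<^bsub>R\<^esub> \<one>\<^bsub>R\<^esub>) \<odot>\<^bsub>M\<^esub> x) = (\<ominus>\<^bsub>R\<^esub> \<one>\<^bsub>R\<^esub>) \<odot>\<^bsub>N\<^esub> h x"
    by (rule is_linear_smult [OF assms(3)]) (use assms in auto)
  then show ?thesis
    using is_linear_closed [OF assms(3,4)] assms(4) by (simp add: M.smult_l_minus N.smult_l_minus)
qed

lemma is_linear_finsum:
  assumes "module R M" "module R N" "is_linear R M N h" "finite A" "f \<in> A \<rightarrow> carrier M"
  shows "h (\<Oplus>\<^bsub>M\<^esub>i\<in>A. f i) = (\<Oplus>\<^bsub>N\<^esub>i\<in>A. h (f i))"
  using assms(4,5)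
proof (induction A)
  case empty
  interpret M: module R M by fact
  interpret N: module R N by fact
  show ?case
    using is_linear_zero [OF assms(1-3)] by simp
next
  case (insert i A)
  interpret M: module R M by fact
  interpret N: module R N by fact
  have hf: "(\<lambda>i. h (f i)) \<in> A \<rightarrow> carrier N" "h (f i) \<in> carrier N"
    using insert.prems is_linear_closed [OF assms(3)] by auto
  show ?case
    using insert hf by (simp add: Pi_iff is_linear_add [OF assms(3)])
qed

lemma submodule_vimage:
  assumes "module R M" "module R N" "is_linear R M N h" "submodule P R N"
  shows "submodule {x \<in> carrier M. h x \<in> P} R M"
proof -
  interpret M: module R M by fact
  interpret N: module R N by fact
  note P = N.submoduleE [OF assms(4)]
  have "\<zero>\<^bsub>N\<^esub> \<in> P"
    using assms(4) by (auto simp: submodule_def dest: subgroup.one_closed)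
  then show ?thesis
    by (intro M.submoduleI) (auto simp: is_linear_zero [OF assms(1-3)] is_linear_neg [OF assms(1-3)]
      is_linear_add [OF assms(3)] is_linear_smult [OF assms(3)] P)
qed

lemma submodule_zero:
  assumes "module R M"
  shows "submodule {\<zero>\<^bsub>M\<^esub>} R M"
proof -
  interpret M: module R M by fact
  show ?thesis by (rule M.submoduleI) auto
qed

lemma (in module) abelian_subgroup_submodule:
  assumes "submodule N R M"
  shows "abelian_subgroup N M"
  by (rule abelian_subgroupI3)
    (use assms in \<open>simp_all add: additive_subgroup_def submodule_def M.abelian_group_axioms\<close>)

lemma (in module) quotient_module_facts:
  assumes N: "submodule N R M"
  defines "Q \<equiv> quotient_module M N"
  shows carrier_quotient_module: "carrier Q = {N +>\<^bsub>M\<^esub> x | x. x \<in> carrier M}"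
    and zero_quotient_module: "\<zero>\<^bsub>Q\<^esub> = N +>\<^bsub>M\<^esub> \<zero>\<^bsub>M\<^esub>"
    and add_quotient_module: "\<And>x y. x \<in> carrier M \<Longrightarrow> y \<in> carrier M \<Longrightarrow>
      (N +>\<^bsub>M\<^esub> x) \<oplus>\<^bsub>Q\<^esub> (N +>\<^bsub>M\<^esub> y) = N +>\<^bsub>M\<^esub> (x \<oplus>\<^bsub>M\<^esub> y)"
    and smult_quotient_module: "\<And>a x. a \<in> carrier R \<Longrightarrow> x \<in> carrier M \<Longrightarrow>
      a \<odot>\<^bsub>Q\<^esub> (N +>\<^bsub>M\<^esub> x) = N +>\<^bsub>M\<^esub> (a \<odot>\<^bsub>M\<^esub> x)"
    and coset_eq_iff: "\<And>x y. x \<in> carrier M \<Longrightarrow> y \<in> carrier M \<Longrightarrow>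
      N +>\<^bsub>M\<^esub> x = N +>\<^bsub>M\<^esub> y \<longleftrightarrow> x \<ominus>\<^bsub>M\<^esub> y \<in> N"
    and coset_self: "\<And>x. x \<in> carrier M \<Longrightarrow> x \<in> N +>\<^bsub>M\<^esub> x"
    and coset_elem: "\<And>x y. x \<in> carrier M \<Longrightarrow> y \<in> N +>\<^bsub>M\<^esub> x \<Longrightarrow> y \<in> carrier M \<and> y \<ominus>\<^bsub>M\<^esub> x \<in> N"
proof -
  interpret N: abelian_subgroup N M
    by (rule abelian_subgroup_submodule [OF N])
  note NE = submoduleE [OF N]
  show "carrier Q = {N +>\<^bsub>M\<^esub> x | x. x \<in> carrier M}"
    unfolding Q_def quotient_module_def by (auto simp: A_RCOSETS_def')
  show "\<zero>\<^bsub>Q\<^esub> = N +>\<^bsub>M\<^esub> \<zero>\<^bsub>M\<^esub>"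
    unfolding Q_def quotient_module_def using NE(1) by simp
  show "(N +>\<^bsub>M\<^esub> x) \<oplus>\<^bsub>Q\<^esub> (N +>\<^bsub>M\<^esub> y) = N +>\<^bsub>M\<^esub> (x \<oplus>\<^bsub>M\<^esub> y)"
    if "x \<in> carrier M" "y \<in> carrier M" for x y
    unfolding Q_def quotient_module_def using that by (simp add: N.a_rcos_sum)
  show eq: "N +>\<^bsub>M\<^esub> x = N +>\<^bsub>M\<^esub> y \<longleftrightarrow> x \<ominus>\<^bsub>M\<^esub> y \<in> N"
    if "x \<in> carrier M" "y \<in> carrier M" for x y
  proof -
    have "x \<in> N +>\<^bsub>M\<^esub> y \<longleftrightarrow> x \<ominus>\<^bsub>M\<^esub> y \<in> N"
      using N.a_rcos_module [OF that(2,1)] by (simp add: a_minus_def)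
    moreover have "N +>\<^bsub>M\<^esub> x = N +>\<^bsub>M\<^esub> y \<longleftrightarrow> x \<in> N +>\<^bsub>M\<^esub> y"
      using N.a_rcos_self [OF that(1)] M.a_repr_independence [OF _ that(2)] N.a_subgroup by metis
    ultimately show ?thesis by simp
  qed
  show self: "x \<in> N +>\<^bsub>M\<^esub> x" if "x \<in> carrier M" for x
    using N.a_rcos_self [OF that] .
  show elem: "y \<in> carrier M \<and> y \<ominus>\<^bsub>M\<^esub> x \<in> N" if "x \<in> carrier M" "y \<in> N +>\<^bsub>M\<^esub> x" for x y
  proof -
    have y: "y \<in> carrier M"
      using M.a_r_coset_subset_G [OF NE(1) that(1)] that(2) by blast
    then show ?thesis
      using N.a_rcos_module [OF that(1) y] that by (simp add: a_minus_def)
  qed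
  show "a \<odot>\<^bsub>Q\<^esub> (N +>\<^bsub>M\<^esub> x) = N +>\<^bsub>M\<^esub> (a \<odot>\<^bsub>M\<^esub> x)" if a: "a \<in> carrier R" and x: "x \<in> carrier M" for a x
  proof -
    have "N +>\<^bsub>M\<^esub> (a \<odot>\<^bsub>M\<^esub> y) = N +>\<^bsub>M\<^esub> (a \<odot>\<^bsub>M\<^esub> x)" if "y \<in> N +>\<^bsub>M\<^esub> x" for y
    proof -
      have y: "y \<in> carrier M" "y \<ominus>\<^bsub>M\<^esub> x \<in> N" using elem [OF x that] by auto
      have "a \<odot>\<^bsub>M\<^esub> y \<ominus>\<^bsub>M\<^esub> a \<odot>\<^bsub>M\<^esub> x = a \<odot>\<^bsub>M\<^esub> (y \<ominus>\<^bsub>M\<^esub> x)"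
        using a x y by (simp add: a_minus_def smult_r_distr smult_r_minus)
      also have "\<dots> \<in> N" using NE(4) a y by blast
      finally show ?thesis using eq a x y by simp
    qed
    then have "(\<Union>y\<in>N +>\<^bsub>M\<^esub> x. N +>\<^bsub>M\<^esub> (a \<odot>\<^bsub>M\<^esub> y)) = (\<Union>y\<in>N +>\<^bsub>M\<^esub> x. N +>\<^bsub>M\<^esub> (a \<odot>\<^bsub>M\<^esub> x))"
      by (rule SUP_cong [OF refl])
    also have "\<dots> = N +>\<^bsub>M\<^esub> (a \<odot>\<^bsub>M\<^esub> x)"
      by (rule UN_constant [THEN trans]) (use self [OF x] in auto)
    finally show ?thesis
      unfolding Q_def quotient_module_def by simp
  qed
qed

lemma (in module) module_quotient_module:
  assumes N: "submodule N R M"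
  shows "module R (quotient_module M N)"
proof -
  have Q: "x \<in> carrier (quotient_module M N) \<longleftrightarrow> (\<exists>y. x = N +>\<^bsub>M\<^esub> y \<and> y \<in> carrier M)" for x
    by (simp add: quotient_module_facts(1) [OF N])
  note [simp] = quotient_module_facts(2-4) [OF N]
  have inv: "\<exists>y\<in>carrier (quotient_module M N). y \<oplus>\<^bsub>quotient_module M N\<^esub> (N +>\<^bsub>M\<^esub> x) = \<zero>\<^bsub>quotient_module M N\<^esub>"
    if x: "x \<in> carrier M" for x
  proof (rule bexI)
    show "(N +>\<^bsub>M\<^esub> (\<ominus>\<^bsub>M\<^esub> x)) \<oplus>\<^bsub>quotient_module M N\<^esub> (N +>\<^bsub>M\<^esub> x) = \<zero>\<^bsub>quotient_module M N\<^esub>"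
      using x by (simp add: M.l_neg)
  qed (use x Q in auto)
  show ?thesis
  proof (rule moduleI [OF R.is_cring abelian_groupI])
    show "\<exists>y\<in>carrier (quotient_module M N). y \<oplus>\<^bsub>quotient_module M N\<^esub> x = \<zero>\<^bsub>quotient_module M N\<^esub>"
      if "x \<in> carrier (quotient_module M N)" for x
      using that inv by (auto simp only: Q)
  qed (auto simp: Q M.a_ac smult_l_distr smult_r_distr smult_assoc1)
qed

lemma (in module) is_linear_coset:
  assumes N: "submodule N R M"
  shows "is_linear R M (quotient_module M N) (\<lambda>x. N +>\<^bsub>M\<^esub> x)"
  unfolding is_linear_def carrier_quotient_module [OF N]
proof (intro conjI ballI)
  show "N +>\<^bsub>M\<^esub> x \<in> {N +>\<^bsub>M\<^esub> x |x. x \<in> carrier M}" if "x \<in> carrier M" for x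
    using that by blast
qed (simp_all only: quotient_module_facts(3,4) [OF N])

text \<open>The universal property of the quotient module.\<close>

lemma (in module) linear_factor:
  assumes N: "submodule N R M" and P: "module R P" and h: "is_linear R M P h"
    and ker: "\<And>x. x \<in> N \<Longrightarrow> h x = \<zero>\<^bsub>P\<^esub>"
  obtains h' where "is_linear R (quotient_module M N) P h'" "\<And>x. x \<in> carrier M \<Longrightarrow> h' (N +>\<^bsub>M\<^esub> x) = h x"
proof -
  interpret P: module R P by fact
  define h' where "h' A = h (SOME x. x \<in> A)" for A
  have h': "h' (N +>\<^bsub>M\<^esub> x) = h x" if x: "x \<in> carrier M" for x
  proof -
    define y where "y = (SOME y. y \<in> N +>\<^bsub>M\<^esub> x)"
    have "y \<in> N +>\<^bsub>M\<^esub> x"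
      unfolding y_def by (rule someI) (rule coset_self [OF N x])
    then have y: "y \<in> carrier M" "y \<ominus>\<^bsub>M\<^esub> x \<in> N"
      using coset_elem [OF N x] by auto
    have "h ((y \<ominus>\<^bsub>M\<^esub> x) \<oplus>\<^bsub>M\<^esub> x) = h (y \<ominus>\<^bsub>M\<^esub> x) \<oplus>\<^bsub>P\<^esub> h x"
      using x y by (intro is_linear_add [OF h]) auto
    moreover have "(y \<ominus>\<^bsub>M\<^esub> x) \<oplus>\<^bsub>M\<^esub> x = y"
      using x y by (simp add: a_minus_def M.a_assoc M.l_neg)
    ultimately have "h y = h x"
      using ker [OF y(2)] is_linear_closed [OF h x] by simp
    then show ?thesis by (simp add: h'_def y_def)
  qed
  have "is_linear R (quotient_module M N) P h'"
    unfolding is_linear_def carrier_quotient_module [OF N]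
    using is_linear_closed [OF h] is_linear_add [OF h] is_linear_smult [OF h]
    by (auto simp: quotient_module_facts(3,4) [OF N] h')
  then show ?thesis using h' that by blast
qed

text \<open>The ring as a module over itself, so that linear forms are linear maps into it.\<close>

definition self_module :: "('r, 'x) ring_scheme \<Rightarrow> ('r, 'r) module" where
  "self_module R = \<lparr>carrier = carrier R, mult = undefined, one = undefined,
     zero = \<zero>\<^bsub>R\<^esub>, add = (\<oplus>\<^bsub>R\<^esub>), smult = (\<otimes>\<^bsub>R\<^esub>)\<rparr>"

lemma self_module_simps [simp]:
  "carrier (self_module R) = carrier R" "zero (self_module R) = \<zero>\<^bsub>R\<^esub>"
  "add (self_module R) = add R" "smult (self_module R) = mult R"
  by (simp_all add: self_module_def)

lemma module_self_module:
  assumes "cring R"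
  shows "module R (self_module R)"
proof -
  interpret R: cring R by fact
  show ?thesis
  proof (rule moduleI [OF assms abelian_groupI])
    show "\<exists>y\<in>carrier (self_module R). y \<oplus>\<^bsub>self_module R\<^esub> x = \<zero>\<^bsub>self_module R\<^esub>"
      if "x \<in> carrier (self_module R)" for x
      using that by (intro bexI [of _ "\<ominus>\<^bsub>R\<^esub> x"]) (auto simp: R.l_neg)
  qed (auto simp: R.a_ac R.l_distr R.r_distr R.m_assoc)
qed

lemma finsum_self_module:
  assumes "cring R" "finite A" "f \<in> A \<rightarrow> carrier R"
  shows "finsum (self_module R) f A = finsum R f A"
proof -
  interpret R: cring R by fact
  interpret S: module R "self_module R" by (rule module_self_module [OF assms(1)])
  show ?thesis
    using assms(2,3) by (induction A) (simp_all add: Pi_iff)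
qed

lemma submodule_torsion_submodule:
  assumes M: "module R M"
  shows "submodule (torsion_submodule R M) R M"
proof -
  interpret M: module R M by fact
  have mult: "a \<otimes>\<^bsub>R\<^esub> b \<in> nonzerodivisors R" if "a \<in> nonzerodivisors R" "b \<in> nonzerodivisors R" for a b
  proof -
    have ab: "a \<in> carrier R" "b \<in> carrier R"
      using that by (simp_all add: nonzerodivisors_def)
    have "c = \<zero>\<^bsub>R\<^esub>" if c: "c \<in> carrier R" "a \<otimes>\<^bsub>R\<^esub> b \<otimes>\<^bsub>R\<^esub> c = \<zero>\<^bsub>R\<^esub>" for c
    proof -
      have "a \<otimes>\<^bsub>R\<^esub> (b \<otimes>\<^bsub>R\<^esub> c) = \<zero>\<^bsub>R\<^esub>"
        using c ab by (simp add: M.R.m_assoc)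
      then have "b \<otimes>\<^bsub>R\<^esub> c = \<zero>\<^bsub>R\<^esub>"
        using \<open>a \<in> nonzerodivisors R\<close> ab c by (simp add: nonzerodivisors_def)
      then show ?thesis
        using \<open>b \<in> nonzerodivisors R\<close> c by (simp add: nonzerodivisors_def)
    qed
    then show ?thesis using ab by (simp add: nonzerodivisors_def)
  qed
  show ?thesis
  proof (rule M.submoduleI)
    show "torsion_submodule R M \<subseteq> carrier M" by (auto simp: torsion_submodule_def)
    have "\<one>\<^bsub>R\<^esub> \<in> nonzerodivisors R" by (auto simp: nonzerodivisors_def)
    then show "\<zero>\<^bsub>M\<^esub> \<in> torsion_submodule R M"
      by (auto simp: torsion_submodule_def intro!: bexI [of _ "\<one>\<^bsub>R\<^esub>"])
  next
    fix m assume "m \<in> torsion_submodule R M"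
    then obtain a where "m \<in> carrier M" "a \<in> nonzerodivisors R" "a \<odot>\<^bsub>M\<^esub> m = \<zero>\<^bsub>M\<^esub>"
      by (auto simp: torsion_submodule_def)
    then show "\<ominus>\<^bsub>M\<^esub> m \<in> torsion_submodule R M"
      by (auto simp: torsion_submodule_def nonzerodivisors_def M.smult_r_minus intro!: bexI [of _ a])
  next
    fix m k assume "m \<in> torsion_submodule R M" "k \<in> torsion_submodule R M"
    then obtain a b where *: "m \<in> carrier M" "a \<in> nonzerodivisors R" "a \<odot>\<^bsub>M\<^esub> m = \<zero>\<^bsub>M\<^esub>"
      "k \<in> carrier M" "b \<in> nonzerodivisors R" "b \<odot>\<^bsub>M\<^esub> k = \<zero>\<^bsub>M\<^esub>"
      by (auto simp: torsion_submodule_def)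
    then have ab: "a \<in> carrier R" "b \<in> carrier R" by (auto simp: nonzerodivisors_def)
    have "(a \<otimes>\<^bsub>R\<^esub> b) \<odot>\<^bsub>M\<^esub> m = b \<odot>\<^bsub>M\<^esub> (a \<odot>\<^bsub>M\<^esub> m)"
      using * ab by (simp add: M.R.m_comm [of a b] M.smult_assoc1)
    moreover have "(a \<otimes>\<^bsub>R\<^esub> b) \<odot>\<^bsub>M\<^esub> k = a \<odot>\<^bsub>M\<^esub> (b \<odot>\<^bsub>M\<^esub> k)"
      using * ab by (simp add: M.smult_assoc1)
    ultimately have "(a \<otimes>\<^bsub>R\<^esub> b) \<odot>\<^bsub>M\<^esub> (m \<oplus>\<^bsub>M\<^esub> k) = \<zero>\<^bsub>M\<^esub>"
      using * ab by (simp add: M.smult_r_distr)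
    then show "m \<oplus>\<^bsub>M\<^esub> k \<in> torsion_submodule R M"
      using * mult [of a b] by (auto simp: torsion_submodule_def)
  next
    fix c m assume c: "c \<in> carrier R" and "m \<in> torsion_submodule R M"
    then obtain a where *: "m \<in> carrier M" "a \<in> nonzerodivisors R" "a \<odot>\<^bsub>M\<^esub> m = \<zero>\<^bsub>M\<^esub>"
      by (auto simp: torsion_submodule_def)
    then have a: "a \<in> carrier R" by (auto simp: nonzerodivisors_def)
    have "a \<odot>\<^bsub>M\<^esub> (c \<odot>\<^bsub>M\<^esub> m) = c \<odot>\<^bsub>M\<^esub> (a \<odot>\<^bsub>M\<^esub> m)"
      using M.smult_assoc1 [OF a c *(1)] M.smult_assoc1 [OF c a *(1)] M.R.m_comm [OF a c] by simp
    then show "c \<odot>\<^bsub>M\<^esub> m \<in> torsion_submodule R M"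
      using * a c by (auto simp: torsion_submodule_def intro!: bexI [of _ a])
  qed
qed

text \<open>A linear form takes values in the ring, where non-zero-divisors cancel.\<close>

lemma linear_form_torsion:
  assumes "module R M" "is_linear R M (self_module R) T" "m \<in> torsion_submodule R M"
  shows "T m = \<zero>\<^bsub>R\<^esub>"
proof -
  interpret M: module R M by fact
  obtain a where a: "m \<in> carrier M" "a \<in> nonzerodivisors R" "a \<odot>\<^bsub>M\<^esub> m = \<zero>\<^bsub>M\<^esub>"
    using assms(3) by (auto simp: torsion_submodule_def)
  then have ac: "a \<in> carrier R" by (auto simp: nonzerodivisors_def)
  have "a \<otimes>\<^bsub>R\<^esub> T m = T (a \<odot>\<^bsub>M\<^esub> m)"
    using is_linear_smult [OF assms(2) ac a(1)] by simp
  also have "\<dots> = \<zero>\<^bsub>R\<^esub>"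
    using is_linear_zero [OF assms(1) module_self_module [OF M.R.is_cring] assms(2)] a(3) by simp
  finally show ?thesis
    using a(2) is_linear_closed [OF assms(2) a(1)] by (auto simp: nonzerodivisors_def)
qed

lemma free_module_span:
  assumes R: "cring R" and P: "submodule P R (free_module R S)" and "\<And>s. s \<in> S \<Longrightarrow> unit_vector R s \<in> P"
  shows "carrier (free_module R S) \<subseteq> P"
proof
  interpret R: cring R by fact
  interpret F: module R "free_module R S" by (rule module_free_module [OF R])
  note PE = F.submoduleE [OF P]
  have zP: "(\<lambda>s. \<zero>\<^bsub>R\<^esub>) \<in> P"
    using P by (auto simp: submodule_def dest: subgroup.one_closed)
  fix u assume "u \<in> carrier (free_module R S)"
  moreover have "u \<in> P" if "finite A" "u \<in> carrier (free_module R S)" "{s. u s \<noteq> \<zero>\<^bsub>R\<^esub>} \<subseteq> A" for A u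
    using that
  proof (induction A arbitrary: u)
    case empty
    then have "u = (\<lambda>s. \<zero>\<^bsub>R\<^esub>)" by auto
    then show ?case using zP by simp
  next
    case (insert s A)
    define v where "v = u (s := \<zero>\<^bsub>R\<^esub>)"
    have u: "\<And>s. u s \<in> carrier R" "\<And>s. s \<notin> S \<Longrightarrow> u s = \<zero>\<^bsub>R\<^esub>"
      using insert.prems by (auto simp: carrier_free_module)
    have "finite {t. v t \<noteq> \<zero>\<^bsub>R\<^esub>}"
      by (rule finite_subset [of _ A]) (use insert in \<open>auto simp: v_def\<close>)
    then have "v \<in> P"
      using insert u by (intro insert.IH) (auto simp: v_def carrier_free_module)
    show ?case
    proof (cases "s \<in> S")
      case True
      have "v \<oplus>\<^bsub>free_module R S\<^esub> (u s \<odot>\<^bsub>free_module R S\<^esub> unit_vector R s) \<in> P"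
        using \<open>v \<in> P\<close> PE(4,5) u(1) assms(3) [OF True] by blast
      also have "v \<oplus>\<^bsub>free_module R S\<^esub> (u s \<odot>\<^bsub>free_module R S\<^esub> unit_vector R s) = u"
        using u(1) by (auto simp: v_def unit_vector_def fun_eq_iff)
      finally show ?thesis .
    next
      case False
      then have "v = u" using u(2) by (auto simp: v_def)
      with \<open>v \<in> P\<close> show ?thesis by simp
    qed
  qed
  ultimately show "u \<in> P"
    by (auto simp: carrier_free_module)
qed

lemma free_module_lift:
  assumes R: "cring R" and t: "\<And>s. s \<in> S \<Longrightarrow> t s \<in> carrier R"
  obtains T where "is_linear R (free_module R S) (self_module R) T"
    "\<And>s. s \<in> S \<Longrightarrow> T (unit_vector R s) = t s"
proof -
  interpret R: cring R by fact
  define t' where "t' s = (if s \<in> S then t s else \<zero>\<^bsub>R\<^esub>)" for s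
  have t': "t' s \<in> carrier R" for s using t by (simp add: t'_def)
  define T where "T u = (\<Oplus>\<^bsub>R\<^esub>s\<in>{s. u s \<noteq> \<zero>\<^bsub>R\<^esub>}. u s \<otimes>\<^bsub>R\<^esub> t' s)" for u
  have T: "T u = (\<Oplus>\<^bsub>R\<^esub>s\<in>A. u s \<otimes>\<^bsub>R\<^esub> t' s)"
    if "u \<in> carrier (free_module R S)" "{s. u s \<noteq> \<zero>\<^bsub>R\<^esub>} \<subseteq> A" "finite A" for u A
    unfolding T_def using that t'
    by (intro R.add.finprod_mono_neutral_cong_left) (auto simp: carrier_free_module)
  have fin: "finite {s. u s \<noteq> \<zero>\<^bsub>R\<^esub>}" and uc: "u s \<in> carrier R" if "u \<in> carrier (free_module R S)" for u s
    using that by (auto simp: carrier_free_module)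
  interpret F: module R "free_module R S" by (rule module_free_module [OF R])
  have "is_linear R (free_module R S) (self_module R) T"
    unfolding is_linear_def
  proof (intro conjI ballI)
    fix u assume u: "u \<in> carrier (free_module R S)"
    show "T u \<in> carrier (self_module R)"
      unfolding T_def using uc [OF u] t' by (auto intro!: R.finsum_closed)
    fix v assume v: "v \<in> carrier (free_module R S)"
    let ?A = "{s. u s \<noteq> \<zero>\<^bsub>R\<^esub>} \<union> {s. v s \<noteq> \<zero>\<^bsub>R\<^esub>}"
    have A: "finite ?A" using fin u v by auto
    have "T (u \<oplus>\<^bsub>free_module R S\<^esub> v) = (\<Oplus>\<^bsub>R\<^esub>s\<in>?A. (u \<oplus>\<^bsub>free_module R S\<^esub> v) s \<otimes>\<^bsub>R\<^esub> t' s)"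
      by (rule T [OF F.M.a_closed [OF u v] _ A]) auto
    also have "\<dots> = (\<Oplus>\<^bsub>R\<^esub>s\<in>?A. u s \<otimes>\<^bsub>R\<^esub> t' s \<oplus>\<^bsub>R\<^esub> v s \<otimes>\<^bsub>R\<^esub> t' s)"
      by (rule R.finsum_cong') (auto simp: R.l_distr uc [OF u] uc [OF v] t')
    also have "\<dots> = T u \<oplus>\<^bsub>R\<^esub> T v"
      using T [OF u _ A] T [OF v _ A] uc [OF u] uc [OF v] t' by (subst R.finsum_addf) auto
    finally show "T (u \<oplus>\<^bsub>free_module R S\<^esub> v) = T u \<oplus>\<^bsub>self_module R\<^esub> T v" by simp
  next
    fix a u assume a: "a \<in> carrier R" and u: "u \<in> carrier (free_module R S)"
    let ?A = "{s. u s \<noteq> \<zero>\<^bsub>R\<^esub>}"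
    have "T (a \<odot>\<^bsub>free_module R S\<^esub> u) = (\<Oplus>\<^bsub>R\<^esub>s\<in>?A. (a \<odot>\<^bsub>free_module R S\<^esub> u) s \<otimes>\<^bsub>R\<^esub> t' s)"
      by (rule T [OF F.smult_closed [OF a u] _ fin [OF u]]) (use a in auto)
    also have "\<dots> = (\<Oplus>\<^bsub>R\<^esub>s\<in>?A. a \<otimes>\<^bsub>R\<^esub> (u s \<otimes>\<^bsub>R\<^esub> t' s))"
      by (rule R.finsum_cong') (auto simp: R.m_assoc uc [OF u] t' a)
    also have "\<dots> = a \<otimes>\<^bsub>R\<^esub> T u"
      unfolding T_def using uc [OF u] t' a fin [OF u] by (subst R.finsum_rdistr) auto
    finally show "T (a \<odot>\<^bsub>free_module R S\<^esub> u) = a \<odot>\<^bsub>self_module R\<^esub> T u" by simp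
  qed
  moreover have "T (unit_vector R s) = t s" if s: "s \<in> S" for s
  proof -
    have "T (unit_vector R s) = (\<Oplus>\<^bsub>R\<^esub>s'\<in>{s}. unit_vector R s s' \<otimes>\<^bsub>R\<^esub> t' s')"
      by (rule T [OF unit_vector_carrier [OF R s]]) (auto simp: unit_vector_def)
    then show ?thesis
      using t' [of s] s by (simp add: unit_vector_def) (simp add: t'_def)
  qed
  ultimately show ?thesis using that by blast
qed

lemma tuples_update: "ms \<in> tuples p M \<Longrightarrow> a \<in> carrier M \<Longrightarrow> ms[i := a] \<in> tuples p M"
  unfolding tuples_def using set_update_subset_insert [of ms i a] by auto

context module
begin

abbreviation "tuple_module p \<equiv> free_module R (tuples p M)"

lemma exterior_relations_carrier: "exterior_relations R p M \<subseteq> carrier (tuple_module p)"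
proof -
  interpret F: module R "tuple_module p" by (rule module_free_module [OF R.is_cring])
  have \<delta>: "unit_vector R ms \<in> carrier (tuple_module p)" if "ms \<in> tuples p M" for ms
    by (rule unit_vector_carrier [OF R.is_cring that])
  show ?thesis
    unfolding exterior_relations_def Let_def
    by (auto simp del: free_module_simps intro!: F.M.minus_closed F.M.a_closed F.smult_closed \<delta> tuples_update)
qed

lemma submodule_exterior_relations:
  "submodule (generated_submodule R (tuple_module p) (exterior_relations R p M)) R (tuple_module p)"
proof -
  interpret F: module R "tuple_module p" by (rule module_free_module [OF R.is_cring])
  show ?thesis
    by (rule F.submodule_generated_submodule [OF exterior_relations_carrier])
qed

lemma module_exterior_power: "module R (exterior_power R p M)"
proof -
  interpret F: module R "tuple_module p" by (rule module_free_module [OF R.is_cring])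
  show ?thesis
    unfolding exterior_power_def Let_def by (rule F.module_quotient_module [OF submodule_exterior_relations])
qed

lemma wedge_closed: "ms \<in> tuples p M \<Longrightarrow> wedge R p M ms \<in> carrier (exterior_power R p M)"
proof -
  assume "ms \<in> tuples p M"
  interpret F: module R "tuple_module p" by (rule module_free_module [OF R.is_cring])
  show ?thesis
    unfolding exterior_power_def Let_def wedge_def F.carrier_quotient_module [OF submodule_exterior_relations]
    using unit_vector_carrier [OF R.is_cring \<open>ms \<in> tuples p M\<close>] by blast
qed

lemma
  assumes ms: "ms \<in> tuples p M"
  shows wedge_add: "\<lbrakk>i < p; a \<in> carrier M; b \<in> carrier M\<rbrakk> \<Longrightarrow> wedge R p M (ms[i := a \<oplus>\<^bsub>M\<^esub> b]) =
      wedge R p M (ms[i := a]) \<oplus>\<^bsub>exterior_power R p M\<^esub> wedge R p M (ms[i := b])"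
    and wedge_smult: "\<lbrakk>i < p; r \<in> carrier R; a \<in> carrier M\<rbrakk> \<Longrightarrow> wedge R p M (ms[i := r \<odot>\<^bsub>M\<^esub> a]) =
      r \<odot>\<^bsub>exterior_power R p M\<^esub> wedge R p M (ms[i := a])"
    and wedge_alternating: "\<lbrakk>i < j; j < p; ms ! i = ms ! j\<rbrakk> \<Longrightarrow>
      wedge R p M ms = \<zero>\<^bsub>exterior_power R p M\<^esub>"
proof -
  interpret F: module R "tuple_module p" by (rule module_free_module [OF R.is_cring])
  let ?N = "generated_submodule R (tuple_module p) (exterior_relations R p M)"
  note N = submodule_exterior_relations [of p]
  note Q = F.quotient_module_facts [OF N]
  have \<delta>: "unit_vector R ms \<in> carrier (tuple_module p)" if "ms \<in> tuples p M" for ms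
    by (rule unit_vector_carrier [OF R.is_cring that])
  note rel = subset_generated_submodule [of "exterior_relations R p M" R "tuple_module p", THEN subsetD]
  note upd = tuples_update [OF ms]
  show "wedge R p M (ms[i := a \<oplus>\<^bsub>M\<^esub> b]) =
      wedge R p M (ms[i := a]) \<oplus>\<^bsub>exterior_power R p M\<^esub> wedge R p M (ms[i := b])"
    if "i < p" "a \<in> carrier M" "b \<in> carrier M"
  proof -
    have "unit_vector R (ms[i := a \<oplus>\<^bsub>M\<^esub> b]) \<ominus>\<^bsub>tuple_module p\<^esub>
      (unit_vector R (ms[i := a]) \<oplus>\<^bsub>tuple_module p\<^esub> unit_vector R (ms[i := b])) \<in> ?N"
      by (rule rel, unfold exterior_relations_def Let_def, rule UnI1, rule UnI1, intro CollectI exI conjI)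
        (rule refl, (rule ms that)+)
    then show ?thesis
      unfolding exterior_power_def wedge_def Let_def
      using that by (subst Q(3)) (auto simp only: Q(5) \<delta> upd M.a_closed F.M.a_closed)
  qed
  show "wedge R p M (ms[i := r \<odot>\<^bsub>M\<^esub> a]) = r \<odot>\<^bsub>exterior_power R p M\<^esub> wedge R p M (ms[i := a])"
    if "i < p" "r \<in> carrier R" "a \<in> carrier M"
  proof -
    have "unit_vector R (ms[i := r \<odot>\<^bsub>M\<^esub> a]) \<ominus>\<^bsub>tuple_module p\<^esub>
      (r \<odot>\<^bsub>tuple_module p\<^esub> unit_vector R (ms[i := a])) \<in> ?N"
      by (rule rel, unfold exterior_relations_def Let_def, rule UnI1, rule UnI2, intro CollectI exI conjI)
        (rule refl, (rule ms that)+)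
    then show ?thesis
      unfolding exterior_power_def wedge_def Let_def
      using that by (subst Q(4)) (auto simp only: Q(5) \<delta> upd smult_closed F.smult_closed)
  qed
  show "wedge R p M ms = \<zero>\<^bsub>exterior_power R p M\<^esub>" if "i < j" "j < p" "ms ! i = ms ! j"
  proof -
    have "unit_vector R ms \<in> ?N"
      by (rule rel, unfold exterior_relations_def Let_def, rule UnI2, intro CollectI exI conjI)
        (rule refl, (rule ms that)+)
    moreover have m0: "\<ominus>\<^bsub>tuple_module p\<^esub> \<zero>\<^bsub>tuple_module p\<^esub> = \<zero>\<^bsub>tuple_module p\<^esub>"
      by (rule F.M.minus_equality) (simp_all del: free_module_simps)
    ultimately have "unit_vector R ms \<ominus>\<^bsub>tuple_module p\<^esub> \<zero>\<^bsub>tuple_module p\<^esub> \<in> ?N"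
      unfolding a_minus_def m0 F.M.r_zero [OF \<delta> [OF ms]] by simp
    then show ?thesis
      unfolding exterior_power_def wedge_def Let_def
      by (subst Q(2)) (simp only: Q(5) \<delta> ms F.M.zero_closed)
  qed
qed

lemma wedge_span:
  assumes P: "submodule P R (exterior_power R p M)" and w: "\<And>ms. ms \<in> tuples p M \<Longrightarrow> wedge R p M ms \<in> P"
  shows "carrier (exterior_power R p M) \<subseteq> P"
proof -
  interpret F: module R "tuple_module p" by (rule module_free_module [OF R.is_cring])
  let ?N = "generated_submodule R (tuple_module p) (exterior_relations R p M)"
  note N = submodule_exterior_relations [of p]
  have lin: "is_linear R (tuple_module p) (exterior_power R p M) (\<lambda>x. ?N +>\<^bsub>tuple_module p\<^esub> x)"
    unfolding exterior_power_def Let_def by (rule F.is_linear_coset [OF N])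
  have "carrier (tuple_module p) \<subseteq> {x \<in> carrier (tuple_module p). ?N +>\<^bsub>tuple_module p\<^esub> x \<in> P}"
  proof (rule free_module_span [OF R.is_cring])
    show "submodule {x \<in> carrier (tuple_module p). ?N +>\<^bsub>tuple_module p\<^esub> x \<in> P} R (tuple_module p)"
      by (rule submodule_vimage [OF module_free_module [OF R.is_cring] module_exterior_power lin P])
  qed (use w in \<open>auto simp: wedge_def Let_def unit_vector_carrier [OF R.is_cring]\<close>)
  then show ?thesis
    unfolding exterior_power_def Let_def F.carrier_quotient_module [OF N] by blast
qed

text \<open>The universal property of the exterior power, for alternating forms with values in the ring.\<close>

lemma exterior_power_lift:
  assumes t: "\<And>ms. ms \<in> tuples p M \<Longrightarrow> t ms \<in> carrier R"
    and t_add: "\<And>ms i a b. \<lbrakk>ms \<in> tuples p M; i < p; a \<in> carrier M; b \<in> carrier M\<rbrakk> \<Longrightarrow>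
      t (ms[i := a \<oplus>\<^bsub>M\<^esub> b]) = t (ms[i := a]) \<oplus>\<^bsub>R\<^esub> t (ms[i := b])"
    and t_smult: "\<And>ms i r a. \<lbrakk>ms \<in> tuples p M; i < p; r \<in> carrier R; a \<in> carrier M\<rbrakk> \<Longrightarrow>
      t (ms[i := r \<odot>\<^bsub>M\<^esub> a]) = r \<otimes>\<^bsub>R\<^esub> t (ms[i := a])"
    and t_alt: "\<And>ms i j. \<lbrakk>ms \<in> tuples p M; i < j; j < p; ms ! i = ms ! j\<rbrakk> \<Longrightarrow> t ms = \<zero>\<^bsub>R\<^esub>"
  obtains T where "is_linear R (exterior_power R p M) (self_module R) T"
    "\<And>ms. ms \<in> tuples p M \<Longrightarrow> T (wedge R p M ms) = t ms"
proof -
  interpret F: module R "tuple_module p" by (rule module_free_module [OF R.is_cring])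
  interpret S: module R "self_module R" by (rule module_self_module [OF R.is_cring])
  let ?N = "generated_submodule R (tuple_module p) (exterior_relations R p M)"
  note N = submodule_exterior_relations [of p]
  obtain T0 where T0: "is_linear R (tuple_module p) (self_module R) T0"
    "\<And>ms. ms \<in> tuples p M \<Longrightarrow> T0 (unit_vector R ms) = t ms"
    by (rule free_module_lift [OF R.is_cring t], assumption, rule that)
  have \<delta>: "unit_vector R ms \<in> carrier (tuple_module p)" if "ms \<in> tuples p M" for ms
    by (rule unit_vector_carrier [OF R.is_cring that])
  have diff: "T0 (u \<ominus>\<^bsub>tuple_module p\<^esub> v) = \<zero>\<^bsub>R\<^esub>"
    if "T0 u = T0 v" "u \<in> carrier (tuple_module p)" "v \<in> carrier (tuple_module p)" for u v
    using that is_linear_closed [OF T0(1), of v] S.M.r_neg [of "T0 v"]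
    by (simp add: a_minus_def is_linear_add [OF T0(1)] is_linear_neg [OF F.module_axioms S.module_axioms T0(1)] 
      del: free_module_simps)
  have "exterior_relations R p M \<subseteq> {x \<in> carrier (tuple_module p). T0 x \<in> {\<zero>\<^bsub>self_module R\<^esub>}}"
  proof
    fix x assume x: "x \<in> exterior_relations R p M"
    have "T0 x = \<zero>\<^bsub>R\<^esub>"
      using x unfolding exterior_relations_def Let_def
    proof (elim UnE CollectE exE conjE)
      fix ms i a b
      assume "x = unit_vector R (ms[i := a \<oplus>\<^bsub>M\<^esub> b]) \<ominus>\<^bsub>tuple_module p\<^esub>
        (unit_vector R (ms[i := a]) \<oplus>\<^bsub>tuple_module p\<^esub> unit_vector R (ms[i := b]))"
        and *: "ms \<in> tuples p M" "i < p" "a \<in> carrier M" "b \<in> carrier M"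
      moreover have "T0 (unit_vector R (ms[i := a \<oplus>\<^bsub>M\<^esub> b])) =
        T0 (unit_vector R (ms[i := a]) \<oplus>\<^bsub>tuple_module p\<^esub> unit_vector R (ms[i := b]))"
        using * by (subst is_linear_add [OF T0(1)]) (simp_all add: \<delta> tuples_update T0(2) t_add del: free_module_simps)
      ultimately show ?thesis
        by (simp only: diff \<delta> tuples_update M.a_closed F.M.a_closed)
    next
      fix ms i r a
      assume "x = unit_vector R (ms[i := r \<odot>\<^bsub>M\<^esub> a]) \<ominus>\<^bsub>tuple_module p\<^esub>
        (r \<odot>\<^bsub>tuple_module p\<^esub> unit_vector R (ms[i := a]))"
        and *: "ms \<in> tuples p M" "i < p" "r \<in> carrier R" "a \<in> carrier M"
      moreover have "T0 (unit_vector R (ms[i := r \<odot>\<^bsub>M\<^esub> a])) =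
        T0 (r \<odot>\<^bsub>tuple_module p\<^esub> unit_vector R (ms[i := a]))"
        using * by (subst is_linear_smult [OF T0(1)]) (simp_all add: \<delta> tuples_update T0(2) t_smult del: free_module_simps)
      ultimately show ?thesis
        by (simp only: diff \<delta> tuples_update smult_closed F.smult_closed)
    next
      fix ms i j
      assume "x = unit_vector R ms" "ms \<in> tuples p M" "i < j" "j < p" "ms ! i = ms ! j"
      then show ?thesis using t_alt T0(2) by simp
    qed
    then show "x \<in> {x \<in> carrier (tuple_module p). T0 x \<in> {\<zero>\<^bsub>self_module R\<^esub>}}"
      using x exterior_relations_carrier by auto
  qed
  from generated_submodule_subset [OF submodule_vimage [OF F.module_axioms S.module_axioms T0(1)
        submodule_zero [OF S.module_axioms]] this]
  have ker: "T0 x = \<zero>\<^bsub>self_module R\<^esub>" if "x \<in> ?N" for x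
    using that by blast
  obtain T where T: "is_linear R (quotient_module (tuple_module p) ?N) (self_module R) T"
    "\<And>x. x \<in> carrier (tuple_module p) \<Longrightarrow> T (?N +>\<^bsub>tuple_module p\<^esub> x) = T0 x"
    by (rule F.linear_factor [OF N S.module_axioms T0(1) ker], assumption, rule that)
  show ?thesis
  proof (rule that)
    show "is_linear R (exterior_power R p M) (self_module R) T"
      unfolding exterior_power_def Let_def by (rule T(1))
    show "T (wedge R p M ms) = t ms" if "ms \<in> tuples p M" for ms
      unfolding wedge_def Let_def by (simp only: T(2) [OF \<delta> [OF that]] T0(2) [OF that])
  qed
qed

end

section \<open>Germs of holomorphic functions and local rings\<close>

lemma holo_at_const [simp]: "holo_at x (\<lambda>_. c)"
  unfolding holo_at_def using holo_on_const open_UNIV by blast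

lemma holo_at_coord [simp]: "holo_at x (\<lambda>z. z $ k)"
  unfolding holo_at_def using holo_on_coord open_UNIV by blast

lemma holo_at_pairE:
  assumes "holo_at x f" "holo_at x g"
  obtains U where "open U" "x \<in> U" "holo_on f U" "holo_on g U"
proof -
  obtain U V where UV: "open U" "x \<in> U" "holo_on f U" "open V" "x \<in> V" "holo_on g V"
    using assms unfolding holo_at_def by blast
  show ?thesis
    by (rule that [of "U \<inter> V"])
      (use UV in \<open>auto intro: holo_on_subset [of _ U] holo_on_subset [of _ V]\<close>)
qed

lemma holo_at_add: "holo_at x f \<Longrightarrow> holo_at x g \<Longrightarrow> holo_at x (\<lambda>z. f z + g z)"
  by (erule (1) holo_at_pairE) (use holo_on_add in \<open>auto simp: holo_at_def\<close>)

lemma holo_at_diff: "holo_at x f \<Longrightarrow> holo_at x g \<Longrightarrow> holo_at x (\<lambda>z. f z - g z)"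
  by (erule (1) holo_at_pairE) (use holo_on_diff in \<open>auto simp: holo_at_def\<close>)

lemma holo_at_mult: "holo_at x f \<Longrightarrow> holo_at x g \<Longrightarrow> holo_at x (\<lambda>z. f z * g z)"
  by (erule (1) holo_at_pairE) (use holo_on_mult in \<open>auto simp: holo_at_def\<close>)

lemma holo_at_sum: "(\<And>i. i \<in> A \<Longrightarrow> holo_at x (f i)) \<Longrightarrow> holo_at x (\<lambda>z. \<Sum>i\<in>A. f i z)"
  by (induction A rule: infinite_finite_induct) (simp_all add: holo_at_add)

lemma holo_at_prod: "(\<And>i. i \<in> A \<Longrightarrow> holo_at x (f i)) \<Longrightarrow> holo_at x (\<lambda>z. \<Prod>i\<in>A. f i z)"
  by (induction A rule: infinite_finite_induct) (simp_all add: holo_at_mult)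

lemma holo_at_partial_deriv: "holo_at x f \<Longrightarrow> holo_at x (partial_deriv j f)"
  unfolding holo_at_def using holo_on_partial_deriv by blast

lemma holo_at_cong:
  assumes "holo_at x f" "\<forall>\<^sub>F z in nhds x. f z = g z"
  shows "holo_at x g"
proof -
  obtain U where U: "open U" "x \<in> U" "holo_on f U"
    using assms(1) unfolding holo_at_def by blast
  obtain V where V: "open V" "x \<in> V" "\<And>z. z \<in> V \<Longrightarrow> f z = g z"
    using assms(2) unfolding eventually_nhds by blast
  have "holo_on g (U \<inter> V)"
    by (rule holo_on_cong_open [of _ f]) (use U V in \<open>auto intro: holo_on_subset [of _ U]\<close>)
  then show ?thesis
    unfolding holo_at_def using U V by blast
qed

lemma holo_at_imp_isCont: "holo_at x f \<Longrightarrow> isCont f x"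
  unfolding holo_at_def
  by (meson continuous_on_eq_continuous_at holo_on_imp_continuous_on)

lemma holo_at_inverse:
  assumes "holo_at x f" "f x \<noteq> 0"
  shows "holo_at x (\<lambda>z. 1 / f z)"
proof -
  obtain U where U: "open U" "x \<in> U" "holo_on f U"
    using assms(1) unfolding holo_at_def by blast
  let ?V = "U \<inter> f -` (- {0})"
  have "open ?V"
    by (rule continuous_open_preimage [OF holo_on_imp_continuous_on [OF U(3)] U(1)]) auto
  moreover have "holo_on (\<lambda>z. 1 / f z) ?V"
    by (intro holo_on_divide holo_on_const holo_on_subset [OF U(3)]) auto
  ultimately show ?thesis
    unfolding holo_at_def using U assms(2) by blast
qed

lemma germ_eq_iff: "germ x f = germ x g \<longleftrightarrow> (\<forall>\<^sub>F z in nhds x. f z = g z)"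
proof
  assume "germ x f = germ x g"
  moreover have "f \<in> germ x f" by (simp add: germ_def)
  ultimately show "\<forall>\<^sub>F z in nhds x. f z = g z" by (simp add: germ_def)
next
  assume fg: "\<forall>\<^sub>F z in nhds x. f z = g z"
  have "(\<forall>\<^sub>F z in nhds x. h z = f z) = (\<forall>\<^sub>F z in nhds x. h z = g z)" for h
    using eventually_elim2 [OF _ fg, of "\<lambda>z. h z = f z" "\<lambda>z. h z = g z"]
      eventually_elim2 [OF _ fg, of "\<lambda>z. h z = g z" "\<lambda>z. h z = f z"] by auto
  then show "germ x f = germ x g" by (simp add: germ_def)
qed

lemma germ_ring_carrier: "carrier (germ_ring x) = germ x ` {f. holo_at x f}"
  by (simp add: germ_ring_def)

lemma germ_in_carrier [simp]: "holo_at x f \<Longrightarrow> germ x f \<in> carrier (germ_ring x)"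
  by (simp add: germ_ring_carrier)

lemma
  shows germ_ring_zero: "\<zero>\<^bsub>germ_ring x\<^esub> = germ x (\<lambda>_. 0)"
    and germ_ring_one: "\<one>\<^bsub>germ_ring x\<^esub> = germ x (\<lambda>_. 1)"
    and germ_ring_add: "germ x f \<oplus>\<^bsub>germ_ring x\<^esub> germ x g = germ x (\<lambda>z. f z + g z)"
    and germ_ring_mult: "germ x f \<otimes>\<^bsub>germ_ring x\<^esub> germ x g = germ x (\<lambda>z. f z * g z)"
proof -
  have self: "h \<in> germ x h" for h by (simp add: germ_def)
  have *: "germ x (\<lambda>z. b (f' z) (g' z)) = germ x (\<lambda>z. b (f z) (g z))"
    if "f' \<in> germ x f" "g' \<in> germ x g" for f' g' and b :: "complex \<Rightarrow> complex \<Rightarrow> complex"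
  proof -
    have "\<forall>\<^sub>F z in nhds x. f' z = f z" "\<forall>\<^sub>F z in nhds x. g' z = g z"
      using that by (simp_all add: germ_def)
    then show ?thesis
      unfolding germ_eq_iff by eventually_elim simp
  qed
  have **: "(\<Union>f'\<in>germ x f. \<Union>g'\<in>germ x g. germ x (\<lambda>z. b (f' z) (g' z))) = germ x (\<lambda>z. b (f z) (g z))"
    for b :: "complex \<Rightarrow> complex \<Rightarrow> complex"
  proof -
    have "(\<Union>f'\<in>germ x f. \<Union>g'\<in>germ x g. germ x (\<lambda>z. b (f' z) (g' z))) =
      (\<Union>f'\<in>germ x f. \<Union>g'\<in>germ x g. germ x (\<lambda>z. b (f z) (g z)))"
      by (intro SUP_cong refl *)
    also have "\<dots> = germ x (\<lambda>z. b (f z) (g z))"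
    proof -
      have "germ x f \<noteq> {}" "germ x g \<noteq> {}"
        using self [of f] self [of g] by (metis empty_iff)+
      then show ?thesis by (simp only: UN_constant if_False)
    qed
    finally show ?thesis .
  qed
  show "\<zero>\<^bsub>germ_ring x\<^esub> = germ x (\<lambda>_. 0)" "\<one>\<^bsub>germ_ring x\<^esub> = germ x (\<lambda>_. 1)"
    by (simp_all add: germ_ring_def)
  show "germ x f \<oplus>\<^bsub>germ_ring x\<^esub> germ x g = germ x (\<lambda>z. f z + g z)"
    using ** [of "(+)"] by (simp add: germ_ring_def)
  show "germ x f \<otimes>\<^bsub>germ_ring x\<^esub> germ x g = germ x (\<lambda>z. f z * g z)"
    using ** [of "(*)"] by (simp add: germ_ring_def)
qed

lemma cring_germ_ring: "cring (germ_ring x)"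
proof (rule cringI)
  note simps = germ_ring_zero germ_ring_one germ_ring_add germ_ring_mult germ_ring_carrier
  show "abelian_group (germ_ring x)"
  proof (rule abelian_groupI)
    show "\<exists>b\<in>carrier (germ_ring x). b \<oplus>\<^bsub>germ_ring x\<^esub> a = \<zero>\<^bsub>germ_ring x\<^esub>"
      if "a \<in> carrier (germ_ring x)" for a
    proof -
      obtain f where "a = germ x f" "holo_at x f" using \<open>a \<in> carrier _\<close> by (auto simp: simps)
      then show ?thesis
        using holo_at_diff [OF holo_at_const, of x f 0]
        by (intro bexI [of _ "germ x (\<lambda>z. 0 - f z)"]) (auto simp: simps)
    qed
  qed (auto simp: simps algebra_simps intro!: imageI holo_at_add)
  show "comm_monoid (germ_ring x)"
    by (rule comm_monoidI) (auto simp: simps algebra_simps intro!: imageI holo_at_mult)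
qed (auto simp: germ_ring_add germ_ring_mult germ_ring_carrier algebra_simps)

text \<open>The ideal of \<open>X\<close> at \<open>y\<close>, as a set of functions instead of germs, so that computations modulo the ideal
can be carried out with functions.\<close>

definition ideal_fun ::
  "'m::finite space_germ \<Rightarrow> complex ^ 'm \<Rightarrow> (complex ^ 'm \<Rightarrow> complex) set" where
  "ideal_fun X y = {f. holo_at y f \<and> germ y f \<in> ideal_at X y}"

locale germ_at =
  fixes X :: "'m::finite space_germ" and y :: "complex ^ 'm"
  assumes holo_eqns: "f \<in> eqns X \<Longrightarrow> holo_at y f"
begin

abbreviation "cls \<equiv> local_class X y"
abbreviation "LR \<equiv> local_ring X y"

lemma ideal_ideal_at: "ideal (ideal_at X y) (germ_ring y)"
proof -
  interpret G: cring "germ_ring y" by (rule cring_germ_ring)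
  show ?thesis
    unfolding ideal_at_def by (rule G.genideal_ideal) (use holo_eqns in auto)
qed

sublocale G: cring "germ_ring y" by (rule cring_germ_ring)
sublocale I: ideal "ideal_at X y" "germ_ring y" by (rule ideal_ideal_at)

lemma cring_local_ring: "cring LR"
  unfolding local_ring_def by (rule I.quotient_is_cring [OF cring_germ_ring])

sublocale LR: cring LR by (rule cring_local_ring)

lemma cls_hom: "(+>\<^bsub>germ_ring y\<^esub>) (ideal_at X y) \<in> ring_hom (germ_ring y) LR"
  unfolding local_ring_def by (rule I.rcos_ring_hom)

lemma cls_carrier [simp]: "holo_at y f \<Longrightarrow> cls f \<in> carrier LR"
  unfolding local_class_def by (rule ring_hom_closed [OF cls_hom]) simp

lemma cls_add: "holo_at y f \<Longrightarrow> holo_at y g \<Longrightarrow> cls (\<lambda>z. f z + g z) = cls f \<oplus>\<^bsub>LR\<^esub> cls g"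
  unfolding local_class_def by (simp add: ring_hom_add [OF cls_hom, symmetric] germ_ring_add)

lemma cls_mult: "holo_at y f \<Longrightarrow> holo_at y g \<Longrightarrow> cls (\<lambda>z. f z * g z) = cls f \<otimes>\<^bsub>LR\<^esub> cls g"
  unfolding local_class_def by (simp add: ring_hom_mult [OF cls_hom, symmetric] germ_ring_mult)

lemma cls_one: "cls (\<lambda>_. 1) = \<one>\<^bsub>LR\<^esub>"
  unfolding local_class_def using ring_hom_one [OF cls_hom] by (simp add: germ_ring_one)

lemma cls_surj:
  assumes "a \<in> carrier LR"
  obtains f where "holo_at y f" "a = cls f"
proof -
  obtain u where "u \<in> carrier (germ_ring y)" "a = ideal_at X y +>\<^bsub>germ_ring y\<^esub> u"
    using assms unfolding local_ring_def FactRing_def by (auto simp: A_RCOSETS_def')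
  then show ?thesis
    using that by (auto simp: germ_ring_carrier local_class_def)
qed

lemma germ_minus:
  assumes "holo_at y f" "holo_at y g"
  shows "germ y f \<ominus>\<^bsub>germ_ring y\<^esub> germ y g = germ y (\<lambda>z. f z - g z)"
proof -
  have "germ y f = germ y (\<lambda>z. f z - g z) \<oplus>\<^bsub>germ_ring y\<^esub> germ y g"
    by (simp add: germ_ring_add)
  then show ?thesis
    using assms holo_at_diff [OF assms] by (simp add: a_minus_def G.a_assoc G.r_neg)
qed

lemma cls_eq_iff: "holo_at y f \<Longrightarrow> holo_at y g \<Longrightarrow> cls f = cls g \<longleftrightarrow> (\<lambda>z. f z - g z) \<in> ideal_fun X y"
proof -
  assume f: "holo_at y f" and g: "holo_at y g"
  have "germ y f \<in> ideal_at X y +>\<^bsub>germ_ring y\<^esub> germ y g \<longleftrightarrow>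
    germ y f \<ominus>\<^bsub>germ_ring y\<^esub> germ y g \<in> ideal_at X y"
    using f g by (intro I.a_rcos_module_minus) (simp_all add: G.ring_axioms)
  moreover have "germ y f \<in> ideal_at X y +>\<^bsub>germ_ring y\<^esub> germ y f"
    using f by (simp add: I.a_rcos_self)
  then have "cls f = cls g \<longleftrightarrow> germ y f \<in> ideal_at X y +>\<^bsub>germ_ring y\<^esub> germ y g"
    unfolding local_class_def
    using G.a_repr_independence [of "germ y f" "ideal_at X y" "germ y g"] g I.a_subgroup by auto
  ultimately show ?thesis
    using f g by (simp add: germ_minus ideal_fun_def holo_at_diff)
qed

lemma cls_zero: "cls (\<lambda>_. 0) = \<zero>\<^bsub>LR\<^esub>"
proof -
  have "cls (\<lambda>_. 0) \<oplus>\<^bsub>LR\<^esub> cls (\<lambda>_. 0) = cls (\<lambda>_. 0)"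
    by (simp flip: cls_add)
  then show ?thesis
    by (metis LR.add.l_cancel_one' cls_carrier holo_at_const)
qed

lemma cls_eq_zero_iff: "holo_at y f \<Longrightarrow> cls f = \<zero>\<^bsub>LR\<^esub> \<longleftrightarrow> f \<in> ideal_fun X y"
  using cls_eq_iff [of f "\<lambda>_. 0"] by (simp add: cls_zero)

lemma ideal_fun_holo: "f \<in> ideal_fun X y \<Longrightarrow> holo_at y f"
  by (simp add: ideal_fun_def)

lemma ideal_fun_zero: "(\<lambda>_. 0) \<in> ideal_fun X y"
  using cls_eq_zero_iff cls_zero by auto

lemma ideal_fun_add: "f \<in> ideal_fun X y \<Longrightarrow> g \<in> ideal_fun X y \<Longrightarrow> (\<lambda>z. f z + g z) \<in> ideal_fun X y"
  by (auto simp: ideal_fun_def holo_at_add germ_ring_add [symmetric] I.a_closed)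

lemma ideal_fun_mult: "holo_at y c \<Longrightarrow> f \<in> ideal_fun X y \<Longrightarrow> (\<lambda>z. c z * f z) \<in> ideal_fun X y"
  by (auto simp: ideal_fun_def holo_at_mult germ_ring_mult [symmetric] I.I_l_closed)

lemma ideal_fun_cong:
  assumes "f \<in> ideal_fun X y" "\<forall>\<^sub>F z in nhds y. f z = g z"
  shows "g \<in> ideal_fun X y"
  using assms holo_at_cong [of y f g] germ_eq_iff [of y f g] by (simp add: ideal_fun_def)

lemma ideal_fun_eqns: "f \<in> eqns X \<Longrightarrow> f \<in> ideal_fun X y"
proof -
  assume f: "f \<in> eqns X"
  have "germ y ` eqns X \<subseteq> carrier (germ_ring y)"
    using holo_eqns by auto
  from G.genideal_self [OF this] f show ?thesis
    by (simp add: ideal_fun_def ideal_at_def holo_eqns image_subset_iff)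
qed

text \<open>An induction principle stating that the ideal is generated by the equations of \<open>X\<close>: the germs of a set of
functions with these closure properties form an ideal.\<close>

lemma ideal_fun_induct:
  assumes f: "f \<in> ideal_fun X y" and eqns: "eqns X \<subseteq> S" and holo: "\<And>f. f \<in> S \<Longrightarrow> holo_at y f"
    and zero: "(\<lambda>_. 0) \<in> S"
    and add: "\<And>f g. f \<in> S \<Longrightarrow> g \<in> S \<Longrightarrow> (\<lambda>z. f z + g z) \<in> S"
    and mult: "\<And>c f. holo_at y c \<Longrightarrow> f \<in> S \<Longrightarrow> (\<lambda>z. c z * f z) \<in> S"
    and cong: "\<And>f g. f \<in> S \<Longrightarrow> \<forall>\<^sub>F z in nhds y. f z = g z \<Longrightarrow> g \<in> S"
  shows "f \<in> S"
proof -
  have neg: "\<ominus>\<^bsub>germ_ring y\<^esub> germ y g = germ y (\<lambda>z. (- 1) * g z)" if "holo_at y g" for g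
    using germ_minus [of "\<lambda>_. 0" g] that by (simp add: a_minus_def flip: germ_ring_zero)
  have "ideal (germ y ` S) (germ_ring y)"
  proof (rule idealI [OF G.ring_axioms])
    show "subgroup (germ y ` S) (add_monoid (germ_ring y))"
    proof (rule G.add.subgroupI)
      show "germ y ` S \<subseteq> carrier (germ_ring y)" using holo by auto
      show "germ y ` S \<noteq> {}" using zero by auto
      show "\<ominus>\<^bsub>germ_ring y\<^esub> a \<in> germ y ` S" if "a \<in> germ y ` S" for a
      proof -
        obtain f where "a = germ y f" "f \<in> S" using \<open>a \<in> _\<close> by auto
        then show ?thesis
          using neg [OF holo] mult [OF holo_at_const [of y "- 1"], of f] by simp
      qed
      show "a \<oplus>\<^bsub>germ_ring y\<^esub> b \<in> germ y ` S" if "a \<in> germ y ` S" "b \<in> germ y ` S" for a b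
        using that add by (auto simp: germ_ring_add)
    qed
    show "c \<otimes>\<^bsub>germ_ring y\<^esub> a \<in> germ y ` S" "a \<otimes>\<^bsub>germ_ring y\<^esub> c \<in> germ y ` S"
      if "a \<in> germ y ` S" "c \<in> carrier (germ_ring y)" for a c
    proof -
      show "c \<otimes>\<^bsub>germ_ring y\<^esub> a \<in> germ y ` S"
        using that mult by (auto simp: germ_ring_mult germ_ring_carrier)
      then show "a \<otimes>\<^bsub>germ_ring y\<^esub> c \<in> germ y ` S"
        using that holo G.m_comm [of a c] by auto
    qed
  qed
  then have "ideal_at X y \<subseteq> germ y ` S"
    unfolding ideal_at_def by (rule G.genideal_minimal) (use eqns in auto)
  then obtain g where "g \<in> S" "germ y f = germ y g"
    using f by (auto simp: ideal_fun_def)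
  then show ?thesis
    using cong [of g f] by (simp add: germ_eq_iff eq_commute)
qed

end

lemma holo_at_nbhd:
  assumes "finite A" "\<And>i. i \<in> A \<Longrightarrow> holo_at x (f i)"
  obtains U where "open U" "x \<in> U" "\<And>i. i \<in> A \<Longrightarrow> holo_on (f i) U"
proof -
  have "\<forall>i\<in>A. \<exists>U. open U \<and> x \<in> U \<and> holo_on (f i) U"
    using assms(2) unfolding holo_at_def by blast
  then obtain U where U: "\<And>i. i \<in> A \<Longrightarrow> open (U i) \<and> x \<in> U i \<and> holo_on (f i) (U i)"
    by metis
  show ?thesis
  proof (rule that [of "\<Inter>i\<in>A. U i"])
    show "open (\<Inter>i\<in>A. U i)" using assms(1) U by blast
    show "x \<in> (\<Inter>i\<in>A. U i)" using U by blast
    show "holo_on (f i) (\<Inter>i\<in>A. U i)" if "i \<in> A" for i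
      by (rule holo_on_subset [of _ "U i"]) (use U [OF that] that in auto)
  qed
qed

lemma isCont_vec:
  fixes \<phi> :: "complex ^ 'a::finite \<Rightarrow> complex ^ 'b::finite"
  assumes "\<And>k. holo_at x (\<lambda>z. \<phi> z $ k)"
  shows "isCont \<phi> x"
proof -
  have "isCont (\<lambda>z. \<chi> k. \<phi> z $ k) x"
    unfolding isCont_def by (intro tendsto_vec_lambda) (use holo_at_imp_isCont [OF assms] in \<open>simp add: isCont_def\<close>)
  then show ?thesis by simp
qed

lemma eventually_compose:
  assumes "isCont \<phi> x" "\<forall>\<^sub>F w in nhds (\<phi> x). P w"
  shows "\<forall>\<^sub>F z in nhds x. P (\<phi> z)"
  using assms filterlim_iff isCont_def tendsto_at_iff_tendsto_nhds by metis

lemma holo_at_compose: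
  fixes \<phi> :: "complex ^ 'a::finite \<Rightarrow> complex ^ 'b::finite"
  assumes \<phi>: "\<And>k. holo_at x (\<lambda>z. \<phi> z $ k)" and g: "holo_at (\<phi> x) g"
  shows "holo_at x (\<lambda>z. g (\<phi> z))"
    and "\<forall>\<^sub>F z in nhds x. \<forall>j. partial_deriv j (\<lambda>z. g (\<phi> z)) z =
      (\<Sum>k\<in>UNIV. partial_deriv k g (\<phi> z) * partial_deriv j (\<lambda>z. \<phi> z $ k) z)"
proof -
  obtain W where W: "open W" "\<phi> x \<in> W" "holo_on g W"
    using g unfolding holo_at_def by blast
  obtain U where U: "open U" "x \<in> U" "\<And>k. holo_on (\<lambda>z. \<phi> z $ k) U"
    by (rule holo_at_nbhd [of UNIV x "\<lambda>k z. \<phi> z $ k"]) (use \<phi> in auto)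
  have "\<forall>\<^sub>F z in nhds x. \<phi> z \<in> W"
    by (rule eventually_compose [OF isCont_vec [OF \<phi>]]) (use W eventually_nhds_in_open in blast)
  then obtain V where V: "open V" "x \<in> V" "\<And>z. z \<in> V \<Longrightarrow> \<phi> z \<in> W"
    unfolding eventually_nhds by blast
  have UV: "holo_on (\<lambda>z. \<phi> z $ k) (U \<inter> V)" for k
    by (rule holo_on_subset [OF U(3)]) simp
  have "holo_on (\<lambda>z. g (\<phi> z)) (U \<inter> V)"
    by (rule holo_on_compose [OF UV W(3)]) (use V in simp)
  then show "holo_at x (\<lambda>z. g (\<phi> z))"
    unfolding holo_at_def using U(1,2) V(1,2) by blast
  have "partial_deriv j (\<lambda>z. g (\<phi> z)) z =
      (\<Sum>k\<in>UNIV. partial_deriv k g (\<phi> z) * partial_deriv j (\<lambda>z. \<phi> z $ k) z)" if "z \<in> U \<inter> V" for z j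
    by (rule partial_deriv_compose [OF UV W(3) _ that]) (use V in simp)
  moreover have "\<forall>\<^sub>F z in nhds x. z \<in> U \<inter> V"
    by (rule eventually_nhds_in_open) (use U V in auto)
  ultimately show "\<forall>\<^sub>F z in nhds x. \<forall>j. partial_deriv j (\<lambda>z. g (\<phi> z)) z =
      (\<Sum>k\<in>UNIV. partial_deriv k g (\<phi> z) * partial_deriv j (\<lambda>z. \<phi> z $ k) z)"
    by (auto elim: eventually_mono)
qed

lemma partial_deriv_eventually_cong:
  assumes "\<forall>\<^sub>F z in nhds x. f z = g z"
  shows "\<forall>\<^sub>F z in nhds x. \<forall>j. partial_deriv j f z = partial_deriv j g z"
proof -
  obtain V where V: "open V" "x \<in> V" "\<And>z. z \<in> V \<Longrightarrow> f z = g z"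
    using assms unfolding eventually_nhds by blast
  have "\<forall>\<^sub>F z in nhds x. z \<in> V"
    by (rule eventually_nhds_in_open) (use V in auto)
  then show ?thesis
    by (rule eventually_mono) (intro allI partial_deriv_cong [OF V(1) _ V(3)])
qed

text \<open>The germ version of \<open>difference_as_combination\<close>; a ball inside the domain of \<open>g\<close> contains the segments.\<close>

lemma holo_at_difference:
  fixes u u' :: "complex ^ 'a::finite \<Rightarrow> complex ^ 'b::finite"
  assumes u: "\<And>k. holo_at x (\<lambda>z. u z $ k)" "\<And>k. holo_at x (\<lambda>z. u' z $ k)"
    and eq: "u x = u' x" and g: "holo_at (u x) g"
  obtains K where "\<And>k. holo_at x (K k)"
    "\<forall>\<^sub>F z in nhds x. g (u z) - g (u' z) = (\<Sum>k\<in>UNIV. (u z $ k - u' z $ k) * K k z)"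
proof -
  obtain W where W: "open W" "u x \<in> W" "holo_on g W"
    using g unfolding holo_at_def by blast
  obtain r where r: "r > 0" "ball (u x) r \<subseteq> W"
    using openE [OF W(1,2)] by blast
  have b: "\<forall>\<^sub>F w in nhds (u x). w \<in> ball (u x) r"
    using r(1) by (intro eventually_nhds_in_open) auto
  have ev: "\<forall>\<^sub>F z in nhds x. u z \<in> ball (u x) r" "\<forall>\<^sub>F z in nhds x. u' z \<in> ball (u x) r"
    using eventually_compose [OF isCont_vec [OF u(1)] b]
      eventually_compose [OF isCont_vec [OF u(2)], of "\<lambda>w. w \<in> ball (u x) r"] b eq by simp_all
  obtain V where V: "open V" "x \<in> V" "\<And>z. z \<in> V \<Longrightarrow> u z \<in> ball (u x) r \<and> u' z \<in> ball (u x) r"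
    using eventually_conj [OF ev] unfolding eventually_nhds by blast
  obtain U where U: "open U" "x \<in> U" "\<And>k. holo_on (\<lambda>z. u z $ k) U"
    by (rule holo_at_nbhd [of UNIV x "\<lambda>k z. u z $ k"]) (use u in auto)
  obtain U' where U': "open U'" "x \<in> U'" "\<And>k. holo_on (\<lambda>z. u' z $ k) U'"
    by (rule holo_at_nbhd [of UNIV x "\<lambda>k z. u' z $ k"]) (use u in auto)
  let ?V = "V \<inter> U \<inter> U'"
  have oV: "open ?V" and xV: "x \<in> ?V" using V U U' by auto
  have h: "holo_on (\<lambda>z. u z $ k) ?V" "holo_on (\<lambda>z. u' z $ k) ?V" for k
    by (auto intro: holo_on_subset [OF U(3)] holo_on_subset [OF U'(3)])
  obtain K where K: "\<And>k. holo_on (K k) ?V"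
    "\<And>z. z \<in> ?V \<Longrightarrow> g (u z) - g (u' z) = (\<Sum>k\<in>UNIV. (u z $ k - u' z $ k) * K k z)"
  proof (rule difference_as_combination [OF oV h holo_on_subset [OF W(3) r(2)] open_ball])
    show "u' z + of_real s *s (u z - u' z) \<in> ball (u x) r" if "z \<in> ?V" "s \<in> {0..1}" for z and s :: real
    proof -
      have "(1 - s) *\<^sub>R u' z + s *\<^sub>R u z \<in> ball (u x) r"
        using V(3) [of z] that by (intro convexD [OF convex_ball]) auto
      moreover have "(1 - s) *\<^sub>R u' z + s *\<^sub>R u z = u' z + of_real s *s (u z - u' z)"
        by (simp add: vec_eq_iff scaleR_conv_of_real[where 'a = complex] algebra_simps)
      ultimately show ?thesis by simp
    qed
  qed (auto simp: that)
  show ?thesis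
  proof (rule that)
    show "holo_at x (K k)" for k
      unfolding holo_at_def using K(1) oV xV by blast
    show "\<forall>\<^sub>F z in nhds x. g (u z) - g (u' z) = (\<Sum>k\<in>UNIV. (u z $ k - u' z $ k) * K k z)"
      using eventually_nhds_in_open [OF oV xV] by (rule eventually_mono) (rule K(2))
  qed
qed

section \<open>Hypersurface germs with a nonvanishing partial derivative\<close>

text \<open>Gaussian elimination, for systems indexed by arbitrary finite sets.\<close>

lemma underdetermined_system:
  fixes a :: "'s \<Rightarrow> 't \<Rightarrow> 'k::field"
  assumes "finite T" "finite S" "card T < card S"
  shows "\<exists>c. (\<exists>s\<in>S. c s \<noteq> 0) \<and> (\<forall>t\<in>T. (\<Sum>s\<in>S. c s * a s t) = 0)"
  using assms
proof (induction T arbitrary: S a)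
  case empty
  then have "S \<noteq> {}" by auto
  then show ?case by (intro exI [of _ "\<lambda>_. 1"]) auto
next
  case (insert t T)
  show ?case
  proof (cases "\<forall>s\<in>S. a s t = 0")
    case True
    obtain c where "\<exists>s\<in>S. c s \<noteq> 0" "\<forall>t\<in>T. (\<Sum>s\<in>S. c s * a s t) = 0"
      using insert.IH [of S a] insert.prems insert.hyps by (auto dest: Suc_lessD)
    with True show ?thesis by (intro exI [of _ c]) auto
  next
    case False
    then obtain s0 where s0: "s0 \<in> S" "a s0 t \<noteq> 0" by blast
    let ?S = "S - {s0}"
    define a' where "a' s u = a s u - a s t / a s0 t * a s0 u" for s u
    have "card T < card ?S"
      using insert s0 by (simp add: card_Diff_singleton)
    then obtain c where c: "\<exists>s\<in>?S. c s \<noteq> 0" "\<forall>u\<in>T. (\<Sum>s\<in>?S. c s * a' s u) = 0"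
      using insert.IH [of ?S a'] insert.prems by auto
    define d where "d s = (if s = s0 then - (\<Sum>s\<in>?S. c s * a s t) / a s0 t else c s)" for s
    have eq: "(\<Sum>s\<in>S. d s * a s u) = (\<Sum>s\<in>?S. c s * a' s u)" for u
    proof -
      have "(\<Sum>s\<in>S. d s * a s u) = d s0 * a s0 u + (\<Sum>s\<in>?S. d s * a s u)"
        using insert.prems s0 by (simp add: sum.remove)
      also have "(\<Sum>s\<in>?S. d s * a s u) = (\<Sum>s\<in>?S. c s * a s u)"
        by (rule sum.cong) (auto simp: d_def)
      also have "d s0 * a s0 u = - (\<Sum>s\<in>?S. c s * (a s t / a s0 t * a s0 u))"
        by (simp add: d_def sum_distrib_right sum_divide_distrib mult.assoc)
      finally show ?thesis
        by (simp add: a'_def right_diff_distrib sum_subtractf)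
    qed
    have "(\<Sum>s\<in>S. d s * a s t) = 0"
      using s0 by (simp add: eq a'_def)
    moreover have "\<exists>s\<in>S. d s \<noteq> 0"
      using c(1) by (auto simp: d_def)
    ultimately show ?thesis
      using c(2) by (intro exI [of _ d]) (simp add: eq)
  qed
qed

definition multiple_of where
  "multiple_of y f h \<longleftrightarrow> (\<exists>c. holo_at y c \<and> (\<forall>\<^sub>F z in nhds y. h z = c z * f z))"
  for f h :: "complex ^ 'm::finite \<Rightarrow> complex"

lemma multiple_of_cong:
  assumes "multiple_of y f h" "\<forall>\<^sub>F z in nhds y. h z = k z"
  shows "multiple_of y f k"
proof -
  obtain c where c: "holo_at y c" "\<forall>\<^sub>F z in nhds y. h z = c z * f z"
    using assms(1) unfolding multiple_of_def by blast
  have "\<forall>\<^sub>F z in nhds y. k z = c z * f z"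
    using c(2) assms(2) by eventually_elim simp
  then show ?thesis
    unfolding multiple_of_def using c(1) by blast
qed

lemma multiple_of_add:
  assumes "multiple_of y f h" "multiple_of y f k"
  shows "multiple_of y f (\<lambda>z. h z + k z)"
proof -
  obtain c d where cd: "holo_at y c" "\<forall>\<^sub>F z in nhds y. h z = c z * f z"
    "holo_at y d" "\<forall>\<^sub>F z in nhds y. k z = d z * f z"
    using assms unfolding multiple_of_def by blast
  have "\<forall>\<^sub>F z in nhds y. h z + k z = (c z + d z) * f z"
    using cd(2,4) by eventually_elim (simp add: distrib_right)
  then show ?thesis
    unfolding multiple_of_def using holo_at_add [OF cd(1,3)] by blast
qed

lemma multiple_of_mult:
  assumes "holo_at y c" "multiple_of y f h"
  shows "multiple_of y f (\<lambda>z. c z * h z)"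
proof -
  obtain d where d: "holo_at y d" "\<forall>\<^sub>F z in nhds y. h z = d z * f z"
    using assms unfolding multiple_of_def by blast
  have "\<forall>\<^sub>F z in nhds y. c z * h z = (c z * d z) * f z"
    using d(2) by eventually_elim simp
  then show ?thesis
    unfolding multiple_of_def using holo_at_mult [OF assms(1) d(1)] by blast
qed

lemma multiple_of_zero: "multiple_of y f (\<lambda>_. 0)"
  unfolding multiple_of_def by (intro exI [of _ "\<lambda>_. 0"]) simp

lemma multiple_of_self: "multiple_of y f f"
  unfolding multiple_of_def by (intro exI [of _ "\<lambda>_. 1"]) simp

lemma multiple_of_sum:
  "(\<And>i. i \<in> A \<Longrightarrow> multiple_of y f (h i)) \<Longrightarrow> multiple_of y f (\<lambda>z. \<Sum>i\<in>A. h i z)"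
  by (induction A rule: infinite_finite_induct) (simp_all add: multiple_of_zero multiple_of_add)

context germ_at
begin

lemma ideal_fun_sum: "(\<And>i. i \<in> A \<Longrightarrow> h i \<in> ideal_fun X y) \<Longrightarrow> (\<lambda>z. \<Sum>i\<in>A. h i z) \<in> ideal_fun X y"
  by (induction A rule: infinite_finite_induct) (simp_all add: ideal_fun_zero ideal_fun_add)

lemma ideal_fun_uminus: "h \<in> ideal_fun X y \<Longrightarrow> (\<lambda>z. - h z) \<in> ideal_fun X y"
  using ideal_fun_mult [OF holo_at_const [of y "- 1"], of h] by simp

lemma ideal_fun_diff: "h \<in> ideal_fun X y \<Longrightarrow> k \<in> ideal_fun X y \<Longrightarrow> (\<lambda>z. h z - k z) \<in> ideal_fun X y"
  using ideal_fun_add [OF _ ideal_fun_uminus, of h k] by simp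

lemma ideal_fun_mult_right: "holo_at y c \<Longrightarrow> h \<in> ideal_fun X y \<Longrightarrow> (\<lambda>z. h z * c z) \<in> ideal_fun X y"
  using ideal_fun_mult [of c h] by (simp add: mult.commute)

text \<open>Two maps that agree modulo the ideal pull functions back to the same class, by Hadamard's lemma.\<close>

lemma ideal_fun_compose_diff:
  fixes u u' :: "complex ^ 'm \<Rightarrow> complex ^ 'b::finite"
  assumes u: "\<And>k. holo_at y (\<lambda>z. u z $ k)" "\<And>k. holo_at y (\<lambda>z. u' z $ k)"
    and eq: "u y = u' y" and g: "holo_at (u y) g"
    and I: "\<And>k. (\<lambda>z. u z $ k - u' z $ k) \<in> ideal_fun X y"
  shows "(\<lambda>z. g (u z) - g (u' z)) \<in> ideal_fun X y"
proof -
  obtain K where K: "\<And>k. holo_at y (K k)"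
    "\<forall>\<^sub>F z in nhds y. g (u z) - g (u' z) = (\<Sum>k\<in>UNIV. (u z $ k - u' z $ k) * K k z)"
    by (rule holo_at_difference [OF u eq g]) (rule that)
  have "(\<lambda>z. \<Sum>k\<in>UNIV. (u z $ k - u' z $ k) * K k z) \<in> ideal_fun X y"
    by (intro ideal_fun_sum ideal_fun_mult_right K I)
  then show ?thesis
    by (rule ideal_fun_cong) (use K(2) in \<open>simp add: eq_commute\<close>)
qed

end

lemma multiple_of_compose_diff:
  fixes u u' :: "complex ^ 'm::finite \<Rightarrow> complex ^ 'b::finite"
  assumes u: "\<And>k. holo_at y (\<lambda>z. u z $ k)" "\<And>k. holo_at y (\<lambda>z. u' z $ k)"
    and eq: "u y = u' y" and g: "holo_at (u y) g"
    and I: "\<And>k. multiple_of y f (\<lambda>z. u z $ k - u' z $ k)"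
  shows "multiple_of y f (\<lambda>z. g (u z) - g (u' z))"
proof -
  obtain K where K: "\<And>k. holo_at y (K k)"
    "\<forall>\<^sub>F z in nhds y. g (u z) - g (u' z) = (\<Sum>k\<in>UNIV. (u z $ k - u' z $ k) * K k z)"
    by (rule holo_at_difference [OF u eq g]) (rule that)
  have "multiple_of y f (\<lambda>z. \<Sum>k\<in>UNIV. K k z * (u z $ k - u' z $ k))"
    by (intro multiple_of_sum multiple_of_mult K I)
  then show ?thesis
    by (rule multiple_of_cong) (use K(2) in \<open>simp add: eq_commute mult.commute\<close>)
qed

text \<open>An isomorphism between a germ \<open>X\<close> at \<open>x\<close> and the hypersurface germ \<open>f = 0\<close> at \<open>y\<close>, spelled out with
functions: the ideal of the hypersurface consists of the multiples of \<open>f\<close>.\<close>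

locale hypersurface_iso =
  fixes X :: "'a::finite space_germ" and f :: "complex ^ 'm::finite \<Rightarrow> complex"
    and x y and \<phi> :: "complex ^ 'a \<Rightarrow> complex ^ 'm" and \<psi> :: "complex ^ 'm \<Rightarrow> complex ^ 'a"
  assumes germ_at_X: "germ_at X x" and f: "holo_at y f" and f_y: "f y = 0"
    and \<phi>: "\<And>k. holo_at x (\<lambda>z. \<phi> z $ k)" and \<phi>_x: "\<phi> x = y"
    and \<psi>: "\<And>k. holo_at y (\<lambda>z. \<psi> z $ k)" and \<psi>_y: "\<psi> y = x"
    and f_\<phi>: "(\<lambda>z. f (\<phi> z)) \<in> ideal_fun X x"
    and eqns_\<psi>: "\<And>g. g \<in> eqns X \<Longrightarrow> multiple_of y f (\<lambda>z. g (\<psi> z))"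
    and \<psi>_\<phi>: "\<And>j. (\<lambda>z. \<psi> (\<phi> z) $ j - z $ j) \<in> ideal_fun X x"
    and \<phi>_\<psi>: "\<And>j. multiple_of y f (\<lambda>z. \<phi> (\<psi> z) $ j - z $ j)"
begin

sublocale X: germ_at X x by (rule germ_at_X)

lemma holo_at_comp_\<phi>: "holo_at y g \<Longrightarrow> holo_at x (\<lambda>z. g (\<phi> z))"
  by (rule holo_at_compose(1) [OF \<phi>]) (simp add: \<phi>_x)

lemma holo_at_comp_\<psi>: "holo_at x g \<Longrightarrow> holo_at y (\<lambda>z. g (\<psi> z))"
  by (rule holo_at_compose(1) [OF \<psi>]) (simp add: \<psi>_y)

lemma eventually_\<phi>: "\<forall>\<^sub>F w in nhds y. P w \<Longrightarrow> \<forall>\<^sub>F z in nhds x. P (\<phi> z)"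
  by (rule eventually_compose [OF isCont_vec [OF \<phi>]]) (simp add: \<phi>_x)

lemma eventually_\<psi>: "\<forall>\<^sub>F w in nhds x. P w \<Longrightarrow> \<forall>\<^sub>F z in nhds y. P (\<psi> z)"
  by (rule eventually_compose [OF isCont_vec [OF \<psi>]]) (simp add: \<psi>_y)

lemma ideal_fun_\<psi>:
  assumes "g \<in> ideal_fun X x"
  shows "multiple_of y f (\<lambda>z. g (\<psi> z))"
proof -
  have "g \<in> {g. holo_at x g \<and> multiple_of y f (\<lambda>z. g (\<psi> z))}"
  proof (rule X.ideal_fun_induct [OF assms])
    show "g' \<in> {g. holo_at x g \<and> multiple_of y f (\<lambda>z. g (\<psi> z))}"
      if "g \<in> {g. holo_at x g \<and> multiple_of y f (\<lambda>z. g (\<psi> z))}" "\<forall>\<^sub>F z in nhds x. g z = g' z" for g g'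
      using that multiple_of_cong [OF _ eventually_\<psi> [OF that(2)]] holo_at_cong by blast
  qed (auto simp: X.holo_eqns eqns_\<psi> multiple_of_zero multiple_of_add holo_at_add holo_at_mult
      intro: multiple_of_mult [OF holo_at_comp_\<psi>])
  then show ?thesis by simp
qed

lemma multiple_of_\<phi>:
  assumes "multiple_of y f g"
  shows "(\<lambda>z. g (\<phi> z)) \<in> ideal_fun X x"
proof -
  obtain c where c: "holo_at y c" "\<forall>\<^sub>F z in nhds y. g z = c z * f z"
    using assms unfolding multiple_of_def by blast
  show ?thesis
    by (rule X.ideal_fun_cong [OF X.ideal_fun_mult [OF holo_at_comp_\<phi> [OF c(1)] f_\<phi>]])
      (use eventually_\<phi> [OF c(2)] in \<open>simp add: eq_commute\<close>)
qed

lemma comp_\<psi>_\<phi>: "holo_at x g \<Longrightarrow> (\<lambda>z. g (\<psi> (\<phi> z)) - g z) \<in> ideal_fun X x"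
  by (rule X.ideal_fun_compose_diff [where u = "\<lambda>z. \<psi> (\<phi> z)" and u' = "\<lambda>z. z"])
    (simp_all add: holo_at_comp_\<phi> [OF \<psi>] \<phi>_x \<psi>_y \<psi>_\<phi>)

lemma comp_\<phi>_\<psi>: "holo_at y g \<Longrightarrow> multiple_of y f (\<lambda>z. g (\<phi> (\<psi> z)) - g z)"
  by (rule multiple_of_compose_diff [where u = "\<lambda>z. \<phi> (\<psi> z)" and u' = "\<lambda>z. z"])
    (simp_all add: holo_at_comp_\<psi> [OF \<phi>] \<phi>_x \<psi>_y \<phi>_\<psi>)

lemma ideal_fun_comp_\<phi>D:
  assumes "holo_at y g" "(\<lambda>z. g (\<phi> z)) \<in> ideal_fun X x"
  shows "multiple_of y f g"
proof -
  have "multiple_of y f (\<lambda>z. g (\<phi> (\<psi> z)) + (- 1) * (g (\<phi> (\<psi> z)) - g z))"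
    by (intro multiple_of_add multiple_of_mult holo_at_const comp_\<phi>_\<psi> assms(1) ideal_fun_\<psi> [OF assms(2)])
  then show ?thesis by simp
qed

end

text \<open>The real inverse function theorem provides the inverse map; its derivative is the inverse of a complex
linear map and hence complex linear, so the inverse is holomorphic.\<close>

lemma complex_inverse_function:
  fixes \<Theta> :: "complex ^ 'm::finite \<Rightarrow> complex ^ 'm"
  assumes \<Theta>: "\<And>k. holo_at y (\<lambda>z. \<Theta> z $ k)"
    and inj: "\<And>v. \<forall>k. (\<Sum>j\<in>UNIV. v $ j * partial_deriv j (\<lambda>z. \<Theta> z $ k) y) = 0 \<Longrightarrow> v = 0"
  obtains \<Gamma> where "\<And>k. holo_at (\<Theta> y) (\<lambda>w. \<Gamma> w $ k)" "\<Gamma> (\<Theta> y) = y"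
    "\<forall>\<^sub>F z in nhds y. \<Gamma> (\<Theta> z) = z" "\<forall>\<^sub>F w in nhds (\<Theta> y). \<Theta> (\<Gamma> w) = w"
proof -
  obtain U where U: "open U" "y \<in> U" "\<And>k. holo_on (\<lambda>z. \<Theta> z $ k) U"
    by (rule holo_at_nbhd [of UNIV y "\<lambda>k z. \<Theta> z $ k"]) (use \<Theta> in auto)
  define A where "A z v = (\<chi> k. \<Sum>j\<in>UNIV. v $ j * partial_deriv j (\<lambda>z. \<Theta> z $ k) z)" for z v
  have A_lin: "linear (A z)" for z
    by (rule linearI) (simp_all add: A_def vec_eq_iff sum.distrib algebra_simps scaleR_sum_right)
  have A_c: "A z (c *s v) = c *s A z v" for z c v
    by (simp add: A_def vec_eq_iff sum_distrib_left algebra_simps)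
  have A_bl: "bounded_linear (A z)" for z
    using A_lin linear_conv_bounded_linear by blast
  define D where "D z = Blinfun (A z)" for z
  have D: "blinfun_apply (D z) = A z" for z
    unfolding D_def by (rule bounded_linear_Blinfun_apply [OF A_bl])
  have der: "(\<Theta> has_derivative blinfun_apply (D z)) (at z)" if "z \<in> U" for z
    unfolding D by (rule has_derivative_vecI) (simp add: A_def holo_on_imp_has_derivative [OF U(3) that])
  have contp: "continuous_on U (partial_deriv j (\<lambda>z. \<Theta> z $ k))" for j k
    by (rule holo_on_imp_continuous_on [OF holo_on_partial_deriv [OF U(3) U(1)]])
  have contD: "continuous_on U D"
  proof (rule continuous_on_blinfun_componentwise)
    show "continuous_on U (\<lambda>z. blinfun_apply (D z) v)" for v
      unfolding D A_def by (intro continuous_intros contp)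
  qed
  have injA: "inj (A y)"
    unfolding linear_injective_0 [OF A_lin]
  proof (intro allI impI)
    fix v assume "A y v = 0"
    then have "A y v $ k = 0" for k by simp
    then show "v = 0" by (intro inj) (simp add: A_def)
  qed
  obtain B where B: "linear B" "\<And>v. B (A y v) = v"
    using linear_injective_left_inverse [OF A_lin injA] by (auto simp: fun_eq_iff)
  have BD: "Blinfun B o\<^sub>L D y = id_blinfun"
    using B linear_conv_bounded_linear [of B]
    by (intro blinfun_eqI) (simp add: D bounded_linear_Blinfun_apply)
  obtain U' V \<Gamma> g' where *: "open U'" "U' \<subseteq> U" "y \<in> U'" "open V" "\<Theta> y \<in> V" "homeomorphism U' V \<Theta> \<Gamma>"
    "\<And>w. w \<in> V \<Longrightarrow> (\<Gamma> has_derivative (g' w)) (at w)"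
    "\<And>w. w \<in> V \<Longrightarrow> g' w = inv_into UNIV (blinfun_apply (D (\<Gamma> w)))"
    "\<And>w. w \<in> V \<Longrightarrow> bij (blinfun_apply (D (\<Gamma> w)))"
    by (rule inverse_function_theorem [OF U(1) der contD U(2) BD], assumption, rule that)
  have g'_c: "g' w (c *s v) = c *s g' w v" if w: "w \<in> V" for w c v
  proof -
    have b: "bij (A (\<Gamma> w))" using *(9) [OF w] by (simp add: D)
    have "A (\<Gamma> w) (c *s g' w v) = c *s v"
      using bij_is_surj [OF b] by (simp add: A_c *(8) [OF w] D surj_f_inv_f)
    then show ?thesis
      using bij_is_inj [OF b] by (metis *(8) [OF w] D inv_f_f)
  qed
  have "holo_on (\<lambda>w. \<Gamma> w $ k) V" for k
    unfolding holo_on_def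
  proof
    fix w assume w: "w \<in> V"
    have "((\<lambda>w. \<Gamma> w $ k) has_derivative (\<lambda>v. g' w v $ k)) (at w)"
      by (rule bounded_linear.has_derivative [OF bounded_linear_vec_nth *(7) [OF w]])
    then show "\<exists>D. ((\<lambda>w. \<Gamma> w $ k) has_derivative D) (at w) \<and> (\<forall>c v. D (c *s v) = c * D v)"
      by (intro exI [of _ "\<lambda>v. g' w v $ k"]) (simp add: g'_c [OF w])
  qed
  then have "holo_at (\<Theta> y) (\<lambda>w. \<Gamma> w $ k)" for k
    unfolding holo_at_def using *(4,5) by blast
  moreover have "\<Gamma> (\<Theta> y) = y"
    using homeomorphism_apply1 [OF *(6) *(3)] .
  moreover have "\<forall>\<^sub>F z in nhds y. \<Gamma> (\<Theta> z) = z"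
    using eventually_nhds_in_open [OF *(1) *(3)] by (rule eventually_mono) (rule homeomorphism_apply1 [OF *(6)])
  moreover have "\<forall>\<^sub>F w in nhds (\<Theta> y). \<Theta> (\<Gamma> w) = w"
    using eventually_nhds_in_open [OF *(4) *(5)] by (rule eventually_mono) (rule homeomorphism_apply2 [OF *(6)])
  ultimately show ?thesis by (rule that)
qed

context hypersurface_iso
begin

text \<open>The hypersurface has tangent vectors in at least \<open>m - 1\<close> independent directions, and the derivative of \<open>\<psi>\<close>
is injective on them because \<open>\<phi> \<circ> \<psi>\<close> is the identity modulo \<open>f\<close>. So the space containing \<open>X\<close> has enough
coordinates to realise the coordinate germ of dimension \<open>m - 1\<close>.\<close>

lemma card_le_ambient:
  "card (UNIV - {i} :: 'm set) \<le> CARD('a)"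
proof (rule ccontr)
  assume "\<not> card (UNIV - {i} :: 'm set) \<le> CARD('a)"
  then have lt: "card (insert None (range Some) :: 'a option set) < card (UNIV :: 'm set)"
    by (simp add: card_image card_Diff_singleton)
  define a :: "'m \<Rightarrow> 'a option \<Rightarrow> complex" where
    "a j t = (case t of None \<Rightarrow> partial_deriv j f y | Some k \<Rightarrow> partial_deriv j (\<lambda>z. \<psi> z $ k) y)" for j t
  obtain v where v: "\<exists>j. v j \<noteq> 0" "(\<Sum>j\<in>UNIV. v j * partial_deriv j f y) = 0"
    "\<And>k. (\<Sum>j\<in>UNIV. v j * partial_deriv j (\<lambda>z. \<psi> z $ k) y) = 0"
    using underdetermined_system [OF _ _ lt, of a] by (auto simp: a_def)
  have "v j = 0" for j
  proof -
    obtain c where c: "holo_at y c" "\<forall>\<^sub>F z in nhds y. \<phi> (\<psi> z) $ j - z $ j = c z * f z"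
      using \<phi>_\<psi> unfolding multiple_of_def by blast
    have "\<forall>\<^sub>F z in nhds y. (\<lambda>z. \<phi> (\<psi> z) $ j) z = (\<lambda>z. z $ j + c z * f z) z"
      using c(2) by eventually_elim (simp add: algebra_simps)
    from eventually_nhds_x_imp_x [OF partial_deriv_eventually_cong [OF this]]
    have e1: "partial_deriv i (\<lambda>z. \<phi> (\<psi> z) $ j) y = partial_deriv i (\<lambda>z. z $ j + c z * f z) y" for i
      by blast
    obtain U where U: "open U" "y \<in> U" "holo_on c U" "holo_on f U"
      by (rule holo_at_pairE [OF c(1) f]) (rule that)
    have e2: "partial_deriv i (\<lambda>z. z $ j + c z * f z) y = (if i = j then 1 else 0) + c y * partial_deriv i f y" for i
      unfolding partial_deriv_add [OF holo_on_coord holo_on_mult [OF U(3,4)] U(2)]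
        partial_deriv_mult [OF U(3,4,2)] by (simp add: f_y)
    have "holo_at (\<psi> y) (\<lambda>z. \<phi> z $ j)" using \<phi> \<psi>_y by simp
    from eventually_nhds_x_imp_x [OF holo_at_compose(2) [OF \<psi> this]]
    have e3: "partial_deriv i (\<lambda>z. \<phi> (\<psi> z) $ j) y =
      (\<Sum>k\<in>UNIV. partial_deriv k (\<lambda>z. \<phi> z $ j) x * partial_deriv i (\<lambda>z. \<psi> z $ k) y)" for i
      by (simp add: \<psi>_y)
    have "(\<Sum>i\<in>UNIV. v i * ((if i = j then 1 else 0) + c y * partial_deriv i f y)) =
      (\<Sum>i\<in>UNIV. v i * (\<Sum>k\<in>UNIV. partial_deriv k (\<lambda>z. \<phi> z $ j) x * partial_deriv i (\<lambda>z. \<psi> z $ k) y))"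
      using e1 e2 e3 by simp
    also have "\<dots> = (\<Sum>k\<in>UNIV. partial_deriv k (\<lambda>z. \<phi> z $ j) x * (\<Sum>i\<in>UNIV. v i * partial_deriv i (\<lambda>z. \<psi> z $ k) y))"
      unfolding sum_distrib_left by (subst sum.swap) (simp add: algebra_simps)
    also have "\<dots> = 0" using v(3) by simp
    also have "(\<Sum>i\<in>UNIV. v i * ((if i = j then 1 else 0) + c y * partial_deriv i f y)) =
      v j + c y * (\<Sum>i\<in>UNIV. v i * partial_deriv i f y)"
      by (simp add: distrib_left sum.distrib sum_distrib_left algebra_simps if_distrib [where f = "\<lambda>x. _ * x"] cong: if_cong)
    finally show ?thesis using v(2) by simp
  qed
  then show False using v(1) by blast
qed

text \<open>Replacing the \<open>i\<close>-th coordinate by \<open>f\<close> is a change of coordinates near \<open>y\<close>, in which the hypersurface becomes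
the coordinate subspace of the remaining coordinates. An injection \<open>\<sigma>\<close> of these into the coordinates of the
space containing \<open>X\<close> embeds it there.\<close>

lemma smooth_if_partial_deriv_nonzero:
  assumes base: "base X = x" and fi: "partial_deriv i f y \<noteq> 0"
  shows "smooth_germ X"
proof -
  let ?K = "UNIV - {i} :: 'm set"
  obtain \<sigma> :: "'m \<Rightarrow> 'a" where \<sigma>: "inj_on \<sigma> ?K"
    using card_le_ambient [of i] by (metis card_le_inj finite finite_class.finite_UNIV)
  define S where "S = \<sigma> ` ?K"
  define \<tau> where "\<tau> = inv_into ?K \<sigma>"
  have \<tau>: "\<tau> (\<sigma> k) = k" if "k \<noteq> i" for k
    unfolding \<tau>_def using \<sigma> that by (intro inv_into_f_f) auto
  define \<Theta> where "\<Theta> z = (\<chi> k. if k = i then f z else z $ k)" for z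
  have \<Theta>_i: "\<Theta> z $ i = f z" and \<Theta>_k: "k \<noteq> i \<Longrightarrow> \<Theta> z $ k = z $ k" for z k
    by (simp_all add: \<Theta>_def)
  have h\<Theta>: "holo_at z (\<lambda>z. \<Theta> z $ k)" if "holo_at z f" for z k
    using that by (cases "k = i") (simp_all add: \<Theta>_def)
  have inj: "v = 0" if v: "\<forall>k. (\<Sum>j\<in>UNIV. v $ j * partial_deriv j (\<lambda>z. \<Theta> z $ k) y) = 0" for v
  proof -
    have vk: "v $ k = 0" if "k \<noteq> i" for k
      using v [rule_format, of k] that by (simp add: \<Theta>_def if_distrib [where f = "\<lambda>x. _ * x"] cong: if_cong)
    have "(\<Sum>j\<in>UNIV. v $ j * partial_deriv j f y) = v $ i * partial_deriv i f y"
      by (subst sum.remove [of _ i]) (auto simp: vk intro!: sum.neutral)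
    with v [rule_format, of i] fi have "v $ i = 0" by (simp add: \<Theta>_def)
    with vk show ?thesis by (metis vec_eq_iff zero_index)
  qed
  obtain \<Gamma> where \<Gamma>: "\<And>k. holo_at (\<Theta> y) (\<lambda>w. \<Gamma> w $ k)" "\<Gamma> (\<Theta> y) = y"
    "\<forall>\<^sub>F z in nhds y. \<Gamma> (\<Theta> z) = z" "\<forall>\<^sub>F w in nhds (\<Theta> y). \<Theta> (\<Gamma> w) = w"
    by (rule complex_inverse_function [OF h\<Theta> [OF f] inj], assumption, rule that)
  define \<alpha> where "\<alpha> w = (\<chi> k. if k = i then 0 else w $ \<sigma> k + y $ k)" for w :: "complex ^ 'a"
  define \<pi> where "\<pi> u = (\<chi> s. if s \<in> S then u $ \<tau> s - y $ \<tau> s else 0)" for u :: "complex ^ 'm"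
  have \<alpha>0: "\<alpha> 0 = \<Theta> y" by (simp add: \<alpha>_def \<Theta>_def vec_eq_iff f_y)
  have h\<alpha>: "holo_at w (\<lambda>w. \<alpha> w $ k)" for w k
    by (cases "k = i") (simp_all add: \<alpha>_def holo_at_add)
  have h\<pi>: "holo_at u (\<lambda>u. \<pi> u $ s)" for u s
    by (cases "s \<in> S") (simp_all add: \<pi>_def holo_at_diff)
  define \<Phi> where "\<Phi> z = \<pi> (\<phi> z)" for z
  define \<Psi> where "\<Psi> w = \<psi> (\<Gamma> (\<alpha> w))" for w
  let ?C = "coordinate_germ S"
  have bC: "base ?C = 0" by (simp add: coordinate_germ_def)
  have eC: "eqns ?C = (\<lambda>s z. z $ s) ` (- S)" by (simp add: coordinate_germ_def)
  interpret C: germ_at ?C 0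
    by unfold_locales (auto simp: eC)
  have \<Phi>x: "\<Phi> x = 0" by (simp add: \<Phi>_def \<pi>_def \<phi>_x vec_eq_iff)
  have \<Psi>0: "\<Psi> 0 = x" by (simp add: \<Psi>_def \<alpha>0 \<Gamma>(2) \<psi>_y)
  have h\<Phi>: "holo_at x (\<lambda>z. \<Phi> z $ s)" for s
    unfolding \<Phi>_def by (rule holo_at_comp_\<phi> [OF h\<pi>])
  have h\<Gamma>\<alpha>: "holo_at 0 (\<lambda>w. \<Gamma> (\<alpha> w) $ k)" for k
    by (rule holo_at_compose(1) [OF h\<alpha>]) (simp add: \<alpha>0 \<Gamma>(1))
  have h\<Psi>: "holo_at 0 (\<lambda>w. \<Psi> w $ j)" for j
    unfolding \<Psi>_def by (rule holo_at_compose(1) [OF h\<Gamma>\<alpha>]) (simp add: \<alpha>0 \<Gamma>(2) \<psi>)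
  have ev_\<Gamma>\<alpha>: "\<forall>\<^sub>F w in nhds 0. P (\<Gamma> (\<alpha> w))" if "\<forall>\<^sub>F u in nhds y. P u" for P
    by (rule eventually_compose [OF isCont_vec [OF h\<Gamma>\<alpha>]]) (simp add: \<alpha>0 \<Gamma>(2) that)
  have ev_\<Theta>: "\<forall>\<^sub>F w in nhds 0. \<Theta> (\<Gamma> (\<alpha> w)) = \<alpha> w"
    by (rule eventually_compose [OF isCont_vec [OF h\<alpha>]]) (simp add: \<alpha>0 \<Gamma>(4))
  have ev_f: "\<forall>\<^sub>F w in nhds 0. f (\<Gamma> (\<alpha> w)) = 0"
    using ev_\<Theta>
  proof eventually_elim
    case (elim w)
    then have "\<Theta> (\<Gamma> (\<alpha> w)) $ i = \<alpha> w $ i" by simp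
    then show ?case by (simp add: \<Theta>_i \<alpha>_def)
  qed
  have vanish: "\<forall>\<^sub>F w in nhds 0. h (\<Gamma> (\<alpha> w)) = 0" if "multiple_of y f h" for h
  proof -
    obtain c where "\<forall>\<^sub>F z in nhds y. h z = c z * f z"
      using \<open>multiple_of y f h\<close> unfolding multiple_of_def by blast
    from ev_\<Gamma>\<alpha> [OF this] ev_f show ?thesis
      by eventually_elim simp
  qed
  have 1: "germ_map X ?C \<Phi>"
    unfolding germ_map_def base bC
  proof (intro conjI allI ballI)
    fix g assume "g \<in> eqns ?C"
    then have "(\<lambda>z. g (\<Phi> z)) = (\<lambda>_. 0)" by (auto simp: eC \<Phi>_def \<pi>_def)
    then show "germ x (\<lambda>z. g (\<Phi> z)) \<in> ideal_at X x"
      using X.ideal_fun_zero by (simp add: ideal_fun_def)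
  qed (simp_all add: h\<Phi> \<Phi>x)
  have 2: "germ_map ?C X \<Psi>"
    unfolding germ_map_def base bC
  proof (intro conjI allI ballI)
    fix g assume "g \<in> eqns X"
    from vanish [OF eqns_\<psi> [OF this]] have "\<forall>\<^sub>F w in nhds 0. 0 = g (\<Psi> w)"
      unfolding \<Psi>_def by (rule eventually_mono) (rule sym)
    from C.ideal_fun_cong [OF C.ideal_fun_zero this]
    show "germ 0 (\<lambda>w. g (\<Psi> w)) \<in> ideal_at ?C 0"
      by (simp add: ideal_fun_def)
  qed (simp_all add: h\<Psi> \<Psi>0)
  have 3: "(\<lambda>z. \<Psi> (\<Phi> z) $ j - z $ j) \<in> ideal_fun X x" for j
  proof -
    define u where "u z = \<alpha> (\<pi> (\<phi> z))" for z
    define u' where "u' z = \<Theta> (\<phi> z)" for z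
    have hu: "holo_at x (\<lambda>z. u z $ k)" for k
      unfolding u_def by (rule holo_at_comp_\<phi> [OF holo_at_compose(1) [OF h\<pi> h\<alpha>]])
    have hu': "holo_at x (\<lambda>z. u' z $ k)" for k
      unfolding u'_def by (rule holo_at_comp_\<phi> [OF h\<Theta> [OF f]])
    have u_k: "u z $ k = (if k = i then 0 else \<phi> z $ k)" for z k
      using \<tau> [of k] by (auto simp: u_def \<alpha>_def \<pi>_def S_def)
    have u'_k: "u' z $ k = (if k = i then f (\<phi> z) else \<phi> z $ k)" for z k
      by (simp add: u'_def \<Theta>_def)
    have ux: "u x = u' x"
      by (simp add: vec_eq_iff u_k u'_k \<phi>_x f_y)
    have u'x: "u' x = \<Theta> y" by (simp add: u'_def \<phi>_x)
    have hg: "holo_at (u x) (\<lambda>w. \<psi> (\<Gamma> w) $ j)"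
      unfolding ux u'x by (rule holo_at_compose(1) [OF \<Gamma>(1)]) (simp add: \<Gamma>(2) \<psi>)
    have "(\<lambda>z. u z $ k - u' z $ k) \<in> ideal_fun X x" for k
      using X.ideal_fun_uminus [OF f_\<phi>] X.ideal_fun_zero by (cases "k = i") (simp_all add: u_k u'_k)
    from X.ideal_fun_compose_diff [OF hu hu' ux hg this]
    have d: "(\<lambda>z. \<psi> (\<Gamma> (u z)) $ j - \<psi> (\<Gamma> (u' z)) $ j) \<in> ideal_fun X x" .
    have "\<forall>\<^sub>F z in nhds x. (\<psi> (\<Gamma> (u z)) $ j - \<psi> (\<Gamma> (u' z)) $ j) + (\<psi> (\<phi> z) $ j - z $ j) = \<Psi> (\<Phi> z) $ j - z $ j"
      using eventually_\<phi> [OF \<Gamma>(3)]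
      by eventually_elim (simp add: u_def u'_def \<Psi>_def \<Phi>_def)
    from X.ideal_fun_cong [OF X.ideal_fun_add [OF d \<psi>_\<phi>] this] show ?thesis .
  qed
  have 4: "(\<lambda>w. \<Phi> (\<Psi> w) $ s - w $ s) \<in> ideal_fun ?C 0" for s
  proof (cases "s \<in> S")
    case True
    then obtain k where k: "s = \<sigma> k" "k \<noteq> i" by (auto simp: S_def)
    have "\<forall>\<^sub>F w in nhds 0. 0 = \<Phi> (\<Psi> w) $ s - w $ s"
      using vanish [OF \<phi>_\<psi> [of k]] ev_\<Theta>
    proof eventually_elim
      case (elim w)
      have "\<Theta> (\<Gamma> (\<alpha> w)) $ k = \<alpha> w $ k" using elim(2) by simp
      then show ?case
        using elim(1) k True \<tau> [of k] by (simp add: \<Phi>_def \<Psi>_def \<pi>_def \<Theta>_k \<alpha>_def)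
    qed
    from C.ideal_fun_cong [OF C.ideal_fun_zero this] show ?thesis .
  next
    case False
    then have "(\<lambda>w. w $ s) \<in> ideal_fun ?C 0"
      by (intro C.ideal_fun_eqns) (auto simp: eC)
    from C.ideal_fun_uminus [OF this] show ?thesis
      using False by (simp add: \<Phi>_def \<pi>_def)
  qed
  show ?thesis
    unfolding smooth_germ_def germ_iso_def using 1 2 3 4
    by (intro exI [of _ S] exI [of _ \<Phi>] exI [of _ \<Psi>]) (simp add: ideal_fun_def base bC)
qed

end

section \<open>Linear algebra over a reduced local ring\<close>

text \<open>Nakayama's lemma by elimination: if every \<open>G i\<close> is a combination of the \<open>G j\<close> with coefficients vanishing
at \<open>y\<close>, up to elements of a submodule \<open>P\<close>, then the coefficient \<open>1 - \<mu> a\<close> of \<open>G a\<close> is invertible and \<open>G a\<close>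
can be eliminated from all other equations.\<close>

lemma nakayama_elimination:
  fixes G :: "'i \<Rightarrow> complex ^ 'm::finite \<Rightarrow> complex"
  assumes fin: "finite A"
    and P_add: "\<And>F H. P F \<Longrightarrow> P H \<Longrightarrow> P (\<lambda>z. F z + H z)"
    and P_mult: "\<And>c F. holo_at y c \<Longrightarrow> P F \<Longrightarrow> P (\<lambda>z. c z * F z)"
    and P_cong: "\<And>F H. P F \<Longrightarrow> \<forall>\<^sub>F z in nhds y. F z = H z \<Longrightarrow> P H"
    and G: "\<And>i. i \<in> A \<Longrightarrow> \<exists>\<mu>. (\<forall>j. holo_at y (\<mu> j) \<and> \<mu> j y = 0) \<and>
      P (\<lambda>z. G i z - (\<Sum>j\<in>A. \<mu> j z * G j z))"
    and i: "i \<in> A"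
  shows "P (G i)"
  using fin G i
proof (induction A arbitrary: i)
  case empty
  then show ?case by simp
next
  case (insert a A)
  obtain \<mu> where \<mu>: "\<And>j. holo_at y (\<mu> j)" "\<And>j. \<mu> j y = 0"
    "P (\<lambda>z. G a z - (\<Sum>j\<in>insert a A. \<mu> j z * G j z))"
    using insert.prems(1) [of a] by blast
  define w where "w z = 1 / (1 - \<mu> a z)" for z
  have hu: "holo_at y (\<lambda>z. 1 - \<mu> a z)"
    by (intro holo_at_diff holo_at_const \<mu>)
  have w: "holo_at y w"
    unfolding w_def by (rule holo_at_inverse [OF hu]) (simp add: \<mu>)
  have "((\<lambda>z. 1 - \<mu> a z) \<longlongrightarrow> 1 - \<mu> a y) (nhds y)"
    by (rule tendsto_at_iff_tendsto_nhds [THEN iffD1, OF holo_at_imp_isCont [OF hu, unfolded isCont_def]])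
  from topological_tendstoD [OF this, of "- {0}"] have "\<forall>\<^sub>F z in nhds y. 1 - \<mu> a z \<noteq> 0"
    by (simp add: open_Compl \<mu>(2))
  then have w1: "\<forall>\<^sub>F z in nhds y. w z * (1 - \<mu> a z) = 1"
    by eventually_elim (simp add: w_def)
  have Ga: "P (\<lambda>z. G a z - (\<Sum>j\<in>A. w z * \<mu> j z * G j z))"
  proof (rule P_cong [OF P_mult [OF w \<mu>(3)]])
    show "\<forall>\<^sub>F z in nhds y. w z * (G a z - (\<Sum>j\<in>insert a A. \<mu> j z * G j z)) =
      G a z - (\<Sum>j\<in>A. w z * \<mu> j z * G j z)"
      using w1
    proof eventually_elim
      case (elim z)
      have "w z * (G a z - (\<Sum>j\<in>insert a A. \<mu> j z * G j z)) =
        (w z * (1 - \<mu> a z)) * G a z - w z * (\<Sum>j\<in>A. \<mu> j z * G j z)"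
        using insert.hyps by (simp add: algebra_simps)
      then show ?case
        unfolding elim by (simp add: sum_distrib_left mult.assoc)
    qed
  qed
  have "\<exists>\<nu>. (\<forall>j. holo_at y (\<nu> j) \<and> \<nu> j y = 0) \<and> P (\<lambda>z. G i z - (\<Sum>j\<in>A. \<nu> j z * G j z))"
    if "i \<in> A" for i
  proof -
    obtain \<kappa> where \<kappa>: "\<And>j. holo_at y (\<kappa> j)" "\<And>j. \<kappa> j y = 0"
      "P (\<lambda>z. G i z - (\<Sum>j\<in>insert a A. \<kappa> j z * G j z))"
      using insert.prems(1) [of i] \<open>i \<in> A\<close> by blast
    define \<nu> where "\<nu> j z = \<kappa> j z + \<kappa> a z * (w z * \<mu> j z)" for j z
    have "P (\<lambda>z. (G i z - (\<Sum>j\<in>insert a A. \<kappa> j z * G j z)) +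
        \<kappa> a z * (G a z - (\<Sum>j\<in>A. w z * \<mu> j z * G j z)))"
      by (rule P_add [OF \<kappa>(3) P_mult [OF \<kappa>(1) Ga]])
    moreover have "(\<lambda>z. (G i z - (\<Sum>j\<in>insert a A. \<kappa> j z * G j z)) +
        \<kappa> a z * (G a z - (\<Sum>j\<in>A. w z * \<mu> j z * G j z))) = (\<lambda>z. G i z - (\<Sum>j\<in>A. \<nu> j z * G j z))"
      using insert.hyps by (simp add: \<nu>_def fun_eq_iff algebra_simps sum.distrib sum_distrib_left)
    moreover have "\<forall>j. holo_at y (\<nu> j) \<and> \<nu> j y = 0"
      unfolding \<nu>_def using \<kappa> \<mu> w by (auto intro!: holo_at_add holo_at_mult)
    ultimately show ?thesis by (intro exI [of _ \<nu>]) simp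
  qed
  then have GA: "P (G i)" if "i \<in> A" for i
    using insert.IH that by blast
  have "P (\<lambda>z. (G a z - (\<Sum>j\<in>A. w z * \<mu> j z * G j z)) + (\<Sum>j\<in>A. (w z * \<mu> j z) * G j z))"
  proof -
    have "P (\<lambda>z. (G a z - (\<Sum>j\<in>A. w z * \<mu> j z * G j z)) + (\<Sum>j\<in>B. (w z * \<mu> j z) * G j z))"
      if "finite B" "B \<subseteq> A" for B
      using that
    proof (induction B)
      case empty
      then show ?case using Ga by simp
    next
      case (insert b B)
      have "P (\<lambda>z. (G a z - (\<Sum>j\<in>A. w z * \<mu> j z * G j z)) + (\<Sum>j\<in>B. (w z * \<mu> j z) * G j z))"
        using insert by simp
      moreover have "P (\<lambda>z. (w z * \<mu> b z) * G b z)"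
        using insert.prems by (intro P_mult holo_at_mult w \<mu> GA) simp
      ultimately have "P (\<lambda>z. ((G a z - (\<Sum>j\<in>A. w z * \<mu> j z * G j z)) + (\<Sum>j\<in>B. (w z * \<mu> j z) * G j z)) +
        (w z * \<mu> b z) * G b z)"
        by (rule P_add)
      moreover have "(\<lambda>z. ((G a z - (\<Sum>j\<in>A. w z * \<mu> j z * G j z)) + (\<Sum>j\<in>B. (w z * \<mu> j z) * G j z)) +
        (w z * \<mu> b z) * G b z) = (\<lambda>z. (G a z - (\<Sum>j\<in>A. w z * \<mu> j z * G j z)) +
        (\<Sum>j\<in>insert b B. (w z * \<mu> j z) * G j z))"
        using insert.hyps by (simp add: fun_eq_iff)
      ultimately show ?case by simp
    qed
    from this [OF insert.hyps(1)] show ?thesis by simp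
  qed
  then have "P (G a)" by simp
  then show ?case
    using GA insert.prems(2) by blast
qed

context germ_at
begin

text \<open>If \<open>g\<close> times the identity matrix of size \<open>card R\<close> factors through fewer dimensions, then \<open>g = 0\<close> in a reduced
ring. Eliminating the column \<open>K\<close> by means of the row \<open>k0\<close> gives the same situation in one dimension less,
with \<open>g\<close> replaced by \<open>U\<^sub>k\<^sub>0\<^sub>K g\<close>. By induction \<open>g\<close> is annihilated by all entries of \<open>U\<close>, hence by itself.\<close>

lemma rank_inequality:
  fixes U :: "'r \<Rightarrow> 'q \<Rightarrow> complex ^ 'm \<Rightarrow> complex"
  assumes radical: "\<And>F. holo_at y F \<Longrightarrow> (\<lambda>z. F z * F z) \<in> ideal_fun X y \<Longrightarrow> F \<in> ideal_fun X y"
    and "finite Q" "finite R" "card Q < card R"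
    and "\<And>k L. holo_at y (U k L)" "\<And>L l. holo_at y (V L l)" "holo_at y g"
    and "\<And>k l. k \<in> R \<Longrightarrow> l \<in> R \<Longrightarrow>
      (\<lambda>z. (\<Sum>L\<in>Q. U k L z * V L l z) - (if k = l then g z else 0)) \<in> ideal_fun X y"
  shows "g \<in> ideal_fun X y"
  using assms(2-)
proof (induction "card Q" arbitrary: Q R U g)
  case 0
  then have "Q = {}" "R \<noteq> {}" by auto
  then obtain k where "k \<in> R" by blast
  with "0.prems"(7) [of k k] \<open>Q = {}\<close> ideal_fun_uminus [of "\<lambda>z. - g z"] show ?case by simp
next
  case (Suc n)
  note hU = Suc.prems(4) and hV = Suc.prems(5) and hg = Suc.prems(6) and UV = Suc.prems(7)
  have ug: "(\<lambda>z. U k0 K z * g z) \<in> ideal_fun X y" if k0: "k0 \<in> R" and K: "K \<in> Q" for k0 K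
  proof -
    define U' where "U' k L z = U k0 K z * U k L z - U k K z * U k0 L z" for k L z
    show ?thesis
    proof (rule Suc.hyps(1) [of "Q - {K}" "R - {k0}" U'])
    show "n = card (Q - {K})" using Suc.hyps(2) K Suc.prems(1) by simp
    then show "card (Q - {K}) < card (R - {k0})"
      using Suc.prems(2,3) k0 Suc.hyps(2) by simp
    show "finite (Q - {K})" "finite (R - {k0})" using Suc.prems by auto
    show "holo_at y (\<lambda>z. U k0 K z * g z)" by (intro holo_at_mult hU hg)
    show "holo_at y (V L l)" for L l by (rule hV)
    show "holo_at y (U' k L)" for k L
      unfolding U'_def by (intro holo_at_diff holo_at_mult hU)
    show "(\<lambda>z. (\<Sum>L\<in>Q - {K}. U' k L z * V L l z) - (if k = l then U k0 K z * g z else 0)) \<in> ideal_fun X y"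
      if kl: "k \<in> R - {k0}" "l \<in> R - {k0}" for k l
    proof -
      have split: "(\<Sum>L\<in>Q. U k L z * V L l z) = U k K z * V K l z + (\<Sum>L\<in>Q - {K}. U k L z * V L l z)" for k z
        using K Suc.prems(1) by (rule sum.remove [rotated])
      have "(\<lambda>z. U k0 K z * ((\<Sum>L\<in>Q. U k L z * V L l z) - (if k = l then g z else 0)) -
          U k K z * ((\<Sum>L\<in>Q. U k0 L z * V L l z) - (if k0 = l then g z else 0))) \<in> ideal_fun X y"
        using kl k0 by (intro ideal_fun_diff ideal_fun_mult hU UV) auto
      moreover have "(\<lambda>z. U k0 K z * ((\<Sum>L\<in>Q. U k L z * V L l z) - (if k = l then g z else 0)) -
          U k K z * ((\<Sum>L\<in>Q. U k0 L z * V L l z) - (if k0 = l then g z else 0))) =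
        (\<lambda>z. (\<Sum>L\<in>Q - {K}. U' k L z * V L l z) - (if k = l then U k0 K z * g z else 0))"
      proof
        fix z
        have "(\<Sum>L\<in>Q - {K}. U' k L z * V L l z) =
          U k0 K z * (\<Sum>L\<in>Q - {K}. U k L z * V L l z) - U k K z * (\<Sum>L\<in>Q - {K}. U k0 L z * V L l z)"
          by (simp add: U'_def left_diff_distrib sum_subtractf sum_distrib_left mult.assoc)
        then show "U k0 K z * ((\<Sum>L\<in>Q. U k L z * V L l z) - (if k = l then g z else 0)) -
          U k K z * ((\<Sum>L\<in>Q. U k0 L z * V L l z) - (if k0 = l then g z else 0)) =
          (\<Sum>L\<in>Q - {K}. U' k L z * V L l z) - (if k = l then U k0 K z * g z else 0)"
          using kl unfolding split by (auto simp: algebra_simps)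
      qed
      ultimately show ?thesis by simp
    qed
    qed
  qed
  obtain k where k: "k \<in> R" using Suc.prems(3) by fastforce
  have "(\<lambda>z. V L k z * (U k L z * g z)) \<in> ideal_fun X y" if "L \<in> Q" for L
    by (rule ideal_fun_mult [OF hV ug [OF k that]])
  moreover have "(\<lambda>z. g z * ((\<Sum>L\<in>Q. U k L z * V L k z) - g z)) \<in> ideal_fun X y"
    using UV [OF k k] by (intro ideal_fun_mult [OF hg]) simp
  ultimately have "(\<lambda>z. (\<Sum>L\<in>Q. V L k z * (U k L z * g z)) - g z * ((\<Sum>L\<in>Q. U k L z * V L k z) - g z)) \<in> ideal_fun X y"
    by (rule ideal_fun_diff [OF ideal_fun_sum])
  moreover have "(\<lambda>z. (\<Sum>L\<in>Q. V L k z * (U k L z * g z)) - g z * ((\<Sum>L\<in>Q. U k L z * V L k z) - g z)) =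
    (\<lambda>z. g z * g z)"
    by (simp add: fun_eq_iff right_diff_distrib sum_distrib_left algebra_simps)
  ultimately show ?case
    using radical [OF hg] by simp
qed

text \<open>Membership in \<open>\<mm>J\<close>, where \<open>J\<close> is the ideal generated by the \<open>G j\<close>, modulo the ideal of \<open>X\<close>.\<close>

definition in_mJ :: "('i::finite \<Rightarrow> complex ^ 'm \<Rightarrow> complex) \<Rightarrow> (complex ^ 'm \<Rightarrow> complex) \<Rightarrow> bool" where
  "in_mJ G F \<longleftrightarrow> (\<exists>\<mu>. (\<forall>j. holo_at y (\<mu> j) \<and> \<mu> j y = 0) \<and>
    (\<lambda>z. F z - (\<Sum>j\<in>UNIV. \<mu> j z * G j z)) \<in> ideal_fun X y)"

lemma in_mJ_scale:
  assumes "in_mJ G F"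
  shows "in_mJ G (\<lambda>z. c * F z)"
proof -
  obtain \<mu> where \<mu>: "\<And>j. holo_at y (\<mu> j)" "\<And>j. \<mu> j y = 0"
    "(\<lambda>z. F z - (\<Sum>j\<in>UNIV. \<mu> j z * G j z)) \<in> ideal_fun X y"
    using assms unfolding in_mJ_def by blast
  have "(\<lambda>z. c * (F z - (\<Sum>j\<in>UNIV. \<mu> j z * G j z))) \<in> ideal_fun X y"
    by (rule ideal_fun_mult [OF holo_at_const \<mu>(3)])
  then have "(\<lambda>z. c * F z - (\<Sum>j\<in>UNIV. (c * \<mu> j z) * G j z)) \<in> ideal_fun X y"
    by (simp add: right_diff_distrib sum_distrib_left mult.assoc)
  moreover have "\<forall>j. holo_at y (\<lambda>z. c * \<mu> j z) \<and> c * \<mu> j y = 0"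
    using \<mu> by (simp add: holo_at_mult)
  ultimately show ?thesis
    unfolding in_mJ_def by (intro exI [of _ "\<lambda>j z. c * \<mu> j z"]) simp
qed

text \<open>Replacing the coefficients of a relation between the \<open>G i\<close> by their values at \<open>y\<close> changes it by an element
of \<open>\<mm>J\<close>.\<close>

lemma in_mJ_of_relation:
  assumes \<omega>: "\<And>i. i \<in> K \<Longrightarrow> holo_at y (\<omega> i)"
    and rel: "(\<lambda>z. \<Sum>i\<in>K. s i * G i z * \<omega> i z) \<in> ideal_fun X y"
  shows "in_mJ G (\<lambda>z. \<Sum>i\<in>K. s i * \<omega> i y * G i z)"
proof -
  define \<mu> where "\<mu> i z = (if i \<in> K then s i * (\<omega> i y - \<omega> i z) else 0)" for i z
  have "holo_at y (\<mu> i)" for i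
    using \<omega> by (cases "i \<in> K") (simp_all add: \<mu>_def [abs_def] holo_at_mult holo_at_diff)
  moreover have "(\<Sum>i\<in>K. s i * \<omega> i y * G i z) - (\<Sum>i\<in>UNIV. \<mu> i z * G i z) =
    (\<Sum>i\<in>K. s i * G i z * \<omega> i z)" for z
  proof -
    have "(\<Sum>i\<in>UNIV. \<mu> i z * G i z) = (\<Sum>i\<in>K. s i * (\<omega> i y - \<omega> i z) * G i z)"
      by (rule sum.mono_neutral_cong_right) (auto simp: \<mu>_def)
    then show ?thesis
      by (simp add: sum_subtractf [symmetric] algebra_simps)
  qed
  ultimately show ?thesis
    unfolding in_mJ_def using rel by (intro exI [of _ \<mu>]) (simp add: \<mu>_def)
qed

lemma sum_single_term:
  assumes "finite K" "a \<in> K" "\<And>i. i \<in> K \<Longrightarrow> i \<noteq> a \<Longrightarrow> h i = 0"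
  shows "sum h K = h a"
  using assms by (simp add: sum.remove [of K a])

text \<open>This isolates the linear algebra in the passage from a free module of forms to a principal ideal. In the
application \<open>A K\<close> are the coordinates of the form \<open>d\<phi>\<^sub>K\<close> with respect to a basis and \<open>B k\<close> expresses the
\<open>k\<close>-th basis element by these forms. The hypothesis \<open>rel\<close> is the relation \<open>df \<and> d\<phi>\<^sub>K = 0\<close> for
\<open>card K = p - 1\<close>, and \<open>koszul\<close> says that a relation \<open>c\<close> between the forms satisfies \<open>df \<and> c = 0\<close>, read off at
the coefficient \<open>K'\<close>. The numbers \<open>s\<close> and \<open>t\<close> stand for signs.\<close>

theorem jacobian_principal:
  fixes G :: "'i::finite \<Rightarrow> complex ^ 'm \<Rightarrow> complex" and A :: "'i set \<Rightarrow> nat \<Rightarrow> complex ^ 'm \<Rightarrow> complex"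
  assumes radical: "\<And>F. holo_at y F \<Longrightarrow> (\<lambda>z. F z * F z) \<in> ideal_fun X y \<Longrightarrow> F \<in> ideal_fun X y"
    and p: "1 \<le> p" "p < CARD('i)"
    and hG: "\<And>i. holo_at y (G i)" and hA: "\<And>K k. holo_at y (A K k)" and hB: "\<And>k K. holo_at y (B k K)"
    and BA: "\<And>k l. k < r \<Longrightarrow> l < r \<Longrightarrow>
      (\<lambda>z. (\<Sum>K\<in>{K. card K = p}. B k K z * A K l z) - (if k = l then 1 else 0)) \<in> ideal_fun X y"
    and s: "\<And>K i. s K i \<noteq> (0::complex)" and t: "\<And>K i. t K i \<noteq> (0::complex)"
    and koszul: "\<And>c K'. \<lbrakk>\<And>K. holo_at y (c K);
      \<And>k. k < r \<Longrightarrow> (\<lambda>z. \<Sum>K\<in>{K. card K = p}. c K z * A K k z) \<in> ideal_fun X y; card K' = Suc p\<rbrakk> \<Longrightarrow>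
      (\<lambda>z. \<Sum>i\<in>K'. s K' i * G i z * c (K' - {i}) z) \<in> ideal_fun X y"
    and rel: "\<And>K k. card K = p - 1 \<Longrightarrow> k < r \<Longrightarrow>
      (\<lambda>z. \<Sum>j\<in>- K. t K j * G j z * A (insert j K) k z) \<in> ideal_fun X y"
  obtains i where "\<And>j. \<exists>a. holo_at y a \<and> (\<lambda>z. G j z - a z * G i z) \<in> ideal_fun X y"
proof -
  let ?I = "ideal_fun X y"
  let ?P = "{K :: 'i set. card K = p}"
  have UNIV_fin: "finite (UNIV :: 'i set)" by simp
  show ?thesis
  proof (cases "\<forall>i. in_mJ G (G i)")
    case True
    have GI: "G i \<in> ?I" for i
    proof (rule nakayama_elimination [of UNIV "\<lambda>F. F \<in> ?I"])
      show "\<exists>\<mu>. (\<forall>j. holo_at y (\<mu> j) \<and> \<mu> j y = 0) \<and> (\<lambda>z. G i z - (\<Sum>j\<in>UNIV. \<mu> j z * G j z)) \<in> ?I" for i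
        using True unfolding in_mJ_def by blast
    qed (auto intro: ideal_fun_add ideal_fun_mult ideal_fun_cong)
    show ?thesis
      by (rule that [of undefined]) (use GI in \<open>auto intro!: exI [of _ "\<lambda>_. 0"]\<close>)
  next
    case False
    then obtain i1 where i1: "\<not> in_mJ G (G i1)" by blast
    have g: "G i1 \<notin> ?I"
      using i1 unfolding in_mJ_def by (auto dest!: spec [of _ "\<lambda>_ _. 0"])
    define Q where "Q = {K \<in> ?P. i1 \<notin> K}"
    define reduces where "reduces K C \<longleftrightarrow> (\<forall>K'. holo_at y (C K')) \<and>
      (\<forall>l<r. (\<lambda>z. G i1 z * A K l z - (\<Sum>K'\<in>Q. C K' z * A K' l z)) \<in> ?I)" for K C
    (* After multiplication by G i1, every form becomes a combination of the forms whose index set avoids i1. *)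
    have "\<exists>C. reduces K C" if K: "K \<in> ?P" for K
    proof (cases "i1 \<in> K")
      case False
      define C where "C K' = (if K' = K then G i1 else (\<lambda>_. 0))" for K'
      have "(\<Sum>K'\<in>Q. C K' z * A K' l z) = G i1 z * A K l z" for z l
        using K False by (subst sum_single_term [of Q K]) (auto simp: C_def Q_def)
      then show ?thesis
        using ideal_fun_zero hG by (intro exI [of _ C]) (simp add: C_def reduces_def)
    next
      case True
      define K2 where "K2 = K - {i1}"
      have K2: "card K2 = p - 1" "insert i1 K2 = K" "i1 \<notin> K2"
        using K True by (auto simp: K2_def)
      define J where "J = - K2 - {i1}"
      define u where "u j = - t K2 j / t K2 i1" for j
      define C where "C K' z = (\<Sum>j\<in>J. if insert j K2 = K' then u j * G j z else 0)" for K' z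
      have "holo_at y (C K')" for K'
        unfolding C_def
      proof (rule holo_at_sum)
        show "holo_at y (\<lambda>z. if insert j K2 = K' then u j * G j z else 0)" for j
          by (cases "insert j K2 = K'") (simp_all add: holo_at_mult hG)
      qed
      moreover have "(\<lambda>z. G i1 z * A K l z - (\<Sum>K'\<in>Q. C K' z * A K' l z)) \<in> ?I" if l: "l < r" for l
      proof -
        have inQ: "insert j K2 \<in> Q" if "j \<in> J" for j
        proof -
          have "card (insert j K2) = Suc (card K2)"
            using \<open>j \<in> J\<close> by (intro card_insert_disjoint) (auto simp: J_def)
          then show ?thesis
            using \<open>j \<in> J\<close> p K2 by (auto simp: Q_def J_def)
        qed
        have "(\<Sum>K'\<in>Q. C K' z * A K' l z) = (\<Sum>j\<in>J. u j * G j z * A (insert j K2) l z)" for z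
        proof -
          have "(\<Sum>K'\<in>Q. C K' z * A K' l z) =
            (\<Sum>K'\<in>Q. \<Sum>j\<in>J. (if insert j K2 = K' then u j * G j z else 0) * A K' l z)"
            by (simp add: C_def sum_distrib_right)
          also have "\<dots> = (\<Sum>j\<in>J. \<Sum>K'\<in>Q. (if insert j K2 = K' then u j * G j z else 0) * A K' l z)"
            by (rule sum.swap)
          also have "\<dots> = (\<Sum>j\<in>J. u j * G j z * A (insert j K2) l z)"
          proof (rule sum.cong [OF refl])
            fix j assume j: "j \<in> J"
            show "(\<Sum>K'\<in>Q. (if insert j K2 = K' then u j * G j z else 0) * A K' l z) =
              u j * G j z * A (insert j K2) l z"
              by (subst sum_single_term [of Q "insert j K2"]) (use inQ [OF j] in auto)
          qed
          finally show ?thesis .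
        qed
        moreover have "(\<lambda>z. (1 / t K2 i1) * (\<Sum>j\<in>- K2. t K2 j * G j z * A (insert j K2) l z)) \<in> ?I"
          by (intro ideal_fun_mult holo_at_const rel K2 l)
        moreover have "(1 / t K2 i1) * (\<Sum>j\<in>- K2. t K2 j * G j z * A (insert j K2) l z) =
          G i1 z * A K l z - (\<Sum>j\<in>J. u j * G j z * A (insert j K2) l z)" for z
        proof -
          have "(\<Sum>j\<in>- K2. t K2 j * G j z * A (insert j K2) l z) = t K2 i1 * G i1 z * A K l z +
            (\<Sum>j\<in>J. t K2 j * G j z * A (insert j K2) l z)"
            unfolding J_def by (subst sum.remove [of _ i1]) (use K2 in auto)
          then show ?thesis
            using t [of K2 i1] by (simp add: u_def distrib_left sum_distrib_left sum_negf [symmetric])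
        qed
        ultimately show ?thesis by simp
      qed
      ultimately show ?thesis by (intro exI [of _ C]) (simp add: reduces_def)
    qed
    then have "\<forall>K\<in>?P. \<exists>C. reduces K C" by (rule ballI)
    from bchoice [OF this] obtain C where "\<forall>K\<in>?P. reduces K (C K)" ..
    then have hC: "\<And>K K'. K \<in> ?P \<Longrightarrow> holo_at y (C K K')" and
      C: "\<And>K l. K \<in> ?P \<Longrightarrow> l < r \<Longrightarrow> (\<lambda>z. G i1 z * A K l z - (\<Sum>K'\<in>Q. C K K' z * A K' l z)) \<in> ?I"
      by (simp_all add: reduces_def)
    (* The product of the basis expressions B with these combinations factors G i1 times the identity
       through Q. *)
    have "r \<le> card Q"
    proof (rule ccontr)
      assume "\<not> r \<le> card Q"
      define U where "U k K' z = (\<Sum>K\<in>?P. B k K z * C K K' z)" for k K' z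
      have "G i1 \<in> ?I"
      proof (rule rank_inequality [OF radical, of Q "{..<r}" U A])
        show "holo_at y (U k L)" for k L
          unfolding U_def by (intro holo_at_sum holo_at_mult hB hC)
        show "(\<lambda>z. (\<Sum>L\<in>Q. U k L z * A L l z) - (if k = l then G i1 z else 0)) \<in> ?I"
          if kl: "k \<in> {..<r}" "l \<in> {..<r}" for k l
        proof -
          have "(\<lambda>z. G i1 z * ((\<Sum>K\<in>?P. B k K z * A K l z) - (if k = l then 1 else 0)) -
            (\<Sum>K\<in>?P. B k K z * (G i1 z * A K l z - (\<Sum>K'\<in>Q. C K K' z * A K' l z)))) \<in> ?I"
            using kl by (intro ideal_fun_diff ideal_fun_mult ideal_fun_sum hB hG C BA) auto
          moreover have "G i1 z * ((\<Sum>K\<in>?P. B k K z * A K l z) - (if k = l then 1 else 0)) -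
            (\<Sum>K\<in>?P. B k K z * (G i1 z * A K l z - (\<Sum>K'\<in>Q. C K K' z * A K' l z))) =
            (\<Sum>L\<in>Q. U k L z * A L l z) - (if k = l then G i1 z else 0)" for z
          proof -
            have "(\<Sum>L\<in>Q. U k L z * A L l z) = (\<Sum>K\<in>?P. B k K z * (\<Sum>K'\<in>Q. C K K' z * A K' l z))"
              unfolding U_def sum_distrib_right sum_distrib_left
              by (subst sum.swap) (simp add: mult.assoc)
            moreover have "(\<Sum>K\<in>?P. B k K z * (G i1 z * A K l z)) = G i1 z * (\<Sum>K\<in>?P. B k K z * A K l z)"
              by (simp add: sum_distrib_left mult.left_commute)
            ultimately show ?thesis
              by (simp add: right_diff_distrib sum_subtractf)
          qed
          ultimately show ?thesis by simp
        qed
      qed (use \<open>\<not> r \<le> card Q\<close> hA hG in auto)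
      then show False using g by blast
    qed
    have key: "\<exists>c. in_mJ G (\<lambda>z. G j z - c * G i1 z)" for j
    proof (cases "j = i1")
      case True
      have "in_mJ G (\<lambda>_. 0)"
        unfolding in_mJ_def using ideal_fun_zero by (intro exI [of _ "\<lambda>_ _. 0"]) simp
      then show ?thesis using True by (intro exI [of _ 1]) simp
    next
      case False
      have "card (UNIV - {i1, j}) = CARD('i) - 2"
        using False by (simp add: card_Diff_subset)
      then have "p - 1 \<le> card (UNIV - {i1, j})" using p by simp
      then obtain K1 where K1: "K1 \<subseteq> UNIV - {i1, j}" "card K1 = p - 1"
        by (rule obtain_subset_with_card_n) (rule that)
      (* As 1 <= p < CARD('i), there is an index set that contains i1 but not j. *)
      define K0 where "K0 = insert i1 K1"
      have K0: "card K0 = p" "i1 \<in> K0" "j \<notin> K0"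
        using K1 p False by (auto simp: K0_def card_insert_if subset_iff)
      define S where "S = insert K0 Q"
      have K0Q: "K0 \<notin> Q" using K0 by (simp add: Q_def)
      have SP: "S \<subseteq> ?P" using K0 by (auto simp: S_def Q_def)
      have "card {..<r} < card S"
        using \<open>r \<le> card Q\<close> K0Q by (simp add: S_def)
      then obtain c where c: "\<exists>K\<in>S. c K \<noteq> 0" "\<And>k. k < r \<Longrightarrow> (\<Sum>K\<in>S. c K * A K k y) = 0"
        using underdetermined_system [of "{..<r}" S "\<lambda>K k. A K k y"] by auto
      (* The constant vector c is a relation only at y. Subtracting its expression in the basis gives a relation
         omega whose coefficients have the values v at y. *)
      define \<mu> where "\<mu> k z = (\<Sum>K\<in>S. c K * A K k z)" for k z
      define v where "v K = (if K \<in> S then c K else 0)" for K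
      define \<omega> where "\<omega> K z = v K - (\<Sum>k<r. \<mu> k z * B k K z)" for K z
      have h\<mu>: "holo_at y (\<mu> k)" for k
        unfolding \<mu>_def by (intro holo_at_sum holo_at_mult holo_at_const hA)
      have h\<omega>: "holo_at y (\<omega> K)" for K
        unfolding \<omega>_def by (intro holo_at_diff holo_at_sum holo_at_mult holo_at_const h\<mu> hB)
      have \<omega>y: "\<omega> K y = v K" for K
        by (simp add: \<omega>_def \<mu>_def c(2))
      have "(\<lambda>z. \<Sum>K\<in>?P. \<omega> K z * A K l z) \<in> ?I" if l: "l < r" for l
      proof -
        have "(\<lambda>z. - (\<Sum>k<r. \<mu> k z * ((\<Sum>K\<in>?P. B k K z * A K l z) - (if k = l then 1 else 0)))) \<in> ?I"
          using l by (intro ideal_fun_uminus ideal_fun_sum ideal_fun_mult h\<mu> BA) auto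
        moreover have "- (\<Sum>k<r. \<mu> k z * ((\<Sum>K\<in>?P. B k K z * A K l z) - (if k = l then 1 else 0))) =
          (\<Sum>K\<in>?P. \<omega> K z * A K l z)" for z
        proof -
          have "(\<Sum>K\<in>?P. v K * A K l z) = \<mu> l z"
            unfolding \<mu>_def by (rule sum.mono_neutral_cong_right) (use SP in \<open>auto simp: v_def\<close>)
          moreover have "(\<Sum>K\<in>?P. (\<Sum>k<r. \<mu> k z * B k K z) * A K l z) =
            (\<Sum>k<r. \<mu> k z * (\<Sum>K\<in>?P. B k K z * A K l z))"
            unfolding sum_distrib_right sum_distrib_left by (subst sum.swap) (simp add: mult.assoc)
          moreover have "(\<Sum>k<r. \<mu> k z * (if k = l then 1 else 0)) = \<mu> l z"
            by (subst sum_single_term [of _ l]) (use l in auto)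
          ultimately show ?thesis
            by (simp add: \<omega>_def right_diff_distrib left_diff_distrib sum_subtractf)
        qed
        ultimately show ?thesis by simp
      qed
      note kz = koszul [OF h\<omega> this]
      have mJ: "in_mJ G (\<lambda>z. \<Sum>i\<in>K'. s K' i * v (K' - {i}) * G i z)" if "card K' = Suc p" for K'
        using in_mJ_of_relation [of K' "\<lambda>i. \<omega> (K' - {i})" "s K'" G, OF h\<omega> kz [OF _ that]] by (simp add: \<omega>y)
      have v0: "v K = 0" if "i1 \<in> K" "K \<noteq> K0" for K
        using that by (auto simp: v_def S_def Q_def)
      show ?thesis
      proof (cases "c K0 = 0")
        case True
        then obtain K where K: "K \<in> Q" "c K \<noteq> 0"
          using c(1) by (auto simp: S_def)
        then have i1K: "i1 \<notin> K" and cK: "card K = p" by (auto simp: Q_def)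
        (* The coefficient at insert i1 K would put G i1 into mJ. *)
        let ?K = "insert i1 K"
        have "v K0 = 0" using True by (simp add: v_def)
        then have v0': "v L = 0" if "i1 \<in> L" for L
          using v0 that by (cases "L = K0") auto
        have "(\<Sum>i\<in>?K. s ?K i * v (?K - {i}) * G i z) = s ?K i1 * v (?K - {i1}) * G i1 z" for z
          by (rule sum_single_term) (auto simp: v0')
        moreover have "v (?K - {i1}) = c K"
          using i1K K by (simp add: v_def S_def)
        moreover have "card ?K = Suc p" using i1K cK by simp
        ultimately have "in_mJ G (\<lambda>z. s ?K i1 * c K * G i1 z)"
          using mJ [of ?K] by simp
        from in_mJ_scale [OF this, of "1 / (s ?K i1 * c K)"] have "in_mJ G (G i1)"
          using s [of ?K i1] K by simp
        then show ?thesis using i1 by blast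
      next
        case c0: False
        (* The coefficient at insert j K0 involves only G j and G i1 modulo mJ. *)
        let ?K = "insert j K0"
        have "card ?K = Suc p" using K0 by simp
        then have m: "in_mJ G (\<lambda>z. \<Sum>i\<in>?K. s ?K i * v (?K - {i}) * G i z)" by (rule mJ)
        define d where "d = s ?K i1 * v (?K - {i1})"
        define e where "e = s ?K j * c K0"
        have e: "e \<noteq> 0" using s c0 by (simp add: e_def)
        have vj: "v (?K - {j}) = c K0" using K0 by (simp add: v_def S_def)
        have "(\<Sum>i\<in>?K. s ?K i * v (?K - {i}) * G i z) = e * G j z + d * G i1 z" for z
        proof -
          have "(\<Sum>i\<in>K0. s ?K i * v (?K - {i}) * G i z) = s ?K i1 * v (?K - {i1}) * G i1 z"
          proof (rule sum_single_term)
            fix i assume i: "i \<in> K0" "i \<noteq> i1"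
            then have "?K - {i} \<noteq> K0" by auto
            then have "v (?K - {i}) = 0" using v0 [of "?K - {i}"] i K0 by auto
            then show "s ?K i * v (?K - {i}) * G i z = 0" by simp
          qed (use K0 in auto)
          then show ?thesis
            using K0(3) vj by (simp add: e_def d_def)
        qed
        with m have "in_mJ G (\<lambda>z. e * G j z + d * G i1 z)" by simp
        from in_mJ_scale [OF this, of "1 / e"] have "in_mJ G (\<lambda>z. G j z - (- d / e) * G i1 z)"
          using e by (simp add: distrib_left)
        then show ?thesis by blast
      qed
    qed
    have "\<exists>a. holo_at y a \<and> (\<lambda>z. G j z - a z * G i1 z) \<in> ?I" for j
    proof (rule nakayama_elimination [of UNIV "\<lambda>F. \<exists>a. holo_at y a \<and> (\<lambda>z. F z - a z * G i1 z) \<in> ?I"])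
      fix F H assume "\<exists>a. holo_at y a \<and> (\<lambda>z. F z - a z * G i1 z) \<in> ?I"
        "\<exists>a. holo_at y a \<and> (\<lambda>z. H z - a z * G i1 z) \<in> ?I"
      then obtain a b where ab: "holo_at y a" "(\<lambda>z. F z - a z * G i1 z) \<in> ?I"
        "holo_at y b" "(\<lambda>z. H z - b z * G i1 z) \<in> ?I" by blast
      have "(\<lambda>z. F z + H z - (a z + b z) * G i1 z) \<in> ?I"
        using ideal_fun_add [OF ab(2,4)] by (simp add: algebra_simps)
      then show "\<exists>a. holo_at y a \<and> (\<lambda>z. F z + H z - a z * G i1 z) \<in> ?I"
        using holo_at_add [OF ab(1,3)] by (intro exI [of _ "\<lambda>z. a z + b z"]) simp
    next
      fix c F assume c: "holo_at y c" and "\<exists>a. holo_at y a \<and> (\<lambda>z. F z - a z * G i1 z) \<in> ?I"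
      then obtain a where a: "holo_at y a" "(\<lambda>z. F z - a z * G i1 z) \<in> ?I" by blast
      have "(\<lambda>z. c z * F z - (c z * a z) * G i1 z) \<in> ?I"
        using ideal_fun_mult [OF c a(2)] by (simp add: algebra_simps)
      then show "\<exists>a. holo_at y a \<and> (\<lambda>z. c z * F z - a z * G i1 z) \<in> ?I"
        using holo_at_mult [OF c a(1)] by (intro exI [of _ "\<lambda>z. c z * a z"]) simp
    next
      fix F H assume "\<exists>a. holo_at y a \<and> (\<lambda>z. F z - a z * G i1 z) \<in> ?I" and FH: "\<forall>\<^sub>F z in nhds y. F z = H z"
      then obtain a where a: "holo_at y a" "(\<lambda>z. F z - a z * G i1 z) \<in> ?I" by blast
      have "\<forall>\<^sub>F z in nhds y. F z - a z * G i1 z = H z - a z * G i1 z"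
        using FH by eventually_elim simp
      then show "\<exists>a. holo_at y a \<and> (\<lambda>z. H z - a z * G i1 z) \<in> ?I"
        using ideal_fun_cong [OF a(2)] a(1) by (intro exI [of _ a]) simp
    next
      fix i
      obtain c where "in_mJ G (\<lambda>z. G i z - c * G i1 z)" using key by blast
      then obtain \<mu> where \<mu>: "\<forall>j. holo_at y (\<mu> j) \<and> \<mu> j y = 0"
        "(\<lambda>z. (G i z - c * G i1 z) - (\<Sum>j\<in>UNIV. \<mu> j z * G j z)) \<in> ?I"
        unfolding in_mJ_def by blast
      have "(\<lambda>z. (G i z - (\<Sum>j\<in>UNIV. \<mu> j z * G j z)) - c * G i1 z) \<in> ?I"
        using \<mu>(2) by (simp add: algebra_simps)
      then have "\<exists>a. holo_at y a \<and> (\<lambda>z. (G i z - (\<Sum>j\<in>UNIV. \<mu> j z * G j z)) - a z * G i1 z) \<in> ?I"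
        by (intro exI [of _ "\<lambda>_. c"]) simp
      with \<mu>(1) show "\<exists>\<mu>. (\<forall>j. holo_at y (\<mu> j) \<and> \<mu> j y = 0) \<and>
        (\<exists>a. holo_at y a \<and> (\<lambda>z. (G i z - (\<Sum>j\<in>UNIV. \<mu> j z * G j z)) - a z * G i1 z) \<in> ?I)"
        by blast
    qed auto
    then show ?thesis by (rule that)
  qed
qed

end

section \<open>Spanning families, signs and coordinates\<close>

context module
begin

lemma submodule_finsum:
  assumes P: "submodule P R M" and "finite A" "f \<in> A \<rightarrow> P"
  shows "(\<Oplus>\<^bsub>M\<^esub>i\<in>A. f i) \<in> P"
  using assms(2,3)
proof (induction A)
  case empty
  then show ?case using P by (auto simp: submodule_def dest: subgroup.one_closed)
next
  case (insert i A)
  note PE = submoduleE [OF P]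
  have "f \<in> A \<rightarrow> carrier M" "f i \<in> carrier M"
    using insert.prems PE(1) by auto
  then show ?case
    using insert PE(5) by (simp add: Pi_iff)
qed

text \<open>The linear combinations of a finite family, for use with the span lemmas below.\<close>

lemma submodule_combinations:
  assumes A: "finite A" and e: "e \<in> A \<rightarrow> carrier M"
  shows "submodule {\<Oplus>\<^bsub>M\<^esub>i\<in>A. c i \<odot>\<^bsub>M\<^esub> e i | c. c \<in> A \<rightarrow> carrier R} R M" (is "submodule ?C R M")
proof -
  have ce: "(\<lambda>i. c i \<odot>\<^bsub>M\<^esub> e i) \<in> A \<rightarrow> carrier M" if "c \<in> A \<rightarrow> carrier R" for c
    using that e by auto
  have sm: "a \<odot>\<^bsub>M\<^esub> m \<in> ?C" if a: "a \<in> carrier R" and m: "m \<in> ?C" for a m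
  proof -
    obtain c where c: "c \<in> A \<rightarrow> carrier R" "m = (\<Oplus>\<^bsub>M\<^esub>i\<in>A. c i \<odot>\<^bsub>M\<^esub> e i)" using m by blast
    have "a \<odot>\<^bsub>M\<^esub> m = (\<Oplus>\<^bsub>M\<^esub>i\<in>A. a \<odot>\<^bsub>M\<^esub> (c i \<odot>\<^bsub>M\<^esub> e i))"
      unfolding c(2) by (rule finsum_smult_ldistr [OF A a ce [OF c(1)]])
    also have "\<dots> = (\<Oplus>\<^bsub>M\<^esub>i\<in>A. (a \<otimes>\<^bsub>R\<^esub> c i) \<odot>\<^bsub>M\<^esub> e i)"
      using a c(1) e by (intro M.finsum_cong') (auto simp: smult_assoc1 Pi_iff)
    finally show ?thesis
      using a c(1) by (intro CollectI exI [of _ "\<lambda>i. a \<otimes>\<^bsub>R\<^esub> c i"]) auto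
  qed
  show ?thesis
  proof (rule submoduleI)
    show sub: "?C \<subseteq> carrier M" using ce by (auto intro!: M.finsum_closed)
    have "(\<Oplus>\<^bsub>M\<^esub>i\<in>A. \<zero>\<^bsub>R\<^esub> \<odot>\<^bsub>M\<^esub> e i) = (\<Oplus>\<^bsub>M\<^esub>i\<in>A. \<zero>\<^bsub>M\<^esub>)"
      using e by (intro M.finsum_cong') (auto simp: Pi_iff)
    then have "(\<Oplus>\<^bsub>M\<^esub>i\<in>A. \<zero>\<^bsub>R\<^esub> \<odot>\<^bsub>M\<^esub> e i) = \<zero>\<^bsub>M\<^esub>" by simp
    then show "\<zero>\<^bsub>M\<^esub> \<in> ?C"
      by (intro CollectI exI [of _ "\<lambda>_. \<zero>\<^bsub>R\<^esub>"]) auto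
    show "\<ominus>\<^bsub>M\<^esub> m \<in> ?C" if "m \<in> ?C" for m
    proof -
      have "m \<in> carrier M" using sub that by blast
      then have "\<ominus>\<^bsub>M\<^esub> m = (\<ominus>\<^bsub>R\<^esub> \<one>\<^bsub>R\<^esub>) \<odot>\<^bsub>M\<^esub> m" by (simp add: smult_l_minus)
      then show ?thesis using sm [OF _ that, of "\<ominus>\<^bsub>R\<^esub> \<one>\<^bsub>R\<^esub>"] by simp
    qed
    show "m \<oplus>\<^bsub>M\<^esub> k \<in> ?C" if "m \<in> ?C" "k \<in> ?C" for m k
    proof -
      obtain c d where cd: "c \<in> A \<rightarrow> carrier R" "m = (\<Oplus>\<^bsub>M\<^esub>i\<in>A. c i \<odot>\<^bsub>M\<^esub> e i)"
        "d \<in> A \<rightarrow> carrier R" "k = (\<Oplus>\<^bsub>M\<^esub>i\<in>A. d i \<odot>\<^bsub>M\<^esub> e i)"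
        using \<open>m \<in> ?C\<close> \<open>k \<in> ?C\<close> by blast
      have "m \<oplus>\<^bsub>M\<^esub> k = (\<Oplus>\<^bsub>M\<^esub>i\<in>A. c i \<odot>\<^bsub>M\<^esub> e i \<oplus>\<^bsub>M\<^esub> d i \<odot>\<^bsub>M\<^esub> e i)"
        unfolding cd(2,4) using ce cd by (simp add: M.finsum_addf)
      also have "\<dots> = (\<Oplus>\<^bsub>M\<^esub>i\<in>A. (c i \<oplus>\<^bsub>R\<^esub> d i) \<odot>\<^bsub>M\<^esub> e i)"
        using cd e by (intro M.finsum_cong') (auto simp: smult_l_distr Pi_iff)
      finally show ?thesis
        using cd by (intro CollectI exI [of _ "\<lambda>i. c i \<oplus>\<^bsub>R\<^esub> d i"]) auto
    qed
  qed (rule sm)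
qed

lemma mem_combinations:
  assumes A: "finite A" and e: "e \<in> A \<rightarrow> carrier M" and i: "i \<in> A"
  shows "e i \<in> {\<Oplus>\<^bsub>M\<^esub>i\<in>A. c i \<odot>\<^bsub>M\<^esub> e i | c. c \<in> A \<rightarrow> carrier R}"
proof -
  define c where "c j = (if j = i then \<one>\<^bsub>R\<^esub> else \<zero>\<^bsub>R\<^esub>)" for j
  have "(\<Oplus>\<^bsub>M\<^esub>j\<in>A. c j \<odot>\<^bsub>M\<^esub> e j) = (\<Oplus>\<^bsub>M\<^esub>j\<in>A. if j = i then e j else \<zero>\<^bsub>M\<^esub>)"
    using e by (intro M.finsum_cong') (auto simp: c_def Pi_iff)
  also have "\<dots> = e i"
    by (rule M.add.finprod_singleton_swap [OF i A e])
  finally show ?thesis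
    by (intro CollectI exI [of _ c]) (simp add: c_def)
qed

lemma wedge_linear:
  assumes "ms \<in> tuples p M" "i < p"
  shows "is_linear R M (exterior_power R p M) (\<lambda>a. wedge R p M (ms[i := a]))"
  unfolding is_linear_def
  using wedge_closed [OF tuples_update [OF assms(1)]] wedge_add [OF assms] wedge_smult [OF assms] by blast

text \<open>Expand the wedge product with \<open>a + b\<close> in both places.\<close>

lemma wedge_swap:
  assumes ms: "ms \<in> tuples p M" and ij: "i < j" "j < p"
  shows "wedge R p M (ms[i := ms ! j, j := ms ! i]) = \<ominus>\<^bsub>exterior_power R p M\<^esub> wedge R p M ms"
proof -
  interpret E: module R "exterior_power R p M" by (rule module_exterior_power)
  let ?E = "exterior_power R p M"
  define a where "a = ms ! i"
  define b where "b = ms ! j"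
  have len: "length ms = p" using ms by (simp add: tuples_def)
  have ab: "a \<in> carrier M" "b \<in> carrier M"
    using ms ij nth_mem [of i ms] nth_mem [of j ms] by (auto simp: tuples_def a_def b_def)
  define w where "w u v = wedge R p M (ms[i := u, j := v])" for u v
  have wc: "w u v \<in> carrier ?E" if "u \<in> carrier M" "v \<in> carrier M" for u v
    unfolding w_def by (intro wedge_closed tuples_update ms that)
  have w1: "w (u \<oplus>\<^bsub>M\<^esub> u') v = w u v \<oplus>\<^bsub>?E\<^esub> w u' v"
    if "u \<in> carrier M" "u' \<in> carrier M" "v \<in> carrier M" for u u' v
    using wedge_add [OF tuples_update [OF ms that(3), of j], of i u u'] that ij
    by (simp add: w_def list_update_swap [of i j])
  have w2: "w u (v \<oplus>\<^bsub>M\<^esub> v') = w u v \<oplus>\<^bsub>?E\<^esub> w u v'"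
    if "u \<in> carrier M" "v \<in> carrier M" "v' \<in> carrier M" for u v v'
    using wedge_add [OF tuples_update [OF ms that(1), of i], of j v v'] that ij
    by (simp add: w_def)
  have w0: "w u u = \<zero>\<^bsub>?E\<^esub>" if "u \<in> carrier M" for u
    unfolding w_def
    by (rule wedge_alternating [OF _ ij]) (use that ij len in \<open>simp_all add: tuples_update ms\<close>)
  have "w (a \<oplus>\<^bsub>M\<^esub> b) (a \<oplus>\<^bsub>M\<^esub> b) = (w a a \<oplus>\<^bsub>?E\<^esub> w a b) \<oplus>\<^bsub>?E\<^esub> (w b a \<oplus>\<^bsub>?E\<^esub> w b b)"
    using ab by (simp add: w1 w2 wc E.M.a_ac)
  then have "w b a \<oplus>\<^bsub>?E\<^esub> w a b = \<zero>\<^bsub>?E\<^esub>"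
    using ab by (simp add: w0 wc E.M.a_comm)
  then have "\<ominus>\<^bsub>?E\<^esub> w a b = w b a"
    using ab by (intro E.M.minus_equality wc)
  moreover have "ms[i := a, j := b] = ms" by (simp add: a_def b_def)
  ultimately show ?thesis
    by (simp add: w_def a_def b_def)
qed

lemma wedge_permute:
  assumes "\<pi> permutes {..<p}" "ms \<in> tuples p M"
  shows "wedge R p M (permute_list \<pi> ms) = wedge R p M ms \<or>
    wedge R p M (permute_list \<pi> ms) = \<ominus>\<^bsub>exterior_power R p M\<^esub> wedge R p M ms"
  using assms(1) finite_lessThan [of p] assms(2)
proof (induction \<pi> arbitrary: ms rule: permutes_induct)
  case id
  then show ?case by simp
next
  case (swap a b \<pi>)
  interpret E: module R "exterior_power R p M" by (rule module_exterior_power)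
  have len: "length ms = p" using swap.prems by (simp add: tuples_def)
  let ?ms = "permute_list (Transposition.transpose a b) ms"
  have tr: "?ms = ms[a := ms ! b, b := ms ! a]"
    using swap.hyps len
    by (intro nth_equalityI) (auto simp: permute_list_def Transposition.transpose_def nth_list_update)
  have ms': "?ms \<in> tuples p M"
    using swap.prems swap.hyps len by (auto simp: tr intro!: tuples_update) (auto simp: tuples_def)
  have "wedge R p M ?ms = \<ominus>\<^bsub>exterior_power R p M\<^esub> wedge R p M ms"
  proof (cases "a < b")
    case True
    then show ?thesis using wedge_swap [OF swap.prems True] swap.hyps tr by simp
  next
    case False
    then have "b < a" using swap.hyps by simp
    then show ?thesis
      using wedge_swap [OF swap.prems, of b a] swap.hyps tr by (simp add: list_update_swap [of a b])
  qed
  then have eq: "\<ominus>\<^bsub>exterior_power R p M\<^esub> wedge R p M ?ms = wedge R p M ms"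
    using E.M.minus_minus [OF wedge_closed [OF swap.prems]] by simp
  have "permute_list (Transposition.transpose a b \<circ> \<pi>) ms = permute_list \<pi> ?ms"
    using swap.hyps len by (intro permute_list_compose) simp
  then show ?case
    using swap.IH [OF ms'] unfolding \<open>wedge R p M ?ms = _\<close> [symmetric] eq by metis
qed

lemma submodule_if:
  assumes sub: "P \<subseteq> carrier M" and zero: "\<zero>\<^bsub>M\<^esub> \<in> P"
    and add: "\<And>a b. a \<in> P \<Longrightarrow> b \<in> P \<Longrightarrow> a \<oplus>\<^bsub>M\<^esub> b \<in> P"
    and smult: "\<And>c a. c \<in> carrier R \<Longrightarrow> a \<in> P \<Longrightarrow> c \<odot>\<^bsub>M\<^esub> a \<in> P"
  shows "submodule P R M"
proof (rule submoduleI [OF sub zero _ add smult])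
  show "\<ominus>\<^bsub>M\<^esub> a \<in> P" if "a \<in> P" for a
  proof -
    have "\<ominus>\<^bsub>M\<^esub> a = (\<ominus>\<^bsub>R\<^esub> \<one>\<^bsub>R\<^esub>) \<odot>\<^bsub>M\<^esub> a"
      using that sub by (auto simp: smult_l_minus)
    then show ?thesis using smult [OF _ that, of "\<ominus>\<^bsub>R\<^esub> \<one>\<^bsub>R\<^esub>"] by simp
  qed
qed

text \<open>The entries of a tuple are replaced by generators one after the other, as the wedge product is linear in
each entry.\<close>

lemma wedge_span_generators:
  assumes D: "D \<subseteq> carrier M" and span: "\<And>Q. submodule Q R M \<Longrightarrow> D \<subseteq> Q \<Longrightarrow> carrier M \<subseteq> Q"
    and P: "submodule P R (exterior_power R p M)"
    and w: "\<And>ms. length ms = p \<Longrightarrow> set ms \<subseteq> D \<Longrightarrow> wedge R p M ms \<in> P"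
  shows "carrier (exterior_power R p M) \<subseteq> P"
proof (rule wedge_span [OF P])
  have *: "wedge R p M ms \<in> P"
    if "ms \<in> tuples p M" "n \<le> p" "\<forall>i<p. n \<le> i \<longrightarrow> ms ! i \<in> D" for n ms
    using that
  proof (induction n arbitrary: ms)
    case 0
    then show ?case by (intro w) (auto simp: tuples_def in_set_conv_nth)
  next
    case (Suc n)
    have len: "length ms = p" using Suc.prems by (simp add: tuples_def)
    let ?Q = "{a \<in> carrier M. wedge R p M (ms[n := a]) \<in> P}"
    have "submodule ?Q R M"
      using Suc.prems
      by (intro submodule_vimage [OF module_axioms module_exterior_power wedge_linear P]) auto
    moreover have "D \<subseteq> ?Q"
    proof
      fix a assume a: "a \<in> D"
      then have aM: "a \<in> carrier M" using D by blast
      have "wedge R p M (ms[n := a]) \<in> P"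
        using Suc.prems len a
        by (intro Suc.IH tuples_update aM) (auto simp: nth_list_update Suc_le_eq)
      with aM show "a \<in> ?Q" by simp
    qed
    ultimately have "carrier M \<subseteq> ?Q" by (rule span)
    moreover have "ms ! n \<in> carrier M"
      using Suc.prems len nth_mem [of n ms] by (auto simp: tuples_def)
    ultimately have "wedge R p M (ms[n := ms ! n]) \<in> P" by blast
    then show ?case by simp
  qed
  show "wedge R p M ms \<in> P" if "ms \<in> tuples p M" for ms
    using * [OF that order_refl] by simp
qed

lemma wedge_map_not_distinct:
  assumes d: "\<And>i. d i \<in> carrier M" and J: "length J = p" "\<not> distinct J"
  shows "wedge R p M (map d J) = \<zero>\<^bsub>exterior_power R p M\<^esub>"
proof -
  obtain i j where "i < length J" "j < length J" "i \<noteq> j" "J ! i = J ! j"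
    using J(2) by (auto simp: distinct_conv_nth)
  then obtain i j where ij: "i < j" "j < p" "J ! i = J ! j"
    using J(1) by (metis linorder_neqE_nat)
  show ?thesis
    by (rule wedge_alternating [OF _ ij(1,2)]) (use d J ij in \<open>auto simp: tuples_def\<close>)
qed

lemma wedge_map_same_set:
  assumes d: "\<And>i. d i \<in> carrier M" and J: "length J = p" "distinct J"
    and L: "distinct L" "set L = set J"
  shows "wedge R p M (map d J) = wedge R p M (map d L) \<or>
    wedge R p M (map d J) = \<ominus>\<^bsub>exterior_power R p M\<^esub> wedge R p M (map d L)"
proof -
  have "mset J = mset L"
    using J L by (simp add: set_eq_iff_mset_eq_distinct)
  then obtain \<pi> where \<pi>: "\<pi> permutes {..<length L}" "permute_list \<pi> L = J"
    by (rule mset_eq_permutation)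
  have len: "length L = p" using \<open>mset J = mset L\<close> J(1) mset_eq_length by metis
  have "permute_list \<pi> (map d L) = map d J"
    using permute_list_map [OF \<pi>(1), of d] \<pi>(2) by simp
  moreover have "map d L \<in> tuples p M"
    using d len by (auto simp: tuples_def)
  ultimately show ?thesis
    using wedge_permute [of \<pi> p "map d L"] \<pi>(1) len by simp
qed

end

text \<open>The coordinate forms of a basis.\<close>

lemma basis_coordinates:
  assumes M: "module R M" and b: "is_basis R M r b"
  obtains \<beta> where "\<And>k. k < r \<Longrightarrow> is_linear R M (self_module R) (\<beta> k)"
    "\<And>k l. k < r \<Longrightarrow> l < r \<Longrightarrow> \<beta> k (b l) = (if k = l then \<one>\<^bsub>R\<^esub> else \<zero>\<^bsub>R\<^esub>)"
    "\<And>m. m \<in> carrier M \<Longrightarrow> \<forall>k<r. \<beta> k m = \<zero>\<^bsub>R\<^esub> \<Longrightarrow> m = \<zero>\<^bsub>M\<^esub>"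
proof -
  interpret M: module R M by fact
  have bc: "b k \<in> carrier M" if "k < r" for k
    using b that unfolding is_basis_def by auto
  have ex: "\<exists>!a. a \<in> {..<r} \<rightarrow>\<^sub>E carrier R \<and> m = (\<Oplus>\<^bsub>M\<^esub>k\<in>{..<r}. a k \<odot>\<^bsub>M\<^esub> b k)" if "m \<in> carrier M" for m
    using b that unfolding is_basis_def by blast
  define \<gamma> where "\<gamma> m = (THE a. a \<in> {..<r} \<rightarrow>\<^sub>E carrier R \<and> m = (\<Oplus>\<^bsub>M\<^esub>k\<in>{..<r}. a k \<odot>\<^bsub>M\<^esub> b k))" for m
  have \<gamma>: "\<gamma> m \<in> {..<r} \<rightarrow>\<^sub>E carrier R" "m = (\<Oplus>\<^bsub>M\<^esub>k\<in>{..<r}. \<gamma> m k \<odot>\<^bsub>M\<^esub> b k)" if "m \<in> carrier M" for m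
    using theI' [OF ex [OF that]] unfolding \<gamma>_def by blast+
  have \<gamma>c: "\<gamma> m k \<in> carrier R" if "m \<in> carrier M" "k < r" for m k
    using \<gamma>(1) [OF that(1)] that(2) by auto
  have uniq: "\<gamma> m k = a k"
    if m: "m \<in> carrier M" and a: "\<And>k. k < r \<Longrightarrow> a k \<in> carrier R"
      "m = (\<Oplus>\<^bsub>M\<^esub>k\<in>{..<r}. a k \<odot>\<^bsub>M\<^esub> b k)" and k: "k < r" for m a k
  proof -
    have "(\<Oplus>\<^bsub>M\<^esub>k\<in>{..<r}. restrict a {..<r} k \<odot>\<^bsub>M\<^esub> b k) = (\<Oplus>\<^bsub>M\<^esub>k\<in>{..<r}. a k \<odot>\<^bsub>M\<^esub> b k)"
      using a(1) bc by (intro M.M.finsum_cong') auto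
    then have "restrict a {..<r} \<in> {..<r} \<rightarrow>\<^sub>E carrier R \<and>
      m = (\<Oplus>\<^bsub>M\<^esub>k\<in>{..<r}. restrict a {..<r} k \<odot>\<^bsub>M\<^esub> b k)"
      using a by auto
    then have "restrict a {..<r} = \<gamma> m"
      using ex [OF m] \<gamma> [OF m] by blast
    then show ?thesis using k by (metis lessThan_iff restrict_apply')
  qed
  show ?thesis
  proof (rule that [of "\<lambda>k m. \<gamma> m k"])
    fix k assume k: "k < r"
    show "is_linear R M (self_module R) (\<lambda>m. \<gamma> m k)"
      unfolding is_linear_def
    proof (intro conjI ballI)
      fix m assume m: "m \<in> carrier M"
      show "\<gamma> m k \<in> carrier (self_module R)" using \<gamma>c [OF m k] by simp
      fix m' assume m': "m' \<in> carrier M"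
      have "m \<oplus>\<^bsub>M\<^esub> m' = (\<Oplus>\<^bsub>M\<^esub>k\<in>{..<r}. \<gamma> m k \<odot>\<^bsub>M\<^esub> b k \<oplus>\<^bsub>M\<^esub> \<gamma> m' k \<odot>\<^bsub>M\<^esub> b k)"
        using \<gamma>c [OF m] \<gamma>c [OF m'] bc
        by (subst M.M.finsum_addf) (auto simp flip: \<gamma>(2) [OF m] \<gamma>(2) [OF m'])
      also have "\<dots> = (\<Oplus>\<^bsub>M\<^esub>k\<in>{..<r}. (\<gamma> m k \<oplus>\<^bsub>R\<^esub> \<gamma> m' k) \<odot>\<^bsub>M\<^esub> b k)"
        using \<gamma>c [OF m] \<gamma>c [OF m'] bc by (intro M.M.finsum_cong') (auto simp: M.smult_l_distr)
      finally have eq: "m \<oplus>\<^bsub>M\<^esub> m' = (\<Oplus>\<^bsub>M\<^esub>k\<in>{..<r}. (\<gamma> m k \<oplus>\<^bsub>R\<^esub> \<gamma> m' k) \<odot>\<^bsub>M\<^esub> b k)" .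
      have "\<gamma> m k \<oplus>\<^bsub>R\<^esub> \<gamma> m' k \<in> carrier R" if "k < r" for k
        using \<gamma>c [OF m that] \<gamma>c [OF m' that] by simp
      from uniq [OF M.M.a_closed [OF m m'] this eq k]
      show "\<gamma> (m \<oplus>\<^bsub>M\<^esub> m') k = \<gamma> m k \<oplus>\<^bsub>self_module R\<^esub> \<gamma> m' k" by simp
    next
      fix a m assume a: "a \<in> carrier R" and m: "m \<in> carrier M"
      have "a \<odot>\<^bsub>M\<^esub> m = (\<Oplus>\<^bsub>M\<^esub>k\<in>{..<r}. a \<odot>\<^bsub>M\<^esub> (\<gamma> m k \<odot>\<^bsub>M\<^esub> b k))"
        using \<gamma>c [OF m] bc a by (subst M.finsum_smult_ldistr [symmetric]) (auto simp flip: \<gamma>(2) [OF m])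
      also have "\<dots> = (\<Oplus>\<^bsub>M\<^esub>k\<in>{..<r}. (a \<otimes>\<^bsub>R\<^esub> \<gamma> m k) \<odot>\<^bsub>M\<^esub> b k)"
        using \<gamma>c [OF m] bc a by (intro M.M.finsum_cong') (auto simp: M.smult_assoc1)
      finally have eq: "a \<odot>\<^bsub>M\<^esub> m = (\<Oplus>\<^bsub>M\<^esub>k\<in>{..<r}. (a \<otimes>\<^bsub>R\<^esub> \<gamma> m k) \<odot>\<^bsub>M\<^esub> b k)" .
      have "a \<otimes>\<^bsub>R\<^esub> \<gamma> m k \<in> carrier R" if "k < r" for k
        using \<gamma>c [OF m that] a by simp
      from uniq [OF M.smult_closed [OF a m] this eq k]
      show "\<gamma> (a \<odot>\<^bsub>M\<^esub> m) k = a \<odot>\<^bsub>self_module R\<^esub> \<gamma> m k" by simp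
    qed
  next
    fix k l assume kl: "k < r" "l < r"
    have "(\<Oplus>\<^bsub>M\<^esub>k\<in>{..<r}. (if k = l then \<one>\<^bsub>R\<^esub> else \<zero>\<^bsub>R\<^esub>) \<odot>\<^bsub>M\<^esub> b k) =
      (\<Oplus>\<^bsub>M\<^esub>k\<in>{..<r}. if k = l then b k else \<zero>\<^bsub>M\<^esub>)"
      using bc by (intro M.M.finsum_cong') auto
    also have "\<dots> = b l"
      using bc kl by (intro M.M.add.finprod_singleton_swap) auto
    finally have eq: "b l = (\<Oplus>\<^bsub>M\<^esub>k\<in>{..<r}. (if k = l then \<one>\<^bsub>R\<^esub> else \<zero>\<^bsub>R\<^esub>) \<odot>\<^bsub>M\<^esub> b k)"
      by (rule sym)
    show "\<gamma> (b l) k = (if k = l then \<one>\<^bsub>R\<^esub> else \<zero>\<^bsub>R\<^esub>)"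
      by (rule uniq [OF bc [OF kl(2)] _ eq kl(1)]) simp
  next
    fix m assume m: "m \<in> carrier M" and 0: "\<forall>k<r. \<gamma> m k = \<zero>\<^bsub>R\<^esub>"
    have "(\<Oplus>\<^bsub>M\<^esub>k\<in>{..<r}. \<gamma> m k \<odot>\<^bsub>M\<^esub> b k) = (\<Oplus>\<^bsub>M\<^esub>k\<in>{..<r}. \<zero>\<^bsub>M\<^esub>)"
      using 0 bc by (intro M.M.finsum_cong') auto
    then have "(\<Oplus>\<^bsub>M\<^esub>k\<in>{..<r}. \<gamma> m k \<odot>\<^bsub>M\<^esub> b k) = \<zero>\<^bsub>M\<^esub>" by simp
    with \<gamma>(2) [OF m] show "m = \<zero>\<^bsub>M\<^esub>" by (rule trans)
  qed
qed

section \<open>Determinants as functions of a list of rows\<close>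

text \<open>An enumeration of the rows of a square matrix, so that rows can be given as a list.\<close>

definition row_index :: "'m::finite \<Rightarrow> nat" where
  "row_index = (SOME e. bij_betw e UNIV {..<CARD('m)})"

lemma row_index: "bij_betw (row_index :: 'm::finite \<Rightarrow> nat) UNIV {..<CARD('m)}"
proof -
  have "\<exists>e. bij_betw e (UNIV :: 'm set) {..<CARD('m)}"
    using ex_bij_betw_finite_nat [of "UNIV :: 'm set"] by (simp add: lessThan_atLeast0)
  then show ?thesis unfolding row_index_def by (rule someI_ex)
qed

definition row_det :: "(complex ^ 'm::finite) list \<Rightarrow> complex" where
  "row_det ws = det (\<chi> r. ws ! row_index r)"

lemma row_det_update:
  fixes ws :: "(complex ^ 'm::finite) list"
  assumes "length ws = CARD('m)" "i < CARD('m)"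
  obtains k :: 'm where "\<And>u. row_det (ws[i := u]) = det (\<chi> r. if r = k then u else ws ! row_index r)"
proof -
  obtain k :: 'm where k: "row_index k = i"
    using row_index assms(2) unfolding bij_betw_def by (metis imageE lessThan_iff)
  have idx: "row_index r = i \<longleftrightarrow> r = k" for r :: 'm
    using row_index k unfolding bij_betw_def inj_on_def by (metis UNIV_I)
  have "ws[i := u] ! row_index r = (if r = k then u else ws ! row_index r)" for u and r :: 'm
    using assms k idx [of r] by (cases "r = k") auto
  then show ?thesis by (intro that [of k]) (simp add: row_det_def)
qed

lemma
  fixes ws :: "(complex ^ 'm::finite) list"
  assumes ws: "length ws = CARD('m)" "i < CARD('m)"
  shows row_det_add: "row_det (ws[i := u + v]) = row_det (ws[i := u]) + row_det (ws[i := v])"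
    and row_det_mult: "row_det (ws[i := c *s u]) = c * row_det (ws[i := u])"
proof -
  obtain k :: 'm where k: "\<And>u. row_det (ws[i := u]) = det (\<chi> r. if r = k then u else ws ! row_index r)"
    by (rule row_det_update [OF ws]) (rule that)
  show "row_det (ws[i := u + v]) = row_det (ws[i := u]) + row_det (ws[i := v])"
    unfolding k by (rule det_row_add)
  show "row_det (ws[i := c *s u]) = c * row_det (ws[i := u])"
    unfolding k by (rule det_row_mul)
qed

lemma row_det_sum:
  fixes ws :: "(complex ^ 'm::finite) list"
  assumes ws: "length ws = CARD('m)" "i < CARD('m)"
  shows "row_det (ws[i := \<Sum>j\<in>A. v j]) = (\<Sum>j\<in>A. row_det (ws[i := v j]))"
proof (induction A rule: infinite_finite_induct)
  case (infinite A)
  then show ?case using row_det_mult [OF ws, of 0 0] by simp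
next
  case empty
  then show ?case using row_det_mult [OF ws, of 0 0] by simp
next
  case (insert j A)
  then show ?case by (simp add: row_det_add [OF ws])
qed

lemma row_det_expand:
  fixes ws :: "(complex ^ 'm::finite) list"
  assumes ws: "length ws = CARD('m)" "i < CARD('m)"
  shows "row_det (ws[i := v]) = (\<Sum>j\<in>UNIV. v $ j * row_det (ws[i := axis j 1]))"
proof -
  have "v = (\<Sum>j\<in>UNIV. v $ j *s axis j 1)"
    by (simp add: vec_eq_iff sum_component axis_def if_distrib [where f = "\<lambda>x. _ * x"] cong: if_cong)
  then have "row_det (ws[i := v]) = row_det (ws[i := \<Sum>j\<in>UNIV. v $ j *s axis j 1])" by simp
  also have "\<dots> = (\<Sum>j\<in>UNIV. v $ j * row_det (ws[i := axis j 1]))"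
    by (simp only: row_det_sum [OF ws] row_det_mult [OF ws])
  finally show ?thesis .
qed

lemma row_det_identical:
  fixes ws :: "(complex ^ 'm::finite) list"
  assumes "i < j" "j < CARD('m)" "ws ! i = ws ! j"
  shows "row_det ws = 0"
proof -
  obtain k l :: 'm where kl: "row_index k = i" "row_index l = j"
    using row_index assms(1,2) unfolding bij_betw_def by (metis imageE lessThan_iff order.strict_trans)
  show ?thesis
    unfolding row_det_def
    by (rule det_identical_rows [of k l]) (use kl assms in \<open>auto simp: row_def vec_eq_iff\<close>)
qed

text \<open>The rows of the identity matrix, permuted or with repetitions.\<close>

lemma row_det_axes:
  fixes N :: "'m::finite list"
  assumes N: "length N = CARD('m)"
  shows "row_det (map (\<lambda>k. axis k 1) N) \<noteq> 0 \<longleftrightarrow> distinct N"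
proof
  assume "row_det (map (\<lambda>k. axis k 1) N) \<noteq> 0"
  then show "distinct N"
    using row_det_identical [of _ _ "map (\<lambda>k. axis k 1) N"] N
    by (auto simp: distinct_conv_nth) (metis linorder_neqE_nat)
next
  assume "distinct N"
  define \<pi> :: "'m \<Rightarrow> 'm" where "\<pi> r = N ! row_index r" for r
  have lt: "row_index r < length N" for r :: 'm
    using row_index N unfolding bij_betw_def by (metis UNIV_I imageI lessThan_iff)
  have "inj \<pi>"
  proof (rule injI)
    fix r s assume "\<pi> r = \<pi> s"
    then have "row_index r = row_index s"
      using nth_eq_iff_index_eq [OF \<open>distinct N\<close> lt lt, of r s] by (simp add: \<pi>_def)
    then show "r = s"
      using row_index unfolding bij_betw_def inj_on_def by blast
  qed
  then have perm: "\<pi> permutes UNIV"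
    by (simp add: permutes_univ bij_iff [symmetric] bij_def finite_UNIV_inj_surj)
  have "row_det (map (\<lambda>k. axis k 1) N) = det (\<chi> r. (mat 1 :: complex ^ 'm ^ 'm) $ \<pi> r)"
    unfolding row_det_def using lt by (simp add: \<pi>_def mat_def axis_def vec_eq_iff eq_commute)
  also have "\<dots> = of_int (sign \<pi>) * det (mat 1 :: complex ^ 'm ^ 'm)"
    by (rule det_permute_rows [OF perm])
  finally show "row_det (map (\<lambda>k. axis k 1) N) \<noteq> 0"
    by (simp add: sign_def)
qed

lemma holo_at_row_det:
  fixes ws :: "(complex ^ 'a::finite \<Rightarrow> complex ^ 'm::finite) list"
  assumes ws: "length ws = CARD('m)" and holo: "\<And>i k. i < CARD('m) \<Longrightarrow> holo_at x (\<lambda>z. (ws ! i) z $ k)"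
  shows "holo_at x (\<lambda>z. row_det (map (\<lambda>w. w z) ws))"
proof -
  have lt: "row_index r < CARD('m)" for r :: 'm
    using row_index unfolding bij_betw_def by (metis UNIV_I imageI lessThan_iff)
  then show ?thesis
    unfolding row_det_def det_def using ws
    by (simp add: holo_at_sum holo_at_mult holo_at_prod holo)
qed

section \<open>Kaehler differentials at a point of a germ\<close>

lemma finsum_free_module:
  assumes R: "cring R" and "finite A" "f \<in> A \<rightarrow> carrier (free_module R S)"
  shows "(\<Oplus>\<^bsub>free_module R S\<^esub>i\<in>A. f i) s = (\<Oplus>\<^bsub>R\<^esub>i\<in>A. f i s)"
  using assms(2,3)
proof (induction A)
  case empty
  interpret R: cring R by fact
  interpret F: module R "free_module R S" by (rule module_free_module [OF R])
  show ?case using F.M.finsum_empty by simp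
next
  case (insert i A)
  interpret R: cring R by fact
  interpret F: module R "free_module R S" by (rule module_free_module [OF R])
  have f: "f \<in> A \<rightarrow> carrier (free_module R S)" "f i \<in> carrier (free_module R S)"
    using insert.prems by auto
  have "(\<Oplus>\<^bsub>free_module R S\<^esub>i\<in>insert i A. f i) = f i \<oplus>\<^bsub>free_module R S\<^esub> (\<Oplus>\<^bsub>free_module R S\<^esub>i\<in>A. f i)"
    by (rule F.M.finsum_insert) (use insert.hyps f in auto)
  moreover have "(\<Oplus>\<^bsub>R\<^esub>i\<in>insert i A. f i s) = f i s \<oplus>\<^bsub>R\<^esub> (\<Oplus>\<^bsub>R\<^esub>i\<in>A. f i s)"
    by (rule R.finsum_insert) (use insert.hyps f in \<open>auto simp: carrier_free_module Pi_iff\<close>)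
  ultimately show ?case using insert.IH [OF f(1)] by simp
qed

context germ_at
begin

lemma cls_cong: "\<forall>\<^sub>F z in nhds y. g z = h z \<Longrightarrow> cls g = cls h"
  unfolding local_class_def by (simp add: germ_eq_iff [THEN iffD2])

lemma cls_sum:
  assumes "finite A" "\<And>i. i \<in> A \<Longrightarrow> holo_at y (h i)"
  shows "cls (\<lambda>z. \<Sum>i\<in>A. h i z) = (\<Oplus>\<^bsub>LR\<^esub>i\<in>A. cls (h i))"
  using assms
proof (induction A)
  case empty
  then show ?case by (simp add: cls_zero)
next
  case (insert i A)
  have "cls (\<lambda>z. \<Sum>i\<in>insert i A. h i z) = cls (h i) \<oplus>\<^bsub>LR\<^esub> cls (\<lambda>z. \<Sum>i\<in>A. h i z)"
    using insert by (simp add: cls_add holo_at_sum)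
  also have "\<dots> = (\<Oplus>\<^bsub>LR\<^esub>i\<in>insert i A. cls (h i))"
    using insert by (subst LR.finsum_insert) auto
  finally show ?case .
qed

text \<open>A function representing a class in the local ring.\<close>

definition rep where
  "rep a = (SOME g. holo_at y g \<and> cls g = a)"

lemma
  assumes "a \<in> carrier LR"
  shows holo_at_rep: "holo_at y (rep a)" and cls_rep: "cls (rep a) = a"
proof -
  have "\<exists>g. holo_at y g \<and> cls g = a" using cls_surj [OF assms] by metis
  then have "holo_at y (rep a) \<and> cls (rep a) = a"
    unfolding rep_def by (rule someI_ex)
  then show "holo_at y (rep a)" "cls (rep a) = a" by auto
qed

abbreviation "F1 \<equiv> ambient_forms_at X y"
abbreviation "Con \<equiv> conormal_image_at X y"
abbreviation "Om \<equiv> kaehler_1_forms_at X y"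
abbreviation "dF \<equiv> differential_at X y"

lemma module_F1: "module LR F1"
  by (rule module_free_module [OF cring_local_ring])

lemma carrier_F1: "u \<in> carrier F1 \<longleftrightarrow> (\<forall>j. u j \<in> carrier LR)"
  by (auto simp: carrier_free_module)

lemma dF_carrier: "holo_at y g \<Longrightarrow> dF g \<in> carrier F1"
  by (simp add: carrier_F1 differential_at_def holo_at_partial_deriv)

lemma dF_add:
  assumes "holo_at y g" "holo_at y h"
  shows "dF (\<lambda>z. g z + h z) = dF g \<oplus>\<^bsub>F1\<^esub> dF h"
proof -
  obtain U where U: "open U" "y \<in> U" "holo_on g U" "holo_on h U"
    by (rule holo_at_pairE [OF assms]) (rule that)
  have "cls (partial_deriv j (\<lambda>z. g z + h z)) = cls (\<lambda>z. partial_deriv j g z + partial_deriv j h z)" for j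
    by (rule cls_cong, rule eventually_mono [OF eventually_nhds_in_open [OF U(1,2)]])
      (rule partial_deriv_add [OF U(3,4)])
  then show ?thesis
    by (simp add: differential_at_def fun_eq_iff cls_add holo_at_partial_deriv assms)
qed

lemma dF_mult:
  assumes "holo_at y c" "holo_at y h"
  shows "dF (\<lambda>z. c z * h z) = (cls c \<odot>\<^bsub>F1\<^esub> dF h) \<oplus>\<^bsub>F1\<^esub> (cls h \<odot>\<^bsub>F1\<^esub> dF c)"
proof -
  obtain U where U: "open U" "y \<in> U" "holo_on c U" "holo_on h U"
    by (rule holo_at_pairE [OF assms]) (rule that)
  have "cls (partial_deriv j (\<lambda>z. c z * h z)) = cls (\<lambda>z. c z * partial_deriv j h z + h z * partial_deriv j c z)" for j
    by (rule cls_cong, rule eventually_mono [OF eventually_nhds_in_open [OF U(1,2)]])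
      (simp add: partial_deriv_mult [OF U(3,4)])
  then show ?thesis
    by (simp add: differential_at_def fun_eq_iff cls_add cls_mult holo_at_partial_deriv holo_at_mult assms)
qed

lemma dF_cong: "\<forall>\<^sub>F z in nhds y. g z = h z \<Longrightarrow> dF g = dF h"
proof -
  assume "\<forall>\<^sub>F z in nhds y. g z = h z"
  from partial_deriv_eventually_cong [OF this]
  have "\<forall>\<^sub>F z in nhds y. partial_deriv j g z = partial_deriv j h z" for j
    by (rule eventually_mono) blast
  then show ?thesis
    unfolding differential_at_def by (intro ext cls_cong)
qed

lemma submodule_Con: "submodule Con LR F1"
proof -
  interpret F: module LR F1 by (rule module_F1)
  show ?thesis
    by (rule F.submodule_generated_submodule) (use dF_carrier holo_eqns in auto)
qed

text \<open>By the product rule, the elements of the ideal whose differential lies in the conormal image form an ideal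
themselves, and this contains the equations.\<close>

lemma dF_ideal_fun:
  assumes "g \<in> ideal_fun X y"
  shows "dF g \<in> Con"
proof -
  interpret F: module LR F1 by (rule module_F1)
  note CE = F.submoduleE [OF submodule_Con]
  have "g \<in> {g \<in> ideal_fun X y. dF g \<in> Con}"
  proof (rule ideal_fun_induct [OF assms])
    show "eqns X \<subseteq> {g \<in> ideal_fun X y. dF g \<in> Con}"
      using subset_generated_submodule [of "dF ` eqns X" LR F1] ideal_fun_eqns by auto
    show "holo_at y g" if "g \<in> {g \<in> ideal_fun X y. dF g \<in> Con}" for g
      using that ideal_fun_holo by blast
    have "partial_deriv j (\<lambda>_. 0) = (\<lambda>_. 0)" for j :: 'm
      by (simp add: partial_deriv_def fun_eq_iff)
    then have "dF (\<lambda>_. 0) = \<zero>\<^bsub>F1\<^esub>"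
      by (simp add: differential_at_def cls_zero)
    moreover have "\<zero>\<^bsub>F1\<^esub> \<in> Con"
      using submodule_Con by (auto simp: submodule_def simp del: free_module_simps dest: subgroup.one_closed)
    ultimately show "(\<lambda>_. 0) \<in> {g \<in> ideal_fun X y. dF g \<in> Con}"
      by (simp add: ideal_fun_zero)
    show "(\<lambda>z. g z + h z) \<in> {g \<in> ideal_fun X y. dF g \<in> Con}"
      if "g \<in> {g \<in> ideal_fun X y. dF g \<in> Con}" "h \<in> {g \<in> ideal_fun X y. dF g \<in> Con}" for g h
      using that CE(5) [of "dF g" "dF h"] ideal_fun_add [of g h] dF_add [of g h] ideal_fun_holo
      by (simp del: free_module_simps)
    show "(\<lambda>z. c z * g z) \<in> {g \<in> ideal_fun X y. dF g \<in> Con}"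
      if c: "holo_at y c" and g: "g \<in> {g \<in> ideal_fun X y. dF g \<in> Con}" for c g
    proof -
      have "holo_at y g" "cls g = \<zero>\<^bsub>LR\<^esub>"
        using g ideal_fun_holo cls_eq_zero_iff by blast+
      then have "dF (\<lambda>z. c z * g z) = cls c \<odot>\<^bsub>F1\<^esub> dF g"
        using dF_mult [OF c, of g] dF_carrier [OF c] dF_carrier [of g] c
        by (simp del: free_module_simps)
      then show ?thesis
        using g CE(4) [of "cls c" "dF g"] c ideal_fun_mult [OF c, of g] by (simp del: free_module_simps)
    qed
    show "h \<in> {g \<in> ideal_fun X y. dF g \<in> Con}"
      if "g \<in> {g \<in> ideal_fun X y. dF g \<in> Con}" "\<forall>\<^sub>F z in nhds y. g z = h z" for g h
      using that dF_cong [of g h] ideal_fun_cong [of g h] by simp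
  qed
  then show ?thesis by simp
qed

lemma module_Om: "module LR Om"
  unfolding kaehler_1_forms_at_def by (rule module.module_quotient_module [OF module_F1 submodule_Con])

lemma is_linear_Om: "is_linear LR F1 Om (\<lambda>u. Con +>\<^bsub>F1\<^esub> u)"
  unfolding kaehler_1_forms_at_def by (rule module.is_linear_coset [OF module_F1 submodule_Con])

text \<open>The differential of a function on \<open>X\<close>.\<close>

definition dOm where
  "dOm g = Con +>\<^bsub>F1\<^esub> dF g"

lemma dOm_carrier: "holo_at y g \<Longrightarrow> dOm g \<in> carrier Om"
  unfolding dOm_def by (rule is_linear_closed [OF is_linear_Om dF_carrier])

lemma carrier_Om: "carrier Om = {Con +>\<^bsub>F1\<^esub> u | u. u \<in> carrier F1}"
  unfolding kaehler_1_forms_at_def by (rule module.quotient_module_facts(1) [OF module_F1 submodule_Con])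

lemma coset_zero_Om: "u \<in> Con \<Longrightarrow> Con +>\<^bsub>F1\<^esub> u = \<zero>\<^bsub>Om\<^esub>"
proof -
  assume u: "u \<in> Con"
  interpret F: module LR F1 by (rule module_F1)
  have uF: "u \<in> carrier F1" using F.submoduleE(1) [OF submodule_Con] u by blast
  have "u \<ominus>\<^bsub>F1\<^esub> \<zero>\<^bsub>F1\<^esub> = u"
    using uF by (simp add: a_minus_def del: free_module_simps)
  then show ?thesis
    unfolding kaehler_1_forms_at_def F.quotient_module_facts(2) [OF submodule_Con]
    using F.quotient_module_facts(5) [OF submodule_Con uF F.M.zero_closed] u
    by (simp del: free_module_simps)
qed

lemma dOm_ideal_fun: "g \<in> ideal_fun X y \<Longrightarrow> dOm g = \<zero>\<^bsub>Om\<^esub>"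
  unfolding dOm_def by (rule coset_zero_Om [OF dF_ideal_fun])

lemma dOm_chain:
  fixes \<phi> :: "complex ^ 'm \<Rightarrow> complex ^ 'b::finite"
  assumes \<phi>: "\<And>k. holo_at y (\<lambda>z. \<phi> z $ k)" and g: "holo_at (\<phi> y) g"
  shows "dOm (\<lambda>z. g (\<phi> z)) =
    (\<Oplus>\<^bsub>Om\<^esub>k\<in>UNIV. cls (\<lambda>z. partial_deriv k g (\<phi> z)) \<odot>\<^bsub>Om\<^esub> dOm (\<lambda>z. \<phi> z $ k))"
proof -
  interpret F: module LR F1 by (rule module_F1)
  have h: "holo_at y (\<lambda>z. partial_deriv k g (\<phi> z))" for k
    by (rule holo_at_compose(1) [OF \<phi> holo_at_partial_deriv [OF g]])
  have c: "cls (\<lambda>z. partial_deriv k g (\<phi> z)) \<odot>\<^bsub>F1\<^esub> dF (\<lambda>z. \<phi> z $ k) \<in> carrier F1" for k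
    by (intro F.smult_closed dF_carrier \<phi> cls_carrier h)
  have "dF (\<lambda>z. g (\<phi> z)) j =
    (\<Oplus>\<^bsub>LR\<^esub>k\<in>UNIV. cls (\<lambda>z. partial_deriv k g (\<phi> z)) \<otimes>\<^bsub>LR\<^esub> dF (\<lambda>z. \<phi> z $ k) j)" for j
  proof -
    have "dF (\<lambda>z. g (\<phi> z)) j =
      cls (\<lambda>z. \<Sum>k\<in>UNIV. partial_deriv k g (\<phi> z) * partial_deriv j (\<lambda>z. \<phi> z $ k) z)"
      unfolding differential_at_def
      by (rule cls_cong, rule eventually_mono [OF holo_at_compose(2) [OF \<phi> g]]) blast
    also have "\<dots> = (\<Oplus>\<^bsub>LR\<^esub>k\<in>UNIV. cls (\<lambda>z. partial_deriv k g (\<phi> z) * partial_deriv j (\<lambda>z. \<phi> z $ k) z))"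
      by (intro cls_sum holo_at_mult h holo_at_partial_deriv \<phi>) simp
    finally show ?thesis
      by (simp add: cls_mult h holo_at_partial_deriv \<phi> differential_at_def)
  qed
  then have eq: "dF (\<lambda>z. g (\<phi> z)) =
    (\<Oplus>\<^bsub>F1\<^esub>k\<in>UNIV. cls (\<lambda>z. partial_deriv k g (\<phi> z)) \<odot>\<^bsub>F1\<^esub> dF (\<lambda>z. \<phi> z $ k))"
    using c by (intro ext) (simp add: finsum_free_module [OF cring_local_ring] Pi_iff)
  show ?thesis
    unfolding dOm_def eq using c
    by (subst is_linear_finsum [OF module_F1 module_Om is_linear_Om])
      (auto simp: is_linear_smult [OF is_linear_Om] h dF_carrier \<phi> simp del: free_module_simps)
qed

lemma unit_vector_dF: "unit_vector LR j = dF (\<lambda>z. z $ j)"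
proof -
  have "partial_deriv i (\<lambda>z. z $ j) = (\<lambda>_. if i = j then 1 else 0)" for i
    by (simp add: partial_deriv_coord fun_eq_iff)
  then show ?thesis
    by (intro ext) (simp add: unit_vector_def differential_at_def cls_one cls_zero)
qed

end

section \<open>Differential forms as rows modulo the gradient\<close>

context germ_at
begin

lemma rep_cls: "holo_at y h \<Longrightarrow> (\<lambda>z. rep (cls h) z - h z) \<in> ideal_fun X y"
  using cls_eq_iff [of "rep (cls h)" h] holo_at_rep [of "cls h"] cls_rep [of "cls h"] by simp

lemma rep_add:
  assumes "a \<in> carrier LR" "b \<in> carrier LR"
  shows "(\<lambda>z. rep (a \<oplus>\<^bsub>LR\<^esub> b) z - (rep a z + rep b z)) \<in> ideal_fun X y"
  using rep_cls [OF holo_at_add [OF holo_at_rep holo_at_rep], OF assms]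
  by (simp add: cls_add holo_at_rep cls_rep assms)

lemma rep_mult:
  assumes "holo_at y c" "b \<in> carrier LR"
  shows "(\<lambda>z. rep (cls c \<otimes>\<^bsub>LR\<^esub> b) z - c z * rep b z) \<in> ideal_fun X y"
  using rep_cls [OF holo_at_mult [OF assms(1) holo_at_rep], OF assms(2)]
  by (simp add: cls_mult holo_at_rep cls_rep assms)

end

definition holo_vec :: "complex ^ 'a::finite \<Rightarrow> (complex ^ 'a \<Rightarrow> complex ^ 'm::finite) \<Rightarrow> bool" where
  "holo_vec x v \<longleftrightarrow> (\<forall>k. holo_at x (\<lambda>z. v z $ k))"

lemma holo_vec_intros:
  "holo_vec x (\<lambda>_. u)"
  "holo_vec x v \<Longrightarrow> holo_vec x w \<Longrightarrow> holo_vec x (\<lambda>z. v z + w z)"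
  "holo_vec x v \<Longrightarrow> holo_vec x w \<Longrightarrow> holo_vec x (\<lambda>z. v z - w z)"
  "holo_at x c \<Longrightarrow> holo_vec x v \<Longrightarrow> holo_vec x (\<lambda>z. c z *s v z)"
  by (simp_all add: holo_vec_def holo_at_add holo_at_diff holo_at_mult)

lemma holo_at_row_det':
  fixes ws :: "(complex ^ 'a::finite \<Rightarrow> complex ^ 'm::finite) list"
  assumes "length ws = CARD('m)" "\<And>w. w \<in> set ws \<Longrightarrow> holo_vec x w"
  shows "holo_at x (\<lambda>z. row_det (map (\<lambda>w. w z) ws))"
  by (rule holo_at_row_det [OF assms(1)]) (use assms in \<open>auto simp: holo_vec_def\<close>)

context hypersurface_iso
begin

definition grad :: "complex ^ 'a \<Rightarrow> complex ^ 'm" where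
  "grad z = (\<chi> k. partial_deriv k f (\<phi> z))"

lemma holo_grad: "holo_vec x grad"
  by (simp add: holo_vec_def grad_def holo_at_comp_\<phi> holo_at_partial_deriv f)

text \<open>The rows that agree with a multiple of the gradient of \<open>f\<close> modulo the ideal of \<open>X\<close>. They do not change a
determinant one of whose rows is the gradient.\<close>

definition null_row :: "(complex ^ 'a \<Rightarrow> complex ^ 'm) \<Rightarrow> bool" where
  "null_row v \<longleftrightarrow> (\<exists>r. holo_at x r \<and> (\<forall>k. (\<lambda>z. v z $ k - r z * grad z $ k) \<in> ideal_fun X x))"

lemma null_rowI: "(\<And>k. (\<lambda>z. v z $ k) \<in> ideal_fun X x) \<Longrightarrow> null_row v"
  unfolding null_row_def by (intro exI [of _ "\<lambda>_. 0"]) simp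

lemma null_row_add:
  assumes "null_row v" "null_row w"
  shows "null_row (\<lambda>z. v z + w z)"
proof -
  obtain r s where rs: "holo_at x r" "\<And>k. (\<lambda>z. v z $ k - r z * grad z $ k) \<in> ideal_fun X x"
    "holo_at x s" "\<And>k. (\<lambda>z. w z $ k - s z * grad z $ k) \<in> ideal_fun X x"
    using assms unfolding null_row_def by blast
  have "(\<lambda>z. (v z + w z) $ k - (r z + s z) * grad z $ k) \<in> ideal_fun X x" for k
    using X.ideal_fun_add [OF rs(2) [of k] rs(4) [of k]] by (simp add: algebra_simps)
  then show ?thesis
    unfolding null_row_def using holo_at_add [OF rs(1,3)] by blast
qed

lemma null_row_mult:
  assumes "holo_at x c" "null_row v"
  shows "null_row (\<lambda>z. c z *s v z)"
proof -
  obtain r where r: "holo_at x r" "\<And>k. (\<lambda>z. v z $ k - r z * grad z $ k) \<in> ideal_fun X x"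
    using assms unfolding null_row_def by blast
  have "(\<lambda>z. (c z *s v z) $ k - (c z * r z) * grad z $ k) \<in> ideal_fun X x" for k
    using X.ideal_fun_mult [OF assms(1) r(2) [of k]] by (simp add: algebra_simps)
  then show ?thesis
    unfolding null_row_def using holo_at_mult [OF assms(1) r(1)] by blast
qed

definition row_equiv :: "(complex ^ 'a \<Rightarrow> complex ^ 'm) \<Rightarrow> (complex ^ 'a \<Rightarrow> complex ^ 'm) \<Rightarrow> bool" where
  "row_equiv v w \<longleftrightarrow> null_row (\<lambda>z. v z - w z)"

lemma row_equivI: "(\<And>k. (\<lambda>z. v z $ k - w z $ k) \<in> ideal_fun X x) \<Longrightarrow> row_equiv v w"
  unfolding row_equiv_def by (rule null_rowI) simp

lemma row_equiv_sym: "row_equiv v w \<Longrightarrow> row_equiv w v"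
  unfolding row_equiv_def using null_row_mult [of "\<lambda>_. - 1"] by (force simp: vec_eq_iff vector_smult_lneg)

lemma row_equiv_trans [trans]: "row_equiv u v \<Longrightarrow> row_equiv v w \<Longrightarrow> row_equiv u w"
  unfolding row_equiv_def using null_row_add by fastforce

lemma row_equiv_add:
  "row_equiv v v' \<Longrightarrow> row_equiv w w' \<Longrightarrow> row_equiv (\<lambda>z. v z + w z) (\<lambda>z. v' z + w' z)"
  unfolding row_equiv_def by (drule (1) null_row_add) (simp add: algebra_simps)

lemma row_equiv_mult: "holo_at x c \<Longrightarrow> row_equiv v w \<Longrightarrow> row_equiv (\<lambda>z. c z *s v z) (\<lambda>z. c z *s w z)"
  unfolding row_equiv_def by (drule (1) null_row_mult) (simp add: vector_ssub_ldistrib)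

text \<open>The components of the pullback under \<open>\<psi>\<close> of a 1-form \<open>u\<close> on the space containing \<open>X\<close>, as functions on
this space via \<open>\<phi>\<close>.\<close>

definition pull :: "('a \<Rightarrow> (complex ^ 'a \<Rightarrow> complex) set set) \<Rightarrow> complex ^ 'a \<Rightarrow> complex ^ 'm" where
  "pull u z = (\<chi> i. \<Sum>j\<in>UNIV. X.rep (u j) z * partial_deriv i (\<lambda>w. \<psi> w $ j) (\<phi> z))"

lemma holo_d\<psi>: "holo_at x (\<lambda>z. partial_deriv i (\<lambda>w. \<psi> w $ j) (\<phi> z))"
  by (intro holo_at_comp_\<phi> holo_at_partial_deriv \<psi>)

lemma holo_pull: "u \<in> carrier X.F1 \<Longrightarrow> holo_vec x (pull u)"
  by (simp add: holo_vec_def pull_def X.carrier_F1 holo_at_sum holo_at_mult X.holo_at_rep holo_d\<psi>)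

lemma pull_add:
  assumes "u \<in> carrier X.F1" "v \<in> carrier X.F1"
  shows "row_equiv (pull (u \<oplus>\<^bsub>X.F1\<^esub> v)) (\<lambda>z. pull u z + pull v z)"
proof (rule row_equivI)
  fix i
  have "(\<lambda>z. \<Sum>j\<in>UNIV. (X.rep (u j \<oplus>\<^bsub>X.LR\<^esub> v j) z - (X.rep (u j) z + X.rep (v j) z)) *
    partial_deriv i (\<lambda>w. \<psi> w $ j) (\<phi> z)) \<in> ideal_fun X x"
    using assms by (intro X.ideal_fun_sum X.ideal_fun_mult_right X.rep_add holo_d\<psi>) (simp_all add: X.carrier_F1)
  then show "(\<lambda>z. pull (u \<oplus>\<^bsub>X.F1\<^esub> v) z $ i - (pull u z + pull v z) $ i) \<in> ideal_fun X x"
    by (simp add: pull_def left_diff_distrib distrib_right sum_subtractf sum.distrib)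
qed

lemma pull_mult:
  assumes "holo_at x c" "u \<in> carrier X.F1"
  shows "row_equiv (pull (X.cls c \<odot>\<^bsub>X.F1\<^esub> u)) (\<lambda>z. c z *s pull u z)"
proof (rule row_equivI)
  fix i
  have "(\<lambda>z. \<Sum>j\<in>UNIV. (X.rep (X.cls c \<otimes>\<^bsub>X.LR\<^esub> u j) z - c z * X.rep (u j) z) *
    partial_deriv i (\<lambda>w. \<psi> w $ j) (\<phi> z)) \<in> ideal_fun X x"
    using assms by (intro X.ideal_fun_sum X.ideal_fun_mult_right X.rep_mult holo_d\<psi>) (simp_all add: X.carrier_F1)
  then show "(\<lambda>z. pull (X.cls c \<odot>\<^bsub>X.F1\<^esub> u) z $ i - (c z *s pull u z) $ i) \<in> ideal_fun X x"
    by (simp add: pull_def left_diff_distrib sum_subtractf sum_distrib_left mult.assoc)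
qed

text \<open>The chain rule for \<open>g \<circ> \<psi>\<close>: if \<open>g \<circ> \<psi> = h + c f\<close>, then the differential of \<open>g\<close> pulls back to that of \<open>h\<close> up to a
multiple of the gradient of \<open>f\<close> and multiples of \<open>f\<close>. The case \<open>h = 0\<close> treats the equations of \<open>X\<close> and
the case of a coordinate \<open>h\<close> the components of \<open>\<phi>\<close>.\<close>

lemma pull_dF:
  assumes g: "holo_at x g" and h: "holo_at y h" and c: "holo_at y c"
    and eq: "\<forall>\<^sub>F w in nhds y. g (\<psi> w) = h w + c w * f w"
  shows "row_equiv (pull (X.dF g)) (\<lambda>z. \<chi> i. partial_deriv i h (\<phi> z))"
proof -
  let ?P = "\<lambda>i j z. partial_deriv i (\<lambda>w. \<psi> w $ j) (\<phi> z)"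
  have g\<psi>: "holo_at (\<psi> y) g" using g \<psi>_y by simp
  obtain U where U: "open U" "y \<in> U" "holo_on c U" "holo_on f U" 
    by (rule holo_at_pairE [OF c f]) (rule that)
  obtain V where V: "open V" "y \<in> V" "holo_on h V"
    using h unfolding holo_at_def by blast
  have UV: "open (U \<inter> V)" "y \<in> U \<inter> V" using U V by auto
  have 1: "\<forall>\<^sub>F w in nhds y. \<forall>i. (\<Sum>j\<in>UNIV. partial_deriv j g (\<psi> w) * partial_deriv i (\<lambda>w. \<psi> w $ j) w) =
    partial_deriv i h w + (c w * partial_deriv i f w + partial_deriv i c w * f w)"
    using holo_at_compose(2) [OF \<psi> g\<psi>] partial_deriv_eventually_cong [OF eq]
      eventually_nhds_in_open [OF UV]
  proof eventually_elim
    case (elim w)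
    have hU: "holo_on h (U \<inter> V)" "holo_on c (U \<inter> V)" "holo_on f (U \<inter> V)"
      using U V by (auto intro: holo_on_subset)
    show ?case
      using elim partial_deriv_add [OF hU(1) holo_on_mult [OF hU(2,3)] elim(3)]
        partial_deriv_mult [OF hU(2,3) elim(3)] by (simp add: algebra_simps)
  qed
  have rg: "(\<lambda>z. X.rep (X.dF g j) z - partial_deriv j g (\<psi> (\<phi> z))) \<in> ideal_fun X x" for j
    using X.ideal_fun_diff [OF X.rep_cls comp_\<psi>_\<phi>, OF holo_at_partial_deriv holo_at_partial_deriv, OF g g, of j j]
    by (simp add: differential_at_def)
  show ?thesis
    unfolding row_equiv_def null_row_def
  proof (intro exI [of _ "\<lambda>z. c (\<phi> z)"] conjI allI)
    show "holo_at x (\<lambda>z. c (\<phi> z))" by (rule holo_at_comp_\<phi> [OF c])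
    fix i
    have "(\<lambda>z. (\<Sum>j\<in>UNIV. (X.rep (X.dF g j) z - partial_deriv j g (\<psi> (\<phi> z))) * ?P i j z) +
      partial_deriv i c (\<phi> z) * f (\<phi> z)) \<in> ideal_fun X x"
      by (intro X.ideal_fun_add X.ideal_fun_sum X.ideal_fun_mult_right rg holo_d\<psi>
        X.ideal_fun_mult holo_at_comp_\<phi> holo_at_partial_deriv c f_\<phi>)
    then show "(\<lambda>z. (pull (X.dF g) z - (\<chi> i. partial_deriv i h (\<phi> z))) $ i - c (\<phi> z) * grad z $ i) \<in> ideal_fun X x"
    proof (rule X.ideal_fun_cong)
      show "\<forall>\<^sub>F z in nhds x. (\<Sum>j\<in>UNIV. (X.rep (X.dF g j) z - partial_deriv j g (\<psi> (\<phi> z))) * ?P i j z) +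
        partial_deriv i c (\<phi> z) * f (\<phi> z) =
        (pull (X.dF g) z - (\<chi> i. partial_deriv i h (\<phi> z))) $ i - c (\<phi> z) * grad z $ i"
        using eventually_\<phi> [OF 1]
        by eventually_elim (simp add: pull_def grad_def left_diff_distrib sum_subtractf)
    qed
  qed
qed

lemma null_row_pull_Con:
  assumes "u \<in> X.Con"
  shows "null_row (pull u)"
proof -
  interpret F: module X.LR X.F1 by (rule X.module_F1)
  let ?P = "{u \<in> carrier X.F1. null_row (pull u)}"
  have null: "null_row w" if "row_equiv w v" "null_row v" for v w
    using null_row_add [OF that(1) [unfolded row_equiv_def] that(2)] by simp
  have "submodule ?P X.LR X.F1"
  proof (rule F.submodule_if)
    have "pull \<zero>\<^bsub>X.F1\<^esub> = (\<lambda>z. \<chi> i. \<Sum>j\<in>UNIV. X.rep (X.cls (\<lambda>_. 0)) z * partial_deriv i (\<lambda>w. \<psi> w $ j) (\<phi> z))"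
      by (simp add: pull_def X.cls_zero fun_eq_iff)
    moreover have "(\<lambda>z. \<Sum>j\<in>UNIV. X.rep (X.cls (\<lambda>_. 0)) z * partial_deriv i (\<lambda>w. \<psi> w $ j) (\<phi> z)) \<in> ideal_fun X x" for i
      using X.rep_cls [OF holo_at_const, of 0]
      by (intro X.ideal_fun_sum X.ideal_fun_mult_right holo_d\<psi>) simp
    ultimately have "null_row (pull \<zero>\<^bsub>X.F1\<^esub>)"
      by (intro null_rowI) (simp del: free_module_simps)
    then show "\<zero>\<^bsub>X.F1\<^esub> \<in> ?P" by blast
    show "u \<oplus>\<^bsub>X.F1\<^esub> v \<in> ?P" if "u \<in> ?P" "v \<in> ?P" for u v
      using that null [OF pull_add null_row_add, of u v] by (simp del: free_module_simps)
    show "a \<odot>\<^bsub>X.F1\<^esub> u \<in> ?P" if a: "a \<in> carrier X.LR" and u: "u \<in> ?P" for a u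
      using u a null [OF pull_mult null_row_mult, OF X.holo_at_rep [OF a] _ X.holo_at_rep [OF a], of u]
      by (simp add: X.cls_rep del: free_module_simps)
  qed auto
  moreover have "X.dF ` eqns X \<subseteq> ?P"
  proof
    fix u assume "u \<in> X.dF ` eqns X"
    then obtain g where g: "g \<in> eqns X" "u = X.dF g" by blast
    obtain c where c: "holo_at y c" "\<forall>\<^sub>F z in nhds y. g (\<psi> z) = c z * f z"
      using eqns_\<psi> [OF g(1)] unfolding multiple_of_def by blast
    have "row_equiv (pull u) (\<lambda>z. \<chi> i. partial_deriv i (\<lambda>_. 0) (\<phi> z))"
      unfolding g(2) by (rule pull_dF [OF X.holo_eqns [OF g(1)] holo_at_const c(1)]) (use c(2) in simp)
    then have "null_row (pull u)"
      by (rule null) (rule null_rowI, simp add: partial_deriv_def X.ideal_fun_zero)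
    then show "u \<in> ?P" using g X.dF_carrier X.holo_eqns by auto
  qed
  ultimately have "X.Con \<subseteq> ?P" by (rule generated_submodule_subset)
  then show ?thesis using assms by blast
qed

text \<open>The pullback of an element of the module of differentials, by means of an arbitrary representative. It is
well defined and linear up to rows in the sense of \<open>null_row\<close>.\<close>

definition rho where
  "rho \<omega> = pull (SOME u. u \<in> carrier X.F1 \<and> \<omega> = X.Con +>\<^bsub>X.F1\<^esub> u)"

lemma rho_coset:
  assumes u: "u \<in> carrier X.F1"
  shows "row_equiv (rho (X.Con +>\<^bsub>X.F1\<^esub> u)) (pull u)" and "holo_vec x (rho (X.Con +>\<^bsub>X.F1\<^esub> u))"
proof -
  interpret F: module X.LR X.F1 by (rule X.module_F1)
  define v where "v = (SOME v. v \<in> carrier X.F1 \<and> X.Con +>\<^bsub>X.F1\<^esub> u = X.Con +>\<^bsub>X.F1\<^esub> v)"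
  have v: "v \<in> carrier X.F1" "X.Con +>\<^bsub>X.F1\<^esub> u = X.Con +>\<^bsub>X.F1\<^esub> v"
    using someI [of "\<lambda>v. v \<in> carrier X.F1 \<and> X.Con +>\<^bsub>X.F1\<^esub> u = X.Con +>\<^bsub>X.F1\<^esub> v" u] u
    unfolding v_def by blast+
  have rho: "rho (X.Con +>\<^bsub>X.F1\<^esub> u) = pull v" by (simp add: rho_def v_def)
  show "holo_vec x (rho (X.Con +>\<^bsub>X.F1\<^esub> u))"
    unfolding rho by (rule holo_pull [OF v(1)])
  have d: "v \<ominus>\<^bsub>X.F1\<^esub> u \<in> X.Con"
    using F.quotient_module_facts(5) [OF X.submodule_Con v(1) u] v(2) by simp
  have dc: "v \<ominus>\<^bsub>X.F1\<^esub> u \<in> carrier X.F1" using u v by (intro F.M.minus_closed)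
  have "v = (v \<ominus>\<^bsub>X.F1\<^esub> u) \<oplus>\<^bsub>X.F1\<^esub> u"
    using u v by (simp add: a_minus_def F.M.a_assoc F.M.l_neg del: free_module_simps)
  with pull_add [OF dc u] have "null_row (\<lambda>z. pull v z - (pull (v \<ominus>\<^bsub>X.F1\<^esub> u) z + pull u z))"
    by (simp add: row_equiv_def del: free_module_simps)
  from null_row_add [OF this null_row_pull_Con [OF d]]
  show "row_equiv (rho (X.Con +>\<^bsub>X.F1\<^esub> u)) (pull u)"
    unfolding rho row_equiv_def by (simp add: algebra_simps)
qed

lemma holo_rho: "a \<in> carrier X.Om \<Longrightarrow> holo_vec x (rho a)"
  using rho_coset(2) by (auto simp: X.carrier_Om)

lemma rho_add:
  assumes "a \<in> carrier X.Om" "b \<in> carrier X.Om"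
  shows "row_equiv (rho (a \<oplus>\<^bsub>X.Om\<^esub> b)) (\<lambda>z. rho a z + rho b z)"
proof -
  interpret F: module X.LR X.F1 by (rule X.module_F1)
  obtain u v where uv: "u \<in> carrier X.F1" "a = X.Con +>\<^bsub>X.F1\<^esub> u" "v \<in> carrier X.F1" "b = X.Con +>\<^bsub>X.F1\<^esub> v"
    using assms unfolding X.carrier_Om by blast
  have "a \<oplus>\<^bsub>X.Om\<^esub> b = X.Con +>\<^bsub>X.F1\<^esub> (u \<oplus>\<^bsub>X.F1\<^esub> v)"
    unfolding uv by (rule is_linear_add [OF X.is_linear_Om uv(1,3), symmetric])
  then have "row_equiv (rho (a \<oplus>\<^bsub>X.Om\<^esub> b)) (pull (u \<oplus>\<^bsub>X.F1\<^esub> v))"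
    using rho_coset(1) [OF F.M.a_closed [OF uv(1,3)]] by simp
  also have "row_equiv (pull (u \<oplus>\<^bsub>X.F1\<^esub> v)) (\<lambda>z. pull u z + pull v z)"
    by (rule pull_add [OF uv(1,3)])
  also have "row_equiv (\<lambda>z. pull u z + pull v z) (\<lambda>z. rho a z + rho b z)"
    unfolding uv(2,4) by (intro row_equiv_add row_equiv_sym [OF rho_coset(1)] uv)
  finally show ?thesis .
qed

lemma rho_mult:
  assumes c: "holo_at x c" and "a \<in> carrier X.Om"
  shows "row_equiv (rho (X.cls c \<odot>\<^bsub>X.Om\<^esub> a)) (\<lambda>z. c z *s rho a z)"
proof -
  interpret F: module X.LR X.F1 by (rule X.module_F1)
  obtain u where u: "u \<in> carrier X.F1" "a = X.Con +>\<^bsub>X.F1\<^esub> u"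
    using assms unfolding X.carrier_Om by blast
  have "X.cls c \<odot>\<^bsub>X.Om\<^esub> a = X.Con +>\<^bsub>X.F1\<^esub> (X.cls c \<odot>\<^bsub>X.F1\<^esub> u)"
    unfolding u by (rule is_linear_smult [OF X.is_linear_Om _ u(1), symmetric]) (simp add: c)
  then have "row_equiv (rho (X.cls c \<odot>\<^bsub>X.Om\<^esub> a)) (pull (X.cls c \<odot>\<^bsub>X.F1\<^esub> u))"
    using rho_coset(1) [OF F.smult_closed [OF X.cls_carrier [OF c] u(1)]] by simp
  also have "row_equiv (pull (X.cls c \<odot>\<^bsub>X.F1\<^esub> u)) (\<lambda>z. c z *s pull u z)"
    by (rule pull_mult [OF c u(1)])
  also have "row_equiv (\<lambda>z. c z *s pull u z) (\<lambda>z. c z *s rho a z)"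
    unfolding u(2) by (intro row_equiv_mult c row_equiv_sym [OF rho_coset(1)] u)
  finally show ?thesis .
qed

definition dphi where
  "dphi k = X.dOm (\<lambda>z. \<phi> z $ k)"

lemma dphi_carrier: "dphi k \<in> carrier X.Om"
  unfolding dphi_def by (rule X.dOm_carrier [OF \<phi>])

lemma rho_dphi: "row_equiv (rho (dphi k)) (\<lambda>_. axis k 1)"
proof -
  obtain c where c: "holo_at y c" "\<forall>\<^sub>F z in nhds y. \<phi> (\<psi> z) $ k - z $ k = c z * f z"
    using \<phi>_\<psi> unfolding multiple_of_def by blast
  have "row_equiv (rho (dphi k)) (pull (X.dF (\<lambda>z. \<phi> z $ k)))"
    unfolding dphi_def X.dOm_def by (rule rho_coset(1) [OF X.dF_carrier [OF \<phi>]])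
  also have "row_equiv (pull (X.dF (\<lambda>z. \<phi> z $ k))) (\<lambda>z. \<chi> i. partial_deriv i (\<lambda>w. w $ k) (\<phi> z))"
  proof (rule pull_dF [OF \<phi> holo_at_coord c(1)])
    show "\<forall>\<^sub>F w in nhds y. \<phi> (\<psi> w) $ k = w $ k + c w * f w"
      using c(2) by eventually_elim (simp add: algebra_simps)
  qed
  also have "(\<lambda>z. \<chi> i. partial_deriv i (\<lambda>w. w $ k) (\<phi> z)) = (\<lambda>_. axis k 1)"
    by (auto simp: partial_deriv_coord axis_def vec_eq_iff fun_eq_iff)
  finally show ?thesis .
qed

text \<open>Subtract the multiple of the gradient, which is the first row, and expand the determinant along row \<open>i\<close>:
what remains is a combination of elements of the ideal.\<close>

lemma row_det_equiv_step:
  assumes ws: "length ws = CARD('m)" "ws ! 0 = grad" "\<And>w. w \<in> set ws \<Longrightarrow> holo_vec x w"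
    and i: "0 < i" "i < CARD('m)" and vw: "row_equiv v w"
  shows "(\<lambda>z. row_det (map (\<lambda>w. w z) (ws[i := v])) - row_det (map (\<lambda>w. w z) (ws[i := w]))) \<in> ideal_fun X x"
proof -
  obtain r where r: "\<And>k. (\<lambda>z. (v z - w z) $ k - r z * grad z $ k) \<in> ideal_fun X x"
    using vw unfolding row_equiv_def null_row_def by blast
  have hol: "holo_at x (\<lambda>z. row_det (map (\<lambda>w. w z) (ws[i := \<lambda>_. axis j 1])))" for j
    by (rule holo_at_row_det')
      (use ws set_update_subset_insert [of ws i "\<lambda>_. axis j 1"] in \<open>auto simp: holo_vec_intros\<close>)
  have "row_det (map (\<lambda>w. w z) (ws[i := v])) - row_det (map (\<lambda>w. w z) (ws[i := w])) =
    (\<Sum>j\<in>UNIV. ((v z - w z) $ j - r z * grad z $ j) * row_det (map (\<lambda>w. w z) (ws[i := \<lambda>_. axis j 1])))" for z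
  proof -
    let ?M = "map (\<lambda>w. w z) ws"
    have M: "length ?M = CARD('m)" using ws by simp
    have G: "row_det (?M[i := grad z]) = 0"
      by (rule row_det_identical [of 0 i]) (use i ws in simp_all)
    have "v z = w z + (r z *s grad z + (v z - w z - r z *s grad z))"
      by simp
    then have "row_det (?M[i := v z]) = row_det (?M[i := w z]) +
      (r z * row_det (?M[i := grad z]) + row_det (?M[i := v z - w z - r z *s grad z]))"
      by (metis row_det_add [OF M i(2)] row_det_mult [OF M i(2)])
    then show ?thesis
      using row_det_expand [OF M i(2), of "v z - w z - r z *s grad z"] by (simp add: G map_update)
  qed
  moreover have "(\<lambda>z. \<Sum>j\<in>UNIV. ((v z - w z) $ j - r z * grad z $ j) *
    row_det (map (\<lambda>w. w z) (ws[i := \<lambda>_. axis j 1]))) \<in> ideal_fun X x"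
    by (intro X.ideal_fun_sum X.ideal_fun_mult_right hol r)
  ultimately show ?thesis by simp
qed

lemma row_det_equiv:
  assumes vs: "length vs = CARD('m)" "vs ! 0 = grad" "\<And>w. w \<in> set vs \<Longrightarrow> holo_vec x w"
    and ws: "length ws = CARD('m)" "ws ! 0 = grad" "\<And>w. w \<in> set ws \<Longrightarrow> holo_vec x w"
    and eq: "\<And>i. 0 < i \<Longrightarrow> i < CARD('m) \<Longrightarrow> row_equiv (vs ! i) (ws ! i)"
  shows "X.cls (\<lambda>z. row_det (map (\<lambda>w. w z) vs)) = X.cls (\<lambda>z. row_det (map (\<lambda>w. w z) ws))"
proof -
  have "(\<lambda>z. row_det (map (\<lambda>w. w z) vs) - row_det (map (\<lambda>w. w z) (take n ws @ drop n vs))) \<in> ideal_fun X x"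
    if "n \<le> CARD('m)" for n
    using that
  proof (induction n)
    case 0
    then show ?case by (simp add: X.ideal_fun_zero)
  next
    case (Suc n)
    let ?us = "take n ws @ drop n vs"
    have n: "n < CARD('m)" using Suc.prems by simp
    have us: "length ?us = CARD('m)" using vs ws n by simp
    have us_n: "?us ! n = vs ! n" using vs ws n by (simp add: nth_append)
    have upd: "take (Suc n) ws @ drop (Suc n) vs = ?us[n := ws ! n]"
      using vs ws n
      by (simp add: take_Suc_conv_app_nth list_update_append Cons_nth_drop_Suc [symmetric])
    have "(\<lambda>z. row_det (map (\<lambda>w. w z) ?us) - row_det (map (\<lambda>w. w z) (?us[n := ws ! n]))) \<in> ideal_fun X x"
    proof (cases "n = 0")
      case True
      then have "?us[n := ws ! n] = ?us" using vs ws by (metis list_update_id us_n)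
      then show ?thesis by (simp add: X.ideal_fun_zero)
    next
      case False
      have "(\<lambda>z. row_det (map (\<lambda>w. w z) (?us[n := vs ! n])) - row_det (map (\<lambda>w. w z) (?us[n := ws ! n]))) \<in> ideal_fun X x"
      proof (rule row_det_equiv_step [OF us])
        show "?us ! 0 = grad" using False ws n by (simp add: nth_append)
        show "holo_vec x w" if "w \<in> set ?us" for w
          using that vs(3) ws(3) by (auto dest: in_set_takeD in_set_dropD)
      qed (use False n eq in auto)
      moreover have "?us[n := vs ! n] = ?us" by (metis list_update_id us_n)
      ultimately show ?thesis by simp
    qed
    from X.ideal_fun_add [OF Suc.IH this] n show ?case unfolding upd by simp
  qed
  from this [of "CARD('m)"] vs(1) ws(1) show ?thesis
    by (subst X.cls_eq_iff) (simp_all add: holo_at_row_det' vs(3) ws(3))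
qed

end

section \<open>Linear forms on exterior powers of the differentials\<close>

lemma linear_form_combination:
  assumes M: "module R M" and h: "is_linear R M (self_module R) h" and A: "finite A"
    and c: "c \<in> A \<rightarrow> carrier R" and e: "e \<in> A \<rightarrow> carrier M"
  shows "h (\<Oplus>\<^bsub>M\<^esub>i\<in>A. c i \<odot>\<^bsub>M\<^esub> e i) = (\<Oplus>\<^bsub>R\<^esub>i\<in>A. c i \<otimes>\<^bsub>R\<^esub> h (e i))"
proof -
  interpret M: module R M by fact
  interpret S: module R "self_module R" by (rule module_self_module [OF M.R.is_cring])
  have he: "h (e i) \<in> carrier R" if "i \<in> A" for i
    using is_linear_closed [OF h, of "e i"] e that by auto
  have "h (\<Oplus>\<^bsub>M\<^esub>i\<in>A. c i \<odot>\<^bsub>M\<^esub> e i) = (\<Oplus>\<^bsub>self_module R\<^esub>i\<in>A. h (c i \<odot>\<^bsub>M\<^esub> e i))"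
    by (rule is_linear_finsum [OF M S.module_axioms h A]) (use c e in auto)
  also have "\<dots> = (\<Oplus>\<^bsub>self_module R\<^esub>i\<in>A. c i \<otimes>\<^bsub>R\<^esub> h (e i))"
    using c e he is_linear_smult [OF h] by (intro S.M.finsum_cong') (auto simp: Pi_iff)
  also have "\<dots> = (\<Oplus>\<^bsub>R\<^esub>i\<in>A. c i \<otimes>\<^bsub>R\<^esub> h (e i))"
    using c he by (intro finsum_self_module M.R.is_cring A) auto
  finally show ?thesis .
qed

context germ_at
begin

lemma linear_form_combination_cls:
  assumes M: "module LR M" and h: "is_linear LR M (self_module LR) h" and A: "finite A"
    and c: "\<And>i. i \<in> A \<Longrightarrow> holo_at y (c i)" and e: "e \<in> A \<rightarrow> carrier M"
    and a: "\<And>i. i \<in> A \<Longrightarrow> holo_at y (a i)" "\<And>i. i \<in> A \<Longrightarrow> h (e i) = cls (a i)"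
  shows "h (\<Oplus>\<^bsub>M\<^esub>i\<in>A. cls (c i) \<odot>\<^bsub>M\<^esub> e i) = cls (\<lambda>z. \<Sum>i\<in>A. c i z * a i z)"
proof -
  have "h (\<Oplus>\<^bsub>M\<^esub>i\<in>A. cls (c i) \<odot>\<^bsub>M\<^esub> e i) = (\<Oplus>\<^bsub>LR\<^esub>i\<in>A. cls (c i) \<otimes>\<^bsub>LR\<^esub> h (e i))"
    by (rule linear_form_combination [OF M h A _ e]) (use c in auto)
  also have "\<dots> = (\<Oplus>\<^bsub>LR\<^esub>i\<in>A. cls (\<lambda>z. c i z * a i z))"
    using c a by (intro LR.finsum_cong') (auto simp: cls_mult holo_at_mult)
  also have "\<dots> = cls (\<lambda>z. \<Sum>i\<in>A. c i z * a i z)"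
    by (rule cls_sum [symmetric]) (use A c a in \<open>auto simp: holo_at_mult\<close>)
  finally show ?thesis .
qed

end

context hypersurface_iso
begin

definition eform :: "nat \<Rightarrow> 'm list \<Rightarrow> _" where
  "eform p J = wedge X.LR p X.Om (map dphi J)"

lemma tuples_dphi: "length J = p \<Longrightarrow> map dphi J \<in> tuples p X.Om"
  using dphi_carrier by (auto simp: tuples_def)

text \<open>The coefficient of \<open>df \<and> \<omega>\<close> complementary to \<open>L\<close>, as a linear form in the \<open>p\<close>-form \<open>\<omega>\<close> on \<open>X\<close>. On the
ambient space it is the determinant with rows the gradient of \<open>f\<close>, the \<open>p\<close> factors and the unit vectors of
\<open>L\<close>. It descends to the differentials of \<open>X\<close> because rows matter only up to multiples of the gradient.\<close>

lemma wedge_functional: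
  assumes len: "p + length L + 1 = CARD('m)"
  obtains T where "is_linear X.LR (exterior_power X.LR p X.Om) (self_module X.LR) T"
    "\<And>J. length J = p \<Longrightarrow> T (eform p J) = X.cls (\<lambda>z. row_det (grad z # map (\<lambda>k. axis k 1) (J @ L)))"
proof -
  interpret Om: module X.LR X.Om by (rule X.module_Om)
  define rows where "rows ms = grad # map rho ms @ map (\<lambda>k _. axis k 1) L" for ms
  define t where "t ms = X.cls (\<lambda>z. row_det (map (\<lambda>w. w z) (rows ms)))" for ms
  have rows_len: "length (rows ms) = CARD('m)" if "ms \<in> tuples p X.Om" for ms
    using that len by (simp add: rows_def tuples_def)
  have rows_0: "rows ms ! 0 = grad" for ms by (simp add: rows_def)
  have rows_holo: "holo_vec x w" if "ms \<in> tuples p X.Om" "w \<in> set (rows ms)" for ms w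
    using that holo_grad by (auto simp: rows_def tuples_def holo_vec_intros intro!: holo_rho)
  have upd_holo: "holo_vec x w" if "ms \<in> tuples p X.Om" "w \<in> set ((rows ms)[i := v])" "holo_vec x v" for ms w v i
    using that rows_holo set_update_subset_insert [of "rows ms" i v] by blast
  have rows_upd: "rows (ms[i := a]) = (rows ms)[Suc i := rho a]" if "ms \<in> tuples p X.Om" "i < p" for ms i a
    using that by (simp add: rows_def tuples_def map_update list_update_append)
  have t_upd: "t (ms[i := a]) = X.cls (\<lambda>z. row_det (map (\<lambda>w. w z) ((rows ms)[Suc i := v])))"
    if ms: "ms \<in> tuples p X.Om" and i: "i < p" and a: "a \<in> carrier X.Om" and v: "holo_vec x v" "row_equiv (rho a) v" for ms i a v
    unfolding t_def rows_upd [OF ms i]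
  proof (subst X.cls_eq_iff)
    show "holo_at x (\<lambda>z. row_det (map (\<lambda>w. w z) ((rows ms)[Suc i := rho a])))"
      by (rule holo_at_row_det') (use rows_len [OF ms] upd_holo [OF ms _ holo_rho [OF a]] in auto)
    show "holo_at x (\<lambda>z. row_det (map (\<lambda>w. w z) ((rows ms)[Suc i := v])))"
      by (rule holo_at_row_det') (use rows_len [OF ms] upd_holo [OF ms _ v(1)] in auto)
    show "(\<lambda>z. row_det (map (\<lambda>w. w z) ((rows ms)[Suc i := rho a])) -
      row_det (map (\<lambda>w. w z) ((rows ms)[Suc i := v]))) \<in> ideal_fun X x"
      by (rule row_det_equiv_step [OF rows_len [OF ms] rows_0 rows_holo [OF ms] _ _ v(2)])
        (use len i in auto)
  qed
  have holo_a: "holo_at x (\<lambda>z. row_det (map (\<lambda>w. w z) ((rows ms)[Suc i := rho a])))"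
    if ms: "ms \<in> tuples p X.Om" and a: "a \<in> carrier X.Om" for ms i a
    by (rule holo_at_row_det') (use rows_len [OF ms] upd_holo [OF ms _ holo_rho [OF a]] in auto)
  have M: "length (map (\<lambda>w. w z) (rows ms)) = CARD('m)" if "ms \<in> tuples p X.Om" for ms z
    using rows_len [OF that] by simp
  have lt: "Suc i < CARD('m)" if "i < p" for i using len that by simp
  obtain T where T: "is_linear X.LR (exterior_power X.LR p X.Om) (self_module X.LR) T"
    "\<And>ms. ms \<in> tuples p X.Om \<Longrightarrow> T (wedge X.LR p X.Om ms) = t ms"
  proof (rule Om.exterior_power_lift [of p t])
    show "t ms \<in> carrier X.LR" if "ms \<in> tuples p X.Om" for ms
      unfolding t_def by (intro X.cls_carrier holo_at_row_det' rows_len [OF that] rows_holo [OF that])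
  next
    fix ms i a b assume *: "ms \<in> tuples p X.Om" "i < p" "a \<in> carrier X.Om" "b \<in> carrier X.Om"
    have "t (ms[i := a \<oplus>\<^bsub>X.Om\<^esub> b]) = X.cls (\<lambda>z. row_det (map (\<lambda>w. w z) ((rows ms)[Suc i := \<lambda>z. rho a z + rho b z])))"
      using * by (intro t_upd Om.M.a_closed holo_vec_intros holo_rho rho_add)
    also have "\<dots> = X.cls (\<lambda>z. row_det (map (\<lambda>w. w z) ((rows ms)[Suc i := rho a])) +
      row_det (map (\<lambda>w. w z) ((rows ms)[Suc i := rho b])))"
      by (simp add: map_update row_det_add [OF M [OF *(1)] lt [OF *(2)]])
    also have "\<dots> = t (ms[i := a]) \<oplus>\<^bsub>X.LR\<^esub> t (ms[i := b])"
      unfolding t_def rows_upd [OF *(1,2)] by (rule X.cls_add) (use * holo_a in blast)+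
    finally show "t (ms[i := a \<oplus>\<^bsub>X.Om\<^esub> b]) = t (ms[i := a]) \<oplus>\<^bsub>X.LR\<^esub> t (ms[i := b])" .
  next
    fix ms i c a assume *: "ms \<in> tuples p X.Om" "i < p" "c \<in> carrier X.LR" "a \<in> carrier X.Om"
    obtain h where h: "holo_at x h" "c = X.cls h" using X.cls_surj [OF *(3)] by blast
    have "t (ms[i := c \<odot>\<^bsub>X.Om\<^esub> a]) = X.cls (\<lambda>z. row_det (map (\<lambda>w. w z) ((rows ms)[Suc i := \<lambda>z. h z *s rho a z])))"
      using * h unfolding h(2)
      by (intro t_upd Om.smult_closed holo_vec_intros holo_rho rho_mult X.cls_carrier)
    also have "\<dots> = X.cls (\<lambda>z. h z * row_det (map (\<lambda>w. w z) ((rows ms)[Suc i := rho a])))"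
      by (simp add: map_update row_det_mult [OF M [OF *(1)] lt [OF *(2)]])
    also have "\<dots> = c \<otimes>\<^bsub>X.LR\<^esub> t (ms[i := a])"
      unfolding t_def rows_upd [OF *(1,2)] h(2) by (rule X.cls_mult) (use * h holo_a in blast)+
    finally show "t (ms[i := c \<odot>\<^bsub>X.Om\<^esub> a]) = c \<otimes>\<^bsub>X.LR\<^esub> t (ms[i := a])" .
  next
    fix ms i j assume *: "ms \<in> tuples p X.Om" "i < j" "j < p" "ms ! i = ms ! j"
    have "row_det (map (\<lambda>w. w z) (rows ms)) = 0" for z
      by (rule row_det_identical [of "Suc i" "Suc j"])
        (use * len in \<open>auto simp: rows_def tuples_def nth_append\<close>)
    then show "t ms = \<zero>\<^bsub>X.LR\<^esub>" by (simp add: t_def X.cls_zero)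
  qed (rule that)
  show ?thesis
  proof (rule that [OF T(1)])
    fix J :: "'m list" assume J: "length J = p"
    let ?ws = "grad # map (\<lambda>k _. axis k 1) (J @ L)"
    have "T (eform p J) = t (map dphi J)"
      unfolding eform_def by (rule T(2) [OF tuples_dphi [OF J]])
    also have "\<dots> = X.cls (\<lambda>z. row_det (map (\<lambda>w. w z) ?ws))"
      unfolding t_def
    proof (rule row_det_equiv [OF rows_len rows_0 rows_holo])
      show "length ?ws = CARD('m)" using J len by simp
      show "holo_vec x w" if "w \<in> set ?ws" for w
        using that holo_grad by (auto simp: holo_vec_intros)
      show "row_equiv (rows (map dphi J) ! i) (?ws ! i)" if "0 < i" "i < CARD('m)" for i
      proof (cases "i - 1 < p")
        case True
        then show ?thesis
          using that J rho_dphi by (cases i) (simp_all add: rows_def nth_append)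
      next
        case False
        then show ?thesis
          using that J len by (cases i) (auto simp: rows_def nth_append intro!: row_equivI X.ideal_fun_zero)
      qed
    qed (use tuples_dphi [OF J] in auto)
    also have "\<dots> = X.cls (\<lambda>z. row_det (grad z # map (\<lambda>k. axis k 1) (J @ L)))"
      by (simp add: comp_def)
    finally show "T (eform p J) = X.cls (\<lambda>z. row_det (grad z # map (\<lambda>k. axis k 1) (J @ L)))" .
  qed
qed

text \<open>A coordinate of the space containing \<open>X\<close> equals a component of \<open>\<psi> \<circ> \<phi>\<close> modulo the ideal, whose differential is a
combination of the \<open>d\<phi>\<^sub>k\<close> by the chain rule.\<close>

lemma dphi_span:
  assumes Q: "submodule Q X.LR X.Om" and dphi: "range dphi \<subseteq> Q"
  shows "carrier X.Om \<subseteq> Q"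
proof -
  interpret Om: module X.LR X.Om by (rule X.module_Om)
  interpret F: module X.LR X.F1 by (rule X.module_F1)
  note QE = Om.submoduleE [OF Q]
  let ?P = "{u \<in> carrier X.F1. X.Con +>\<^bsub>X.F1\<^esub> u \<in> Q}"
  have P: "submodule ?P X.LR X.F1"
    by (rule submodule_vimage [OF X.module_F1 X.module_Om X.is_linear_Om Q])
  have "carrier X.F1 \<subseteq> ?P"
  proof (rule free_module_span [OF X.cring_local_ring P])
    fix j :: 'a
    have h: "holo_at x (\<lambda>z. \<psi> (\<phi> z) $ j)" by (rule holo_at_comp_\<phi> [OF \<psi>])
    have 1: "X.dF (\<lambda>z. \<psi> (\<phi> z) $ j) \<in> ?P"
    proof -
      have "X.dOm (\<lambda>z. \<psi> (\<phi> z) $ j) =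
        (\<Oplus>\<^bsub>X.Om\<^esub>k\<in>UNIV. X.cls (\<lambda>z. partial_deriv k (\<lambda>w. \<psi> w $ j) (\<phi> z)) \<odot>\<^bsub>X.Om\<^esub> dphi k)"
        unfolding dphi_def by (rule X.dOm_chain [OF \<phi>]) (simp add: \<phi>_x \<psi>)
      also have "\<dots> \<in> Q"
        by (rule Om.submodule_finsum [OF Q]) (use dphi in \<open>auto intro!: QE(4) X.cls_carrier holo_d\<psi>\<close>)
      finally show ?thesis using X.dF_carrier [OF h] by (simp add: X.dOm_def)
    qed
    have I: "(\<lambda>z. z $ j - \<psi> (\<phi> z) $ j) \<in> ideal_fun X x"
      using X.ideal_fun_uminus [OF \<psi>_\<phi> [of j]] by simp
    have "X.Con +>\<^bsub>X.F1\<^esub> X.dF (\<lambda>z. z $ j - \<psi> (\<phi> z) $ j) = \<zero>\<^bsub>X.Om\<^esub>"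
      by (rule X.coset_zero_Om [OF X.dF_ideal_fun [OF I]])
    moreover have "\<zero>\<^bsub>X.Om\<^esub> \<in> Q"
      using Q by (auto simp: submodule_def dest: subgroup.one_closed)
    ultimately have 2: "X.dF (\<lambda>z. z $ j - \<psi> (\<phi> z) $ j) \<in> ?P"
      using X.dF_carrier [OF X.ideal_fun_holo [OF I]] by simp
    have "X.dF (\<lambda>z. z $ j) = X.dF (\<lambda>z. \<psi> (\<phi> z) $ j) \<oplus>\<^bsub>X.F1\<^esub> X.dF (\<lambda>z. z $ j - \<psi> (\<phi> z) $ j)"
      using X.dF_add [OF h X.ideal_fun_holo [OF I]] by simp
    then show "unit_vector X.LR j \<in> ?P"
      unfolding X.unit_vector_dF using F.submoduleE(5) [OF P 1 2] by simp
  qed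
  then show ?thesis unfolding X.carrier_Om by blast
qed

lemma df_zero:
  "(\<Oplus>\<^bsub>X.Om\<^esub>k\<in>UNIV. X.cls (\<lambda>z. partial_deriv k f (\<phi> z)) \<odot>\<^bsub>X.Om\<^esub> dphi k) = \<zero>\<^bsub>X.Om\<^esub>"
  unfolding dphi_def using X.dOm_chain [OF \<phi>, of f] X.dOm_ideal_fun [OF f_\<phi>] by (simp add: \<phi>_x f)

text \<open>This is \<open>df \<and> d\<phi>\<^sub>L = 0\<close>.\<close>

lemma eform_relation:
  assumes L: "Suc (length L) = p"
  shows "(\<Oplus>\<^bsub>exterior_power X.LR p X.Om\<^esub>k\<in>UNIV.
    X.cls (\<lambda>z. partial_deriv k f (\<phi> z)) \<odot>\<^bsub>exterior_power X.LR p X.Om\<^esub> eform p (k # L)) =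
    \<zero>\<^bsub>exterior_power X.LR p X.Om\<^esub>"
proof -
  interpret Om: module X.LR X.Om by (rule X.module_Om)
  let ?M = "exterior_power X.LR p X.Om"
  interpret M: module X.LR ?M by (rule Om.module_exterior_power)
  let ?h = "\<lambda>a. wedge X.LR p X.Om ((map dphi (undefined # L))[0 := a])"
  have lin: "is_linear X.LR X.Om ?M ?h"
    by (rule Om.wedge_linear [OF tuples_dphi]) (use L in auto)
  have c: "X.cls (\<lambda>z. partial_deriv k f (\<phi> z)) \<in> carrier X.LR" for k
    by (intro X.cls_carrier holo_at_comp_\<phi> holo_at_partial_deriv f)
  have "(\<Oplus>\<^bsub>?M\<^esub>k\<in>UNIV. X.cls (\<lambda>z. partial_deriv k f (\<phi> z)) \<odot>\<^bsub>?M\<^esub> ?h (dphi k)) =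
    (\<Oplus>\<^bsub>?M\<^esub>k\<in>UNIV. ?h (X.cls (\<lambda>z. partial_deriv k f (\<phi> z)) \<odot>\<^bsub>X.Om\<^esub> dphi k))"
    by (simp only: is_linear_smult [OF lin c dphi_carrier])
  also have "\<dots> = ?h (\<Oplus>\<^bsub>X.Om\<^esub>k\<in>UNIV. X.cls (\<lambda>z. partial_deriv k f (\<phi> z)) \<odot>\<^bsub>X.Om\<^esub> dphi k)"
    by (rule is_linear_finsum [OF X.module_Om M.module_axioms lin, symmetric])
      (use c dphi_carrier in auto)
  also have "\<dots> = \<zero>\<^bsub>?M\<^esub>"
    unfolding df_zero by (rule is_linear_zero [OF X.module_Om M.module_axioms lin])
  finally show ?thesis by (simp add: eform_def)
qed

end

section \<open>Freeness makes the gradient ideal principal\<close>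

lemma (in module) zero_mem_submodule: "submodule P R M \<Longrightarrow> \<zero>\<^bsub>M\<^esub> \<in> P"
  by (auto simp: submodule_def dest: subgroup.one_closed)

lemma card_compl_add: "card (- K) + card K = CARD('m)" for K :: "'m::finite set"
  by (subst card_Un_disjoint [symmetric]) auto

text \<open>A fixed order of the elements of a set of coordinates, which selects one form \<open>d\<phi>\<^sub>K\<close> for each set \<open>K\<close>.\<close>

definition enum_list :: "'m::finite set \<Rightarrow> 'm list" where
  "enum_list K = (SOME l. set l = K \<and> distinct l)"

lemma
  shows set_enum_list [simp]: "set (enum_list K) = K" and distinct_enum_list [simp]: "distinct (enum_list K)"
proof -
  have "\<exists>l. set l = K \<and> distinct l" by (rule finite_distinct_list) simp
  then have "set (enum_list K) = K \<and> distinct (enum_list K)"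
    unfolding enum_list_def by (rule someI_ex)
  then show "set (enum_list K) = K" "distinct (enum_list K)" by auto
qed

lemma length_enum_list [simp]: "length (enum_list K) = card K"
  using distinct_card [OF distinct_enum_list, of K] by simp

text \<open>Expand along the first row. A determinant of unit vectors is nonzero only if they are distinct, so only
the sets \<open>K = K' - {i}\<close> with \<open>i \<in> K'\<close> contribute.\<close>

lemma koszul_sum:
  fixes c :: "'m::finite set \<Rightarrow> complex" and g :: "complex ^ 'm"
  assumes K': "card K' = Suc p"
  shows "(\<Sum>K\<in>{K. card K = p}. c K * row_det (g # map (\<lambda>k. axis k 1) (enum_list K @ enum_list (- K')))) =
    (\<Sum>i\<in>K'. row_det (map (\<lambda>k. axis k 1) (i # enum_list (K' - {i}) @ enum_list (- K'))) * g $ i * c (K' - {i}))"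
proof -
  define D where "D i K = row_det (map (\<lambda>k. axis k 1) (i # enum_list K @ enum_list (- K')))" for i K
  have cK': "card (- K') + Suc p = CARD('m)"
    using card_compl_add [of K'] K' by simp
  have D0: "D i K = 0" if "card K = p" "\<not> (i \<in> K' \<and> K = K' - {i})" for i K
  proof (rule ccontr)
    assume "D i K \<noteq> 0"
    then have "distinct (i # enum_list K @ enum_list (- K'))"
      unfolding D_def by (subst (asm) row_det_axes) (use that cK' in auto)
    then have "i \<in> K'" "K \<subseteq> K' - {i}" by auto
    moreover have "card (K' - {i}) = p" using \<open>i \<in> K'\<close> K' by simp
    ultimately have "K = K' - {i}" using that(1) by (intro card_subset_eq) auto
    with that(2) \<open>i \<in> K'\<close> show False by blast
  qed
  have "row_det (g # map (\<lambda>k. axis k 1) (enum_list K @ enum_list (- K'))) = (\<Sum>i\<in>UNIV. g $ i * D i K)"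
    if "card K = p" for K
    using row_det_expand [of "0 # map (\<lambda>k. axis k 1) (enum_list K @ enum_list (- K'))" 0 g] that cK'
    by (simp add: D_def)
  then have "(\<Sum>K\<in>{K. card K = p}. c K * row_det (g # map (\<lambda>k. axis k 1) (enum_list K @ enum_list (- K')))) =
    (\<Sum>K\<in>{K. card K = p}. \<Sum>i\<in>UNIV. c K * (g $ i * D i K))"
    by (simp add: sum_distrib_left)
  also have "\<dots> = (\<Sum>i\<in>UNIV. \<Sum>K\<in>{K. card K = p}. c K * (g $ i * D i K))"
    by (rule sum.swap)
  also have "\<dots> = (\<Sum>i\<in>K'. \<Sum>K\<in>{K. card K = p}. c K * (g $ i * D i K))"
    by (rule sum.mono_neutral_right) (auto intro!: sum.neutral simp: D0)
  also have "\<dots> = (\<Sum>i\<in>K'. D i (K' - {i}) * g $ i * c (K' - {i}))"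
  proof (rule sum.cong [OF refl])
    fix i assume i: "i \<in> K'"
    have "(\<Sum>K\<in>{K. card K = p}. c K * (g $ i * D i K)) = (\<Sum>K\<in>{K' - {i}}. c K * (g $ i * D i K))"
      by (rule sum.mono_neutral_right) (use K' i in \<open>auto simp: D0\<close>)
    then show "(\<Sum>K\<in>{K. card K = p}. c K * (g $ i * D i K)) = D i (K' - {i}) * g $ i * c (K' - {i})"
      by simp
  qed
  finally show ?thesis by (simp add: D_def)
qed

context germ_at
begin

lemma smult_cls_minus_one:
  assumes M: "module LR M" and m: "m \<in> carrier M"
  shows "cls (\<lambda>_. - 1) \<odot>\<^bsub>M\<^esub> m = \<ominus>\<^bsub>M\<^esub> m"
proof -
  interpret M: module LR M by fact
  have "cls (\<lambda>_. - 1) \<oplus>\<^bsub>LR\<^esub> \<one>\<^bsub>LR\<^esub> = \<zero>\<^bsub>LR\<^esub>"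
    by (simp add: cls_add [symmetric] cls_one [symmetric] cls_zero)
  then have "\<ominus>\<^bsub>LR\<^esub> \<one>\<^bsub>LR\<^esub> = cls (\<lambda>_. - 1)"
    by (intro LR.minus_equality) simp_all
  then show ?thesis
    using m M.smult_l_minus [of "\<one>\<^bsub>LR\<^esub>" m] by simp
qed

end

text \<open>The data for \<open>jacobian_principal\<close>: \<open>A\<close> are the coordinates of the forms \<open>d\<phi>\<^sub>K\<close> with respect to the
given basis, \<open>B\<close> expresses the basis by these forms, the relations \<open>rel\<close> come from \<open>df = 0\<close>, and the
relations \<open>koszul\<close> from the linear forms of \<open>wedge_functional\<close>, which factor through the quotient by torsion.\<close>

theorem (in hypersurface_iso) gradient_principal:
  assumes radical: "\<And>F. holo_at x F \<Longrightarrow> (\<lambda>z. F z * F z) \<in> ideal_fun X x \<Longrightarrow> F \<in> ideal_fun X x"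
    and p: "1 \<le> p" "p < CARD('m)"
    and basis: "is_basis X.LR (kaehler_forms_mod_torsion_at p X x) r b"
  obtains i where "\<And>j. \<exists>a. holo_at x a \<and>
    (\<lambda>z. partial_deriv j f (\<phi> z) - a z * partial_deriv i f (\<phi> z)) \<in> ideal_fun X x"
proof -
  let ?M = "exterior_power X.LR p X.Om"
  let ?T = "torsion_submodule X.LR ?M"
  let ?N = "quotient_module ?M ?T"
  let ?S = "{K :: 'm set. card K = p}"
  interpret Om: module X.LR X.Om by (rule X.module_Om)
  interpret M: module X.LR ?M by (rule Om.module_exterior_power)
  have tor: "submodule ?T X.LR ?M" by (rule submodule_torsion_submodule [OF M.module_axioms])
  interpret N: module X.LR ?N by (rule M.module_quotient_module [OF tor])
  have basis_N: "is_basis X.LR ?N r b"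
    using basis by (simp add: kaehler_forms_mod_torsion_at_def kaehler_forms_at_def)
  have lin_q: "is_linear X.LR ?M ?N (\<lambda>m. ?T +>\<^bsub>?M\<^esub> m)"
    by (rule M.is_linear_coset [OF tor])
  have eform_closed: "eform p J \<in> carrier ?M" if "length J = p" for J
    unfolding eform_def by (rule Om.wedge_closed [OF tuples_dphi [OF that]])
  define E where "E J = ?T +>\<^bsub>?M\<^esub> eform p J" for J
  have E_closed: "E J \<in> carrier ?N" if "length J = p" for J
    unfolding E_def by (rule is_linear_closed [OF lin_q eform_closed [OF that]])
  have E_zero: "E J = \<zero>\<^bsub>?N\<^esub>" if "length J = p" "\<not> distinct J" for J
    unfolding E_def eform_def Om.wedge_map_not_distinct [OF dphi_carrier that]
    by (rule is_linear_zero [OF M.module_axioms N.module_axioms lin_q])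
  have E_sign: "\<exists>\<tau>. \<tau> \<noteq> 0 \<and> E J = X.cls (\<lambda>_. \<tau>) \<odot>\<^bsub>?N\<^esub> E (enum_list (set J))"
    if "length J = p" "distinct J" for J
  proof -
    have len: "length (enum_list (set J)) = p" using that distinct_card [of J] by simp
    have neg: "?T +>\<^bsub>?M\<^esub> (\<ominus>\<^bsub>?M\<^esub> eform p L) = \<ominus>\<^bsub>?N\<^esub> E L" if "length L = p" for L
      unfolding E_def
      by (rule is_linear_neg [OF M.module_axioms N.module_axioms lin_q eform_closed [OF that]])
    have "eform p J = eform p (enum_list (set J)) \<or> eform p J = \<ominus>\<^bsub>?M\<^esub> eform p (enum_list (set J))"
      unfolding eform_def by (rule Om.wedge_map_same_set [OF dphi_carrier that]) simp_all
    then have "E J = E (enum_list (set J)) \<or> E J = \<ominus>\<^bsub>?N\<^esub> E (enum_list (set J))"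
      using neg [OF len] unfolding E_def by metis
    then show ?thesis
    proof
      assume "E J = E (enum_list (set J))"
      then show ?thesis
        using E_closed [OF len] by (intro exI [of _ 1]) (simp add: X.cls_one)
    next
      assume "E J = \<ominus>\<^bsub>?N\<^esub> E (enum_list (set J))"
      then show ?thesis
        using X.smult_cls_minus_one [OF N.module_axioms E_closed [OF len]] by (intro exI [of _ "- 1"]) simp
    qed
  qed
  have eS: "(\<lambda>K. E (enum_list K)) \<in> ?S \<rightarrow> carrier ?N"
    using E_closed by simp
  let ?P = "{\<Oplus>\<^bsub>?N\<^esub>K\<in>?S. c K \<odot>\<^bsub>?N\<^esub> E (enum_list K) | c. c \<in> ?S \<rightarrow> carrier X.LR}"
  have fin: "finite ?S" by simp
  have P: "submodule ?P X.LR ?N" by (rule N.submodule_combinations [OF fin eS])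
  (* The forms d phi_K with K a set of p coordinates span. *)
  have span: "carrier ?N \<subseteq> ?P"
  proof -
    let ?Q = "{m \<in> carrier ?M. ?T +>\<^bsub>?M\<^esub> m \<in> ?P}"
    have "carrier ?M \<subseteq> ?Q"
    proof (rule Om.wedge_span_generators)
      show "range dphi \<subseteq> carrier X.Om" using dphi_carrier by blast
      show "carrier X.Om \<subseteq> Q" if "submodule Q X.LR X.Om" "range dphi \<subseteq> Q" for Q
        by (rule dphi_span [OF that])
      show "submodule ?Q X.LR ?M"
        by (rule submodule_vimage [OF M.module_axioms N.module_axioms lin_q P])
      fix ms assume ms: "length ms = p" "set ms \<subseteq> range dphi"
      then obtain J where J: "ms = map dphi J" "length J = p"
        using ex_map_conv [of ms dphi] by (metis image_iff length_map subsetD)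
      have "E J \<in> ?P"
      proof (cases "distinct J")
        case True
        then have "set J \<in> ?S" using J(2) distinct_card [of J] by simp
        from N.mem_combinations [OF fin eS this] have "E (enum_list (set J)) \<in> ?P" .
        moreover obtain \<tau> where "E J = X.cls (\<lambda>_. \<tau>) \<odot>\<^bsub>?N\<^esub> E (enum_list (set J))"
          using E_sign [OF J(2) True] by blast
        ultimately show ?thesis
          using N.submoduleE(4) [OF P X.cls_carrier [OF holo_at_const]] by simp
      next
        case False
        have "\<zero>\<^bsub>?N\<^esub> \<in> ?P" by (rule N.zero_mem_submodule [OF P])
        then show ?thesis unfolding E_zero [OF J(2) False] .
      qed
      then show "wedge X.LR p X.Om ms \<in> ?Q"
        using eform_closed [OF J(2)] by (simp add: E_def eform_def J(1))
    qed
    then show ?thesis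
      unfolding M.quotient_module_facts(1) [OF tor] by blast
  qed
  obtain \<beta> where \<beta>: "\<And>k. k < r \<Longrightarrow> is_linear X.LR ?N (self_module X.LR) (\<beta> k)"
    "\<And>k l. k < r \<Longrightarrow> l < r \<Longrightarrow> \<beta> k (b l) = (if k = l then \<one>\<^bsub>X.LR\<^esub> else \<zero>\<^bsub>X.LR\<^esub>)"
    "\<And>m. m \<in> carrier ?N \<Longrightarrow> \<forall>k<r. \<beta> k m = \<zero>\<^bsub>X.LR\<^esub> \<Longrightarrow> m = \<zero>\<^bsub>?N\<^esub>"
    by (rule basis_coordinates [OF N.module_axioms basis_N]) (rule that)
  have \<beta>c: "\<beta> k m \<in> carrier X.LR" if "k < r" "m \<in> carrier ?N" for k m
    using is_linear_closed [OF \<beta>(1) [OF that(1)] that(2)] by simp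
  define A where "A K k = (if card K = p \<and> k < r then X.rep (\<beta> k (E (enum_list K))) else (\<lambda>_. 0))" for K k
  have hA: "holo_at x (A K k)" for K k
    unfolding A_def using \<beta>c E_closed by (auto intro: X.holo_at_rep)
  have cA: "\<beta> k (E (enum_list K)) = X.cls (A K k)" if "k < r" "card K = p" for K k
    unfolding A_def using that \<beta>c E_closed by (simp add: X.cls_rep)
  have "\<forall>k. \<exists>B. (\<forall>K. holo_at x (B K)) \<and>
    (k < r \<longrightarrow> b k = (\<Oplus>\<^bsub>?N\<^esub>K\<in>?S. X.cls (B K) \<odot>\<^bsub>?N\<^esub> E (enum_list K)))"
  proof
    fix k
    show "\<exists>B. (\<forall>K. holo_at x (B K)) \<and>
      (k < r \<longrightarrow> b k = (\<Oplus>\<^bsub>?N\<^esub>K\<in>?S. X.cls (B K) \<odot>\<^bsub>?N\<^esub> E (enum_list K)))"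
    proof (cases "k < r")
      case True
      then have "b k \<in> carrier ?N" using basis_N by (auto simp: is_basis_def)
      then obtain c where c: "c \<in> ?S \<rightarrow> carrier X.LR" "b k = (\<Oplus>\<^bsub>?N\<^esub>K\<in>?S. c K \<odot>\<^bsub>?N\<^esub> E (enum_list K))"
        using span by blast
      define B where "B K = (if card K = p then X.rep (c K) else (\<lambda>_. 0))" for K
      have "holo_at x (B K)" for K
        using c(1) by (auto simp: B_def intro!: X.holo_at_rep)
      moreover have "(\<Oplus>\<^bsub>?N\<^esub>K\<in>?S. X.cls (B K) \<odot>\<^bsub>?N\<^esub> E (enum_list K)) = (\<Oplus>\<^bsub>?N\<^esub>K\<in>?S. c K \<odot>\<^bsub>?N\<^esub> E (enum_list K))"
        using c(1) eS by (intro N.M.finsum_cong') (auto simp: B_def X.cls_rep Pi_iff)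
      ultimately show ?thesis using c(2) by (intro exI [of _ B]) simp
    next
      case False
      then show ?thesis by (intro exI [of _ "\<lambda>_ _. 0"]) simp
    qed
  qed
  from choice [OF this] obtain B where B: "\<forall>k. (\<forall>K. holo_at x (B k K)) \<and>
    (k < r \<longrightarrow> b k = (\<Oplus>\<^bsub>?N\<^esub>K\<in>?S. X.cls (B k K) \<odot>\<^bsub>?N\<^esub> E (enum_list K)))"
    by (rule exE)
  have hB: "holo_at x (B k K)" for k K
    by (rule B [THEN spec, THEN conjunct1, THEN spec])
  have cB: "b k = (\<Oplus>\<^bsub>?N\<^esub>K\<in>?S. X.cls (B k K) \<odot>\<^bsub>?N\<^esub> E (enum_list K))" if "k < r" for k
    by (rule B [THEN spec, THEN conjunct2, THEN mp, OF that])
  have \<beta>_comb: "\<beta> k (\<Oplus>\<^bsub>?N\<^esub>K\<in>?S. X.cls (c K) \<odot>\<^bsub>?N\<^esub> E (enum_list K)) = X.cls (\<lambda>z. \<Sum>K\<in>?S. c K z * A K k z)"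
    if "\<And>K. holo_at x (c K)" "k < r" for c k
    by (rule X.linear_form_combination_cls [OF N.module_axioms \<beta>(1) [OF that(2)] fin that(1) eS hA])
      (use that cA in auto)
  (* The sign that sorts j into the enumeration of K. *)
  define t where "t K j = (SOME \<tau>. \<tau> \<noteq> 0 \<and> (card K = p - 1 \<and> j \<notin> K \<longrightarrow>
    E (j # enum_list K) = X.cls (\<lambda>_. \<tau>) \<odot>\<^bsub>?N\<^esub> E (enum_list (insert j K))))" for K j
  have t: "t K j \<noteq> 0 \<and> (card K = p - 1 \<and> j \<notin> K \<longrightarrow>
    E (j # enum_list K) = X.cls (\<lambda>_. t K j) \<odot>\<^bsub>?N\<^esub> E (enum_list (insert j K)))" for K j
    unfolding t_def
  proof (rule someI_ex)
    show "\<exists>\<tau>. \<tau> \<noteq> 0 \<and> (card K = p - 1 \<and> j \<notin> K \<longrightarrow>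
      E (j # enum_list K) = X.cls (\<lambda>_. \<tau>) \<odot>\<^bsub>?N\<^esub> E (enum_list (insert j K)))"
      using E_sign [of "j # enum_list K"] p by (cases "card K = p - 1 \<and> j \<notin> K") (auto intro: exI [of _ 1])
  qed
  (* The coefficient signs of df wedge omega; the value 1 outside the relevant range is a default. *)
  define s where "s K' i = (if card K' = Suc p \<and> i \<in> K'
    then row_det (map (\<lambda>k. axis k 1) (i # enum_list (K' - {i}) @ enum_list (- K'))) else 1)" for K' and i :: 'm
  have s: "s K' i \<noteq> 0" for K' i
  proof (cases "card K' = Suc p \<and> i \<in> K'")
    case True
    then have "card (- K') + Suc p = CARD('m)"
      using card_compl_add [of K'] by simp
    then show ?thesis
      unfolding s_def using True by (simp only: if_True simp_thms) (subst row_det_axes, auto)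
  qed (auto simp: s_def)
  obtain i where i: "\<And>j. \<exists>a. holo_at x a \<and> (\<lambda>z. partial_deriv j f (\<phi> z) - a z * partial_deriv i f (\<phi> z)) \<in> ideal_fun X x"
  proof (rule X.jacobian_principal [where G = "\<lambda>i z. partial_deriv i f (\<phi> z)" and A = A and B = B and s = s and t = t and r = r,
        OF radical p _ hA hB])
    show "holo_at x (\<lambda>z. partial_deriv i f (\<phi> z))" for i
      by (intro holo_at_comp_\<phi> holo_at_partial_deriv f)
    show "(\<lambda>z. (\<Sum>K\<in>?S. B k K z * A K l z) - (if k = l then 1 else 0)) \<in> ideal_fun X x" if "k < r" "l < r" for k l
    proof (subst X.cls_eq_iff [symmetric])
      have "X.cls (\<lambda>z. \<Sum>K\<in>?S. B k K z * A K l z) = \<beta> l (b k)"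
        using \<beta>_comb [of "B k", OF hB that(2)] cB [OF that(1)] by simp
      then show "X.cls (\<lambda>z. \<Sum>K\<in>?S. B k K z * A K l z) = X.cls (\<lambda>_. if k = l then 1 else 0)"
        using \<beta>(2) [OF that(2,1)] by (simp add: X.cls_one X.cls_zero)
    qed (simp_all add: holo_at_sum holo_at_mult hA hB)
    show "s K i \<noteq> 0" for K i by (rule s)
    show "t K i \<noteq> 0" for K i using t by blast
  next
    fix c and K' :: "'m set"
    assume c: "\<And>K. holo_at x (c K)" "\<And>k. k < r \<Longrightarrow> (\<lambda>z. \<Sum>K\<in>?S. c K z * A K k z) \<in> ideal_fun X x"
      and K': "card K' = Suc p"
    let ?L = "enum_list (- K')"
    let ?D = "\<lambda>K z. row_det (grad z # map (\<lambda>k. axis k 1) (enum_list K @ ?L))"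
    have len: "p + length ?L + 1 = CARD('m)"
      using card_compl_add [of K'] K' by simp
    define n where "n = (\<Oplus>\<^bsub>?N\<^esub>K\<in>?S. X.cls (c K) \<odot>\<^bsub>?N\<^esub> E (enum_list K))"
    have "\<beta> k n = \<zero>\<^bsub>X.LR\<^esub>" if "k < r" for k
      unfolding n_def \<beta>_comb [OF c(1) that]
      by (subst X.cls_eq_zero_iff) (simp_all add: c holo_at_sum holo_at_mult hA that)
    moreover have "n \<in> carrier ?N"
      unfolding n_def by (intro N.M.finsum_closed Pi_I N.smult_closed X.cls_carrier c(1) E_closed) simp
    ultimately have n0: "n = \<zero>\<^bsub>?N\<^esub>" using \<beta>(3) by blast
    obtain T where T: "is_linear X.LR ?M (self_module X.LR) T"
      "\<And>J. length J = p \<Longrightarrow> T (eform p J) = X.cls (\<lambda>z. row_det (grad z # map (\<lambda>k. axis k 1) (J @ ?L)))"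
      by (rule wedge_functional [OF len]) (rule that)
    have self: "module X.LR (self_module X.LR)" by (rule module_self_module [OF X.cring_local_ring])
    have ker: "T m = \<zero>\<^bsub>self_module X.LR\<^esub>" if "m \<in> ?T" for m
      using linear_form_torsion [OF M.module_axioms T(1) that] by simp
    obtain T' where T': "is_linear X.LR ?N (self_module X.LR) T'" "\<And>m. m \<in> carrier ?M \<Longrightarrow> T' (?T +>\<^bsub>?M\<^esub> m) = T m"
      by (rule M.linear_factor [OF tor self T(1) ker], assumption, rule that)
    have hD: "holo_at x (?D K)" if "K \<in> ?S" for K
    proof -
      have "holo_at x (\<lambda>z. row_det (map (\<lambda>w. w z) (grad # map (\<lambda>k _. axis k 1) (enum_list K @ ?L))))"
        by (rule holo_at_row_det') (use that len holo_grad in \<open>auto simp: holo_vec_intros\<close>)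
      then show ?thesis by (simp add: comp_def)
    qed
    have "X.cls (\<lambda>z. \<Sum>K\<in>?S. c K z * ?D K z) = T' n"
      unfolding n_def
      by (rule X.linear_form_combination_cls [OF N.module_axioms T'(1) fin c(1) eS hD, symmetric], assumption)
        (use T(2) T'(2) eform_closed in \<open>simp add: E_def\<close>)
    also have "\<dots> = \<zero>\<^bsub>X.LR\<^esub>"
      unfolding n0 using is_linear_zero [OF N.module_axioms self T'(1)] by simp
    finally have cls0: "X.cls (\<lambda>z. \<Sum>K\<in>?S. c K z * ?D K z) = \<zero>\<^bsub>X.LR\<^esub>" .
    have "holo_at x (\<lambda>z. \<Sum>K\<in>?S. c K z * ?D K z)"
      by (intro holo_at_sum holo_at_mult c(1) hD)
    from cls0 [unfolded X.cls_eq_zero_iff [OF this]]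
    have "(\<lambda>z. \<Sum>K\<in>?S. c K z * ?D K z) \<in> ideal_fun X x" .
    moreover have "(\<Sum>K\<in>?S. c K z * ?D K z) = (\<Sum>i\<in>K'. s K' i * partial_deriv i f (\<phi> z) * c (K' - {i}) z)" for z
      unfolding koszul_sum [OF K', of "\<lambda>K. c K z" "grad z"] by (rule sum.cong) (simp_all add: s_def K' grad_def)
    ultimately show "(\<lambda>z. \<Sum>i\<in>K'. s K' i * partial_deriv i f (\<phi> z) * c (K' - {i}) z) \<in> ideal_fun X x"
      by simp
  next
    fix K :: "'m set" and k assume K: "card K = p - 1" and k: "k < r"
    let ?a = "\<lambda>j z. if j \<in> K then 0 else t K j * A (insert j K) k z"
    have len: "Suc (length (enum_list K)) = p" using K p by simp
    have G: "holo_at x (\<lambda>z. partial_deriv j f (\<phi> z))" for j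
      by (intro holo_at_comp_\<phi> holo_at_partial_deriv f)
    have ha: "holo_at x (?a j)" for j
      by (cases "j \<in> K") (simp_all add: holo_at_mult hA)
    have lenj: "length (j # enum_list K) = p" for j using len by simp
    have "(\<Oplus>\<^bsub>?N\<^esub>j\<in>UNIV. X.cls (\<lambda>z. partial_deriv j f (\<phi> z)) \<odot>\<^bsub>?N\<^esub> E (j # enum_list K)) =
      (\<Oplus>\<^bsub>?N\<^esub>j\<in>UNIV. ?T +>\<^bsub>?M\<^esub> (X.cls (\<lambda>z. partial_deriv j f (\<phi> z)) \<odot>\<^bsub>?M\<^esub> eform p (j # enum_list K)))"
      unfolding E_def by (simp only: is_linear_smult [OF lin_q X.cls_carrier [OF G] eform_closed [OF lenj]])
    also have "\<dots> = ?T +>\<^bsub>?M\<^esub> (\<Oplus>\<^bsub>?M\<^esub>j\<in>UNIV. X.cls (\<lambda>z. partial_deriv j f (\<phi> z)) \<odot>\<^bsub>?M\<^esub> eform p (j # enum_list K))"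
      by (rule is_linear_finsum [OF M.module_axioms N.module_axioms lin_q, symmetric])
        (use X.cls_carrier [OF G] eform_closed [OF lenj] in auto)
    also have "\<dots> = \<zero>\<^bsub>?N\<^esub>"
      unfolding eform_relation [OF len]
      by (rule is_linear_zero [OF M.module_axioms N.module_axioms lin_q])
    finally have "\<beta> k (\<Oplus>\<^bsub>?N\<^esub>j\<in>UNIV. X.cls (\<lambda>z. partial_deriv j f (\<phi> z)) \<odot>\<^bsub>?N\<^esub> E (j # enum_list K)) = \<zero>\<^bsub>X.LR\<^esub>"
      using is_linear_zero [OF N.module_axioms module_self_module [OF X.cring_local_ring] \<beta>(1) [OF k]] by simp
    also have "\<beta> k (\<Oplus>\<^bsub>?N\<^esub>j\<in>UNIV. X.cls (\<lambda>z. partial_deriv j f (\<phi> z)) \<odot>\<^bsub>?N\<^esub> E (j # enum_list K)) =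
      X.cls (\<lambda>z. \<Sum>j\<in>UNIV. partial_deriv j f (\<phi> z) * ?a j z)"
    proof (rule X.linear_form_combination_cls [OF N.module_axioms \<beta>(1) [OF k] _ G _ ha])
      show "(\<lambda>j. E (j # enum_list K)) \<in> UNIV \<rightarrow> carrier ?N" using E_closed [OF lenj] by simp
      show "\<beta> k (E (j # enum_list K)) = X.cls (?a j)" for j
      proof (cases "j \<in> K")
        case True
        then have "E (j # enum_list K) = \<zero>\<^bsub>?N\<^esub>" by (intro E_zero lenj) simp
        then show ?thesis
          using True is_linear_zero [OF N.module_axioms module_self_module [OF X.cring_local_ring] \<beta>(1) [OF k]]
          by (simp add: X.cls_zero)
      next
        case False
        then have cK: "card (insert j K) = p" using K p by simp
        have "E (j # enum_list K) = X.cls (\<lambda>_. t K j) \<odot>\<^bsub>?N\<^esub> E (enum_list (insert j K))"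
          using t K False by blast
        then have "\<beta> k (E (j # enum_list K)) = X.cls (\<lambda>_. t K j) \<otimes>\<^bsub>X.LR\<^esub> X.cls (A (insert j K) k)"
          using is_linear_smult [OF \<beta>(1) [OF k] X.cls_carrier [OF holo_at_const] E_closed, of "enum_list (insert j K)"]
            cA [OF k cK] cK by simp
        then show ?thesis using False hA by (simp add: X.cls_mult)
      qed
    qed simp
    finally have cls0: "X.cls (\<lambda>z. \<Sum>j\<in>UNIV. partial_deriv j f (\<phi> z) * ?a j z) = \<zero>\<^bsub>X.LR\<^esub>" .
    have "holo_at x (\<lambda>z. \<Sum>j\<in>UNIV. partial_deriv j f (\<phi> z) * ?a j z)"
      by (intro holo_at_sum holo_at_mult G ha)
    from cls0 [unfolded X.cls_eq_zero_iff [OF this]]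
    have "(\<lambda>z. \<Sum>j\<in>UNIV. partial_deriv j f (\<phi> z) * ?a j z) \<in> ideal_fun X x" .
    moreover have "(\<Sum>j\<in>UNIV. partial_deriv j f (\<phi> z) * ?a j z) =
      (\<Sum>j\<in>- K. t K j * partial_deriv j f (\<phi> z) * A (insert j K) k z)" for z
      by (rule sum.mono_neutral_cong_right) auto
    ultimately show "(\<lambda>z. \<Sum>j\<in>- K. t K j * partial_deriv j f (\<phi> z) * A (insert j K) k z) \<in> ideal_fun X x"
      by simp
  qed (assumption, assumption, rule that)
  show ?thesis by (rule that [OF i])
qed

section \<open>From a principal gradient to smoothness\<close>

lemma (in germ_at) normal_ring_radical:
  assumes normal: "normal_ring LR" and F: "holo_at y F" and FF: "(\<lambda>z. F z * F z) \<in> ideal_fun X y"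
  shows "F \<in> ideal_fun X y"
proof -
  have "cls F [^]\<^bsub>LR\<^esub> (2::nat) = cls F \<otimes>\<^bsub>LR\<^esub> cls F"
    using F by (simp add: numeral_2_eq_2)
  also have "\<dots> = \<zero>\<^bsub>LR\<^esub>"
    using FF F by (simp add: cls_mult [symmetric] cls_eq_zero_iff holo_at_mult)
  finally have "cls F = \<zero>\<^bsub>LR\<^esub>"
    using normal cls_carrier [OF F] unfolding normal_ring_def by blast
  then show ?thesis using F by (simp add: cls_eq_zero_iff)
qed

text \<open>The multiples of \<open>f\<close> vanish at \<open>y\<close>, and their partial derivatives are again multiples of \<open>f\<close>, so
\<open>iterated_partial_derivs_zero_imp_zero\<close> applies.\<close>

lemma gradient_multiple_imp_zero:
  fixes y :: "complex ^ 'm::finite"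
  assumes f: "holo_at y f" "f y = 0" and m: "\<And>j. multiple_of y f (partial_deriv j f)"
  shows "\<forall>\<^sub>F z in nhds y. f z = 0"
proof -
  obtain e where e: "\<And>j. holo_at y (e j)" "\<And>j. \<forall>\<^sub>F z in nhds y. partial_deriv j f z = e j z * f z"
    using m unfolding multiple_of_def by metis
  obtain U where U: "open U" "y \<in> U" "\<And>j. holo_on (e j) U"
    by (rule holo_at_nbhd [of UNIV y e]) (use e in auto)
  obtain U' where U': "open U'" "y \<in> U'" "holo_on f U'"
    using f(1) unfolding holo_at_def by blast
  have "\<forall>\<^sub>F z in nhds y. \<forall>j. partial_deriv j f z = e j z * f z"
    using e(2) by (intro eventually_all_finite) auto
  then obtain V where V: "open V" "y \<in> V" "\<And>z j. z \<in> V \<Longrightarrow> partial_deriv j f z = e j z * f z"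
    unfolding eventually_nhds by blast
  obtain r where r: "r > 0" "ball y r \<subseteq> U \<inter> U' \<inter> V"
    using openE [of "U \<inter> U' \<inter> V" y] U U' V by (metis IntI open_Int)
  have fr: "holo_on f (ball y r)" and er: "\<And>j. holo_on (e j) (ball y r)"
    using r(2) by (auto intro: holo_on_subset [OF U'(3)] holo_on_subset [OF U(3)])
  define Q where "Q = {\<lambda>z. c z * f z | c. holo_on c (ball y r)}"
  have QI: "(\<lambda>z. c z * f z) \<in> Q" if "holo_on c (ball y r)" for c
    using that unfolding Q_def by blast
  have zero: "(\<lambda>z. 1 * f z) z = 0" if "z \<in> ball y r" for z
  proof (rule iterated_partial_derivs_zero_imp_zero [where Q = Q and y = y and r = r])
    show "q y = 0" if "q \<in> Q" for q
      using that f(2) by (auto simp: Q_def)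
    show "holo_on q (ball y r)" if "q \<in> Q" for q
      using that holo_on_mult [OF _ fr] by (auto simp: Q_def)
    show "\<exists>q1\<in>Q. \<exists>q2\<in>Q. \<forall>z\<in>ball y r. partial_deriv j q z = q1 z + q2 z" if q: "q \<in> Q" for q j
    proof -
      obtain c where c: "holo_on c (ball y r)" "q = (\<lambda>z. c z * f z)"
        using q unfolding Q_def by blast
      show ?thesis
      proof (rule bexI [of _ "\<lambda>z. partial_deriv j c z * f z"], rule bexI [of _ "\<lambda>z. (c z * e j z) * f z"], rule ballI)
        show "(\<lambda>z. partial_deriv j c z * f z) \<in> Q"
          by (rule QI) (rule holo_on_partial_deriv [OF c(1) open_ball])
        show "(\<lambda>z. (c z * e j z) * f z) \<in> Q"
          by (rule QI) (rule holo_on_mult [OF c(1) er])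
        show "partial_deriv j q z = partial_deriv j c z * f z + c z * e j z * f z" if z: "z \<in> ball y r" for z
          using V(3) [of z j] z r(2) unfolding c(2) partial_deriv_mult [OF c(1) fr z]
          by (auto simp: subset_iff)
      qed
    qed
    show "(\<lambda>z. 1 * f z) \<in> Q" by (rule QI [OF holo_on_const])
  qed (rule that)
  show ?thesis
    by (rule eventually_mono [OF eventually_nhds_in_open [OF open_ball, of y y r]]) (use r(1) zero in auto)
qed

text \<open>Otherwise \<open>f\<close> divides the square of \<open>\<partial>\<^sub>if\<close>, hence \<open>\<partial>\<^sub>if\<close> because the ideal of \<open>f\<close> is radical, hence all
partial derivatives, and \<open>f\<close> vanishes near \<open>y\<close>.\<close>

lemma principal_gradient_nonzero:
  fixes y :: "complex ^ 'm::finite"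
  assumes f: "holo_at y f" "f y = 0" and nz: "\<not> (\<forall>\<^sub>F z in nhds y. f z = 0)"
    and radical: "\<And>F. holo_at y F \<Longrightarrow> multiple_of y f (\<lambda>z. F z * F z) \<Longrightarrow> multiple_of y f F"
    and a: "\<And>j. holo_at y (a j)"
    and m: "\<And>j. multiple_of y f (\<lambda>z. partial_deriv j f z - a j z * partial_deriv i f z)"
  shows "partial_deriv i f y \<noteq> 0"
proof
  assume i0: "partial_deriv i f y = 0"
  obtain b where b: "\<And>j. holo_at y (b j)"
    "\<And>j. \<forall>\<^sub>F z in nhds y. partial_deriv j f z - a j z * partial_deriv i f z = b j z * f z"
    using m unfolding multiple_of_def by metis
  obtain U where U: "open U" "y \<in> U" "\<And>j. holo_on (a j) U"
    by (rule holo_at_nbhd [of UNIV y a]) (use a in auto)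
  obtain U' where U': "open U'" "y \<in> U'" "\<And>j. holo_on (b j) U'"
    by (rule holo_at_nbhd [of UNIV y b]) (use b in auto)
  obtain W where W: "open W" "y \<in> W" "holo_on f W"
    using f(1) unfolding holo_at_def by blast
  have "\<forall>\<^sub>F z in nhds y. \<forall>j. partial_deriv j f z - a j z * partial_deriv i f z = b j z * f z"
    using b(2) by (intro eventually_all_finite) auto
  then obtain V where V: "open V" "y \<in> V"
    "\<And>z j. z \<in> V \<Longrightarrow> partial_deriv j f z - a j z * partial_deriv i f z = b j z * f z"
    unfolding eventually_nhds by blast
  let ?S = "U \<inter> U' \<inter> W \<inter> V"
  obtain V' H where H: "open V'" "y \<in> V'" "holo_on H V'" "\<And>z. z \<in> V' \<Longrightarrow> (partial_deriv i f z)\<^sup>2 = f z * H z"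
  proof (rule partial_deriv_square_divisible [of ?S y f i a b])
    show "open ?S" "y \<in> ?S" using U U' W V by auto
    show "holo_on f ?S" "holo_on (a j) ?S" "holo_on (b j) ?S" for j
      by (auto intro: holo_on_subset [OF W(3)] holo_on_subset [OF U(3)] holo_on_subset [OF U'(3)])
    show "partial_deriv j f z = a j z * partial_deriv i f z + b j z * f z" if "z \<in> ?S" for z j
      using V(3) [of z j] that by (simp add: algebra_simps)
  qed (use f(2) i0 nz that in auto)
  have "multiple_of y f (\<lambda>z. partial_deriv i f z * partial_deriv i f z)"
    unfolding multiple_of_def
  proof (intro exI [of _ H] conjI)
    show "holo_at y H" unfolding holo_at_def using H(1-3) by blast
    show "\<forall>\<^sub>F z in nhds y. partial_deriv i f z * partial_deriv i f z = H z * f z"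
      by (rule eventually_mono [OF eventually_nhds_in_open [OF H(1,2)]])
        (use H(4) in \<open>simp add: power2_eq_square mult.commute\<close>)
  qed
  then have i: "multiple_of y f (partial_deriv i f)"
    by (rule radical [OF holo_at_partial_deriv [OF f(1)]])
  have "multiple_of y f (partial_deriv j f)" for j
    using multiple_of_add [OF m [of j] multiple_of_mult [OF a [of j] i]] by simp
  from gradient_multiple_imp_zero [OF f this] nz show False by blast
qed

text \<open>The relation between the \<open>G\<^sub>j\<close> on \<open>X\<close> is carried to the hypersurface by \<open>\<psi>\<close>, where it holds modulo \<open>f\<close>.\<close>

theorem (in hypersurface_iso) smooth_if_forms_mod_torsion_free:
  assumes base: "base X = x" and nz: "\<not> (\<forall>\<^sub>F z in nhds y. f z = 0)" and normal: "normal_ring X.LR"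
    and p: "1 \<le> p" "p < CARD('m)"
    and basis: "is_basis X.LR (kaehler_forms_mod_torsion_at p X x) r b"
  shows "smooth_germ X"
proof -
  note radical = X.normal_ring_radical [OF normal]
  obtain i where i: "\<And>j. \<exists>a. holo_at x a \<and>
    (\<lambda>z. partial_deriv j f (\<phi> z) - a z * partial_deriv i f (\<phi> z)) \<in> ideal_fun X x"
    by (rule gradient_principal [OF radical p basis]) (assumption, assumption, rule that)
  then obtain a where a: "\<And>j. holo_at x (a j)"
    "\<And>j. (\<lambda>z. partial_deriv j f (\<phi> z) - a j z * partial_deriv i f (\<phi> z)) \<in> ideal_fun X x"
    by metis
  have "partial_deriv i f y \<noteq> 0"
  proof (rule principal_gradient_nonzero [OF f f_y nz])
    show "holo_at y (\<lambda>w. a j (\<psi> w))" for j by (rule holo_at_comp_\<psi> [OF a(1)])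
    show "multiple_of y f (\<lambda>w. partial_deriv j f w - a j (\<psi> w) * partial_deriv i f w)" for j
    proof -
      have "multiple_of y f (\<lambda>w. (partial_deriv j f (\<phi> (\<psi> w)) - a j (\<psi> w) * partial_deriv i f (\<phi> (\<psi> w))) +
        ((- 1) * (partial_deriv j f (\<phi> (\<psi> w)) - partial_deriv j f w) +
          a j (\<psi> w) * (partial_deriv i f (\<phi> (\<psi> w)) - partial_deriv i f w)))"
        by (intro multiple_of_add multiple_of_mult holo_at_const comp_\<phi>_\<psi> holo_at_comp_\<psi> [OF a(1)]
          holo_at_partial_deriv f ideal_fun_\<psi> [OF a(2)])
      then show ?thesis by (simp add: algebra_simps)
    qed
    show "multiple_of y f F" if "holo_at y F" "multiple_of y f (\<lambda>z. F z * F z)" for F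
      by (rule ideal_fun_comp_\<phi>D [OF that(1) radical [OF holo_at_comp_\<phi> [OF that(1)] multiple_of_\<phi> [OF that(2)]]])
  qed
  then show ?thesis by (rule smooth_if_partial_deriv_nonzero [OF base])
qed

theorem theorem1p9:
  fixes X :: "'a::finite space_germ" and n p :: nat
  assumes "complex_space_germ X"
    and "hypersurface_singularity TYPE('m::finite) n X"
    and "normal_singularity X"
    and "1 \<le> p" and "p \<le> n"
    and "kaehler_mod_torsion_free p X"
  shows "smooth_germ X"
proof -
  obtain Y :: "(complex ^ 'm) set" and f y where Y: "open Y" "connected Y" "holo_on f Y" "\<not> f constant_on Y"
    "y \<in> Y" "f y = 0" and iso: "germ_iso X \<lparr>ambient = Y, eqns = {f}, base = y\<rparr>" and card: "CARD('m) = n + 1"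
    using assms(2) unfolding hypersurface_singularity_def by blast
  let ?H = "\<lparr>ambient = Y, eqns = {f}, base = y\<rparr>"
  obtain \<phi> \<psi> where \<phi>: "germ_map X ?H \<phi>" and \<psi>: "germ_map ?H X \<psi>"
    and \<psi>\<phi>: "\<And>j. germ (base X) (\<lambda>z. \<psi> (\<phi> z) $ j - z $ j) \<in> ideal_at X (base X)"
    and \<phi>\<psi>: "\<And>j. germ y (\<lambda>z. \<phi> (\<psi> z) $ j - z $ j) \<in> ideal_at ?H y"
    using iso unfolding germ_iso_def by auto
  have fy: "holo_at y f" unfolding holo_at_def using Y by blast
  interpret H: germ_at ?H y by unfold_locales (simp add: fy)
  have base: "base X \<in> ambient X"
    using assms(1) by (simp add: complex_space_germ_def zero_locus_def)
  interpret X: germ_at X "base X"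
    by unfold_locales (use assms(1) base in \<open>auto simp: complex_space_germ_def holo_at_def\<close>)
  have mult: "multiple_of y f h" if "holo_at y h" "germ y h \<in> ideal_at ?H y" for h
  proof -
    have "h \<in> ideal_fun ?H y" using that by (simp add: ideal_fun_def)
    then have "h \<in> {h. holo_at y h \<and> multiple_of y f h}"
    proof (rule H.ideal_fun_induct)
      show "k \<in> {h. holo_at y h \<and> multiple_of y f h}"
        if "h \<in> {h. holo_at y h \<and> multiple_of y f h}" "\<forall>\<^sub>F z in nhds y. h z = k z" for h k
        using that holo_at_cong multiple_of_cong by blast
    qed (auto simp: fy multiple_of_self multiple_of_zero intro: holo_at_add holo_at_mult multiple_of_add multiple_of_mult)
    then show ?thesis by simp
  qed
  have \<phi>h: "holo_at (base X) (\<lambda>z. \<phi> z $ k)" and \<phi>x: "\<phi> (base X) = y" for k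
    using \<phi> by (simp_all add: germ_map_def)
  have \<psi>h: "holo_at y (\<lambda>z. \<psi> z $ k)" and \<psi>y: "\<psi> y = base X" for k
    using \<psi> by (simp_all add: germ_map_def)
  have comp\<phi>: "holo_at (base X) (\<lambda>z. h (\<phi> z))" if "holo_at y h" for h
    by (rule holo_at_compose(1) [OF \<phi>h]) (simp add: \<phi>x that)
  have comp\<psi>: "holo_at y (\<lambda>z. h (\<psi> z))" if "holo_at (base X) h" for h
    by (rule holo_at_compose(1) [OF \<psi>h]) (simp add: \<psi>y that)
  interpret hypersurface_iso X f "base X" y \<phi> \<psi>
  proof
    show "(\<lambda>z. f (\<phi> z)) \<in> ideal_fun X (base X)"
      using \<phi> comp\<phi> [OF fy] by (simp add: germ_map_def ideal_fun_def)
    show "multiple_of y f (\<lambda>z. g (\<psi> z))" if "g \<in> eqns X" for g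
      using \<psi> that by (intro mult comp\<psi> X.holo_eqns) (simp_all add: germ_map_def)
    show "(\<lambda>z. \<psi> (\<phi> z) $ j - z $ j) \<in> ideal_fun X (base X)" for j
      using \<psi>\<phi> by (simp add: ideal_fun_def holo_at_diff comp\<phi> [OF \<psi>h])
    show "multiple_of y f (\<lambda>z. \<phi> (\<psi> z) $ j - z $ j)" for j
      by (rule mult [OF holo_at_diff [OF comp\<psi> [OF \<phi>h] holo_at_coord] \<phi>\<psi>])
  qed (use fy Y \<phi>h \<phi>x \<psi>h \<psi>y X.holo_eqns in auto)
  have nz: "\<not> (\<forall>\<^sub>F z in nhds y. f z = 0)"
    using holo_on_zero_on_connected [OF Y(1-3,5)] Y(4) unfolding constant_on_def by blast
  obtain r c where "is_basis (local_ring X (base X)) (kaehler_forms_mod_torsion_at p X (base X)) r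
      (\<lambda>k. form_class_at p X (base X) (c k))"
  proof -
    have "base X \<in> zero_locus X" using assms(1) by (simp add: complex_space_germ_def)
    then show ?thesis using assms(6) that unfolding kaehler_mod_torsion_free_def by blast
  qed
  then show ?thesis
    using assms(3-5) card
    by (intro smooth_if_forms_mod_torsion_free [OF refl nz]) (auto simp: normal_singularity_def)
qed

end
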